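(* Let $b$ and $\sigma$ be coefficients such that for all $t\in[0,T]$, with $r\in[t,T+\delta]$, $$b(t,\cdot,\cdot):\Omega\times\mathbb{R}^n\times L^2(\Omega,\mathcal{F}_r,\mathbb{P};\mathbb{R}^n)\to L^2(\Omega,\mathcal{F}_t,\mathbb{P};\mathbb{R}^n),\qquad \sigma(t,\cdot,\cdot):\Omega\times\mathbb{R}^n\times L^2(\Omega,\mathcal{F}_r,\mathbb{P};\mathbb{R}^n)\to L^2(\Omega,\mathcal{F}_t,\mathbb{P};\mathbb{R}^{n\times d}),$$ and assume: (i) there exists a constant $C>0$ such that for all $t\in[0,T]$, $x,x'\in\mathbb{R}^n$, $\zeta(\cdot),\zeta'(\cdot)\in L^2_{\mathbb{F}}(t,T+\delta;\mathbb{R}^n)$ and $r\in[t,T+\delta]$, $$|b(t,x,\zeta(r))-b(t,x',\zeta'(r))|+|\sigma(t,x,\zeta(r))-\sigma(t,x',\zeta'(r))|\le C\big(|x-x'|+\mathbb{E}^{\mathcal{F}_t}[|\zeta(r)-\zeta'(r)|]\big);$$ (ii) $\sup_{0\le t\le T}\big(|b(t,0,0)|+|\sigma(t,0,0)|\big)<+\infty$. Assume also that $\mathbb{E}|x_0|^2<+\infty$, that $\mathbb{E}\sup_{T\le t\le T+\delta}|\lambda(t)|^2<+\infty$, and that the time delay $\delta$ is sufficiently small. Then the advanced stochastic differential equation $$\left\{\begin{aligned}dx(t)&=b\Big(t,x(t),\int_t^{t+\delta}\phi(t,s)x(s)\alpha(ds)\Big)dt+\sigma\Big(t,x(t),\int_t^{t+\delta}\phi(t,s)x(s)\alpha(ds)\Big)dW(t),\quad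 t\in[0,T],\\ x(0)&=x_0,\\ x(t)&=\lambda(t),\quad t\in(T,T+\delta],\end{aligned}\right.$$ admits a unique $\mathcal{F}_t$-adapted solution (sought in $L^2_{\mathbb{F}}(0,T+\delta;\mathbb{R}^n)$).
   Context: $T>0$ is a finite time horizon and $W$ is a standard $d$-dimensional Brownian motion on a complete probability space $(\Omega,\mathcal{F},\mathbb{P})$; $\mathbb{F}=\{\mathcal{F}_t\}_{t\ge0}$ is the filtration generated by $W$ and augmented by all $\mathbb{P}$-null sets, and $\mathbb{E}^{\mathcal{F}_t}[\cdot]=\mathbb{E}[\cdot\,|\,\mathcal{F}_t]$. $L^2(\Omega,\mathcal{F}_t,\mathbb{P};H)$ is the space of $H$-valued $\mathcal{F}_t$-measurable random variables $\xi$ with $\mathbb{E}|\xi|^2<\infty$, and $L^2_{\mathbb{F}}(t_1,t_2;H)$ is the space of $H$-valued $\mathbb{F}$-adapted processes $h$ on $[t_1,t_2]$ with $\mathbb{E}\int_{t_1}^{t_2}|h(t)|^2dt<\infty$. $\delta$ is the time delay, $\alpha$ is some $\sigma$-finite measure, and $\phi(t,s)$ is a given bounded $\mathcal{F}_s$-adapted process with $|\phi(t,s)|\le M$ for a positive constant $M$. $x_0$ is the initial value and $\lambda(\cdot)$ the prescribed $\mathbb{R}^n$-valued path on $(T,T+\delta]$.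
   Formalization: The measure α is assumed finite on [0,T+δ], not only σ-finite, and b and σ are assumed jointly measurable in time and chance along square-integrable processes; without these the integrals in the equation may not exist. *)

theory Defs
  imports "HOL-Probability.Probability"
begin

section \<open>Brownian motion and its augmented filtration\<close>

definition natural_filtration ::
  "'w measure \<Rightarrow> (real \<Rightarrow> 'w \<Rightarrow> real ^ 'd) \<Rightarrow> real \<Rightarrow> 'w measure" where
  "natural_filtration P W t =
     sigma (space P) (\<Union>u\<in>{0..t}. {W u -` A \<inter> space P |A. A \<in> sets borel})"

definition augmented_filtration ::
  "'w measure \<Rightarrow> (real \<Rightarrow> 'w \<Rightarrow> real ^ 'd) \<Rightarrow> real \<Rightarrow> 'w measure" where
  "augmented_filtration P W t =
     sigma (space P) (sets (natural_filtration P W t) \<union> null_sets P)"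

text \<open>The increments have law \<open>N(0, (t - s) I)\<close>: the coordinates are independent, each of them
  normal with variance \<open>t - s\<close>. The second parameter of \<^const>\<open>normal_density\<close> is the standard
  deviation.\<close>

definition standard_brownian_motion ::
  "'w measure \<Rightarrow> (real \<Rightarrow> 'w \<Rightarrow> real ^ 'd) \<Rightarrow> bool" where
  "standard_brownian_motion P W \<longleftrightarrow>
     (\<forall>t\<ge>0. W t \<in> borel_measurable P) \<and>
     (AE \<omega> in P. W 0 \<omega> = 0) \<and>
     (AE \<omega> in P. continuous_on {0..} (\<lambda>t. W t \<omega>)) \<and>
     (\<forall>s t. 0 \<le> s \<and> s < t \<longrightarrow>
        (\<forall>i. distributed P lborel (\<lambda>\<omega>. (W t \<omega> - W s \<omega>) $ i)
               (\<lambda>y. ennreal (normal_density 0 (sqrt (t - s)) y))) \<and>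
        prob_space.indep_vars P (\<lambda>_. borel) (\<lambda>i \<omega>. (W t \<omega> - W s \<omega>) $ i) UNIV \<and>
        prob_space.indep_set P (sets (natural_filtration P W s))
          (sets (vimage_algebra (space P) (\<lambda>\<omega>. W t \<omega> - W s \<omega>) borel)))"


section \<open>Spaces of square integrable random variables and processes\<close>

text \<open>Elements are functions; almost sure equality is always stated explicitly.\<close>

definition L2_rv ::
  "'w measure \<Rightarrow> 'w measure \<Rightarrow> ('w \<Rightarrow> 'a::euclidean_space) set" where
  "L2_rv P G = {\<xi>. \<xi> \<in> borel_measurable G \<and> integrable P (\<lambda>\<omega>. (norm (\<xi> \<omega>))\<^sup>2)}"

text \<open>A process with time set \<open>S\<close> is adapted and jointly measurable in time and chance; joint
  measurability is what gives a meaning to its time integrals.\<close>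

definition adapted_process ::
  "'w measure \<Rightarrow> (real \<Rightarrow> 'w measure) \<Rightarrow> real set \<Rightarrow> (real \<Rightarrow> 'w \<Rightarrow> 'a::euclidean_space) set" where
  "adapted_process P F S = {h.
     (\<lambda>(t, \<omega>). h t \<omega>) \<in> borel_measurable (restrict_space borel S \<Otimes>\<^sub>M P) \<and>
     (\<forall>t\<in>S. h t \<in> borel_measurable (F t))}"

definition L2_process ::
  "'w measure \<Rightarrow> (real \<Rightarrow> 'w measure) \<Rightarrow> real \<Rightarrow> real \<Rightarrow> (real \<Rightarrow> 'w \<Rightarrow> 'a::euclidean_space) set" where
  "L2_process P F t1 t2 = {h \<in> adapted_process P F {t1..t2}.
     (\<integral>\<^sup>+\<omega>. (\<integral>\<^sup>+t\<in>{t1..t2}. ennreal ((norm (h t \<omega>))\<^sup>2) \<partial>lborel) \<partial>P) < \<infinity>}"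


section \<open>The Ito integral\<close>

text \<open>The triple \<open>N\<close>, \<open>\<tau>\<close>, \<open>\<xi>\<close> represents the simple process with value \<open>\<xi> i\<close> on
  the interval \<open>(\<tau> i, \<tau> (i + 1)]\<close> for \<open>i < N\<close>, and value \<open>0\<close> elsewhere.\<close>

definition simple_integrand ::
  "'w measure \<Rightarrow> (real \<Rightarrow> 'w measure) \<Rightarrow> real \<Rightarrow> nat \<Rightarrow> (nat \<Rightarrow> real) \<Rightarrow>
     (nat \<Rightarrow> 'w \<Rightarrow> real ^ 'd ^ 'n) \<Rightarrow> bool" where
  "simple_integrand P F t N \<tau> \<xi> \<longleftrightarrow>
     (\<forall>i<N. 0 \<le> \<tau> i \<and> \<tau> i \<le> \<tau> (Suc i) \<and> \<tau> (Suc i) \<le> t \<and> \<xi> i \<in> L2_rv P (F (\<tau> i)))"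

definition simple_value ::
  "nat \<Rightarrow> (nat \<Rightarrow> real) \<Rightarrow> (nat \<Rightarrow> 'w \<Rightarrow> real ^ 'd ^ 'n) \<Rightarrow> real \<Rightarrow> 'w \<Rightarrow> real ^ 'd ^ 'n" where
  "simple_value N \<tau> \<xi> s \<omega> = (\<Sum>i<N. indicator {\<tau> i<..\<tau> (Suc i)} s *\<^sub>R \<xi> i \<omega>)"

definition simple_ito_integral ::
  "(real \<Rightarrow> 'w \<Rightarrow> real ^ 'd) \<Rightarrow> nat \<Rightarrow> (nat \<Rightarrow> real) \<Rightarrow> (nat \<Rightarrow> 'w \<Rightarrow> real ^ 'd ^ 'n) \<Rightarrow>
     'w \<Rightarrow> real ^ 'n" where
  "simple_ito_integral W N \<tau> \<xi> \<omega> = (\<Sum>i<N. \<xi> i \<omega> *v (W (\<tau> (Suc i)) \<omega> - W (\<tau> i) \<omega>))"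

text \<open>\<open>has_ito_integral P F W t h I\<close> says that the random variable \<open>I\<close> is a version of
  the integral of \<open>h\<close> with respect to \<open>W\<close> over \<open>[0, t]\<close>. As for
  \<^const>\<open>has_bochner_integral\<close>, the integrals of simple processes are extended by approximation,
  here in mean square.\<close>

definition has_ito_integral ::
  "'w measure \<Rightarrow> (real \<Rightarrow> 'w measure) \<Rightarrow> (real \<Rightarrow> 'w \<Rightarrow> real ^ 'd) \<Rightarrow> real \<Rightarrow>
     (real \<Rightarrow> 'w \<Rightarrow> real ^ 'd ^ 'n) \<Rightarrow> ('w \<Rightarrow> real ^ 'n) \<Rightarrow> bool" where
  "has_ito_integral P F W t h I \<longleftrightarrow>
     h \<in> L2_process P F 0 t \<and> I \<in> L2_rv P (F t) \<and>
     (\<exists>N \<tau> \<xi>.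
        (\<forall>k. simple_integrand P F t (N k) (\<tau> k) (\<xi> k)) \<and>
        (\<lambda>k. \<integral>\<^sup>+\<omega>. (\<integral>\<^sup>+s\<in>{0..t}.
            ennreal ((norm (h s \<omega> - simple_value (N k) (\<tau> k) (\<xi> k) s \<omega>))\<^sup>2) \<partial>lborel) \<partial>P)
          \<longlonglongrightarrow> 0 \<and>
        (\<lambda>k. \<integral>\<^sup>+\<omega>. ennreal ((norm (I \<omega> - simple_ito_integral W (N k) (\<tau> k) (\<xi> k) \<omega>))\<^sup>2) \<partial>P)
          \<longlonglongrightarrow> 0)"


section \<open>The advanced stochastic differential equation\<close>

text \<open>A coefficient \<open>f t\<close> takes a vector \<open>x\<close> and a random variable \<open>\<zeta>\<close> known at
  some time \<open>r \<ge> t\<close>, and returns a random variable known at time \<open>t\<close>.\<close>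

definition coefficient ::
  "'w measure \<Rightarrow> (real \<Rightarrow> 'w measure) \<Rightarrow> real \<Rightarrow> real \<Rightarrow>
     (real \<Rightarrow> real ^ 'n \<Rightarrow> ('w \<Rightarrow> real ^ 'n) \<Rightarrow> 'w \<Rightarrow> 'a::euclidean_space) \<Rightarrow> bool" where
  "coefficient P F T \<delta> f \<longleftrightarrow>
     (\<forall>t\<in>{0..T}. \<forall>r\<in>{t..T + \<delta>}. \<forall>x. \<forall>\<zeta>\<in>L2_rv P (F r). f t x \<zeta> \<in> L2_rv P (F t))"

text \<open>Measurability in time of the coefficient along processes, without which the integrals of the
  equation are not defined. The process \<open>\<zeta>\<close> runs ahead of the filtration by \<open>\<delta>\<close>, as the
  advanced term of the equation does.\<close>

definition time_measurable ::
  "'w measure \<Rightarrow> (real \<Rightarrow> 'w measure) \<Rightarrow> real \<Rightarrow> real \<Rightarrow>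
     (real \<Rightarrow> real ^ 'n \<Rightarrow> ('w \<Rightarrow> real ^ 'n) \<Rightarrow> 'w \<Rightarrow> 'a::euclidean_space) \<Rightarrow> bool" where
  "time_measurable P F T \<delta> f \<longleftrightarrow>
     (\<forall>x\<in>L2_process P F 0 T. \<forall>\<zeta>\<in>L2_process P (\<lambda>t. F (t + \<delta>)) 0 T.
        (\<forall>t\<in>{0..T}. \<zeta> t \<in> L2_rv P (F (t + \<delta>))) \<longrightarrow>
        (\<lambda>(t, \<omega>). f t (x t \<omega>) (\<zeta> t) \<omega>) \<in> borel_measurable (restrict_space borel {0..T} \<Otimes>\<^sub>M P))"

definition bounded_kernel ::
  "'w measure \<Rightarrow> (real \<Rightarrow> 'w measure) \<Rightarrow> real \<Rightarrow> real \<Rightarrow> real \<Rightarrow> (real \<Rightarrow> real \<Rightarrow> 'w \<Rightarrow> real) \<Rightarrow> bool" where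
  "bounded_kernel P F T \<delta> M \<phi> \<longleftrightarrow>
     (\<lambda>((t, s), \<omega>). \<phi> t s \<omega>)
       \<in> borel_measurable (restrict_space borel {(t, s). t \<in> {0..T} \<and> s \<in> {t..t + \<delta>}} \<Otimes>\<^sub>M P) \<and>
     (\<forall>t\<in>{0..T}. \<forall>s\<in>{t..t + \<delta>}.
        \<phi> t s \<in> borel_measurable (F s) \<and> (AE \<omega> in P. \<bar>\<phi> t s \<omega>\<bar> \<le> M))"

definition advanced_term ::
  "real measure \<Rightarrow> real \<Rightarrow> (real \<Rightarrow> real \<Rightarrow> 'w \<Rightarrow> real) \<Rightarrow> (real \<Rightarrow> 'w \<Rightarrow> real ^ 'n) \<Rightarrow>
     real \<Rightarrow> 'w \<Rightarrow> real ^ 'n" where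
  "advanced_term \<alpha> \<delta> \<phi> x t \<omega> = (LINT s:{t..t + \<delta>}|\<alpha>. \<phi> t s \<omega> *\<^sub>R x s \<omega>)"

text \<open>The Bochner integral of a function that is not integrable is \<open>0\<close>; a solution is therefore
  required to make every integral of the equation a convergent one.\<close>

definition asde_solution ::
  "'w measure \<Rightarrow> (real \<Rightarrow> 'w measure) \<Rightarrow> (real \<Rightarrow> 'w \<Rightarrow> real ^ 'd) \<Rightarrow> real \<Rightarrow> real \<Rightarrow>
     real measure \<Rightarrow> (real \<Rightarrow> real \<Rightarrow> 'w \<Rightarrow> real) \<Rightarrow>
     (real \<Rightarrow> real ^ 'n \<Rightarrow> ('w \<Rightarrow> real ^ 'n) \<Rightarrow> 'w \<Rightarrow> real ^ 'n) \<Rightarrow>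
     (real \<Rightarrow> real ^ 'n \<Rightarrow> ('w \<Rightarrow> real ^ 'n) \<Rightarrow> 'w \<Rightarrow> real ^ 'd ^ 'n) \<Rightarrow>
     ('w \<Rightarrow> real ^ 'n) \<Rightarrow> (real \<Rightarrow> 'w \<Rightarrow> real ^ 'n) \<Rightarrow> (real \<Rightarrow> 'w \<Rightarrow> real ^ 'n) \<Rightarrow> bool" where
  "asde_solution P F W T \<delta> \<alpha> \<phi> b \<sigma> x0 l x \<longleftrightarrow>
     x \<in> L2_process P F 0 (T + \<delta>) \<and>
     (AE \<omega> in P. continuous_on {0..T} (\<lambda>t. x t \<omega>)) \<and>
     (\<forall>t\<in>{0..T}.
        (AE \<omega> in P. set_integrable \<alpha> {t..t + \<delta>} (\<lambda>s. \<phi> t s \<omega> *\<^sub>R x s \<omega>)) \<and>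
        advanced_term \<alpha> \<delta> \<phi> x t \<in> L2_rv P (F (t + \<delta>))) \<and>
     (\<lambda>t \<omega>. b t (x t \<omega>) (advanced_term \<alpha> \<delta> \<phi> x t) \<omega>) \<in> L2_process P F 0 T \<and>
     (\<lambda>t \<omega>. \<sigma> t (x t \<omega>) (advanced_term \<alpha> \<delta> \<phi> x t) \<omega>) \<in> L2_process P F 0 T \<and>
     (\<forall>t\<in>{0..T}. \<exists>I.
        has_ito_integral P F W t (\<lambda>s \<omega>. \<sigma> s (x s \<omega>) (advanced_term \<alpha> \<delta> \<phi> x s) \<omega>) I \<and>
        (AE \<omega> in P. x t \<omega> =
           x0 \<omega> + (LINT s:{0..t}|lborel. b s (x s \<omega>) (advanced_term \<alpha> \<delta> \<phi> x s) \<omega>) + I \<omega>)) \<and>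
     (AE \<omega> in P. x 0 \<omega> = x0 \<omega>) \<and>
     (AE \<omega> in P. \<forall>t\<in>{T<..T + \<delta>}. x t \<omega> = l t \<omega>)"

end

theory Submission
  imports Defs
begin

text \<open>
  The equation is solved by Picard iteration in the space of adapted processes \<open>x\<close> whose second
  moments are bounded on \<open>[0, T + \<delta>]\<close>. Two processes \<open>x\<close> and \<open>y\<close> that agree after time
  \<open>T\<close> are compared through \<open>D t\<close>, the mean of \<open>\<bar>x t - y t\<bar>\<^sup>2\<close>, and one iteration leads to
  processes with \<open>D' t\<close> at most a constant \<open>\<kappa>\<close> times the sum of the integral of \<open>D\<close> over
  \<open>[0, t]\<close> and the integral over \<open>[0, t]\<close> of the mean squared distance of the advanced terms
  (\<open>step_dist\<close>). The conditional expectation in the Lipschitz condition does no harm, since it is a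
  contraction in \<open>L\<^sup>2\<close>.

  The first integral is of Volterra type, and the weight \<open>exp (\<beta> t)\<close> with a large \<open>\<beta>\<close> makes it
  small. The second one looks ahead in time, where such a weight does not help. By Cauchy-Schwarz and
  the bound \<open>M\<close> on the kernel, the squared distance of the advanced terms at time \<open>s\<close> is at most
  \<open>M\<^sup>2 a\<close> times the integral of \<open>D\<close> over the window \<open>[s, s + \<delta>]\<close> with respect to \<open>\<alpha>\<close>,
  where \<open>a\<close> is the measure of \<open>[0, T + \<delta>]\<close>. Each point lies in the windows of a set of times
  \<open>s\<close> of length at most \<open>\<delta>\<close>, so by Tonelli's theorem the integral over \<open>s\<close> is at most
  \<open>M\<^sup>2 a\<^sup>2 \<delta>\<close> times the supremum of \<open>D\<close> (\<open>advanced_term_dist\<close>, \<open>window_integral\<close>). For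
  small \<open>\<delta>\<close> the iteration is therefore a contraction in the weighted norm (\<open>step_contraction\<close>),
  with constants that depend on \<open>T\<close>, \<open>C\<close>, \<open>M\<close> and \<open>\<alpha>\<close> only. The iterates converge, a further
  step gives their limit continuous paths, and the limit is a fixed point (\<open>fixed_point_exists\<close>).
  Conversely a solution has bounded second moments by the equation itself
  (\<open>fixed_point_of_asde_solution\<close>), so the contraction also yields uniqueness at each time, and
  continuity of the paths yields it for all times at once.

  For an iteration to make sense, the Ito integral of a square integrable adapted process has to exist
  as a continuous process and to depend on the integrand in a Lipschitz way. Simple processes are
  dense: averages over short intervals, used one interval later so that they are known in time,
  approximate every process (\<open>simple_processes_dense\<close>). That these averages are adapted is not a
  matter of Fubini's theorem, because the process is jointly measurable for the full sigma-algebra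
  only; it rests on completeness (\<open>integral_adapted_measurable_real\<close>), and the same lemma makes the
  drift and the advanced term adapted. The independence of the increments gives the isometry for simple
  processes (\<open>simple_ito_isometry\<close>), and the maximal inequality for their integrals turns
  approximation in mean square into uniform convergence of paths (\<open>maximal_inequality\<close>,
  \<open>ito_integral_exists\<close>).
\<close>

section \<open>Square integrals and measurability on a complete space\<close>

abbreviation sqn :: "'a::real_normed_vector \<Rightarrow> ennreal" where
  "sqn v \<equiv> ennreal ((norm v)\<^sup>2)"

lemma sqn_add_le: "sqn (a + b) \<le> 2 * (sqn a + sqn b)"
proof -
  have "(norm (a + b))\<^sup>2 \<le> (norm a + norm b)\<^sup>2"
    by (simp add: norm_triangle_ineq power_mono)
  also have "\<dots> \<le> 2 * ((norm a)\<^sup>2 + (norm b)\<^sup>2)"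
    using sum_squares_bound[of "norm a" "norm b"] by (simp add: power2_sum)
  finally have "sqn (a + b) \<le> ennreal (2 * ((norm a)\<^sup>2 + (norm b)\<^sup>2))"
    by (rule ennreal_leI)
  also have "\<dots> = 2 * (sqn a + sqn b)"
    by (subst ennreal_mult) (auto simp: ennreal_plus)
  finally show ?thesis .
qed

lemma sqn_diff_le: "sqn (a - b) \<le> 2 * (sqn a + sqn b)"
  using sqn_add_le[of a "- b"] by simp

lemma sqn_triangle: "sqn (a - c) \<le> 2 * (sqn (a - b) + sqn (b - c))"
  using sqn_add_le[of "a - b" "b - c"] by simp

lemma sqn_add3_le: "sqn (a + b + c) \<le> 3 * (sqn a + sqn b + sqn c)"
proof -
  have "(norm (a + b + c))\<^sup>2 \<le> (norm a + norm b + norm c)\<^sup>2"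
    by (intro power_mono norm_triangle_le add_right_mono norm_triangle_ineq) auto
  also have "\<dots> \<le> 3 * ((norm a)\<^sup>2 + (norm b)\<^sup>2 + (norm c)\<^sup>2)"
    using sum_squares_bound[of "norm a" "norm b"] sum_squares_bound[of "norm a" "norm c"]
      sum_squares_bound[of "norm b" "norm c"]
    by (simp add: power2_eq_square algebra_simps)
  finally have "sqn (a + b + c) \<le> ennreal (3 * ((norm a)\<^sup>2 + (norm b)\<^sup>2 + (norm c)\<^sup>2))"
    by (rule ennreal_leI)
  also have "\<dots> = 3 * (sqn a + sqn b + sqn c)"
    by (subst ennreal_mult) (auto simp: ennreal_plus)
  finally show ?thesis .
qed

lemma sqn_triangle3: "sqn (a - d) \<le> 3 * (sqn (a - b) + sqn (b - c) + sqn (c - d))"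
  using sqn_add3_le[of "a - b" "b - c" "c - d"] by simp

lemma sqn_scaleR: "sqn (r *\<^sub>R a) = ennreal (r\<^sup>2) * sqn a"
  by (simp add: power_mult_distrib ennreal_mult)

lemma norm_le_one_plus_square: "norm a \<le> 1 + (norm a)\<^sup>2"
proof -
  have "2 * norm a \<le> (norm a)\<^sup>2 + 1" using sum_squares_bound[of "norm a" 1] by simp
  then show ?thesis using norm_ge_zero[of a] by linarith
qed

text \<open>The two functions differ inside a null set, all of whose subsets belong to the smaller
  sigma-algebra. Solutions, integrals and limits are only determined up to null sets, and this is what
  keeps them adapted.\<close>

lemma measurable_AE_eq_complete:
  fixes X :: "'w \<Rightarrow> 'a::topological_space"
  assumes P: "complete_measure P" and G: "subalgebra P G" "null_sets P \<subseteq> sets G"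
    and X: "X \<in> borel_measurable G" and eq: "AE \<omega> in P. X \<omega> = Y \<omega>"
  shows "Y \<in> borel_measurable G"
proof (rule measurableI)
  interpret complete_measure P by fact
  obtain N where N: "{\<omega> \<in> space P. X \<omega> \<noteq> Y \<omega>} \<subseteq> N" "N \<in> null_sets P"
    using AE_E[OF eq] by (metis (mono_tags, lifting) null_setsI)
  fix A :: "'a set" assume A: "A \<in> sets borel"
  have sp: "space G = space P" using G(1) by (simp add: subalgebra_def)
  have "Y -` A \<inter> N \<inter> space P \<in> null_sets P"
    by (rule complete2[OF _ N(2)]) auto
  then have 1: "Y -` A \<inter> N \<inter> space P \<in> sets G" using G by auto
  have "N \<in> sets G" using N G by auto
  then have 2: "(X -` A \<inter> space G) - N \<in> sets G" using X A by auto
  have "Y -` A \<inter> space G = ((X -` A \<inter> space G) - N) \<union> (Y -` A \<inter> N \<inter> space P)"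
    using N(1) unfolding sp by auto
  then show "Y -` A \<inter> space G \<in> sets G" using 1 2 by simp
qed simp

lemma measurable_AE_lim_complete:
  fixes X :: "nat \<Rightarrow> 'w \<Rightarrow> 'a::{banach, second_countable_topology}"
  assumes P: "complete_measure P" and G: "subalgebra P G" "null_sets P \<subseteq> sets G"
    and X: "\<And>k. X k \<in> borel_measurable G" and lim: "AE \<omega> in P. (\<lambda>k. X k \<omega>) \<longlonglongrightarrow> Y \<omega>"
  shows "Y \<in> borel_measurable G"
proof (rule measurable_AE_eq_complete[OF P G])
  show "(\<lambda>\<omega>. lim (\<lambda>k. X k \<omega>)) \<in> borel_measurable G" using X by simp
  show "AE \<omega> in P. lim (\<lambda>k. X k \<omega>) = Y \<omega>" using lim by eventually_elim (rule limI)
qed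

text \<open>Cauchy-Schwarz against the constant \<open>1\<close>; when \<open>f\<close> is not integrable, its integral
  is \<open>0\<close>.\<close>

lemma sqn_integral_le:
  fixes f :: "'b \<Rightarrow> 'a::{banach, second_countable_topology}"
  assumes f: "f \<in> borel_measurable M"
  shows "sqn (\<integral>x. f x \<partial>M) \<le> emeasure M (space M) * (\<integral>\<^sup>+x. sqn (f x) \<partial>M)"
proof (cases "integrable M f")
  case True
  have [measurable]: "f \<in> borel_measurable M" by fact
  have "sqn (\<integral>x. f x \<partial>M) = (ennreal (norm (\<integral>x. f x \<partial>M)))\<^sup>2"
    by (simp add: ennreal_power)
  also have "\<dots> \<le> (\<integral>\<^sup>+x. ennreal (norm (f x)) * 1 \<partial>M)\<^sup>2"
    using integral_norm_bound_ennreal[OF True] by (intro power_mono) auto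
  also have "\<dots> \<le> (\<integral>\<^sup>+x. (ennreal (norm (f x)))\<^sup>2 \<partial>M) * (\<integral>\<^sup>+x. 1\<^sup>2 \<partial>M)"
    by (rule Cauchy_Schwarz_nn_integral) auto
  also have "\<dots> = emeasure M (space M) * (\<integral>\<^sup>+x. sqn (f x) \<partial>M)"
    by (simp add: ennreal_power mult.commute)
  finally show ?thesis .
next
  case False
  then show ?thesis by (simp add: not_integrable_integral_eq)
qed

lemma sqn_set_integral_le:
  fixes f :: "'b \<Rightarrow> 'a::{banach, second_countable_topology}"
  assumes A: "A \<in> sets M" and f: "(\<lambda>x. indicator A x *\<^sub>R f x) \<in> borel_measurable M"
  shows "sqn (LINT x:A|M. f x) \<le> emeasure M A * (\<integral>\<^sup>+x\<in>A. sqn (f x) \<partial>M)"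
proof -
  have A': "A \<inter> space M \<in> sets M" using A by simp
  have "f \<in> borel_measurable (restrict_space M A)"
    using f borel_measurable_restrict_space_iff[OF A'] by blast
  from sqn_integral_le[OF this] show ?thesis
    using A A' sets.sets_into_space[OF A]
    by (simp add: integral_restrict_space[OF A'] nn_integral_restrict_space[OF A']
        set_lebesgue_integral_def space_restrict_space emeasure_restrict_space Int_absorb2)
qed

text \<open>On a set of finite measure square integrability implies integrability, because
  \<open>\<bar>v\<bar> \<le> 1 + \<bar>v\<bar>\<^sup>2\<close>.\<close>

lemma nn_integral_norm_le_square:
  fixes f :: "'b \<Rightarrow> 'a::{banach, second_countable_topology}"
  assumes A: "A \<in> sets M" and f: "(\<lambda>x. indicator A x *\<^sub>R f x) \<in> borel_measurable M"
  shows "(\<integral>\<^sup>+x. ennreal (norm (indicator A x *\<^sub>R f x)) \<partial>M) \<le>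
    emeasure M A + (\<integral>\<^sup>+x. sqn (indicator A x *\<^sub>R f x) \<partial>M)"
proof -
  have [measurable]: "A \<in> sets M" "(\<lambda>x. indicator A x *\<^sub>R f x) \<in> borel_measurable M" by fact+
  have "(\<integral>\<^sup>+x. ennreal (norm (indicator A x *\<^sub>R f x)) \<partial>M) \<le>
      (\<integral>\<^sup>+x. indicator A x + sqn (indicator A x *\<^sub>R f x) \<partial>M)"
  proof (rule nn_integral_mono)
    fix x
    have "ennreal (norm (f x)) \<le> ennreal (1 + (norm (f x))\<^sup>2)"
      by (rule ennreal_leI[OF norm_le_one_plus_square])
    then show "ennreal (norm (indicator A x *\<^sub>R f x)) \<le> indicator A x + sqn (indicator A x *\<^sub>R f x)"
      by (cases "x \<in> A") (simp_all add: ennreal_plus)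
  qed
  also have "\<dots> = (\<integral>\<^sup>+x. indicator A x \<partial>M) + (\<integral>\<^sup>+x. sqn (indicator A x *\<^sub>R f x) \<partial>M)"
    by (rule nn_integral_add) measurable
  also have "(\<integral>\<^sup>+x. indicator A x \<partial>M) = emeasure M A" by (rule nn_integral_indicator[OF A])
  finally show ?thesis .
qed

lemma set_integrable_of_square:
  fixes f :: "'b \<Rightarrow> 'a::{banach, second_countable_topology}"
  assumes A: "A \<in> sets M" "emeasure M A < \<infinity>"
    and f: "(\<lambda>x. indicator A x *\<^sub>R f x) \<in> borel_measurable M"
    and fin: "(\<integral>\<^sup>+x\<in>A. sqn (f x) \<partial>M) < \<infinity>"
  shows "set_integrable M A f"
proof -
  have "(\<integral>\<^sup>+x. sqn (indicator A x *\<^sub>R f x) \<partial>M) = (\<integral>\<^sup>+x\<in>A. sqn (f x) \<partial>M)"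
    by (intro nn_integral_cong) (auto simp: indicator_def)
  then have "emeasure M A + (\<integral>\<^sup>+x. sqn (indicator A x *\<^sub>R f x) \<partial>M) < \<infinity>"
    using A(2) fin by simp
  from order_le_less_trans[OF nn_integral_norm_le_square[OF A(1) f] this] show ?thesis
    unfolding set_integrable_def by (intro integrableI_bounded f)
qed

lemma L2_dist_triangle:
  fixes X Y Z :: "'w \<Rightarrow> 'a::euclidean_space"
  assumes [measurable]: "X \<in> borel_measurable M" "Y \<in> borel_measurable M" "Z \<in> borel_measurable M"
  shows "(\<integral>\<^sup>+\<omega>. sqn (X \<omega> - Z \<omega>) \<partial>M) \<le>
    2 * ((\<integral>\<^sup>+\<omega>. sqn (X \<omega> - Y \<omega>) \<partial>M) + (\<integral>\<^sup>+\<omega>. sqn (Y \<omega> - Z \<omega>) \<partial>M))"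
proof -
  have "(\<integral>\<^sup>+\<omega>. sqn (X \<omega> - Z \<omega>) \<partial>M) \<le> (\<integral>\<^sup>+\<omega>. 2 * (sqn (X \<omega> - Y \<omega>) + sqn (Y \<omega> - Z \<omega>)) \<partial>M)"
    by (intro nn_integral_mono sqn_triangle)
  also have "\<dots> = 2 * ((\<integral>\<^sup>+\<omega>. sqn (X \<omega> - Y \<omega>) \<partial>M) + (\<integral>\<^sup>+\<omega>. sqn (Y \<omega> - Z \<omega>) \<partial>M))"
    by (subst nn_integral_cmult, measurable, subst nn_integral_add, measurable)
  finally show ?thesis .
qed

lemma L2_Fatou:
  fixes X :: "nat \<Rightarrow> 'w \<Rightarrow> 'a::euclidean_space"
  assumes [measurable]: "\<And>m. X m \<in> borel_measurable M" "Z \<in> borel_measurable M"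
    and lim: "AE \<omega> in M. (\<lambda>m. X m \<omega>) \<longlonglongrightarrow> Y \<omega>"
    and B: "\<And>m. k \<le> m \<Longrightarrow> (\<integral>\<^sup>+\<omega>. sqn (X m \<omega> - Z \<omega>) \<partial>M) \<le> B"
  shows "(\<integral>\<^sup>+\<omega>. sqn (Y \<omega> - Z \<omega>) \<partial>M) \<le> B"
proof -
  have "(\<integral>\<^sup>+\<omega>. sqn (Y \<omega> - Z \<omega>) \<partial>M) = (\<integral>\<^sup>+\<omega>. liminf (\<lambda>m. sqn (X m \<omega> - Z \<omega>)) \<partial>M)"
  proof (rule nn_integral_cong_AE)
    show "AE \<omega> in M. sqn (Y \<omega> - Z \<omega>) = liminf (\<lambda>m. sqn (X m \<omega> - Z \<omega>))"
      using lim
    proof eventually_elim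
      fix \<omega> assume "(\<lambda>m. X m \<omega>) \<longlonglongrightarrow> Y \<omega>"
      then have "(\<lambda>m. sqn (X m \<omega> - Z \<omega>)) \<longlonglongrightarrow> sqn (Y \<omega> - Z \<omega>)" by (intro tendsto_intros)
      from lim_imp_Liminf[OF _ this]
      show "sqn (Y \<omega> - Z \<omega>) = liminf (\<lambda>m. sqn (X m \<omega> - Z \<omega>))" by simp
    qed
  qed
  also have "\<dots> \<le> liminf (\<lambda>m. \<integral>\<^sup>+\<omega>. sqn (X m \<omega> - Z \<omega>) \<partial>M)"
    by (rule nn_integral_liminf) measurable
  also have "\<dots> \<le> limsup (\<lambda>m. \<integral>\<^sup>+\<omega>. sqn (X m \<omega> - Z \<omega>) \<partial>M)"
    by (rule Liminf_le_Limsup) simp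
  also have "\<dots> \<le> B"
    by (rule Limsup_bounded) (use B in \<open>auto simp: eventually_sequentially intro!: exI[of _ k]\<close>)
  finally show ?thesis .
qed

text \<open>The function \<open>h\<close> is jointly measurable for the large sigma-algebra and its sections are
  measurable for the small one, which does not make it jointly measurable for the small one. So the
  measurability of the integral \<open>Y\<close> cannot be read off from Fubini's theorem. Instead \<open>Y\<close> is
  shown to agree almost surely with its conditional expectation \<open>E\<close> given \<open>G\<close>. Put
  \<open>g = sgn (Y - E)\<close> and let \<open>e\<close> be the conditional expectation of \<open>g\<close>. Each \<open>h s\<close> is
  known to \<open>G\<close>, so under the integral over \<open>s\<close> the factor \<open>g\<close> may be replaced by \<open>e\<close>;
  the mean of \<open>Y g\<close> is therefore that of \<open>Y e\<close>, hence that of \<open>E e\<close>, hence that of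
  \<open>E g\<close>. The mean of \<open>\<bar>Y - E\<bar> = (Y - E) g\<close> vanishes.\<close>

lemma integral_adapted_measurable_real:
  fixes h :: "'s \<Rightarrow> 'w \<Rightarrow> real"
  assumes N: "sigma_finite_measure N" and P: "prob_space P" "complete_measure P"
    and G: "subalgebra P G" "null_sets P \<subseteq> sets G"
    and h: "(\<lambda>(s, \<omega>). h s \<omega>) \<in> borel_measurable (N \<Otimes>\<^sub>M P)"
    and hG: "\<And>s. s \<in> space N \<Longrightarrow> h s \<in> borel_measurable G"
    and fin: "(\<integral>\<^sup>+\<omega>. (\<integral>\<^sup>+s. ennreal (norm (h s \<omega>)) \<partial>N) \<partial>P) < \<infinity>"
  shows "(\<lambda>\<omega>. \<integral>s. h s \<omega> \<partial>N) \<in> borel_measurable G"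
proof -
  interpret P: prob_space P by fact
  interpret N: sigma_finite_measure N by fact
  interpret pair_sigma_finite N P ..
  interpret fs: finite_measure_subalgebra P G by standard fact
  have hm[measurable]: "(\<lambda>(s, \<omega>). h s \<omega>) \<in> borel_measurable (N \<Otimes>\<^sub>M P)" by fact
  have int: "integrable (N \<Otimes>\<^sub>M P) (\<lambda>(s, \<omega>). h s \<omega>)"
    using fin nn_integral_snd[of "\<lambda>(s, \<omega>). ennreal (norm (h s \<omega>))"]
    by (intro integrableI_bounded) (auto simp: case_prod_beta')
  define Y where "Y \<omega> = (\<integral>s. h s \<omega> \<partial>N)" for \<omega>
  have Yint: "integrable P Y"
    unfolding Y_def by (rule integrable_snd) (use int in auto)
  have Ym[measurable]: "Y \<in> borel_measurable P" using Yint by simp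
  define E where "E = real_cond_exp P G Y"
  have Em: "E \<in> borel_measurable G" unfolding E_def by simp
  have EP[measurable]: "E \<in> borel_measurable P" unfolding E_def by simp
  have Eint: "integrable P E" unfolding E_def by (rule fs.real_cond_exp_int(1)[OF Yint])
  have intg: "integrable (N \<Otimes>\<^sub>M P) (\<lambda>(s, \<omega>). h s \<omega> * g \<omega>)"
    if [measurable]: "g \<in> borel_measurable P" and b: "\<And>\<omega>. \<bar>g \<omega>\<bar> \<le> 1" for g :: "'w \<Rightarrow> real"
    by (rule Bochner_Integration.integrable_bound[OF int])
      (auto simp: split_beta abs_mult intro!: mult_left_le b)
  have fub: "(\<integral>\<omega>. Y \<omega> * g \<omega> \<partial>P) = (\<integral>s. (\<integral>\<omega>. h s \<omega> * g \<omega> \<partial>P) \<partial>N)"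
    if g: "g \<in> borel_measurable P" and b: "\<And>\<omega>. \<bar>g \<omega>\<bar> \<le> 1" for g :: "'w \<Rightarrow> real"
    using Fubini_integral[OF intg[OF g b]] by (simp add: Y_def)
  define g where "g \<omega> = sgn (Y \<omega> - E \<omega>)" for \<omega>
  have gm[measurable]: "g \<in> borel_measurable P" unfolding g_def by measurable
  have gb: "\<bar>g \<omega>\<bar> \<le> 1" for \<omega> unfolding g_def by (simp add: sgn_if)
  have gint: "integrable P g"
    by (rule P.integrable_const_bound[of _ 1]) (auto intro!: gb)
  \<comment> \<open>Truncated, so that it is bounded everywhere and the products with \<open>h\<close> stay jointly integrable.\<close>
  define e where "e \<omega> = max (-1) (min 1 (real_cond_exp P G g \<omega>))" for \<omega>
  have eG[measurable]: "e \<in> borel_measurable G" unfolding e_def by measurable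
  have eP[measurable]: "e \<in> borel_measurable P" by (rule measurable_from_subalg[OF G(1) eG])
  have eb: "\<bar>e \<omega>\<bar> \<le> 1" for \<omega> unfolding e_def by auto
  have ee: "AE \<omega> in P. real_cond_exp P G g \<omega> = e \<omega>"
  proof -
    have "AE \<omega> in P. real_cond_exp P G g \<omega> \<ge> -1"
      by (rule fs.real_cond_exp_ge_c[OF gint]) (use gb in \<open>auto simp: abs_le_iff minus_le_iff\<close>)
    moreover have "AE \<omega> in P. real_cond_exp P G g \<omega> \<le> 1"
      by (rule fs.real_cond_exp_le_c[OF gint]) (use gb in \<open>auto simp: abs_le_iff\<close>)
    ultimately show ?thesis by eventually_elim (auto simp: e_def)
  qed
  have swap: "(\<integral>\<omega>. f \<omega> * g \<omega> \<partial>P) = (\<integral>\<omega>. f \<omega> * e \<omega> \<partial>P)"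
    if f: "integrable P f" and fG: "f \<in> borel_measurable G" for f :: "'w \<Rightarrow> real"
  proof -
    have [measurable]: "f \<in> borel_measurable P" using f by simp
    have i: "integrable P (\<lambda>\<omega>. f \<omega> * g \<omega>)"
      by (rule Bochner_Integration.integrable_bound[OF f])
        (auto simp: abs_mult intro!: mult_left_le gb)
    have "(\<integral>\<omega>. f \<omega> * g \<omega> \<partial>P) = (\<integral>\<omega>. f \<omega> * real_cond_exp P G g \<omega> \<partial>P)"
      using fs.real_cond_exp_intg(2)[OF i fG gm] by simp
    also have "\<dots> = (\<integral>\<omega>. f \<omega> * e \<omega> \<partial>P)"
      by (rule integral_cong_AE) (use ee in auto)
    finally show ?thesis .
  qed
  have "(\<integral>\<omega>. Y \<omega> * g \<omega> \<partial>P) = (\<integral>s. (\<integral>\<omega>. h s \<omega> * e \<omega> \<partial>P) \<partial>N)"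
    unfolding fub[OF gm gb]
  proof (rule integral_cong_AE)
    have i1: "integrable (N \<Otimes>\<^sub>M P) (\<lambda>(s, \<omega>). h s \<omega> * g \<omega>)" by (rule intg) (use gb in auto)
    have i2: "integrable (N \<Otimes>\<^sub>M P) (\<lambda>(s, \<omega>). h s \<omega> * e \<omega>)" by (rule intg) (use eb in auto)
    show "(\<lambda>s. \<integral>\<omega>. h s \<omega> * g \<omega> \<partial>P) \<in> borel_measurable N"
      "(\<lambda>s. \<integral>\<omega>. h s \<omega> * e \<omega> \<partial>P) \<in> borel_measurable N" by measurable
    show "AE s in N. (\<integral>\<omega>. h s \<omega> * g \<omega> \<partial>P) = (\<integral>\<omega>. h s \<omega> * e \<omega> \<partial>P)"
      using AE_integrable_fst[OF int] by (auto intro!: swap hG)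
  qed
  also have "\<dots> = (\<integral>\<omega>. Y \<omega> * e \<omega> \<partial>P)" by (rule fub[symmetric]) (use eb in auto)
  also have "\<dots> = (\<integral>\<omega>. e \<omega> * E \<omega> \<partial>P)"
  proof -
    have "integrable P (\<lambda>\<omega>. e \<omega> * Y \<omega>)"
      by (rule Bochner_Integration.integrable_bound[OF Yint])
        (auto simp: abs_mult intro!: mult_left_le_one_le eb)
    from fs.real_cond_exp_intg(2)[OF this eG Ym] show ?thesis
      unfolding E_def by (simp add: mult.commute)
  qed
  also have "\<dots> = (\<integral>\<omega>. E \<omega> * g \<omega> \<partial>P)"
    using swap[OF Eint Em] by (simp add: mult.commute)
  finally have eq: "(\<integral>\<omega>. Y \<omega> * g \<omega> \<partial>P) = (\<integral>\<omega>. E \<omega> * g \<omega> \<partial>P)" .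
  have "(\<integral>\<omega>. \<bar>Y \<omega> - E \<omega>\<bar> \<partial>P) = (\<integral>\<omega>. Y \<omega> * g \<omega> - E \<omega> * g \<omega> \<partial>P)"
    by (rule Bochner_Integration.integral_cong)
      (auto simp: g_def left_diff_distrib[symmetric] abs_sgn)
  also have "\<dots> = 0"
  proof -
    have "integrable P (\<lambda>\<omega>. Y \<omega> * g \<omega>)"
      by (rule Bochner_Integration.integrable_bound[OF Yint])
        (auto simp: abs_mult intro!: mult_left_le gb)
    moreover have "integrable P (\<lambda>\<omega>. E \<omega> * g \<omega>)"
      by (rule Bochner_Integration.integrable_bound[OF Eint])
        (auto simp: abs_mult intro!: mult_left_le gb)
    ultimately show ?thesis by (simp add: eq)
  qed
  finally have "AE \<omega> in P. \<bar>Y \<omega> - E \<omega>\<bar> = 0"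
    using Yint Eint by (subst integral_nonneg_eq_0_iff_AE[symmetric]) auto
  then have "AE \<omega> in P. E \<omega> = Y \<omega>" by eventually_elim auto
  from measurable_AE_eq_complete[OF P(2) G Em this] show ?thesis by (simp add: Y_def[abs_def])
qed

text \<open>Joint integrability provides the second claim by Fubini's theorem; the first one holds for each
  component.\<close>

lemma integral_adapted_measurable:
  fixes h :: "'s \<Rightarrow> 'w \<Rightarrow> 'a::euclidean_space"
  assumes N: "sigma_finite_measure N" and P: "prob_space P" "complete_measure P"
    and G: "subalgebra P G" "null_sets P \<subseteq> sets G"
    and h: "(\<lambda>(s, \<omega>). h s \<omega>) \<in> borel_measurable (N \<Otimes>\<^sub>M P)"
    and hG: "\<And>s. s \<in> space N \<Longrightarrow> h s \<in> borel_measurable G"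
    and fin: "(\<integral>\<^sup>+\<omega>. (\<integral>\<^sup>+s. ennreal (norm (h s \<omega>)) \<partial>N) \<partial>P) < \<infinity>"
  shows "(\<lambda>\<omega>. \<integral>s. h s \<omega> \<partial>N) \<in> borel_measurable G"
    and "AE \<omega> in P. integrable N (\<lambda>s. h s \<omega>)"
proof -
  interpret P: prob_space P by fact
  interpret N: sigma_finite_measure N by fact
  interpret pair_sigma_finite N P ..
  have hm[measurable]: "(\<lambda>(s, \<omega>). h s \<omega>) \<in> borel_measurable (N \<Otimes>\<^sub>M P)" by fact
  have int: "integrable (N \<Otimes>\<^sub>M P) (\<lambda>(s, \<omega>). h s \<omega>)"
    using fin nn_integral_snd[of "\<lambda>(s, \<omega>). ennreal (norm (h s \<omega>))"]
    by (intro integrableI_bounded) (auto simp: case_prod_beta')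
  show ae: "AE \<omega> in P. integrable N (\<lambda>s. h s \<omega>)" by (rule AE_integrable_snd[OF int])
  have "(\<lambda>\<omega>. (\<integral>s. h s \<omega> \<partial>N) \<bullet> i) \<in> borel_measurable G" if i: "i \<in> Basis" for i
  proof (rule measurable_AE_eq_complete[OF P(2) G])
    show "(\<lambda>\<omega>. \<integral>s. h s \<omega> \<bullet> i \<partial>N) \<in> borel_measurable G"
    proof (rule integral_adapted_measurable_real[OF N P G])
      show "(\<lambda>(s, \<omega>). h s \<omega> \<bullet> i) \<in> borel_measurable (N \<Otimes>\<^sub>M P)" by measurable
      show "(\<lambda>\<omega>. h s \<omega> \<bullet> i) \<in> borel_measurable G" if "s \<in> space N" for s
        using hG[OF that] by simp
      have "(\<integral>\<^sup>+\<omega>. (\<integral>\<^sup>+s. ennreal (norm (h s \<omega> \<bullet> i)) \<partial>N) \<partial>P)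
          \<le> (\<integral>\<^sup>+\<omega>. (\<integral>\<^sup>+s. ennreal (norm (h s \<omega>)) \<partial>N) \<partial>P)"
        using i by (intro nn_integral_mono ennreal_leI) (simp add: Basis_le_norm)
      then show "(\<integral>\<^sup>+\<omega>. (\<integral>\<^sup>+s. ennreal (norm (h s \<omega> \<bullet> i)) \<partial>N) \<partial>P) < \<infinity>"
        using fin by (simp add: order_le_less_trans)
    qed
    show "AE \<omega> in P. (\<integral>s. h s \<omega> \<bullet> i \<partial>N) = (\<integral>s. h s \<omega> \<partial>N) \<bullet> i"
      using ae by eventually_elim simp
  qed
  then show "(\<lambda>\<omega>. \<integral>s. h s \<omega> \<partial>N) \<in> borel_measurable G"
    by (subst borel_measurable_euclidean_space) blast
qed

lemma set_integral_adapted_measurable: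
  fixes h :: "'s \<Rightarrow> 'w \<Rightarrow> 'a::euclidean_space"
  assumes N: "sigma_finite_measure N" and P: "prob_space P" "complete_measure P"
    and G: "subalgebra P G" "null_sets P \<subseteq> sets G" and A: "A \<in> sets N" "emeasure N A < \<infinity>"
    and h: "(\<lambda>(s, \<omega>). indicator A s *\<^sub>R h s \<omega>) \<in> borel_measurable (N \<Otimes>\<^sub>M P)"
    and hG: "\<And>s. s \<in> A \<Longrightarrow> h s \<in> borel_measurable G"
    and fin: "(\<integral>\<^sup>+\<omega>. (\<integral>\<^sup>+s. sqn (indicator A s *\<^sub>R h s \<omega>) \<partial>N) \<partial>P) < \<infinity>"
  shows "(\<lambda>\<omega>. LINT s:A|N. h s \<omega>) \<in> borel_measurable G"
proof -
  interpret P: prob_space P by fact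
  interpret N: sigma_finite_measure N by fact
  interpret pair_sigma_finite N P ..
  note [measurable] = h
  have hG': "(\<lambda>\<omega>. indicator A s *\<^sub>R h s \<omega>) \<in> borel_measurable G" for s
    using hG[of s] by (cases "s \<in> A") simp_all
  have "(\<integral>\<^sup>+\<omega>. (\<integral>\<^sup>+s. ennreal (norm (indicator A s *\<^sub>R h s \<omega>)) \<partial>N) \<partial>P) \<le>
      (\<integral>\<^sup>+\<omega>. emeasure N A + (\<integral>\<^sup>+s. sqn (indicator A s *\<^sub>R h s \<omega>) \<partial>N) \<partial>P)"
    by (intro nn_integral_mono nn_integral_norm_le_square A) measurable
  also have "\<dots> = (\<integral>\<^sup>+\<omega>. emeasure N A \<partial>P) + (\<integral>\<^sup>+\<omega>. (\<integral>\<^sup>+s. sqn (indicator A s *\<^sub>R h s \<omega>) \<partial>N) \<partial>P)"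
    by (rule nn_integral_add) measurable
  also have "\<dots> < \<infinity>" using fin A(2) by (simp add: P.emeasure_space_1)
  finally have "(\<integral>\<^sup>+\<omega>. (\<integral>\<^sup>+s. ennreal (norm (indicator A s *\<^sub>R h s \<omega>)) \<partial>N) \<partial>P) < \<infinity>" .
  from integral_adapted_measurable(1)[OF N P G h hG' this] show ?thesis
    unfolding set_lebesgue_integral_def .
qed

text \<open>Extension by zero turns statements about processes on a time set \<open>S\<close> into statements about the
  full product space, where integrals can be exchanged.\<close>

lemma restrict_pair_measurable_iff:
  fixes f :: "'s \<Rightarrow> 'w \<Rightarrow> 'a::real_normed_vector"
  assumes S: "S \<in> sets N"
  shows "(\<lambda>(t, \<omega>). f t \<omega>) \<in> borel_measurable (restrict_space N S \<Otimes>\<^sub>M P) \<longleftrightarrow>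
    (\<lambda>(t, \<omega>). indicator S t *\<^sub>R f t \<omega>) \<in> borel_measurable (N \<Otimes>\<^sub>M P)"
proof
  have [measurable]: "S \<in> sets N" by fact
  have S': "S \<times> space P \<in> sets (N \<Otimes>\<^sub>M P)" using S by auto
  {
    assume f: "(\<lambda>(t, \<omega>). f t \<omega>) \<in> borel_measurable (restrict_space N S \<Otimes>\<^sub>M P)"
    have "(\<lambda>z. z) \<in> restrict_space (N \<Otimes>\<^sub>M P) (S \<times> space P) \<rightarrow>\<^sub>M restrict_space N S \<Otimes>\<^sub>M P"
    proof (rule measurable_pair)
      show "fst \<circ> (\<lambda>z. z) \<in> restrict_space (N \<Otimes>\<^sub>M P) (S \<times> space P) \<rightarrow>\<^sub>M restrict_space N S"
        by (rule measurable_restrict_space2)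
          (auto intro!: measurable_restrict_space1 simp: space_restrict_space comp_def)
      show "snd \<circ> (\<lambda>z. z) \<in> restrict_space (N \<Otimes>\<^sub>M P) (S \<times> space P) \<rightarrow>\<^sub>M P"
        by (auto intro!: measurable_restrict_space1 simp: comp_def)
    qed
    from measurable_compose[OF this f]
    have "(\<lambda>z. indicator (S \<times> space P) z *\<^sub>R (case z of (t, \<omega>) \<Rightarrow> f t \<omega>)) \<in> borel_measurable (N \<Otimes>\<^sub>M P)"
      by (subst (asm) borel_measurable_restrict_space_iff) (use S' in auto)
    then show "(\<lambda>(t, \<omega>). indicator S t *\<^sub>R f t \<omega>) \<in> borel_measurable (N \<Otimes>\<^sub>M P)"
      by (rule measurable_cong[THEN iffD1, rotated])
        (auto simp: space_pair_measure indicator_times)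
  next
    assume f: "(\<lambda>(t, \<omega>). indicator S t *\<^sub>R f t \<omega>) \<in> borel_measurable (N \<Otimes>\<^sub>M P)"
    have "(\<lambda>z. z) \<in> restrict_space N S \<Otimes>\<^sub>M P \<rightarrow>\<^sub>M N \<Otimes>\<^sub>M P"
    proof (rule measurable_pair)
      show "fst \<circ> (\<lambda>z. z) \<in> restrict_space N S \<Otimes>\<^sub>M P \<rightarrow>\<^sub>M N"
        by (auto simp: comp_def intro!: measurable_compose[OF measurable_fst] measurable_restrict_space1)
    qed (auto simp: comp_def)
    from measurable_compose[OF this f]
    show "(\<lambda>(t, \<omega>). f t \<omega>) \<in> borel_measurable (restrict_space N S \<Otimes>\<^sub>M P)"
      by (rule measurable_cong[THEN iffD1, rotated])
        (auto simp: space_pair_measure space_restrict_space)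
  }
qed

text \<open>Points of countably many fixed grids, clamped to \<open>[0, T]\<close>: a continuous path is determined
  by its values there.\<close>

lemma grid_tendsto:
  fixes T :: real
  assumes t: "t \<in> {0..T}"
  shows "(\<lambda>n. max 0 (min T (of_int \<lfloor>real (Suc n) * t\<rfloor> / real (Suc n)))) \<longlonglongrightarrow> t"
proof -
  have "(\<lambda>n. of_int \<lfloor>real (Suc n) * t\<rfloor> / real (Suc n)) \<longlonglongrightarrow> t"
  proof (rule tendsto_sandwich)
    show "\<forall>\<^sub>F n in sequentially. t - 1 / real (Suc n) \<le> of_int \<lfloor>real (Suc n) * t\<rfloor> / real (Suc n)"
    proof (intro always_eventually allI)
      fix n
      have "real (Suc n) * t - 1 \<le> of_int \<lfloor>real (Suc n) * t\<rfloor>" by linarith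
      then have "(real (Suc n) * t - 1) / real (Suc n) \<le> of_int \<lfloor>real (Suc n) * t\<rfloor> / real (Suc n)"
        by (rule divide_right_mono) simp
      then show "t - 1 / real (Suc n) \<le> of_int \<lfloor>real (Suc n) * t\<rfloor> / real (Suc n)"
        by (simp add: diff_divide_distrib)
    qed
    show "\<forall>\<^sub>F n in sequentially. of_int \<lfloor>real (Suc n) * t\<rfloor> / real (Suc n) \<le> t"
    proof (intro always_eventually allI)
      fix n
      have "of_int \<lfloor>real (Suc n) * t\<rfloor> \<le> real (Suc n) * t" by linarith
      then show "of_int \<lfloor>real (Suc n) * t\<rfloor> / real (Suc n) \<le> t"
        by (simp add: divide_le_eq mult.commute)
    qed
    show "(\<lambda>n. t - 1 / real (Suc n)) \<longlonglongrightarrow> t"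
      using tendsto_diff[OF tendsto_const[of t] LIMSEQ_inverse_real_of_nat] by (simp add: inverse_eq_divide)
  qed simp
  then have "(\<lambda>n. max 0 (min T (of_int \<lfloor>real (Suc n) * t\<rfloor> / real (Suc n)))) \<longlonglongrightarrow> max 0 (min T t)"
    by (intro tendsto_intros)
  then show ?thesis using t by (simp add: max_def)
qed

text \<open>The process is the limit of the processes frozen at the last point of a grid, and each of these is
  glued from countably many random variables.\<close>

lemma continuous_process_measurable:
  fixes X :: "real \<Rightarrow> 'w \<Rightarrow> 'a::{banach, second_countable_topology}"
  assumes T: "0 \<le> T" and X: "\<And>t. t \<in> {0..T} \<Longrightarrow> X t \<in> borel_measurable P"
    and cont: "\<And>\<omega>. \<omega> \<in> space P \<Longrightarrow> continuous_on {0..T} (\<lambda>t. X t \<omega>)"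
  shows "(\<lambda>(t, \<omega>). X t \<omega>) \<in> borel_measurable (restrict_space borel {0..T} \<Otimes>\<^sub>M P)"
proof (rule borel_measurable_LIMSEQ_metric)
  define r where "r n t = max 0 (min T (of_int \<lfloor>real (Suc n) * t\<rfloor> / real (Suc n)))" for n and t :: real
  show "(\<lambda>(t, \<omega>). X (r n t) \<omega>) \<in> borel_measurable (restrict_space borel {0..T} \<Otimes>\<^sub>M P)" for n
  proof -
    have "(\<lambda>z. X (max 0 (min T (of_int \<lfloor>real (Suc n) * fst z\<rfloor> / real (Suc n)))) (snd z))
        \<in> borel_measurable (restrict_space borel {0..T} \<Otimes>\<^sub>M P)"
    proof (rule measurable_compose_countable'[where I=UNIV and g="\<lambda>z. \<lfloor>real (Suc n) * fst z\<rfloor>" and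
        f="\<lambda>i z. X (max 0 (min T (of_int i / real (Suc n)))) (snd z)"])
      show "(\<lambda>z. X (max 0 (min T (real_of_int i / real (Suc n)))) (snd z))
          \<in> borel_measurable (restrict_space borel {0..T} \<Otimes>\<^sub>M P)" for i
        by (rule measurable_compose[OF measurable_snd X]) (use T in auto)
      have "fst \<in> borel_measurable (restrict_space borel {0..T} \<Otimes>\<^sub>M P)"
        by (rule measurable_compose[OF measurable_fst]) (auto simp: measurable_restrict_space1)
      then show "(\<lambda>z. \<lfloor>real (Suc n) * fst z\<rfloor>)
          \<in> restrict_space borel {0..T} \<Otimes>\<^sub>M P \<rightarrow>\<^sub>M count_space UNIV" by measurable
    qed auto
    then show ?thesis by (simp add: r_def case_prod_beta')
  qed
  fix z assume z: "z \<in> space (restrict_space borel {0..T} \<Otimes>\<^sub>M P)"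
  obtain t \<omega> where [simp]: "z = (t, \<omega>)" by fastforce
  have t: "t \<in> {0..T}" "\<omega> \<in> space P" using z by (auto simp: space_pair_measure space_restrict_space)
  have "(\<lambda>n. r n t) \<longlonglongrightarrow> t" unfolding r_def by (rule grid_tendsto[OF t(1)])
  then have "(\<lambda>n. X (r n t) \<omega>) \<longlonglongrightarrow> X t \<omega>"
    by (rule continuous_on_tendsto_compose[OF cont[OF t(2)]]) (use t T in \<open>auto simp: r_def\<close>)
  then show "(\<lambda>n. case z of (t, \<omega>) \<Rightarrow> X (r n t) \<omega>) \<longlonglongrightarrow> (case z of (t, \<omega>) \<Rightarrow> X t \<omega>)" by simp
qed

text \<open>A Borel function is almost everywhere a limit of continuous functions. Their nearest points in the
  ball that contains the values of \<open>f\<close> still converge to \<open>f\<close> and are bounded, so dominated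
  convergence applies.\<close>

lemma clipped_approximation:
  fixes f :: "real \<Rightarrow> 'a::euclidean_space"
  assumes f: "f \<in> borel_measurable borel" and K: "0 \<le> K" "\<And>t. norm (f t) \<le> K" and e: "0 < (e::ennreal)"
  shows "\<exists>g. continuous_on UNIV g \<and> (\<integral>\<^sup>+t\<in>{a..b}. sqn (f t - g t) \<partial>lborel) < e"
proof -
  have [measurable]: "f \<in> borel_measurable borel" by fact
  have "f \<in> borel_measurable (lebesgue_on UNIV)" using f
    by (intro measurable_restrict_space1 measurable_completion) simp
  then have "f measurable_on UNIV"
    by (intro lebesgue_measurable_imp_measurable_on) auto
  then obtain N g where N: "negligible N" and gc: "\<And>n. continuous_on UNIV (g n)"
    and lim: "\<And>x. x \<notin> N \<Longrightarrow> (\<lambda>n. g n x) \<longlonglongrightarrow> f x"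
    unfolding measurable_on_def by auto
  define c where "c = closest_point (cball (0::'a) K)"
  have cc: "continuous_on UNIV c"
    unfolding c_def using K by (intro continuous_on_closest_point) auto
  have cK: "norm (c v) \<le> K" for v
    using closest_point_in_set[of "cball (0::'a) K" v] K by (auto simp: c_def)
  have cf: "c (f t) = f t" for t
    unfolding c_def by (rule closest_point_self) (use K in auto)
  define h where "h n t = c (g n t)" for n t
  have hc: "continuous_on UNIV (h n)" for n
    unfolding h_def by (rule continuous_on_compose2[OF cc gc]) auto
  have [measurable]: "h n \<in> borel_measurable borel" for n
    using hc by (rule borel_measurable_continuous_onI)
  have "N \<in> null_sets lebesgue" using N by (simp add: negligible_iff_null_sets)
  then obtain N' where N': "N' \<in> null_sets lborel" "N \<subseteq> N'"
    by (auto simp: null_sets_completion_iff2)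
  have ae: "AE t in lborel. (\<lambda>n. h n t) \<longlonglongrightarrow> f t"
  proof (rule AE_I'[OF N'(1)], rule subsetI)
    fix t assume "t \<in> {t \<in> space lborel. \<not> (\<lambda>n. h n t) \<longlonglongrightarrow> f t}"
    moreover have "(\<lambda>n. h n t) \<longlonglongrightarrow> f t" if "t \<notin> N"
      using continuous_on_tendsto_compose[OF cc lim[OF that]] by (simp add: h_def cf)
    ultimately show "t \<in> N'" using N' by auto
  qed
  have "(\<lambda>n. \<integral>\<^sup>+t\<in>{a..b}. sqn (f t - h n t) \<partial>lborel) \<longlonglongrightarrow> (\<integral>\<^sup>+t. 0 \<partial>(lborel :: real measure))"
  proof (rule nn_integral_dominated_convergence[where w="\<lambda>t. ennreal ((K + K)\<^sup>2) * indicator {a..b} t"])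
    show "AE t in lborel. sqn (f t - h n t) * indicator {a..b} t \<le> ennreal ((K + K)\<^sup>2) * indicator {a..b} t" for n
    proof (intro AE_I2 mult_right_mono ennreal_leI power_mono)
      fix t show "norm (f t - h n t) \<le> K + K"
        using norm_triangle_ineq4[of "f t" "h n t"] K(2)[of t] cK[of "g n t"] by (simp add: h_def)
    qed auto
    show "(\<integral>\<^sup>+t. ennreal ((K + K)\<^sup>2) * indicator {a..b} t \<partial>lborel) < \<infinity>"
      using emeasure_bounded_finite[OF bounded_closed_interval, of a b]
      by (simp add: nn_integral_cmult_indicator ennreal_mult_less_top)
    show "AE t in lborel. (\<lambda>n. sqn (f t - h n t) * indicator {a..b} t) \<longlonglongrightarrow> 0"
      using ae
    proof eventually_elim
      fix t assume "(\<lambda>n. h n t) \<longlonglongrightarrow> f t"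
      then have "(\<lambda>n. sqn (f t - h n t)) \<longlonglongrightarrow> ennreal ((norm (f t - f t))\<^sup>2)"
        by (intro tendsto_intros)
      then show "(\<lambda>n. sqn (f t - h n t) * indicator {a..b} t) \<longlonglongrightarrow> 0"
        by (auto simp: indicator_def)
    qed
  qed auto
  then have "eventually (\<lambda>n. (\<integral>\<^sup>+t\<in>{a..b}. sqn (f t - h n t) \<partial>lborel) < e) sequentially"
    using e by (simp add: order_tendstoD(2))
  then show ?thesis using hc by (auto simp: eventually_sequentially)
qed

text \<open>The function is first cut off at a high level and then approximated by clipped continuous
  functions.\<close>

lemma continuous_dense_L2:
  fixes f :: "real \<Rightarrow> 'a::euclidean_space"
  assumes f: "f \<in> borel_measurable borel" and fin: "(\<integral>\<^sup>+t\<in>{a..b}. sqn (f t) \<partial>lborel) < \<infinity>" and e: "0 < (e::ennreal)"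
  shows "\<exists>g. continuous_on UNIV g \<and> (\<integral>\<^sup>+t\<in>{a..b}. sqn (f t - g t) \<partial>lborel) < e"
proof -
  have [measurable]: "f \<in> borel_measurable borel" by fact
  obtain e' :: ennreal where e': "0 < e'" "4 * e' \<le> e"
  proof (cases e)
    case (real r)
    show ?thesis
      by (rule that[of "ennreal (r / 4)"]) (use real e in \<open>auto simp: ennreal_mult' [symmetric] ennreal_numeral[symmetric] simp del: ennreal_numeral\<close>)
  next
    case top
    show ?thesis by (rule that[of 1]) (simp_all add: top)
  qed
  define k where "k n t = (if norm (f t) \<le> real n then f t else 0)" for n t
  have [measurable]: "k n \<in> borel_measurable borel" for n unfolding k_def by measurable
  have "(\<lambda>n. \<integral>\<^sup>+t\<in>{a..b}. sqn (f t - k n t) \<partial>lborel) \<longlonglongrightarrow> (\<integral>\<^sup>+t. 0 \<partial>(lborel :: real measure))"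
  proof (rule nn_integral_dominated_convergence[where w="\<lambda>t. sqn (f t) * indicator {a..b} t"])
    show "AE t in lborel. sqn (f t - k n t) * indicator {a..b} t \<le> sqn (f t) * indicator {a..b} t" for n
      by (intro AE_I2 mult_right_mono) (auto simp: k_def)
    show "AE t in lborel. (\<lambda>n. sqn (f t - k n t) * indicator {a..b} t) \<longlonglongrightarrow> 0"
    proof (rule AE_I2)
      fix t
      have "eventually (\<lambda>n. real n \<ge> norm (f t)) sequentially"
        using filterlim_at_top[THEN iffD1, OF filterlim_real_sequentially] by simp
      then have "eventually (\<lambda>n. sqn (f t - k n t) * indicator {a..b} t = 0) sequentially"
        by eventually_elim (simp add: k_def)
      then show "(\<lambda>n. sqn (f t - k n t) * indicator {a..b} t) \<longlonglongrightarrow> 0" by (rule tendsto_eventually)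
    qed
  qed (use fin in auto)
  then have "eventually (\<lambda>n. (\<integral>\<^sup>+t\<in>{a..b}. sqn (f t - k n t) \<partial>lborel) < e') sequentially"
    using e' by (simp add: order_tendstoD(2))
  then obtain n where n: "(\<integral>\<^sup>+t\<in>{a..b}. sqn (f t - k n t) \<partial>lborel) < e'"
    by (auto simp: eventually_sequentially)
  obtain g where g: "continuous_on UNIV g" "(\<integral>\<^sup>+t\<in>{a..b}. sqn (k n t - g t) \<partial>lborel) < e'"
  proof -
    have "\<And>t. norm (k n t) \<le> real n" by (simp add: k_def)
    from clipped_approximation[of "k n" "real n", OF _ _ this e'(1), where a=a and b=b]
    show ?thesis using that by auto
  qed
  have [measurable]: "g \<in> borel_measurable borel" using g(1) by (rule borel_measurable_continuous_onI)
  have "(\<integral>\<^sup>+t\<in>{a..b}. sqn (f t - g t) \<partial>lborel) \<le>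
    (\<integral>\<^sup>+t. 2 * (sqn (f t - k n t) * indicator {a..b} t + sqn (k n t - g t) * indicator {a..b} t) \<partial>lborel)"
    by (intro nn_integral_mono) (simp add: indicator_def sqn_triangle del: distrib_left_numeral)
  also have "\<dots> = 2 * ((\<integral>\<^sup>+t\<in>{a..b}. sqn (f t - k n t) \<partial>lborel) + (\<integral>\<^sup>+t\<in>{a..b}. sqn (k n t - g t) \<partial>lborel))"
    by (simp add: nn_integral_cmult nn_integral_add)
  also have "\<dots> < 2 * (e' + e')"
    using n g(2) by (intro ennreal_mult_strict_left_mono add_strict_mono) auto
  also have "\<dots> \<le> e" using e'(2) by (simp add: mult_2[symmetric] mult.assoc[symmetric])
  finally show ?thesis using g(1) by blast
qed

section \<open>Approximation by delayed averages\<close>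

lemma tendsto_0_ennrealI:
  fixes X :: "nat \<Rightarrow> ennreal"
  assumes c: "c < \<infinity>" and X: "\<And>e. 0 < (e::real) \<Longrightarrow> eventually (\<lambda>n. X n \<le> c * ennreal e) sequentially"
  shows "X \<longlonglongrightarrow> 0"
proof (rule order_tendstoI)
  fix a :: ennreal assume a: "0 < a"
  obtain k where k: "c = ennreal k" "0 \<le> k" using c by (cases c) auto
  obtain e where e: "0 < (e::real)" "c * ennreal e < a"
  proof (cases a)
    case (real r)
    then have r: "0 < r" using a by auto
    have "c * ennreal (r / (2 * (k + 1))) = ennreal (k * (r / (2 * (k + 1))))"
      unfolding k(1) by (rule ennreal_mult[symmetric]) (use k r in auto)
    also have "\<dots> < ennreal r"
    proof (rule ennreal_lessI[OF r])
      show "k * (r / (2 * (k + 1))) < r" using k r by (auto simp: field_simps intro!: add_nonneg_pos)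
    qed
    finally have "c * ennreal (r / (2 * (k + 1))) < a" using real by simp
    then show ?thesis by (rule that[rotated]) (use r k in simp)
  next
    case top
    show ?thesis by (rule that[of 1]) (use c in \<open>simp_all add: top less_top\<close>)
  qed
  show "eventually (\<lambda>n. X n < a) sequentially"
    using X[OF e(1)] by eventually_elim (use e(2) in auto)
qed simp

lemma ennreal_mult3:
  "0 \<le> a \<Longrightarrow> 0 \<le> b \<Longrightarrow> 0 \<le> c \<Longrightarrow> ennreal a * ennreal b * ennreal c = ennreal (a * b * c)"
  by (simp add: ennreal_mult)

lemma interval_partition_mono:
  fixes \<tau> :: "nat \<Rightarrow> real"
  assumes "\<And>i. i < N \<Longrightarrow> \<tau> i \<le> \<tau> (Suc i)" and "i \<le> j" "j \<le> N"
  shows "\<tau> i \<le> \<tau> j"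
  using assms(2,3)
proof (induction j rule: dec_induct)
  case (step j)
  then show ?case using assms(1)[of j] by simp
qed simp

lemma interval_partition_sum:
  fixes \<tau> :: "nat \<Rightarrow> real" and c :: "nat \<Rightarrow> 'a::comm_monoid_add"
  assumes mono: "\<And>i. i < N \<Longrightarrow> \<tau> i \<le> \<tau> (Suc i)" and i: "i < N" "s \<in> {\<tau> i<..\<tau> (Suc i)}"
  shows "(\<Sum>j<N. if s \<in> {\<tau> j<..\<tau> (Suc j)} then c j else 0) = c i"
proof -
  have "s \<notin> {\<tau> j<..\<tau> (Suc j)}" if "j < N" "j \<noteq> i" for j
  proof (cases "j < i")
    case True
    then have "\<tau> (Suc j) \<le> \<tau> i" using i(1) by (intro interval_partition_mono[where N=N and \<tau>=\<tau>, OF mono]) auto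
    then show ?thesis using i(2) by auto
  next
    case False
    then have "\<tau> (Suc i) \<le> \<tau> j" using that by (intro interval_partition_mono[where N=N and \<tau>=\<tau>, OF mono]) auto
    then show ?thesis using i(2) by auto
  qed
  then have "(\<Sum>j<N. if s \<in> {\<tau> j<..\<tau> (Suc j)} then c j else 0) = (\<Sum>j<N. if j = i then c i else 0)"
    using i(2) by (intro sum.cong) auto
  also have "\<dots> = c i" using i(1) by simp
  finally show ?thesis .
qed

lemma interval_partition_cover:
  fixes \<tau> :: "nat \<Rightarrow> real"
  assumes "s \<in> {\<tau> 0<..\<tau> N}"
  shows "\<exists>i<N. s \<in> {\<tau> i<..\<tau> (Suc i)}"
  using assms
proof (induction N)
  case (Suc N)
  show ?case
  proof (cases "s \<le> \<tau> N")
    case True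
    then show ?thesis using Suc by (auto intro: less_SucI)
  next
    case False
    then show ?thesis using Suc.prems by (intro exI[of _ N]) auto
  qed
qed auto

text \<open>The mean of \<open>f\<close> over the interval \<^emph>\<open>before\<close> the \<open>i\<close>-th of \<open>n\<close> intervals of
  \<open>[0, T]\<close>; for \<open>i = 0\<close> it lies to the left of \<open>0\<close>. Because of this delay, the average of
  an adapted process is known when the interval begins on which it is used.\<close>

definition step_average :: "real \<Rightarrow> nat \<Rightarrow> (real \<Rightarrow> 'a::euclidean_space) \<Rightarrow> nat \<Rightarrow> 'a" where
  "step_average T n f i =
     (real n / T) *\<^sub>R (LINT u:{(real i - 1) * T / real n<..real i * T / real n}|lborel. f u)"

definition delayed_average :: "real \<Rightarrow> nat \<Rightarrow> (real \<Rightarrow> 'a::euclidean_space) \<Rightarrow> real \<Rightarrow> 'a" where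
  "delayed_average T n f s =
     (\<Sum>i<n. indicator {real i * T / real n<..real (Suc i) * T / real n} s *\<^sub>R step_average T n f i)"

lemma delayed_average_eq:
  assumes "0 < T" "i < n" "s \<in> {real i * T / real n<..real (Suc i) * T / real n}"
  shows "delayed_average T n f s = step_average T n f i"
proof -
  have "(\<Sum>j<n. if s \<in> {real j * T / real n<..real (Suc j) * T / real n} then step_average T n f j else 0)
     = step_average T n f i"
    by (rule interval_partition_sum) (use assms in \<open>auto simp: divide_right_mono\<close>)
  moreover have "delayed_average T n f s =
      (\<Sum>j<n. if s \<in> {real j * T / real n<..real (Suc j) * T / real n} then step_average T n f j else 0)"
    unfolding delayed_average_def by (intro sum.cong) (auto simp: indicator_def)
  ultimately show ?thesis by simp
qed

lemma sqn_step_average_le: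
  assumes T: "0 < T" "0 < n" and f: "f \<in> borel_measurable borel"
  shows "ennreal (T / n) * sqn (step_average T n f i) \<le>
    (\<integral>\<^sup>+u\<in>{(real i - 1) * T / real n<..real i * T / real n}. sqn (f u) \<partial>lborel)"
proof -
  have [measurable]: "f \<in> borel_measurable borel" by fact
  let ?I = "{(real i - 1) * T / real n<..real i * T / real n}"
  have em: "emeasure lborel ?I = ennreal (T / n)"
    using T by (simp add: divide_right_mono diff_divide_distrib[symmetric] left_diff_distrib)
  have "ennreal (T / n) * sqn (step_average T n f i)
      = ennreal (T / n) * ennreal ((n / T)\<^sup>2) * sqn (LINT u:?I|lborel. f u)"
    unfolding step_average_def sqn_scaleR by (simp add: mult.assoc)
  also have "\<dots> \<le> ennreal (T / n) * ennreal ((n / T)\<^sup>2) *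
      (ennreal (T / n) * (\<integral>\<^sup>+u\<in>?I. sqn (f u) \<partial>lborel))"
    using sqn_set_integral_le[of ?I lborel f] unfolding em by (intro mult_left_mono) auto
  also have "\<dots> = (ennreal (T / n) * ennreal ((n / T)\<^sup>2) * ennreal (T / n)) * (\<integral>\<^sup>+u\<in>?I. sqn (f u) \<partial>lborel)"
    by (simp only: mult.assoc)
  also have "ennreal (T / n) * ennreal ((n / T)\<^sup>2) * ennreal (T / n) = ennreal (T / n * (n / T)\<^sup>2 * (T / n))"
    by (rule ennreal_mult3) (use T in auto)
  also have "T / n * (n / T)\<^sup>2 * (T / n) = 1"
    using T by (simp add: power2_eq_square)
  finally show ?thesis by simp
qed

lemma delayed_average_measurable [measurable]: "delayed_average T n f \<in> borel_measurable borel"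
  unfolding delayed_average_def[abs_def] by measurable

lemma delayed_interval_lower:
  assumes T: "0 < (T::real)" "0 < n" shows "- T \<le> (real i - 1) * T / real n"
proof -
  have "(- real n) * T \<le> (real i - 1) * T" using T by (intro mult_right_mono) auto
  then show ?thesis using T by (simp add: le_divide_eq mult.commute)
qed

text \<open>By Cauchy-Schwarz each average contributes at most the square integral of \<open>f\<close> over the interval
  it is taken from, and these intervals are disjoint subsets of \<open>[- T, T]\<close>.\<close>

lemma delayed_average_contraction:
  assumes T: "0 < T" "0 < n" and f: "f \<in> borel_measurable borel"
  shows "(\<integral>\<^sup>+s\<in>{0..T}. sqn (delayed_average T n f s) \<partial>lborel) \<le> (\<integral>\<^sup>+s\<in>{-T..T}. sqn (f s) \<partial>lborel)"
proof -
  have [measurable]: "f \<in> borel_measurable borel" by fact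
  let ?J = "\<lambda>i. {real i * T / real n<..real (Suc i) * T / real n}"
  let ?I = "\<lambda>i. {(real i - 1) * T / real n<..real i * T / real n}"
  have em: "emeasure lborel (?J i) = ennreal (T / n)" for i
    using T by (simp add: divide_right_mono diff_divide_distrib[symmetric] left_diff_distrib algebra_simps)
  have "(\<integral>\<^sup>+s\<in>{0..T}. sqn (delayed_average T n f s) \<partial>lborel) \<le>
      (\<integral>\<^sup>+s. (\<Sum>i<n. sqn (step_average T n f i) * indicator (?J i) s) \<partial>lborel)"
  proof (rule nn_integral_mono)
    fix s
    show "sqn (delayed_average T n f s) * indicator {0..T} s
      \<le> (\<Sum>i<n. sqn (step_average T n f i) * indicator (?J i) s)"
    proof (cases "\<exists>i<n. s \<in> ?J i")
      case True
      then obtain i where i: "i < n" "s \<in> ?J i" by blast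
      have "sqn (delayed_average T n f s) * indicator {0..T} s
          \<le> sqn (step_average T n f i) * indicator (?J i) s"
        using delayed_average_eq[OF T(1) i, of f] i by (simp add: indicator_def)
      also have "\<dots> \<le> (\<Sum>i<n. sqn (step_average T n f i) * indicator (?J i) s)"
        using i by (intro member_le_sum) auto
      finally show ?thesis .
    next
      case False
      then have "delayed_average T n f s = 0"
        unfolding delayed_average_def by (intro sum.neutral) (auto simp: indicator_def)
      then show ?thesis by simp
    qed
  qed
  also have "\<dots> = (\<Sum>i<n. sqn (step_average T n f i) * ennreal (T / n))"
    by (subst nn_integral_sum) (auto simp: nn_integral_cmult_indicator em simp del: emeasure_lborel_Ioc of_nat_Suc)
  also have "\<dots> \<le> (\<Sum>i<n. (\<integral>\<^sup>+u\<in>?I i. sqn (f u) \<partial>lborel))"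
    using sqn_step_average_le[OF T f] by (intro sum_mono) (simp add: mult.commute)
  also have "\<dots> = (\<integral>\<^sup>+u. (\<Sum>i<n. sqn (f u) * indicator (?I i) u) \<partial>lborel)"
    by (subst nn_integral_sum) auto
  also have "\<dots> \<le> (\<integral>\<^sup>+s\<in>{-T..T}. sqn (f s) \<partial>lborel)"
  proof (rule nn_integral_mono)
    fix u
    show "(\<Sum>i<n. sqn (f u) * indicator (?I i) u) \<le> sqn (f u) * indicator {-T..T} u"
    proof (cases "\<exists>i<n. u \<in> ?I i")
      case True
      then obtain i where i: "i < n" "u \<in> ?I i" by blast
      have "(\<Sum>j<n. if u \<in> {(real j - 1) * T / real n<..(real (Suc j) - 1) * T / real n} then sqn (f u) else 0)
          = sqn (f u)"
        by (rule interval_partition_sum[where i=i and \<tau>="\<lambda>j. (real j - 1) * T / real n"])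
          (use i T in \<open>auto simp: divide_right_mono\<close>)
      moreover have "(\<Sum>i<n. sqn (f u) * indicator (?I i) u) =
          (\<Sum>j<n. if u \<in> {(real j - 1) * T / real n<..(real (Suc j) - 1) * T / real n} then sqn (f u) else 0)"
        by (intro sum.cong) (auto simp: indicator_def)
      ultimately have "(\<Sum>i<n. sqn (f u) * indicator (?I i) u) = sqn (f u)" by simp
      moreover have "- T \<le> (real i - 1) * T / real n"
        by (rule delayed_interval_lower[OF T])
      moreover have "real i * T / real n \<le> T"
      proof -
        have "real i * T \<le> real n * T" using T i by (intro mult_right_mono) auto
        then show ?thesis using T by (simp add: divide_le_eq mult.commute)
      qed
      ultimately show ?thesis using i by (auto simp: indicator_def)
    next
      case False
      then have "(\<Sum>i<n. sqn (f u) * indicator (?I i) u) = 0"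
        by (intro sum.neutral) (auto simp: indicator_def)
      then show ?thesis by (simp only: zero_le)
    qed
  qed
  finally show ?thesis .
qed

lemma step_average_diff:
  assumes T: "0 < T" "i < n" and f: "set_integrable lborel {-T..T} f" and g: "set_integrable lborel {-T..T} g"
  shows "step_average T n (\<lambda>u. f u - g u) i = step_average T n f i - step_average T n g i"
proof -
  have sub: "{(real i - 1) * T / real n<..real i * T / real n} \<subseteq> {-T..T}"
  proof -
    have "- T \<le> (real i - 1) * T / real n" using T by (intro delayed_interval_lower) auto
    moreover have "real i * T \<le> real n * T" using T by (intro mult_right_mono) auto
    then have "real i * T / real n \<le> T" using T by (simp add: divide_le_eq mult.commute)
    ultimately show ?thesis by auto
  qed
  show ?thesis
    using set_integrable_subset[OF f _ sub] set_integrable_subset[OF g _ sub]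
    by (simp add: step_average_def set_integral_diff scaleR_diff_right)
qed

lemma delayed_average_diff:
  assumes T: "0 < T" and f: "set_integrable lborel {-T..T} f" and g: "set_integrable lborel {-T..T} g"
  shows "delayed_average T n (\<lambda>u. f u - g u) s = delayed_average T n f s - delayed_average T n g s"
  unfolding delayed_average_def sum_subtractf[symmetric] scaleR_diff_right[symmetric]
  by (rule sum.cong) (use step_average_diff[OF T _ f g] in auto)

lemma step_average_const:
  assumes "0 < T" "0 < n" shows "step_average T n (\<lambda>u. v) i = v"
proof -
  have "measure lborel {(real i - 1) * T / real n<..real i * T / real n} = T / n"
    using assms by (simp add: divide_right_mono diff_divide_distrib[symmetric] left_diff_distrib)
  moreover have "emeasure lborel {(real i - 1) * T / real n<..real i * T / real n} < \<infinity>"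
    by (rule emeasure_bounded_finite[unfolded infinity_ennreal_def[symmetric]]) auto
  ultimately show ?thesis using assms
    by (simp add: step_average_def set_integral_const)
qed

text \<open>The points that enter the average at time \<open>s\<close> lie within \<open>2 T / n\<close> of \<open>s\<close>, so the
  uniform continuity of \<open>g\<close> on \<open>[- T, T]\<close> applies.\<close>

lemma delayed_average_tendsto_continuous:
  assumes T: "0 < T" and g: "continuous_on UNIV g" and e: "0 < (e::real)"
  shows "eventually (\<lambda>n. \<forall>s\<in>{0<..T}. sqn (g s - delayed_average T (Suc n) g s) \<le> ennreal e) sequentially"
proof -
  have [measurable]: "g \<in> borel_measurable borel" using g by (rule borel_measurable_continuous_onI)
  have "uniformly_continuous_on {-T..T} g"
    by (intro compact_uniformly_continuous continuous_on_subset[OF g]) auto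
  then obtain d where d: "0 < d"
    "\<And>x y. x \<in> {-T..T} \<Longrightarrow> y \<in> {-T..T} \<Longrightarrow> dist x y < d \<Longrightarrow> dist (g x) (g y) < sqrt e"
    unfolding uniformly_continuous_on_def using e by (meson real_sqrt_gt_zero)
  have gi: "set_integrable lborel {-T..T} g"
    unfolding set_integrable_def
    by (rule borel_integrable_compact) (auto intro: continuous_on_subset[OF g])
  have "eventually (\<lambda>n. real (Suc n) > 2 * T / d) sequentially"
    using filterlim_at_top_dense[THEN iffD1, OF filterlim_real_sequentially, rule_format, of "2 * T / d"]
    by eventually_elim simp
  then show ?thesis
  proof eventually_elim
    case (elim n)
    let ?n = "real (Suc n)"
    have nd: "2 * T / ?n < d" using elim d T by (simp add: field_simps)
    show ?case
    proof
      fix s assume s: "s \<in> {0<..T}"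
      have "\<exists>i<Suc n. s \<in> {real i * T / ?n<..real (Suc i) * T / ?n}"
        by (rule interval_partition_cover[of _ "\<lambda>i. real i * T / ?n"]) (use s in auto)
      then obtain i where i: "i < Suc n" "s \<in> {real i * T / ?n<..real (Suc i) * T / ?n}" by blast
      let ?I = "{(real i - 1) * T / ?n<..real i * T / ?n}"
      have ci: "set_integrable lborel {-T..T} (\<lambda>u. g s)"
        by (auto simp: set_integrable_def emeasure_lborel_Icc_eq)
      have eq: "delayed_average T (Suc n) g s - g s = step_average T (Suc n) (\<lambda>u. g u - g s) i"
        using step_average_diff[OF T i(1) gi ci] step_average_const[OF T, of "Suc n" "g s" i]
          delayed_average_eq[OF T i, of g] by simp
      have close: "sqn (g u - g s) \<le> ennreal e" if u: "u \<in> ?I" for u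
      proof -
        have "s - u < 2 * T / ?n"
          using i u T by (simp add: field_simps)
        then have du: "dist u s < d" using nd i u by (auto simp: dist_real_def)
        have "- T \<le> (real i - 1) * T / ?n" by (rule delayed_interval_lower[OF T]) simp
        then have "dist (g u) (g s) < sqrt e"
          using s u i by (intro d(2) du) auto
        then have "(norm (g u - g s))\<^sup>2 \<le> (sqrt e)\<^sup>2" by (intro power_mono) (auto simp: dist_norm)
        then show ?thesis using e by (simp add: ennreal_leI)
      qed
      have em: "emeasure lborel ?I = ennreal (T / ?n)"
        using T by (simp add: divide_right_mono diff_divide_distrib[symmetric] left_diff_distrib)
      have "ennreal (T / ?n) * sqn (step_average T (Suc n) (\<lambda>u. g u - g s) i) \<le>
          (\<integral>\<^sup>+u\<in>?I. sqn (g u - g s) \<partial>lborel)"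
        by (rule sqn_step_average_le) (use T in auto)
      also have "\<dots> \<le> (\<integral>\<^sup>+u. ennreal e * indicator ?I u \<partial>lborel)"
        using close by (intro nn_integral_mono) (auto simp: indicator_def)
      also have "\<dots> = ennreal (T / ?n) * ennreal e"
        by (subst nn_integral_cmult_indicator) (auto simp: em mult.commute[of "ennreal e"] simp del: emeasure_lborel_Ioc of_nat_Suc)
      finally have "sqn (step_average T (Suc n) (\<lambda>u. g u - g s) i) \<le> ennreal e"
        using T by (subst (asm) ennreal_mult_le_mult_iff) auto
      then show "sqn (g s - delayed_average T (Suc n) g s) \<le> ennreal e"
        unfolding eq[symmetric] by (simp add: norm_minus_commute)
    qed
  qed
qed

text \<open>The averages are linear contractions that converge on the dense set of continuous functions, so
  they converge everywhere.\<close>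

lemma delayed_average_tendsto_L2:
  assumes T: "0 < T" and f: "f \<in> borel_measurable borel"
    and fin: "(\<integral>\<^sup>+s\<in>{-T..T}. sqn (f s) \<partial>lborel) < \<infinity>"
  shows "(\<lambda>n. \<integral>\<^sup>+s\<in>{0..T}. sqn (f s - delayed_average T (Suc n) f s) \<partial>lborel) \<longlonglongrightarrow> 0"
proof (rule tendsto_0_ennrealI)
  have [measurable]: "f \<in> borel_measurable borel" by fact
  have fI: "set_integrable lborel {-T..T} f"
    by (rule set_integrable_of_square) (use fin in \<open>auto simp: emeasure_lborel_Icc_eq\<close>)
  \<comment> \<open>The three terms come from the approximation of \<open>f\<close>, the uniform error for the continuous \<open>g\<close> on an interval of length \<open>T\<close>, and the contraction applied to \<open>g - f\<close>.\<close>
  show "3 * (1 + ennreal T + 1) < \<infinity>" by (auto simp: ennreal_mult_less_top)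
  fix e :: real assume e: "0 < e"
  obtain g where g: "continuous_on UNIV g" "(\<integral>\<^sup>+t\<in>{-T..T}. sqn (f t - g t) \<partial>lborel) < ennreal e"
    using continuous_dense_L2[OF f fin, of "ennreal e"] e by auto
  have [measurable]: "g \<in> borel_measurable borel" using g(1) by (rule borel_measurable_continuous_onI)
  have gI: "set_integrable lborel {-T..T} g"
    unfolding set_integrable_def
    by (rule borel_integrable_compact) (auto intro: continuous_on_subset[OF g(1)])
  show "eventually (\<lambda>n. (\<integral>\<^sup>+s\<in>{0..T}. sqn (f s - delayed_average T (Suc n) f s) \<partial>lborel)
      \<le> 3 * (1 + ennreal T + 1) * ennreal e) sequentially"
    using delayed_average_tendsto_continuous[OF T g(1) e]
  proof eventually_elim
    case (elim n)
    let ?A = "delayed_average T (Suc n)"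
    have lin: "?A g s - ?A f s = ?A (\<lambda>u. g u - f u) s" for s
      by (rule delayed_average_diff[OF T gI fI, symmetric])
    have "(\<integral>\<^sup>+s\<in>{0..T}. sqn (f s - ?A f s) \<partial>lborel) \<le>
      (\<integral>\<^sup>+s. 3 * (sqn (f s - g s) * indicator {-T..T} s + ennreal e * indicator {0..T} s
         + sqn (?A (\<lambda>u. g u - f u) s) * indicator {0..T} s) \<partial>lborel)"
    proof (rule nn_integral_mono_AE)
      have "AE s in lborel. s \<noteq> (0::real)" by (rule AE_lborel_singleton)
      then show "AE s in lborel. sqn (f s - ?A f s) * indicator {0..T} s \<le>
        3 * (sqn (f s - g s) * indicator {-T..T} s + ennreal e * indicator {0..T} s
         + sqn (?A (\<lambda>u. g u - f u) s) * indicator {0..T} s)"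
      proof eventually_elim
        fix s :: real assume s: "s \<noteq> 0"
        show "sqn (f s - ?A f s) * indicator {0..T} s \<le>
          3 * (sqn (f s - g s) * indicator {-T..T} s + ennreal e * indicator {0..T} s
           + sqn (?A (\<lambda>u. g u - f u) s) * indicator {0..T} s)"
        proof (cases "s \<in> {0..T}")
          case True
          then have "sqn (g s - ?A g s) \<le> ennreal e" using s elim by auto
          then have "3 * (sqn (f s - g s) + sqn (g s - ?A g s) + sqn (?A g s - ?A f s)) \<le>
             3 * (sqn (f s - g s) + ennreal e + sqn (?A g s - ?A f s))"
            by (intro mult_left_mono add_mono) auto
          with sqn_triangle3[of "f s" "?A f s" "g s" "?A g s"]
          have "sqn (f s - ?A f s) \<le> 3 * (sqn (f s - g s) + ennreal e + sqn (?A g s - ?A f s))"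
            by (rule order_trans)
          then show ?thesis using True unfolding lin by (simp add: indicator_def)
        qed simp
      qed
    qed
    also have "\<dots> = 3 * ((\<integral>\<^sup>+s\<in>{-T..T}. sqn (f s - g s) \<partial>lborel) + ennreal e * ennreal T
         + (\<integral>\<^sup>+s\<in>{0..T}. sqn (?A (\<lambda>u. g u - f u) s) \<partial>lborel))"
      using T by (simp add: nn_integral_cmult nn_integral_add nn_integral_cmult_indicator)
    also have "\<dots> \<le> 3 * (ennreal e + ennreal e * ennreal T + ennreal e)"
    proof (intro mult_left_mono add_mono)
      have "(\<integral>\<^sup>+s\<in>{0..T}. sqn (?A (\<lambda>u. g u - f u) s) \<partial>lborel) \<le> (\<integral>\<^sup>+s\<in>{-T..T}. sqn (g s - f s) \<partial>lborel)"
        by (rule delayed_average_contraction) (use T in auto)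
      then show "(\<integral>\<^sup>+s\<in>{0..T}. sqn (?A (\<lambda>u. g u - f u) s) \<partial>lborel) \<le> ennreal e"
        using g(2) by (simp add: norm_minus_commute)
    qed (use g(2) in auto)
    also have "\<dots> = 3 * (1 + ennreal T + 1) * ennreal e"
      by (simp add: distrib_left distrib_right mult_ac)
    finally show ?case .
  qed
qed

section \<open>Complete filtrations and density of simple processes\<close>

locale complete_filtration = prob_space P + complete_measure P for P :: "'w measure" +
  fixes F :: "real \<Rightarrow> 'w measure"
  assumes subalgebra_F: "\<And>t. 0 \<le> t \<Longrightarrow> subalgebra P (F t)"
    and null_F: "\<And>t. 0 \<le> t \<Longrightarrow> null_sets P \<subseteq> sets (F t)"
    and mono_F: "\<And>s t. 0 \<le> s \<Longrightarrow> s \<le> t \<Longrightarrow> sets (F s) \<subseteq> sets (F t)"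
begin

lemma space_F: "0 \<le> t \<Longrightarrow> space (F t) = space P"
  using subalgebra_F[of t] by (simp add: subalgebra_def)

lemma measurable_F_P: "0 \<le> t \<Longrightarrow> X \<in> borel_measurable (F t) \<Longrightarrow> X \<in> borel_measurable P"
  by (rule measurable_from_subalg[OF subalgebra_F])

lemma measurable_F_mono:
  "X \<in> borel_measurable (F s) \<Longrightarrow> 0 \<le> s \<Longrightarrow> s \<le> t \<Longrightarrow> X \<in> borel_measurable (F t)"
  by (rule measurable_from_subalg[of "F t" "F s"]) (simp_all add: subalgebra_def space_F mono_F)

lemma measurable_F_AE_eq:
  fixes X :: "'w \<Rightarrow> 'a::topological_space"
  shows "0 \<le> t \<Longrightarrow> X \<in> borel_measurable (F t) \<Longrightarrow> AE \<omega> in P. X \<omega> = Y \<omega> \<Longrightarrow> Y \<in> borel_measurable (F t)"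
  by (rule measurable_AE_eq_complete[OF complete_measure_axioms subalgebra_F null_F])

lemma measurable_F_AE_lim:
  fixes X :: "nat \<Rightarrow> 'w \<Rightarrow> 'a::{banach, second_countable_topology}"
  shows "0 \<le> t \<Longrightarrow> (\<And>k. X k \<in> borel_measurable (F t)) \<Longrightarrow> AE \<omega> in P. (\<lambda>k. X k \<omega>) \<longlonglongrightarrow> Y \<omega>
    \<Longrightarrow> Y \<in> borel_measurable (F t)"
  by (rule measurable_AE_lim_complete[OF complete_measure_axioms subalgebra_F null_F])

lemma L2_rv_iff:
  assumes "0 \<le> t"
  shows "X \<in> L2_rv P (F t) \<longleftrightarrow> X \<in> borel_measurable (F t) \<and> (\<integral>\<^sup>+\<omega>. sqn (X \<omega>) \<partial>P) < \<infinity>"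
proof (cases "X \<in> borel_measurable (F t)")
  case True
  then have [measurable]: "X \<in> borel_measurable P" by (rule measurable_F_P[OF assms])
  show ?thesis using True by (simp add: L2_rv_def integrable_iff_bounded)
qed (simp add: L2_rv_def)

lemma L2_rvD:
  assumes "X \<in> L2_rv P (F t)" "0 \<le> t"
  shows "X \<in> borel_measurable (F t)" "X \<in> borel_measurable P" "(\<integral>\<^sup>+\<omega>. sqn (X \<omega>) \<partial>P) < \<infinity>"
    "integrable P (\<lambda>\<omega>. (norm (X \<omega>))\<^sup>2)"
proof -
  show *: "X \<in> borel_measurable (F t)" "(\<integral>\<^sup>+\<omega>. sqn (X \<omega>) \<partial>P) < \<infinity>"
    using assms(1) unfolding L2_rv_iff[OF assms(2)] by blast+
  show "X \<in> borel_measurable P" by (rule measurable_F_P[OF assms(2) *(1)])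
  show "integrable P (\<lambda>\<omega>. (norm (X \<omega>))\<^sup>2)" using assms(1) by (simp add: L2_rv_def)
qed

lemma L2_rv_mono: "X \<in> L2_rv P (F s) \<Longrightarrow> 0 \<le> s \<Longrightarrow> s \<le> t \<Longrightarrow> X \<in> L2_rv P (F t)"
  unfolding L2_rv_def by (auto intro: measurable_F_mono)

lemma L2_rv_zero [simp]: "(\<lambda>_. 0) \<in> L2_rv P G"
  by (simp add: L2_rv_def)

lemma L2_rv_add:
  assumes "X \<in> L2_rv P (F t)" "Y \<in> L2_rv P (F t)" "0 \<le> t"
  shows "(\<lambda>\<omega>. X \<omega> + Y \<omega>) \<in> L2_rv P (F t)"
proof -
  note [measurable] = L2_rvD(2)[OF assms(1,3)] L2_rvD(2)[OF assms(2,3)]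
  have "(\<integral>\<^sup>+\<omega>. sqn (X \<omega> + Y \<omega>) \<partial>P) \<le> (\<integral>\<^sup>+\<omega>. 2 * (sqn (X \<omega>) + sqn (Y \<omega>)) \<partial>P)"
    by (intro nn_integral_mono sqn_add_le)
  also have "\<dots> = 2 * ((\<integral>\<^sup>+\<omega>. sqn (X \<omega>) \<partial>P) + (\<integral>\<^sup>+\<omega>. sqn (Y \<omega>) \<partial>P))"
    by (simp add: nn_integral_cmult nn_integral_add)
  also have "\<dots> < \<infinity>"
    using L2_rvD(3)[OF assms(1,3)] L2_rvD(3)[OF assms(2,3)] by (simp add: ennreal_mult_less_top)
  finally show ?thesis
    using L2_rvD(1)[OF assms(1,3)] L2_rvD(1)[OF assms(2,3)] by (simp add: L2_rv_iff[OF assms(3)])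
qed

lemma L2_rv_scaleR:
  assumes "X \<in> L2_rv P (F t)" shows "(\<lambda>\<omega>. c *\<^sub>R X \<omega>) \<in> L2_rv P (F t)"
  using assms by (auto simp: L2_rv_def power_mult_distrib)

lemma L2_rv_diff:
  assumes "X \<in> L2_rv P (F t)" "Y \<in> L2_rv P (F t)" "0 \<le> t"
  shows "(\<lambda>\<omega>. X \<omega> - Y \<omega>) \<in> L2_rv P (F t)"
  using L2_rv_add[OF assms(1) L2_rv_scaleR[OF assms(2), of "-1"] assms(3)] by simp

lemma L2_rv_sum:
  assumes "\<And>i. i \<in> I \<Longrightarrow> X i \<in> L2_rv P (F t)" "0 \<le> t"
  shows "(\<lambda>\<omega>. \<Sum>i\<in>I. X i \<omega>) \<in> L2_rv P (F t)"
  using assms by (induction I rule: infinite_finite_induct) (auto intro: L2_rv_add)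

lemma L2_rv_integrable_inner:
  fixes X Y :: "'w \<Rightarrow> 'a::euclidean_space"
  assumes "X \<in> L2_rv P (F s)" "Y \<in> L2_rv P (F t)" "0 \<le> s" "0 \<le> t"
  shows "integrable P (\<lambda>\<omega>. X \<omega> \<bullet> Y \<omega>)"
proof (rule Bochner_Integration.integrable_bound)
  note [measurable] = L2_rvD(2)[OF assms(1,3)] L2_rvD(2)[OF assms(2,4)]
  show "integrable P (\<lambda>\<omega>. (norm (X \<omega>))\<^sup>2 + (norm (Y \<omega>))\<^sup>2)"
    using L2_rvD(4)[OF assms(1,3)] L2_rvD(4)[OF assms(2,4)] by simp
  show "(\<lambda>\<omega>. X \<omega> \<bullet> Y \<omega>) \<in> borel_measurable P" by measurable
  show "AE \<omega> in P. norm (X \<omega> \<bullet> Y \<omega>) \<le> norm ((norm (X \<omega>))\<^sup>2 + (norm (Y \<omega>))\<^sup>2)"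
  proof (rule AE_I2)
    fix \<omega>
    have "\<bar>X \<omega> \<bullet> Y \<omega>\<bar> \<le> norm (X \<omega>) * norm (Y \<omega>)" by (rule Cauchy_Schwarz_ineq2)
    also have "\<dots> \<le> (norm (X \<omega>))\<^sup>2 + (norm (Y \<omega>))\<^sup>2"
      using sum_squares_bound[of "norm (X \<omega>)" "norm (Y \<omega>)"]
        mult_nonneg_nonneg[OF norm_ge_zero norm_ge_zero, of "X \<omega>" "Y \<omega>"] by linarith
    finally show "norm (X \<omega> \<bullet> Y \<omega>) \<le> norm ((norm (X \<omega>))\<^sup>2 + (norm (Y \<omega>))\<^sup>2)" by simp
  qed
qed

lemma L2_process_measurable:
  assumes "h \<in> L2_process P F a b"
  shows "(\<lambda>(t, \<omega>). indicator {a..b} t *\<^sub>R h t \<omega>) \<in> borel_measurable (borel \<Otimes>\<^sub>M P)"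
  using assms restrict_pair_measurable_iff[of "{a..b}" borel h P]
  by (simp add: L2_process_def adapted_process_def)

text \<open>The delayed averages of the paths, extended by \<open>0\<close> to negative times, are simple integrands:
  the average used from time \<open>i T / n\<close> on integrates the process over earlier times only, so it is
  known at that time. They converge to the path for almost every outcome, and since they are
  contractions, dominated convergence gives convergence in mean square.\<close>

theorem simple_processes_dense:
  fixes h :: "real \<Rightarrow> 'w \<Rightarrow> real ^ 'd ^ 'n"
  assumes T: "0 < T" and h: "h \<in> L2_process P F 0 T"
  obtains \<xi> where "\<And>n. simple_integrand P F T (Suc n) (\<lambda>i. real i * T / real (Suc n)) (\<xi> n)"
    "(\<lambda>n. \<integral>\<^sup>+\<omega>. (\<integral>\<^sup>+s\<in>{0..T}.
       sqn (h s \<omega> - simple_value (Suc n) (\<lambda>i. real i * T / real (Suc n)) (\<xi> n) s \<omega>) \<partial>lborel) \<partial>P) \<longlonglongrightarrow> 0"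
proof -
  interpret pair_sigma_finite lborel P ..
  define f where "f u \<omega> = indicator {0..T} u *\<^sub>R h u \<omega>" for u \<omega>
  have fm: "(\<lambda>(u, \<omega>). f u \<omega>) \<in> borel_measurable (borel \<Otimes>\<^sub>M P)"
    unfolding f_def by (rule L2_process_measurable[OF h])
  have sets_eq: "sets (lborel \<Otimes>\<^sub>M P) = sets (borel \<Otimes>\<^sub>M P)" by (intro sets_pair_measure_cong) auto
  have [measurable]: "(\<lambda>(u, \<omega>). f u \<omega>) \<in> borel_measurable (lborel \<Otimes>\<^sub>M P)"
    using fm measurable_cong_sets[OF sets_eq refl] by blast
  have fmw: "(\<lambda>u. f u \<omega>) \<in> borel_measurable borel" if "\<omega> \<in> space P" for \<omega>
    using measurable_compose[OF measurable_Pair2'[OF that, of borel] fm] by simp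
  have fin: "(\<integral>\<^sup>+\<omega>. (\<integral>\<^sup>+s. sqn (f s \<omega>) \<partial>lborel) \<partial>P) < \<infinity>"
  proof -
    have "(\<integral>\<^sup>+\<omega>. (\<integral>\<^sup>+s. sqn (f s \<omega>) \<partial>lborel) \<partial>P) = (\<integral>\<^sup>+\<omega>. (\<integral>\<^sup>+s\<in>{0..T}. sqn (h s \<omega>) \<partial>lborel) \<partial>P)"
      by (intro nn_integral_cong) (auto simp: f_def indicator_def)
    then show ?thesis using h by (simp add: L2_process_def)
  qed
  have fF: "f u \<in> borel_measurable (F t)" if "0 \<le> t" "u \<le> t" for u t
  proof (cases "u \<in> {0..T}")
    case True
    then have "h u \<in> borel_measurable (F u)" using h by (auto simp: L2_process_def adapted_process_def)
    from measurable_F_mono[OF this _ that(2)] True show ?thesis by (simp add: f_def[abs_def])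
  qed (simp add: f_def[abs_def])
  define \<xi> where "\<xi> n i \<omega> = step_average T (Suc n) (\<lambda>u. f u \<omega>) i" for n i \<omega>
  have sv: "simple_value (Suc n) (\<lambda>i. real i * T / real (Suc n)) (\<xi> n) s \<omega> = delayed_average T (Suc n) (\<lambda>u. f u \<omega>) s"
    for n s \<omega>
    unfolding simple_value_def delayed_average_def \<xi>_def ..
  have \<xi>L2: "\<xi> n i \<in> L2_rv P (F (real i * T / real (Suc n)))" for n i
  proof -
    let ?t = "real i * T / real (Suc n)"
    let ?I = "{(real i - 1) * T / real (Suc n)<..?t}"
    have t0: "0 \<le> ?t" using T by simp
    have emI: "emeasure lborel ?I < \<infinity>"
      by (rule emeasure_bounded_finite[unfolded infinity_ennreal_def[symmetric]]) auto
    have "(\<lambda>\<omega>. LINT u:?I|lborel. f u \<omega>) \<in> borel_measurable (F ?t)"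
    proof (rule set_integral_adapted_measurable[OF lborel.sigma_finite_measure_axioms prob_space_axioms
          complete_measure_axioms subalgebra_F[OF t0] null_F[OF t0] _ emI])
      show "(\<lambda>(s, \<omega>). indicator ?I s *\<^sub>R f s \<omega>) \<in> borel_measurable (lborel \<Otimes>\<^sub>M P)" by measurable
      show "f s \<in> borel_measurable (F ?t)" if "s \<in> ?I" for s
        using fF[OF t0, of s] that by simp
      have "(\<integral>\<^sup>+\<omega>. (\<integral>\<^sup>+s. sqn (indicator ?I s *\<^sub>R f s \<omega>) \<partial>lborel) \<partial>P) \<le>
          (\<integral>\<^sup>+\<omega>. (\<integral>\<^sup>+s. sqn (f s \<omega>) \<partial>lborel) \<partial>P)"
        by (intro nn_integral_mono) (auto simp: indicator_def)
      then show "(\<integral>\<^sup>+\<omega>. (\<integral>\<^sup>+s. sqn (indicator ?I s *\<^sub>R f s \<omega>) \<partial>lborel) \<partial>P) < \<infinity>"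
        using fin by (rule order_le_less_trans)
    qed simp
    then have m: "\<xi> n i \<in> borel_measurable (F ?t)"
      unfolding \<xi>_def[abs_def] step_average_def by simp
    have "ennreal (T / real (Suc n)) * (\<integral>\<^sup>+\<omega>. sqn (\<xi> n i \<omega>) \<partial>P)
       = (\<integral>\<^sup>+\<omega>. ennreal (T / real (Suc n)) * sqn (\<xi> n i \<omega>) \<partial>P)"
      using measurable_F_P[OF t0 m] by (subst nn_integral_cmult) auto
    also have "\<dots> \<le> (\<integral>\<^sup>+\<omega>. (\<integral>\<^sup>+s. sqn (f s \<omega>) \<partial>lborel) \<partial>P)"
    proof (rule nn_integral_mono)
      fix \<omega> assume w: "\<omega> \<in> space P"
      have "ennreal (T / real (Suc n)) * sqn (\<xi> n i \<omega>) \<le> (\<integral>\<^sup>+u\<in>?I. sqn (f u \<omega>) \<partial>lborel)"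
        unfolding \<xi>_def by (rule sqn_step_average_le[OF T _ fmw[OF w]]) simp
      also have "\<dots> \<le> (\<integral>\<^sup>+s. sqn (f s \<omega>) \<partial>lborel)"
        by (intro nn_integral_mono) (auto simp: indicator_def)
      finally show "ennreal (T / real (Suc n)) * sqn (\<xi> n i \<omega>) \<le> (\<integral>\<^sup>+s. sqn (f s \<omega>) \<partial>lborel)" .
    qed
    finally have "ennreal (T / real (Suc n)) * (\<integral>\<^sup>+\<omega>. sqn (\<xi> n i \<omega>) \<partial>P) < \<infinity>"
      using fin by (simp add: order_le_less_trans)
    then have "(\<integral>\<^sup>+\<omega>. sqn (\<xi> n i \<omega>) \<partial>P) < \<infinity>"
      using T by (auto simp: ennreal_mult_less_top)
    then show ?thesis using m unfolding L2_rv_iff[OF t0] by blast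
  qed
  show thesis
  proof (rule that[of \<xi>])
    fix n
    show "simple_integrand P F T (Suc n) (\<lambda>i. real i * T / real (Suc n)) (\<xi> n)"
      unfolding simple_integrand_def
    proof (intro allI impI conjI \<xi>L2)
      fix i assume "i < Suc n"
      then have "real (Suc i) * T \<le> real (Suc n) * T" using T by (intro mult_right_mono) auto
      then show "real (Suc i) * T / real (Suc n) \<le> T" by (simp add: divide_le_eq mult.commute)
    qed (use T in \<open>auto simp: divide_right_mono\<close>)
  next
    have [measurable]: "\<xi> n i \<in> borel_measurable P" for n i
      by (rule L2_rvD(2)[OF \<xi>L2]) (use T in simp)
    have dm[measurable]: "(\<lambda>(s, \<omega>). delayed_average T (Suc n) (\<lambda>u. f u \<omega>) s) \<in> borel_measurable (lborel \<Otimes>\<^sub>M P)" for n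
      unfolding sv[symmetric] simple_value_def by measurable
    have ae: "AE \<omega> in P. (\<integral>\<^sup>+s. sqn (f s \<omega>) \<partial>lborel) < \<infinity>"
      using nn_integral_PInf_AE[of "\<lambda>\<omega>. \<integral>\<^sup>+s. sqn (f s \<omega>) \<partial>lborel" P] fin by (auto simp: less_top)
    have "(\<lambda>n. \<integral>\<^sup>+\<omega>. (\<integral>\<^sup>+s\<in>{0..T}. sqn (f s \<omega> - delayed_average T (Suc n) (\<lambda>u. f u \<omega>) s) \<partial>lborel) \<partial>P)
      \<longlonglongrightarrow> (\<integral>\<^sup>+\<omega>. 0 \<partial>P)"
    \<comment> \<open>The constant is \<open>2 * (1 + 1)\<close>: the path and its average have comparable norms.\<close>
    proof (rule nn_integral_dominated_convergence[where w="\<lambda>\<omega>. 4 * (\<integral>\<^sup>+s. sqn (f s \<omega>) \<partial>lborel)"])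
      show "(\<lambda>\<omega>. \<integral>\<^sup>+s\<in>{0..T}. sqn (f s \<omega> - delayed_average T (Suc n) (\<lambda>u. f u \<omega>) s) \<partial>lborel) \<in> borel_measurable P" for n
        by measurable
      show "AE \<omega> in P. (\<integral>\<^sup>+s\<in>{0..T}. sqn (f s \<omega> - delayed_average T (Suc n) (\<lambda>u. f u \<omega>) s) \<partial>lborel)
          \<le> 4 * (\<integral>\<^sup>+s. sqn (f s \<omega>) \<partial>lborel)" for n
      proof (rule AE_I2)
        fix \<omega> assume w: "\<omega> \<in> space P"
        note [measurable] = fmw[OF w]
        have "(\<integral>\<^sup>+s\<in>{0..T}. sqn (f s \<omega> - delayed_average T (Suc n) (\<lambda>u. f u \<omega>) s) \<partial>lborel) \<le>
          (\<integral>\<^sup>+s. 2 * (sqn (f s \<omega>) + sqn (delayed_average T (Suc n) (\<lambda>u. f u \<omega>) s) * indicator {0..T} s) \<partial>lborel)"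
          by (intro nn_integral_mono) (simp add: indicator_def sqn_diff_le del: distrib_left_numeral)
        also have "\<dots> = 2 * ((\<integral>\<^sup>+s. sqn (f s \<omega>) \<partial>lborel) +
            (\<integral>\<^sup>+s\<in>{0..T}. sqn (delayed_average T (Suc n) (\<lambda>u. f u \<omega>) s) \<partial>lborel))"
          by (simp add: nn_integral_cmult nn_integral_add)
        also have "\<dots> \<le> 2 * ((\<integral>\<^sup>+s. sqn (f s \<omega>) \<partial>lborel) + (\<integral>\<^sup>+s\<in>{-T..T}. sqn (f s \<omega>) \<partial>lborel))"
          by (intro mult_left_mono add_left_mono delayed_average_contraction T) auto
        also have "\<dots> \<le> 2 * ((\<integral>\<^sup>+s. sqn (f s \<omega>) \<partial>lborel) + (\<integral>\<^sup>+s. sqn (f s \<omega>) \<partial>lborel))"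
          by (intro mult_left_mono add_left_mono nn_integral_mono) (auto simp: indicator_def)
        also have "\<dots> = 4 * (\<integral>\<^sup>+s. sqn (f s \<omega>) \<partial>lborel)"
          by (simp add: mult_2[symmetric] mult.assoc[symmetric])
        finally show "(\<integral>\<^sup>+s\<in>{0..T}. sqn (f s \<omega> - delayed_average T (Suc n) (\<lambda>u. f u \<omega>) s) \<partial>lborel)
          \<le> 4 * (\<integral>\<^sup>+s. sqn (f s \<omega>) \<partial>lborel)" .
      qed
      show "AE \<omega> in P. (\<lambda>n. \<integral>\<^sup>+s\<in>{0..T}. sqn (f s \<omega> - delayed_average T (Suc n) (\<lambda>u. f u \<omega>) s) \<partial>lborel) \<longlonglongrightarrow> 0"
        using ae AE_space
      proof eventually_elim
        fix \<omega> assume 1: "(\<integral>\<^sup>+s. sqn (f s \<omega>) \<partial>lborel) < \<infinity>" and w: "\<omega> \<in> space P"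
        have "(\<integral>\<^sup>+s\<in>{-T..T}. sqn (f s \<omega>) \<partial>lborel) \<le> (\<integral>\<^sup>+s. sqn (f s \<omega>) \<partial>lborel)"
          by (intro nn_integral_mono) (auto simp: indicator_def)
        then show "(\<lambda>n. \<integral>\<^sup>+s\<in>{0..T}. sqn (f s \<omega> - delayed_average T (Suc n) (\<lambda>u. f u \<omega>) s) \<partial>lborel) \<longlonglongrightarrow> 0"
          using 1 by (intro delayed_average_tendsto_L2 T fmw w) auto
      qed
    qed (use fin in \<open>auto simp: nn_integral_cmult ennreal_mult_less_top\<close>)
    moreover have "(\<integral>\<^sup>+\<omega>. (\<integral>\<^sup>+s\<in>{0..T}. sqn (f s \<omega> - delayed_average T (Suc n) (\<lambda>u. f u \<omega>) s) \<partial>lborel) \<partial>P) =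
      (\<integral>\<^sup>+\<omega>. (\<integral>\<^sup>+s\<in>{0..T}. sqn (h s \<omega> - simple_value (Suc n) (\<lambda>i. real i * T / real (Suc n)) (\<xi> n) s \<omega>) \<partial>lborel) \<partial>P)" for n
      unfolding sv by (intro nn_integral_cong) (auto simp: f_def indicator_def)
    ultimately show "(\<lambda>n. \<integral>\<^sup>+\<omega>. (\<integral>\<^sup>+s\<in>{0..T}.
       sqn (h s \<omega> - simple_value (Suc n) (\<lambda>i. real i * T / real (Suc n)) (\<xi> n) s \<omega>) \<partial>lborel) \<partial>P) \<longlonglongrightarrow> 0"
      by simp
  qed
qed

end

section \<open>Increments of Brownian motion\<close>

lemma subset_natural: "(\<Union>u\<in>{0..t}. {W u -` A \<inter> space P |A. A \<in> sets borel}) \<subseteq> Pow (space P)"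
  by auto

lemma sets_natural_filtration:
  "sets (natural_filtration P W t) =
    sigma_sets (space P) (\<Union>u\<in>{0..t}. {W u -` A \<inter> space P |A. A \<in> sets borel})"
  unfolding natural_filtration_def by (rule sets_measure_of[OF subset_natural])

lemma space_natural_filtration [simp]: "space (natural_filtration P W t) = space P"
  unfolding natural_filtration_def by (rule space_measure_of[OF subset_natural])

lemma subset_augmented: "sets (natural_filtration P W t) \<union> null_sets P \<subseteq> Pow (space P)"
proof -
  have "null_sets P \<subseteq> Pow (space P)" using sets.space_closed[of P] by (auto simp: null_sets_def)
  then show ?thesis using sets.space_closed[of "natural_filtration P W t"] by simp
qed

lemma sets_augmented_filtration:
  "sets (augmented_filtration P W t) =
    sigma_sets (space P) (sets (natural_filtration P W t) \<union> null_sets P)"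
  unfolding augmented_filtration_def
  by (rule sets_measure_of[OF subset_augmented])

lemma space_augmented_filtration [simp]: "space (augmented_filtration P W t) = space P"
  unfolding augmented_filtration_def
  by (rule space_measure_of[OF subset_augmented])

text \<open>Apart from its relation to \<open>W\<close>, the augmented filtration enters below only as an increasing
  family of sigma-algebras that contain the null sets.\<close>

lemma complete_filtration_augmented:
  assumes "prob_space P" "complete_measure P" and W: "\<And>t. 0 \<le> t \<Longrightarrow> W t \<in> borel_measurable P"
  shows "complete_filtration P (augmented_filtration P W)"
proof -
  interpret P: prob_space P by fact
  have nat: "sets (natural_filtration P W t) \<subseteq> sets P" for t
    unfolding sets_natural_filtration
    by (rule sets.sigma_sets_subset) (use W in \<open>auto intro: measurable_sets\<close>)
  show ?thesis
  proof (intro complete_filtration.intro complete_filtration_axioms.intro assms)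
    fix t :: real
    show "subalgebra P (augmented_filtration P W t)"
      unfolding subalgebra_def sets_augmented_filtration
      using nat by (auto intro!: sets.sigma_sets_subset)
    show "null_sets P \<subseteq> sets (augmented_filtration P W t)"
      unfolding sets_augmented_filtration by auto
  next
    fix s t :: real assume "s \<le> t"
    then have "sets (natural_filtration P W s) \<subseteq> sets (natural_filtration P W t)"
      unfolding sets_natural_filtration by (intro sigma_sets_mono' UN_mono) auto
    then show "sets (augmented_filtration P W s) \<subseteq> sets (augmented_filtration P W t)"
      unfolding sets_augmented_filtration by (intro sigma_sets_mono') auto
  qed
qed

locale brownian_filtration = complete_filtration P F
  for P :: "'w measure" and F :: "real \<Rightarrow> 'w measure" +
  fixes W :: "real \<Rightarrow> 'w \<Rightarrow> real ^ 'd"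
  assumes BM: "standard_brownian_motion P W"
    and F_def: "F = augmented_filtration P W"
begin

lemma W_measurable_P: "0 \<le> t \<Longrightarrow> W t \<in> borel_measurable P"
  using BM by (simp add: standard_brownian_motion_def)

lemma W_measurable: assumes "0 \<le> u" "u \<le> t" shows "W u \<in> borel_measurable (F t)"
proof (rule measurableI)
  fix A :: "(real ^ 'd) set" assume A: "A \<in> sets borel"
  have "W u -` A \<inter> space P \<in> sets (natural_filtration P W t)"
    unfolding sets_natural_filtration using assms A by (intro sigma_sets.Basic UN_I[of u]) auto
  then show "W u -` A \<inter> space (F t) \<in> sets (F t)"
    unfolding F_def sets_augmented_filtration by simp
qed simp

lemma W_continuous: "AE \<omega> in P. continuous_on {0..} (\<lambda>t. W t \<omega>)"
  using BM by (simp add: standard_brownian_motion_def)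

text \<open>The sets that agree with a set of the natural filtration up to a null set form a sigma-algebra.\<close>

lemma augmented_set_eq_natural:
  assumes "A \<in> sets (F t)"
  shows "\<exists>B\<in>sets (natural_filtration P W t). AE \<omega> in P. \<omega> \<in> A \<longleftrightarrow> \<omega> \<in> B"
  using assms unfolding F_def sets_augmented_filtration
proof (induction rule: sigma_sets.induct)
  case (Basic a)
  then show ?case
  proof
    assume "a \<in> null_sets P"
    then show ?thesis using AE_not_in[of a P] by (intro bexI[of _ "{}"]) auto
  qed auto
next
  case Empty
  show ?case by (intro bexI[of _ "{}"]) auto
next
  case (Compl a)
  then obtain B where B: "B \<in> sets (natural_filtration P W t)" "AE \<omega> in P. \<omega> \<in> a \<longleftrightarrow> \<omega> \<in> B" by blast
  have "AE \<omega> in P. \<omega> \<in> space P - a \<longleftrightarrow> \<omega> \<in> space P - B" using B(2) by eventually_elim auto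
  moreover have "space P - B \<in> sets (natural_filtration P W t)"
    using sets.compl_sets[OF B(1)] by simp
  ultimately show ?case by blast
next
  case (Union a)
  then obtain B where B: "\<And>i. B i \<in> sets (natural_filtration P W t)" "\<And>i. AE \<omega> in P. \<omega> \<in> a i \<longleftrightarrow> \<omega> \<in> B i"
    by metis
  have "AE \<omega> in P. \<forall>i. \<omega> \<in> a i \<longleftrightarrow> \<omega> \<in> B i" using B(2) by (simp add: AE_all_countable)
  then have "AE \<omega> in P. \<omega> \<in> (\<Union>i. a i) \<longleftrightarrow> \<omega> \<in> (\<Union>i. B i)" by eventually_elim auto
  moreover have "(\<Union>i. B i) \<in> sets (natural_filtration P W t)" using B(1) by auto
  ultimately show ?case by blast
qed

text \<open>The increment is independent of the natural filtration, and by \<open>augmented_set_eq_natural\<close> the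
  augmented one has no further events up to null sets. The two variables of
  \<open>indep_var\<close> have values in one type, so the increment enters through a real function
  \<open>g\<close>.\<close>

lemma increment_independent:
  fixes Y :: "'w \<Rightarrow> real"
  assumes st: "0 \<le> s" "s < t" and Y: "Y \<in> borel_measurable (F s)"
    and g: "g \<in> borel_measurable borel"
  shows "indep_var borel Y borel (\<lambda>\<omega>. g (W t \<omega> - W s \<omega>) :: real)"
proof -
  let ?D = "\<lambda>\<omega>. W t \<omega> - W s \<omega>"
  let ?G = "\<lambda>\<omega>. g (W t \<omega> - W s \<omega>)"
  have Ds: "?D \<in> borel_measurable P"
    using W_measurable_P[of s] W_measurable_P[of t] st by simp
  have Gs: "?G \<in> borel_measurable P" using measurable_compose[OF Ds g] .
  have YP: "Y \<in> borel_measurable P" by (rule measurable_F_P[OF st(1) Y])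
  have ind: "indep_set (sets (natural_filtration P W s)) (sets (vimage_algebra (space P) ?D borel))"
    using BM st by (simp add: standard_brownian_motion_def)
  have sY: "sigma_sets (space P) {Y -` A \<inter> space P |A. A \<in> sets borel} \<subseteq> sets (F s)"
  proof -
    have "{Y -` A \<inter> space P |A. A \<in> sets borel} \<subseteq> sets (F s)"
      using measurable_sets[OF Y] space_F[OF st(1)] by auto
    then show ?thesis using sets.sigma_sets_subset[of _ "F s"] space_F[OF st(1)] by simp
  qed
  have sP: "sets (F s) \<subseteq> sets P" using subalgebra_F[OF st(1)] by (simp add: subalgebra_def)
  have sG: "sigma_sets (space P) {?G -` A \<inter> space P |A. A \<in> sets borel} \<subseteq> sets P"
    by (rule sets.sigma_sets_subset) (use measurable_sets[OF Gs] in auto)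
  have sGD: "sigma_sets (space P) {?G -` A \<inter> space P |A. A \<in> sets borel}
      \<subseteq> sets (vimage_algebra (space P) ?D borel)"
    unfolding sets_vimage_algebra
  proof (rule sigma_sets_mono', rule subsetI)
    fix B assume "B \<in> {?G -` A \<inter> space P |A. A \<in> sets borel}"
    then obtain A where A: "A \<in> sets borel" "B = ?G -` A \<inter> space P" by blast
    then have "B = ?D -` (g -` A) \<inter> space P" by auto
    moreover have "g -` A \<in> sets borel" using measurable_sets[OF g A(1)] by simp
    ultimately show "B \<in> {?D -` A \<inter> space P |A. A \<in> sets borel}" by blast
  qed
  show ?thesis
    unfolding indep_var_eq indep_sets2_eq
  proof (intro conjI ballI YP Gs)
    fix a b assume a: "a \<in> sigma_sets (space P) {Y -` A \<inter> space P |A. A \<in> sets borel}"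
      and b: "b \<in> sigma_sets (space P) {?G -` A \<inter> space P |A. A \<in> sets borel}"
    obtain B where B: "B \<in> sets (natural_filtration P W s)" "AE \<omega> in P. \<omega> \<in> a \<longleftrightarrow> \<omega> \<in> B"
      using augmented_set_eq_natural a sY by blast
    have ev: "a \<in> events" "b \<in> events" "B \<in> events"
      using a sY sP b sG B(1) indep_setD_ev1[OF ind] by auto
    have "prob (a \<inter> b) = prob (B \<inter> b)"
      by (rule finite_measure_eq_AE) (use B(2) ev in auto)
    also have "\<dots> = prob B * prob b"
      using indep_setD[OF ind B(1), of b] b sGD by blast
    also have "prob B = prob a"
      by (rule finite_measure_eq_AE) (use B(2) ev in auto)
    finally show "prob (a \<inter> b) = prob a * prob b" .
  qed (use sY sP sG in auto)
qed

lemma increment_moments: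
  assumes st: "0 \<le> s" "s < t"
  shows "integrable P (\<lambda>\<omega>. (W t \<omega> - W s \<omega>) $ i)"
    and "expectation (\<lambda>\<omega>. (W t \<omega> - W s \<omega>) $ i) = 0"
    and "integrable P (\<lambda>\<omega>. (W t \<omega> - W s \<omega>) $ i * (W t \<omega> - W s \<omega>) $ j)"
    and "expectation (\<lambda>\<omega>. (W t \<omega> - W s \<omega>) $ i * (W t \<omega> - W s \<omega>) $ j) = (if i = j then t - s else 0)"
proof -
  let ?D = "\<lambda>k \<omega>. (W t \<omega> - W s \<omega>) $ k"
  have sg: "0 < sqrt (t - s)" using st by simp
  have dist: "distributed P lborel (?D k) (\<lambda>y. ennreal (normal_density 0 (sqrt (t - s)) y))" for k
    using BM st by (simp add: standard_brownian_motion_def)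
  have ind: "indep_vars (\<lambda>_. borel) ?D UNIV"
    using BM st by (simp add: standard_brownian_motion_def)
  have int1: "integrable P (?D k)" for k
    using distributed_integrable[OF dist, of "\<lambda>x. x" k] integrable_normal_moment_nz_1[OF sg, of 0] by simp
  have exp1: "expectation (?D k) = 0" for k
    by (rule normal_distributed_expectation[OF sg dist])
  have int2: "integrable P (\<lambda>\<omega>. (?D k \<omega>)\<^sup>2)" for k
    using distributed_integrable[OF dist, of "\<lambda>x. x\<^sup>2" k] integrable_normal_moment[OF sg, of 0 2] by simp
  have exp2: "expectation (\<lambda>\<omega>. (?D k \<omega>)\<^sup>2) = t - s" for k
    using normal_distributed_variance[OF sg dist, of k] st by (simp only: exp1) simp
  show "integrable P (?D i)" "expectation (?D i) = 0" by (rule int1 exp1)+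
  show "integrable P (\<lambda>\<omega>. ?D i \<omega> * ?D j \<omega>)"
    and "expectation (\<lambda>\<omega>. ?D i \<omega> * ?D j \<omega>) = (if i = j then t - s else 0)"
  proof (atomize (full), cases "i = j")
    case True
    then show "integrable P (\<lambda>\<omega>. ?D i \<omega> * ?D j \<omega>) \<and>
        expectation (\<lambda>\<omega>. ?D i \<omega> * ?D j \<omega>) = (if i = j then t - s else 0)"
      using int2[of i] exp2[of i] by (simp add: power2_eq_square)
  next
    case False
    have sub: "indep_vars (\<lambda>_. borel) ?D {i, j}"
      by (rule indep_vars_subset[OF ind]) auto
    show "integrable P (\<lambda>\<omega>. ?D i \<omega> * ?D j \<omega>) \<and>
        expectation (\<lambda>\<omega>. ?D i \<omega> * ?D j \<omega>) = (if i = j then t - s else 0)"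
      using indep_vars_lebesgue_integral[OF _ sub int1] indep_vars_integrable[OF _ sub int1] False
        exp1[of i] by simp
  qed
qed

text \<open>Means of products of independent variables factorize; the coordinates of the increment are centred,
  uncorrelated and have variance \<open>t - s\<close>.\<close>

lemma adapted_times_increment:
  fixes Y :: "'w \<Rightarrow> real"
  assumes st: "0 \<le> s" "s < t" and Y: "Y \<in> borel_measurable (F s)" "integrable P Y"
  shows "integrable P (\<lambda>\<omega>. Y \<omega> * (W t \<omega> - W s \<omega>) $ i)"
    and "expectation (\<lambda>\<omega>. Y \<omega> * (W t \<omega> - W s \<omega>) $ i) = 0"
    and "integrable P (\<lambda>\<omega>. Y \<omega> * ((W t \<omega> - W s \<omega>) $ i * (W t \<omega> - W s \<omega>) $ j))"
    and "expectation (\<lambda>\<omega>. Y \<omega> * ((W t \<omega> - W s \<omega>) $ i * (W t \<omega> - W s \<omega>) $ j)) =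
      (if i = j then (t - s) * expectation Y else 0)"
proof -
  have 1: "indep_var borel Y borel (\<lambda>\<omega>. (W t \<omega> - W s \<omega>) $ i)"
    by (rule increment_independent[OF st Y(1)]) (simp add: cart_eq_inner_axis)
  have 2: "indep_var borel Y borel (\<lambda>\<omega>. (W t \<omega> - W s \<omega>) $ i * (W t \<omega> - W s \<omega>) $ j)"
    by (rule increment_independent[OF st Y(1)]) (simp add: cart_eq_inner_axis)
  note m = increment_moments[OF st]
  show "integrable P (\<lambda>\<omega>. Y \<omega> * (W t \<omega> - W s \<omega>) $ i)"
    by (rule indep_var_integrable[OF 1 Y(2) m(1)])
  show "expectation (\<lambda>\<omega>. Y \<omega> * (W t \<omega> - W s \<omega>) $ i) = 0"
    using indep_var_lebesgue_integral[OF 1 Y(2) m(1)] m(2)[of i] by simp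
  show "integrable P (\<lambda>\<omega>. Y \<omega> * ((W t \<omega> - W s \<omega>) $ i * (W t \<omega> - W s \<omega>) $ j))"
    by (rule indep_var_integrable[OF 2 Y(2) m(3)])
  show "expectation (\<lambda>\<omega>. Y \<omega> * ((W t \<omega> - W s \<omega>) $ i * (W t \<omega> - W s \<omega>) $ j)) =
      (if i = j then (t - s) * expectation Y else 0)"
    using indep_var_lebesgue_integral[OF 2 Y(2) m(3)] m(4)[of i j] by simp
qed

text \<open>The Ito integral of the process with value \<open>\<xi>\<close> on \<open>(a, b]\<close>.\<close>

definition elementary :: "('w \<Rightarrow> real ^ 'd ^ 'n) \<Rightarrow> real \<Rightarrow> real \<Rightarrow> 'w \<Rightarrow> real ^ 'n" where
  "elementary \<xi> a b \<omega> = \<xi> \<omega> *v (W b \<omega> - W a \<omega>)"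

lemma elementary_refl [simp]: "elementary \<xi> a a \<omega> = 0"
  by (simp add: elementary_def)

lemma elementary_split: "elementary \<xi> a c \<omega> = elementary \<xi> a b \<omega> + elementary \<xi> b c \<omega>"
  by (simp add: elementary_def matrix_vector_right_distrib[symmetric])

lemma inner_unit_L2:
  fixes X :: "'w \<Rightarrow> 'a::euclidean_space"
  assumes X: "X \<in> L2_rv P (F s)" and s: "0 \<le> s" and u: "norm u \<le> 1"
  shows "(\<lambda>\<omega>. X \<omega> \<bullet> u) \<in> L2_rv P (F s)"
proof -
  have [measurable]: "X \<in> borel_measurable P" by (rule L2_rvD(2)[OF X s])
  have "integrable P (\<lambda>\<omega>. (norm (X \<omega> \<bullet> u))\<^sup>2)"
  proof (rule Bochner_Integration.integrable_bound[OF L2_rvD(4)[OF X s]])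
    show "AE \<omega> in P. norm ((norm (X \<omega> \<bullet> u))\<^sup>2) \<le> norm ((norm (X \<omega>))\<^sup>2)"
    proof (rule AE_I2)
      fix \<omega>
      have "\<bar>X \<omega> \<bullet> u\<bar> \<le> norm (X \<omega>) * norm u" by (rule Cauchy_Schwarz_ineq2)
      also have "\<dots> \<le> norm (X \<omega>)" using u by (simp add: mult_left_le)
      finally have "(norm (X \<omega> \<bullet> u))\<^sup>2 \<le> (norm (X \<omega>))\<^sup>2" by (intro power_mono) auto
      then show "norm ((norm (X \<omega> \<bullet> u))\<^sup>2) \<le> norm ((norm (X \<omega>))\<^sup>2)" by simp
    qed
  qed measurable
  moreover have "(\<lambda>\<omega>. X \<omega> \<bullet> u) \<in> borel_measurable (F s)"
    by (rule borel_measurable_inner[OF L2_rvD(1)[OF X s] borel_measurable_const])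
  ultimately show ?thesis by (simp add: L2_rv_def)
qed

lemma coordinate_L2:
  fixes X :: "'w \<Rightarrow> real ^ 'b"
  assumes "X \<in> L2_rv P (F s)" "0 \<le> s" shows "(\<lambda>\<omega>. X \<omega> $ k) \<in> L2_rv P (F s)"
  using inner_unit_L2[OF assms, of "axis k 1"] by (simp add: inner_axis)

lemma entry_L2:
  fixes X :: "'w \<Rightarrow> real ^ 'b ^ 'a"
  assumes "X \<in> L2_rv P (F s)" "0 \<le> s" shows "(\<lambda>\<omega>. X \<omega> $ k $ i) \<in> L2_rv P (F s)"
  using inner_unit_L2[OF assms, of "axis k (axis i 1)"] by (simp add: inner_axis)

lemma product_L2:
  fixes X Y :: "'w \<Rightarrow> real"
  assumes "X \<in> L2_rv P (F s)" "Y \<in> L2_rv P (F s)" "0 \<le> s"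
  shows "(\<lambda>\<omega>. X \<omega> * Y \<omega>) \<in> borel_measurable (F s)" "integrable P (\<lambda>\<omega>. X \<omega> * Y \<omega>)"
  using L2_rv_integrable_inner[OF assms(1,2,3,3)]
    borel_measurable_times[OF L2_rvD(1)[OF assms(1,3)] L2_rvD(1)[OF assms(2,3)]]
  by (simp_all add: inner_real_def)

lemma elementary_inner_expand:
  "elementary \<xi> a b \<omega> \<bullet> elementary \<eta> a b \<omega> =
    (\<Sum>k\<in>UNIV. \<Sum>i\<in>UNIV. \<Sum>j\<in>UNIV. (\<xi> \<omega> $ k $ i * \<eta> \<omega> $ k $ j) *
      ((W b \<omega> - W a \<omega>) $ i * (W b \<omega> - W a \<omega>) $ j))"
  unfolding elementary_def inner_vec_def matrix_vector_mult_def vec_lambda_beta inner_real_def sum_product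
  by (intro sum.cong refl) (simp only: mult_ac)

text \<open>In the expansion into coordinates, the mixed products of two coordinates of the increment have mean
  \<open>0\<close> against anything known at time \<open>a\<close>, and the squares have mean \<open>b - a\<close>.\<close>

lemma elementary_inner:
  assumes ab: "0 \<le> a" "a \<le> b" and \<xi>: "\<xi> \<in> L2_rv P (F a)" "\<eta> \<in> L2_rv P (F a)"
  shows "integrable P (\<lambda>\<omega>. elementary \<xi> a b \<omega> \<bullet> elementary \<eta> a b \<omega>)"
    and "expectation (\<lambda>\<omega>. elementary \<xi> a b \<omega> \<bullet> elementary \<eta> a b \<omega>) = (b - a) * expectation (\<lambda>\<omega>. \<xi> \<omega> \<bullet> \<eta> \<omega>)"
proof (atomize (full), cases "a = b")
  case False
  then have ab': "a < b" using ab by simp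
  note e = product_L2[OF entry_L2[OF \<xi>(1) ab(1)] entry_L2[OF \<xi>(2) ab(1)] ab(1)]
  note t = adapted_times_increment[OF ab(1) ab' e]
  have "expectation (\<lambda>\<omega>. elementary \<xi> a b \<omega> \<bullet> elementary \<eta> a b \<omega>) =
      (\<Sum>k\<in>UNIV. \<Sum>i\<in>UNIV. \<Sum>j\<in>UNIV. if i = j then (b - a) * expectation (\<lambda>\<omega>. \<xi> \<omega> $ k $ i * \<eta> \<omega> $ k $ j) else 0)"
    unfolding elementary_inner_expand
    by (simp add: t(3,4) del: vector_minus_component)
  also have "\<dots> = (b - a) * (\<Sum>k\<in>UNIV. \<Sum>i\<in>UNIV. expectation (\<lambda>\<omega>. \<xi> \<omega> $ k $ i * \<eta> \<omega> $ k $ i))"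
    by (simp add: sum_distrib_left)
  also have "(\<Sum>k\<in>UNIV. \<Sum>i\<in>UNIV. expectation (\<lambda>\<omega>. \<xi> \<omega> $ k $ i * \<eta> \<omega> $ k $ i)) = expectation (\<lambda>\<omega>. \<xi> \<omega> \<bullet> \<eta> \<omega>)"
    by (simp add: inner_vec_def e(2))
  finally show "integrable P (\<lambda>\<omega>. elementary \<xi> a b \<omega> \<bullet> elementary \<eta> a b \<omega>) \<and>
    expectation (\<lambda>\<omega>. elementary \<xi> a b \<omega> \<bullet> elementary \<eta> a b \<omega>) = (b - a) * expectation (\<lambda>\<omega>. \<xi> \<omega> \<bullet> \<eta> \<omega>)"
    unfolding elementary_inner_expand by (simp add: t(3) del: vector_minus_component)
qed simp

lemma elementary_L2:
  assumes ab: "0 \<le> a" "a \<le> b" and \<xi>: "\<xi> \<in> L2_rv P (F a)"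
  shows "elementary \<xi> a b \<in> L2_rv P (F b)"
proof -
  have 1: "\<xi> \<in> borel_measurable (F b)"
    by (rule measurable_F_mono[OF L2_rvD(1)[OF \<xi> ab(1)] ab])
  have 2: "W a \<in> borel_measurable (F b)" "W b \<in> borel_measurable (F b)"
    using ab by (auto intro: W_measurable)
  have "(\<lambda>\<omega>. elementary \<xi> a b \<omega> $ k) \<in> borel_measurable (F b)" for k
  proof -
    have "(\<lambda>\<omega>. \<xi> \<omega> $ k $ j) \<in> borel_measurable (F b)" for j
      using borel_measurable_inner[OF 1 borel_measurable_const[of "axis k (axis j 1)"]]
      by (simp add: inner_axis)
    moreover have "(\<lambda>\<omega>. (W b \<omega> - W a \<omega>) $ j) \<in> borel_measurable (F b)" for j
      using borel_measurable_inner[OF borel_measurable_diff[OF 2(2,1)] borel_measurable_const[of "axis j 1"]]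
      by (simp add: inner_axis)
    ultimately show ?thesis
      unfolding elementary_def matrix_vector_mult_def vec_lambda_beta
      by (intro borel_measurable_sum borel_measurable_times)
  qed
  then have "elementary \<xi> a b \<in> borel_measurable (F b)"
    by (subst borel_measurable_euclidean_space) (auto simp: Basis_vec_def inner_axis)
  then show ?thesis
    using elementary_inner(1)[OF ab \<xi> \<xi>] by (simp add: L2_rv_def power2_norm_eq_inner)
qed

lemma elementary_orthogonal:
  assumes ab: "0 \<le> a" "a \<le> b" and \<xi>: "\<xi> \<in> L2_rv P (F a)" and Y: "Y \<in> L2_rv P (F a)"
  shows "expectation (\<lambda>\<omega>. elementary \<xi> a b \<omega> \<bullet> Y \<omega>) = 0"
proof (cases "a = b")
  case False
  then have ab': "a < b" using ab by simp
  note e = product_L2[OF entry_L2[OF \<xi> ab(1)] coordinate_L2[OF Y ab(1)] ab(1)]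
  note t = adapted_times_increment[OF ab(1) ab' e]
  have "elementary \<xi> a b \<omega> \<bullet> Y \<omega> = (\<Sum>k\<in>UNIV. \<Sum>i\<in>UNIV. (\<xi> \<omega> $ k $ i * Y \<omega> $ k) * (W b \<omega> - W a \<omega>) $ i)" for \<omega>
    unfolding elementary_def inner_vec_def matrix_vector_mult_def vec_lambda_beta inner_real_def sum_distrib_right
    by (intro sum.cong refl) (simp only: mult_ac)
  then show ?thesis by (simp add: t(1,2) del: vector_minus_component)
qed simp

end

section \<open>The Ito isometry\<close>

context brownian_filtration
begin

lemma elementary_orthogonal':
  assumes ab: "0 \<le> a" "a \<le> b" and \<xi>: "\<xi> \<in> L2_rv P (F a)" and Y: "Y \<in> L2_rv P (F a)"
  shows "expectation (\<lambda>\<omega>. Y \<omega> \<bullet> elementary \<xi> a b \<omega>) = 0"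
  using elementary_orthogonal[OF assms] by (simp add: inner_commute)

lemma elementary_pair_same_start:
  assumes c: "0 \<le> c" "c \<le> b" "b \<le> d" and \<xi>: "\<xi> \<in> L2_rv P (F c)" and \<eta>: "\<eta> \<in> L2_rv P (F c)"
  shows "expectation (\<lambda>\<omega>. elementary \<xi> c b \<omega> \<bullet> elementary \<eta> c d \<omega>) = (b - c) * expectation (\<lambda>\<omega>. \<xi> \<omega> \<bullet> \<eta> \<omega>)"
proof -
  have b0: "0 \<le> b" using c by simp
  have \<eta>b: "\<eta> \<in> L2_rv P (F b)" by (rule L2_rv_mono[OF \<eta> c(1,2)])
  note e\<xi> = elementary_L2[OF c(1,2) \<xi>]
  note e1 = elementary_inner[OF c(1,2) \<xi> \<eta>]
  have e2: "integrable P (\<lambda>\<omega>. elementary \<xi> c b \<omega> \<bullet> elementary \<eta> b d \<omega>)"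
    using c by (intro L2_rv_integrable_inner[OF e\<xi> elementary_L2[OF b0 c(3) \<eta>b]]) auto
  have "expectation (\<lambda>\<omega>. elementary \<xi> c b \<omega> \<bullet> elementary \<eta> c d \<omega>) =
      expectation (\<lambda>\<omega>. elementary \<xi> c b \<omega> \<bullet> elementary \<eta> c b \<omega> + elementary \<xi> c b \<omega> \<bullet> elementary \<eta> b d \<omega>)"
    by (subst elementary_split[of \<eta> c d _ b]) (simp add: inner_add_right)
  also have "\<dots> = (b - c) * expectation (\<lambda>\<omega>. \<xi> \<omega> \<bullet> \<eta> \<omega>)"
    using e1 e2 elementary_orthogonal'[OF b0 c(3) \<eta>b e\<xi>] by simp
  finally show ?thesis .
qed

text \<open>The first integral is split at the later starting time \<open>c\<close>. Its part before \<open>c\<close> is known at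
  time \<open>c\<close> and hence orthogonal to the second integral; from \<open>c\<close> on both integrands are known
  from the start.\<close>

lemma elementary_pair_le:
  assumes a: "0 \<le> a" "a \<le> b" and c: "0 \<le> c" "c \<le> d" and ac: "a \<le> c"
    and \<xi>: "\<xi> \<in> L2_rv P (F a)" and \<eta>: "\<eta> \<in> L2_rv P (F c)"
  shows "expectation (\<lambda>\<omega>. elementary \<xi> a b \<omega> \<bullet> elementary \<eta> c d \<omega>) =
    measure lborel ({a<..b} \<inter> {c<..d}) * expectation (\<lambda>\<omega>. \<xi> \<omega> \<bullet> \<eta> \<omega>)"
proof (cases "b \<le> c")
  case True
  then have "{a<..b} \<inter> {c<..d} = {}" by auto
  then have "measure lborel ({a<..b} \<inter> {c<..d}) = 0" by (simp only: measure_empty)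
  moreover have "elementary \<xi> a b \<in> L2_rv P (F c)"
    using a by (intro L2_rv_mono[OF elementary_L2[OF a \<xi>] _ True]) auto
  ultimately show ?thesis using elementary_orthogonal'[OF c \<eta>] by (simp only: mult_zero_left)
next
  case False
  then have cb: "c \<le> b" by simp
  have \<xi>c: "\<xi> \<in> L2_rv P (F c)" by (rule L2_rv_mono[OF \<xi> a(1) ac])
  have I: "{a<..b} \<inter> {c<..d} = {c<..min b d}" using ac by auto
  have m: "measure lborel ({a<..b} \<inter> {c<..d}) = min b d - c"
    unfolding I using cb c by (simp add: min_def)
  have second: "expectation (\<lambda>\<omega>. elementary \<xi> c b \<omega> \<bullet> elementary \<eta> c d \<omega>) =
      (min b d - c) * expectation (\<lambda>\<omega>. \<xi> \<omega> \<bullet> \<eta> \<omega>)"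
  proof (cases "b \<le> d")
    case True
    then show ?thesis using elementary_pair_same_start[OF c(1) cb True \<xi>c \<eta>] by (simp add: min_def)
  next
    case False
    then show ?thesis using elementary_pair_same_start[OF c(1,2) _ \<eta> \<xi>c, of b]
      by (simp add: min_def inner_commute)
  qed
  have b0: "0 \<le> b" "0 \<le> d" using a c by auto
  note e1 = elementary_L2[OF a(1) ac \<xi>]
  have i1: "integrable P (\<lambda>\<omega>. elementary \<xi> a c \<omega> \<bullet> elementary \<eta> c d \<omega>)"
    by (rule L2_rv_integrable_inner[OF e1 elementary_L2[OF c \<eta>] c(1) b0(2)])
  have i2: "integrable P (\<lambda>\<omega>. elementary \<xi> c b \<omega> \<bullet> elementary \<eta> c d \<omega>)"
    by (rule L2_rv_integrable_inner[OF elementary_L2[OF c(1) cb \<xi>c] elementary_L2[OF c \<eta>] b0])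
  have "expectation (\<lambda>\<omega>. elementary \<xi> a b \<omega> \<bullet> elementary \<eta> c d \<omega>) =
      expectation (\<lambda>\<omega>. elementary \<xi> a c \<omega> \<bullet> elementary \<eta> c d \<omega> + elementary \<xi> c b \<omega> \<bullet> elementary \<eta> c d \<omega>)"
    by (subst elementary_split[of \<xi> a b _ c]) (simp add: inner_add_left)
  also have "\<dots> = measure lborel ({a<..b} \<inter> {c<..d}) * expectation (\<lambda>\<omega>. \<xi> \<omega> \<bullet> \<eta> \<omega>)"
    unfolding m using i1 i2 second elementary_orthogonal'[OF c \<eta> e1] by simp
  finally show ?thesis .
qed

text \<open>The covariance of two elementary integrals depends on the two intervals only through the length of
  their overlap. So the isometry for a sum follows by expanding the square, and no common refinement
  of two partitions has to be formed.\<close>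

lemma elementary_pair:
  assumes a: "0 \<le> a" "a \<le> b" and c: "0 \<le> c" "c \<le> d"
    and \<xi>: "\<xi> \<in> L2_rv P (F a)" and \<eta>: "\<eta> \<in> L2_rv P (F c)"
  shows "expectation (\<lambda>\<omega>. elementary \<xi> a b \<omega> \<bullet> elementary \<eta> c d \<omega>) =
    measure lborel ({a<..b} \<inter> {c<..d}) * expectation (\<lambda>\<omega>. \<xi> \<omega> \<bullet> \<eta> \<omega>)"
proof (cases "a \<le> c")
  case True
  then show ?thesis by (rule elementary_pair_le[OF a c _ \<xi> \<eta>])
next
  case False
  then show ?thesis using elementary_pair_le[OF c a _ \<eta> \<xi>]
    by (simp add: inner_commute Int_commute)
qed

lemma elementary_sum_isometry:
  fixes \<xi> :: "'i \<Rightarrow> 'w \<Rightarrow> real ^ 'd ^ 'n"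
  assumes I: "finite I" and ab: "\<And>i. i \<in> I \<Longrightarrow> 0 \<le> a i" "\<And>i. i \<in> I \<Longrightarrow> a i \<le> b i"
    and \<xi>: "\<And>i. i \<in> I \<Longrightarrow> \<xi> i \<in> L2_rv P (F (a i))"
  shows "(\<integral>\<^sup>+\<omega>. sqn (\<Sum>i\<in>I. elementary (\<xi> i) (a i) (b i) \<omega>) \<partial>P) =
    (\<integral>\<^sup>+\<omega>. (\<integral>\<^sup>+s. sqn (\<Sum>i\<in>I. indicator {a i<..b i} s *\<^sub>R \<xi> i \<omega>) \<partial>lborel) \<partial>P)"
proof -
  let ?e = "\<lambda>i. elementary (\<xi> i) (a i) (b i)"
  let ?J = "\<lambda>i j. {a i<..b i} \<inter> {a j<..b j}"
  have b0: "0 \<le> b i" if "i \<in> I" for i using ab[OF that] by simp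
  have e_int: "integrable P (\<lambda>\<omega>. ?e i \<omega> \<bullet> ?e j \<omega>)" if i: "i \<in> I" and j: "j \<in> I" for i j
    by (rule L2_rv_integrable_inner[OF elementary_L2[OF ab[OF i] \<xi>[OF i]] elementary_L2[OF ab[OF j] \<xi>[OF j]]
          b0[OF i] b0[OF j]])
  have \<xi>_int: "integrable P (\<lambda>\<omega>. \<xi> i \<omega> \<bullet> \<xi> j \<omega>)" if i: "i \<in> I" and j: "j \<in> I" for i j
    by (rule L2_rv_integrable_inner[OF \<xi>[OF i] \<xi>[OF j] ab(1)[OF i] ab(1)[OF j]])
  have sq: "(norm (\<Sum>i\<in>I. v i))\<^sup>2 = (\<Sum>i\<in>I. \<Sum>j\<in>I. v i \<bullet> v j)" for v :: "'i \<Rightarrow> 'b::real_inner"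
    unfolding power2_norm_eq_inner inner_sum_left inner_sum_right by (intro sum.cong refl inner_commute)
  have J: "integrable lborel (indicator (?J i j) :: real \<Rightarrow> real)" for i j
  proof -
    have "emeasure lborel (?J i j) < \<infinity>"
      by (rule emeasure_bounded_finite[unfolded infinity_ennreal_def[symmetric]]) (auto intro: bounded_Int)
    then show ?thesis by (subst integrable_indicator_iff) auto
  qed
  have ind: "(indicator {a i<..b i} s *\<^sub>R v) \<bullet> (indicator {a j<..b j} s *\<^sub>R w) = indicator (?J i j) s * (v \<bullet> w)"
    for i j s and v w :: "real ^ 'd ^ 'n" by (auto simp: indicator_def)
  have "(\<integral>\<^sup>+\<omega>. sqn (\<Sum>i\<in>I. ?e i \<omega>) \<partial>P) = ennreal (expectation (\<lambda>\<omega>. \<Sum>i\<in>I. \<Sum>j\<in>I. ?e i \<omega> \<bullet> ?e j \<omega>))"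
    unfolding sq
  proof (rule nn_integral_eq_integral)
    show "integrable P (\<lambda>\<omega>. \<Sum>i\<in>I. \<Sum>j\<in>I. ?e i \<omega> \<bullet> ?e j \<omega>)"
      using e_int by (intro Bochner_Integration.integrable_sum) auto
    show "AE \<omega> in P. 0 \<le> (\<Sum>i\<in>I. \<Sum>j\<in>I. ?e i \<omega> \<bullet> ?e j \<omega>)"
      unfolding sq[symmetric] by simp
  qed
  also have "expectation (\<lambda>\<omega>. \<Sum>i\<in>I. \<Sum>j\<in>I. ?e i \<omega> \<bullet> ?e j \<omega>) =
      (\<Sum>i\<in>I. \<Sum>j\<in>I. measure lborel (?J i j) * expectation (\<lambda>\<omega>. \<xi> i \<omega> \<bullet> \<xi> j \<omega>))"
    using e_int ab \<xi> by (simp add: Bochner_Integration.integral_sum elementary_pair)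
  also have "\<dots> = expectation (\<lambda>\<omega>. \<Sum>i\<in>I. \<Sum>j\<in>I. measure lborel (?J i j) * (\<xi> i \<omega> \<bullet> \<xi> j \<omega>))"
    using \<xi>_int by (simp add: Bochner_Integration.integral_sum)
  also have "ennreal \<dots> = (\<integral>\<^sup>+\<omega>. ennreal (\<Sum>i\<in>I. \<Sum>j\<in>I. measure lborel (?J i j) * (\<xi> i \<omega> \<bullet> \<xi> j \<omega>)) \<partial>P)"
  proof (rule nn_integral_eq_integral[symmetric])
    show "integrable P (\<lambda>\<omega>. \<Sum>i\<in>I. \<Sum>j\<in>I. measure lborel (?J i j) * (\<xi> i \<omega> \<bullet> \<xi> j \<omega>))"
      using \<xi>_int by (intro Bochner_Integration.integrable_sum integrable_mult_right) auto
    have "0 \<le> (\<Sum>i\<in>I. \<Sum>j\<in>I. measure lborel (?J i j) * (\<xi> i \<omega> \<bullet> \<xi> j \<omega>))" for \<omega>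
    proof -
      have "0 \<le> (\<integral>s. (norm (\<Sum>i\<in>I. indicator {a i<..b i} s *\<^sub>R \<xi> i \<omega>))\<^sup>2 \<partial>lborel)" by simp
      also have "\<dots> = (\<integral>s. (\<Sum>i\<in>I. \<Sum>j\<in>I. indicator (?J i j) s * (\<xi> i \<omega> \<bullet> \<xi> j \<omega>)) \<partial>lborel)"
        unfolding sq ind ..
      also have "\<dots> = (\<Sum>i\<in>I. \<Sum>j\<in>I. measure lborel (?J i j) * (\<xi> i \<omega> \<bullet> \<xi> j \<omega>))"
        using J by (simp add: Bochner_Integration.integral_sum)
      finally show ?thesis .
    qed
    then show "AE \<omega> in P. 0 \<le> (\<Sum>i\<in>I. \<Sum>j\<in>I. measure lborel (?J i j) * (\<xi> i \<omega> \<bullet> \<xi> j \<omega>))" by simp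
  qed
  also have "\<dots> = (\<integral>\<^sup>+\<omega>. (\<integral>\<^sup>+s. sqn (\<Sum>i\<in>I. indicator {a i<..b i} s *\<^sub>R \<xi> i \<omega>) \<partial>lborel) \<partial>P)"
  proof (rule nn_integral_cong)
    fix \<omega>
    have eq: "(norm (\<Sum>i\<in>I. indicator {a i<..b i} s *\<^sub>R \<xi> i \<omega>))\<^sup>2 =
        (\<Sum>i\<in>I. \<Sum>j\<in>I. indicator (?J i j) s * (\<xi> i \<omega> \<bullet> \<xi> j \<omega>))" for s
      unfolding sq ind ..
    have "(\<integral>\<^sup>+s. sqn (\<Sum>i\<in>I. indicator {a i<..b i} s *\<^sub>R \<xi> i \<omega>) \<partial>lborel) =
      ennreal (\<integral>s. (\<Sum>i\<in>I. \<Sum>j\<in>I. indicator (?J i j) s * (\<xi> i \<omega> \<bullet> \<xi> j \<omega>)) \<partial>lborel)"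
      unfolding eq
    proof (rule nn_integral_eq_integral)
      show "integrable lborel (\<lambda>s. \<Sum>i\<in>I. \<Sum>j\<in>I. indicator (?J i j) s * (\<xi> i \<omega> \<bullet> \<xi> j \<omega>))"
        using J by (intro Bochner_Integration.integrable_sum integrable_mult_left) auto
      show "AE s in lborel. 0 \<le> (\<Sum>i\<in>I. \<Sum>j\<in>I. indicator (?J i j) s * (\<xi> i \<omega> \<bullet> \<xi> j \<omega>))"
        unfolding eq[symmetric] by simp
    qed
    also have "(\<integral>s. (\<Sum>i\<in>I. \<Sum>j\<in>I. indicator (?J i j) s * (\<xi> i \<omega> \<bullet> \<xi> j \<omega>)) \<partial>lborel) =
      (\<Sum>i\<in>I. \<Sum>j\<in>I. measure lborel (?J i j) * (\<xi> i \<omega> \<bullet> \<xi> j \<omega>))"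
      using J by (simp add: Bochner_Integration.integral_sum)
    finally show "ennreal (\<Sum>i\<in>I. \<Sum>j\<in>I. measure lborel (?J i j) * (\<xi> i \<omega> \<bullet> \<xi> j \<omega>)) =
      (\<integral>\<^sup>+s. sqn (\<Sum>i\<in>I. indicator {a i<..b i} s *\<^sub>R \<xi> i \<omega>) \<partial>lborel)" ..
  qed
  finally show ?thesis .
qed

lemma elementary_uminus: "elementary (\<lambda>\<omega>. - \<xi> \<omega>) a b \<omega> = - elementary \<xi> a b \<omega>"
  by (simp add: elementary_def matrix_vector_mult_def vec_eq_iff sum_negf)

lemma simple_ito_integral_elementary:
  "simple_ito_integral W N \<tau> \<xi> \<omega> = (\<Sum>i<N. elementary (\<xi> i) (\<tau> i) (\<tau> (Suc i)) \<omega>)"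
  by (simp add: simple_ito_integral_def elementary_def)

text \<open>The difference of two simple processes is again a sum of elementary ones, indexed by the disjoint
  union of the two index sets, with the values of the second family negated.\<close>

lemma simple_ito_isometry:
  assumes \<xi>: "simple_integrand P F t N \<tau> \<xi>" and \<eta>: "simple_integrand P F t M \<rho> \<eta>"
  shows "(\<integral>\<^sup>+\<omega>. sqn (simple_ito_integral W N \<tau> \<xi> \<omega> - simple_ito_integral W M \<rho> \<eta> \<omega>) \<partial>P) =
    (\<integral>\<^sup>+\<omega>. (\<integral>\<^sup>+s\<in>{0..t}. sqn (simple_value N \<tau> \<xi> s \<omega> - simple_value M \<rho> \<eta> s \<omega>) \<partial>lborel) \<partial>P)"
proof -
  let ?I = "{..<N} <+> {..<M}"
  define a where "a = case_sum \<tau> \<rho>"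
  define b where "b = case_sum (\<lambda>i. \<tau> (Suc i)) (\<lambda>i. \<rho> (Suc i))"
  define \<zeta> where "\<zeta> = case_sum \<xi> (\<lambda>i \<omega>. - \<eta> i \<omega>)"
  have sum: "(\<Sum>i\<in>?I. f i) = (\<Sum>i<N. f (Inl i)) + (\<Sum>i<M. f (Inr i))" for f :: "nat + nat \<Rightarrow> 'b::comm_monoid_add"
    by (simp add: sum.Plus)
  have 1: "(\<Sum>i\<in>?I. elementary (\<zeta> i) (a i) (b i) \<omega>) =
      simple_ito_integral W N \<tau> \<xi> \<omega> - simple_ito_integral W M \<rho> \<eta> \<omega>" for \<omega>
    unfolding sum simple_ito_integral_elementary
    by (simp add: a_def b_def \<zeta>_def elementary_uminus sum_negf)
  have 2: "(\<Sum>i\<in>?I. indicator {a i<..b i} s *\<^sub>R \<zeta> i \<omega>) = simple_value N \<tau> \<xi> s \<omega> - simple_value M \<rho> \<eta> s \<omega>" for s \<omega>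
    unfolding sum simple_value_def by (simp add: a_def b_def \<zeta>_def sum_negf)
  have "(\<integral>\<^sup>+\<omega>. sqn (\<Sum>i\<in>?I. elementary (\<zeta> i) (a i) (b i) \<omega>) \<partial>P) =
    (\<integral>\<^sup>+\<omega>. (\<integral>\<^sup>+s. sqn (\<Sum>i\<in>?I. indicator {a i<..b i} s *\<^sub>R \<zeta> i \<omega>) \<partial>lborel) \<partial>P)"
  proof (rule elementary_sum_isometry)
    fix i assume i: "i \<in> ?I"
    show "0 \<le> a i" "a i \<le> b i"
      using i \<xi> \<eta> by (auto simp: a_def b_def simple_integrand_def)
    show "\<zeta> i \<in> L2_rv P (F (a i))"
      using i \<xi> \<eta> by (auto simp: a_def \<zeta>_def simple_integrand_def L2_rv_def)
  qed simp
  also have "\<dots> = (\<integral>\<^sup>+\<omega>. (\<integral>\<^sup>+s\<in>{0..t}. sqn (simple_value N \<tau> \<xi> s \<omega> - simple_value M \<rho> \<eta> s \<omega>) \<partial>lborel) \<partial>P)"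
  proof (intro nn_integral_cong)
    fix \<omega> s
    have "simple_value N \<tau> \<xi> s \<omega> = 0" if "s \<notin> {0..t}"
      unfolding simple_value_def
    proof (intro sum.neutral ballI)
      fix i assume "i \<in> {..<N}"
      then have "{\<tau> i<..\<tau> (Suc i)} \<subseteq> {0..t}" using \<xi> by (force simp: simple_integrand_def)
      then show "indicator {\<tau> i<..\<tau> (Suc i)} s *\<^sub>R \<xi> i \<omega> = 0" using that by (auto simp: indicator_def)
    qed
    moreover have "simple_value M \<rho> \<eta> s \<omega> = 0" if "s \<notin> {0..t}"
      unfolding simple_value_def
    proof (intro sum.neutral ballI)
      fix i assume "i \<in> {..<M}"
      then have "{\<rho> i<..\<rho> (Suc i)} \<subseteq> {0..t}" using \<eta> by (force simp: simple_integrand_def)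
      then show "indicator {\<rho> i<..\<rho> (Suc i)} s *\<^sub>R \<eta> i \<omega> = 0" using that by (auto simp: indicator_def)
    qed
    ultimately show "sqn (\<Sum>i\<in>?I. indicator {a i<..b i} s *\<^sub>R \<zeta> i \<omega>) =
        sqn (simple_value N \<tau> \<xi> s \<omega> - simple_value M \<rho> \<eta> s \<omega>) * indicator {0..t} s"
      unfolding 2 by (auto simp: indicator_def)
  qed
  finally show ?thesis unfolding 1 .
qed

text \<open>The integral over \<open>[0, t]\<close>, as a process in \<open>t\<close>.\<close>

definition stopped_integral :: "nat \<Rightarrow> (nat \<Rightarrow> real) \<Rightarrow> (nat \<Rightarrow> 'w \<Rightarrow> real ^ 'd ^ 'n) \<Rightarrow> real \<Rightarrow> 'w \<Rightarrow> real ^ 'n" where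
  "stopped_integral N \<tau> \<xi> t \<omega> = (\<Sum>i<N. elementary (\<xi> i) (min (\<tau> i) t) (min (\<tau> (Suc i)) t) \<omega>)"

text \<open>At a time \<open>t\<close> before \<open>\<tau> i\<close> the variable \<open>\<xi> i\<close> is not yet known, but then the
  \<open>i\<close>-th interval has no part in \<open>[0, t]\<close>. With the value \<open>0\<close> in this case, cutting off a
  simple process at \<open>t\<close> gives a simple process on \<open>[0, t]\<close>.\<close>

definition started_value :: "(nat \<Rightarrow> real) \<Rightarrow> (nat \<Rightarrow> 'w \<Rightarrow> real ^ 'd ^ 'n) \<Rightarrow> real \<Rightarrow> nat \<Rightarrow> 'w \<Rightarrow> real ^ 'd ^ 'n" where
  "started_value \<tau> \<xi> t i = (if \<tau> i \<le> t then \<xi> i else (\<lambda>_. 0))"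

lemma simple_integrand_stopped:
  assumes \<xi>: "simple_integrand P F T N \<tau> \<xi>" and t: "0 \<le> t"
  shows "simple_integrand P F t N (\<lambda>i. min (\<tau> i) t) (started_value \<tau> \<xi> t)"
  using \<xi> t unfolding simple_integrand_def started_value_def
  by (auto simp: min_def)

lemma stopped_integral_eq:
  assumes "simple_integrand P F T N \<tau> \<xi>"
  shows "stopped_integral N \<tau> \<xi> t \<omega> = simple_ito_integral W N (\<lambda>i. min (\<tau> i) t) (started_value \<tau> \<xi> t) \<omega>"
  unfolding stopped_integral_def simple_ito_integral_elementary
proof (rule sum.cong)
  fix i assume "i \<in> {..<N}"
  then have "\<tau> i \<le> \<tau> (Suc i)" using assms by (simp add: simple_integrand_def)
  then show "elementary (\<xi> i) (min (\<tau> i) t) (min (\<tau> (Suc i)) t) \<omega> =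
      elementary (started_value \<tau> \<xi> t i) (min (\<tau> i) t) (min (\<tau> (Suc i)) t) \<omega>"
    by (cases "\<tau> i \<le> t") (auto simp: started_value_def)
qed simp

lemma simple_value_stopped:
  assumes "s \<le> t"
  shows "simple_value N (\<lambda>i. min (\<tau> i) t) (started_value \<tau> \<xi> t) s \<omega> = simple_value N \<tau> \<xi> s \<omega>"
  unfolding simple_value_def
  by (rule sum.cong) (use assms in \<open>auto simp: indicator_def started_value_def min_def\<close>)

lemma stopped_integral_continuous:
  assumes "continuous_on {0..} (\<lambda>t. W t \<omega>)" and \<xi>: "simple_integrand P F T N \<tau> \<xi>"
  shows "continuous_on {0..T} (\<lambda>t. stopped_integral N \<tau> \<xi> t \<omega>)"
proof -
  have W: "continuous_on {0..T} (\<lambda>t. W (min r t) \<omega>)" if "0 \<le> r" for r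
    by (rule continuous_on_compose2[OF assms(1)]) (use that in \<open>auto intro!: continuous_intros\<close>)
  show ?thesis
    unfolding stopped_integral_def elementary_def
  proof (rule continuous_on_sum)
    fix i assume i: "i \<in> {..<N}"
    then have "0 \<le> \<tau> i" "0 \<le> \<tau> (Suc i)" using \<xi> by (force simp: simple_integrand_def)+
    then show "continuous_on {0..T} (\<lambda>t. \<xi> i \<omega> *v (W (min (\<tau> (Suc i)) t) \<omega> - W (min (\<tau> i) t) \<omega>))"
      by (intro bounded_linear.continuous_on[OF matrix_vector_mul_bounded_linear] continuous_on_diff W)
  qed
qed

lemma stopped_integral_L2:
  assumes \<xi>: "simple_integrand P F T N \<tau> \<xi>" and t: "0 \<le> t"
  shows "stopped_integral N \<tau> \<xi> t \<in> L2_rv P (F t)"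
proof -
  let ?s = "\<lambda>i. min (\<tau> i) t"
  have "elementary (started_value \<tau> \<xi> t i) (?s i) (?s (Suc i)) \<in> L2_rv P (F t)" if "i \<in> {..<N}" for i
  proof -
    have s: "0 \<le> ?s i" "?s i \<le> ?s (Suc i)" "started_value \<tau> \<xi> t i \<in> L2_rv P (F (?s i))"
      using simple_integrand_stopped[OF \<xi> t] that by (auto simp: simple_integrand_def)
    show ?thesis by (rule L2_rv_mono[OF elementary_L2[OF s] order_trans[OF s(1,2)]]) simp
  qed
  from L2_rv_sum[of "{..<N}", OF this t] show ?thesis
    unfolding stopped_integral_eq[OF \<xi>, abs_def] simple_ito_integral_elementary .
qed

text \<open>The martingale property in the form in which it is used: what the integral gains after time
  \<open>u\<close> is a sum of elementary integrals that start at \<open>u\<close> or later.\<close>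

lemma stopped_integral_martingale:
  assumes \<xi>: "simple_integrand P F T N \<tau> \<xi>" and ut: "0 \<le> u" "u \<le> t" and Y: "Y \<in> L2_rv P (F u)"
  shows "expectation (\<lambda>\<omega>. (stopped_integral N \<tau> \<xi> t \<omega> - stopped_integral N \<tau> \<xi> u \<omega>) \<bullet> Y \<omega>) = 0"
proof -
  let ?e = "\<lambda>t i. elementary (\<xi> i) (min (\<tau> i) t) (min (\<tau> (Suc i)) t)"
  have "integrable P (\<lambda>\<omega>. (?e t i \<omega> - ?e u i \<omega>) \<bullet> Y \<omega>) \<and> expectation (\<lambda>\<omega>. (?e t i \<omega> - ?e u i \<omega>) \<bullet> Y \<omega>) = 0"
    if i: "i < N" for i
  proof -
    have b: "0 \<le> \<tau> i" "\<tau> i \<le> \<tau> (Suc i)" "\<xi> i \<in> L2_rv P (F (\<tau> i))"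
      using \<xi> i by (auto simp: simple_integrand_def)
    let ?c = "max (\<tau> i) u" and ?d = "min (\<tau> (Suc i)) t"
    show ?thesis
    proof (cases "?c \<le> ?d")
      case True
      have eq: "?e t i \<omega> - ?e u i \<omega> = elementary (\<xi> i) ?c ?d \<omega>" for \<omega>
      proof (cases "\<tau> i \<le> u")
        case True
        then have "?e t i \<omega> = ?e u i \<omega> + elementary (\<xi> i) (min (\<tau> (Suc i)) u) ?d \<omega>"
          using ut by (simp add: min_absorb1 elementary_split[of "\<xi> i" "\<tau> i" "?d" \<omega> "min (\<tau> (Suc i)) u"])
        moreover have "min (\<tau> (Suc i)) u = u" using \<open>?c \<le> ?d\<close> by auto
        ultimately show ?thesis using True by (simp add: max_absorb2)
      next
        case False
        then have "min (\<tau> i) u = u" "min (\<tau> (Suc i)) u = u" "min (\<tau> i) t = \<tau> i" "?c = \<tau> i"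
          using b True by auto
        then show ?thesis by simp
      qed
      have c0: "0 \<le> ?c" using ut by simp
      have \<xi>c: "\<xi> i \<in> L2_rv P (F ?c)" by (rule L2_rv_mono[OF b(3,1)]) simp
      have Yc: "Y \<in> L2_rv P (F ?c)" by (rule L2_rv_mono[OF Y ut(1)]) simp
      from L2_rv_integrable_inner[OF elementary_L2[OF c0 True \<xi>c] Yc order_trans[OF c0 True] c0]
        elementary_orthogonal[OF c0 True \<xi>c Yc]
      show ?thesis unfolding eq by blast
    next
      case False
      then have "?e t i \<omega> - ?e u i \<omega> = 0" for \<omega>
        using ut b by (auto simp: min_def max_def split: if_splits)
      then show ?thesis by simp
    qed
  qed
  then show ?thesis
    unfolding stopped_integral_def sum_subtractf[symmetric] inner_sum_left
    by (subst Bochner_Integration.integral_sum) auto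
qed

lemma stopped_integral_isometry:
  assumes \<xi>: "simple_integrand P F T N \<tau> \<xi>" and \<eta>: "simple_integrand P F T M \<rho> \<eta>" and t: "0 \<le> t"
  shows "(\<integral>\<^sup>+\<omega>. sqn (stopped_integral N \<tau> \<xi> t \<omega> - stopped_integral M \<rho> \<eta> t \<omega>) \<partial>P) =
    (\<integral>\<^sup>+\<omega>. (\<integral>\<^sup>+s\<in>{0..t}. sqn (simple_value N \<tau> \<xi> s \<omega> - simple_value M \<rho> \<eta> s \<omega>) \<partial>lborel) \<partial>P)"
proof -
  have "(\<integral>\<^sup>+\<omega>. sqn (stopped_integral N \<tau> \<xi> t \<omega> - stopped_integral M \<rho> \<eta> t \<omega>) \<partial>P) =
      (\<integral>\<^sup>+\<omega>. (\<integral>\<^sup>+s\<in>{0..t}. sqn (simple_value N (\<lambda>i. min (\<tau> i) t) (started_value \<tau> \<xi> t) s \<omega> -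
        simple_value M (\<lambda>i. min (\<rho> i) t) (started_value \<rho> \<eta> t) s \<omega>) \<partial>lborel) \<partial>P)"
    unfolding simple_ito_isometry[OF simple_integrand_stopped[OF \<xi> t] simple_integrand_stopped[OF \<eta> t], symmetric]
    by (intro nn_integral_cong) (simp only: stopped_integral_eq[OF \<xi>] stopped_integral_eq[OF \<eta>])
  also have "\<dots> = (\<integral>\<^sup>+\<omega>. (\<integral>\<^sup>+s\<in>{0..t}. sqn (simple_value N \<tau> \<xi> s \<omega> - simple_value M \<rho> \<eta> s \<omega>) \<partial>lborel) \<partial>P)"
    by (intro nn_integral_cong) (auto simp: indicator_def simple_value_stopped)
  finally show ?thesis .
qed

end

section \<open>The maximal inequality\<close>

context complete_filtration
begin

text \<open>Kolmogorov's argument. The event is split according to the first index \<open>j\<close> with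
  \<open>e \<le> \<bar>X j\<bar>\<close>. The part \<open>A j\<close> is known at time \<open>u j\<close>, so \<open>X m - X j\<close> is orthogonal
  to \<open>X j\<close> on \<open>A j\<close>, and the mean of \<open>\<bar>X m\<bar>\<^sup>2\<close> over \<open>A j\<close> is at least that of
  \<open>\<bar>X j\<bar>\<^sup>2\<close>.\<close>

lemma maximal_inequality_discrete:
  fixes X :: "nat \<Rightarrow> 'w \<Rightarrow> 'a::euclidean_space"
  assumes u: "\<And>j. j \<le> m \<Longrightarrow> 0 \<le> u j" "\<And>i j. i \<le> j \<Longrightarrow> j \<le> m \<Longrightarrow> u i \<le> u j"
    and X: "\<And>j. j \<le> m \<Longrightarrow> X j \<in> L2_rv P (F (u j))"
    and orth: "\<And>j Y. j \<le> m \<Longrightarrow> Y \<in> L2_rv P (F (u j)) \<Longrightarrow> expectation (\<lambda>\<omega>. (X m \<omega> - X j \<omega>) \<bullet> Y \<omega>) = 0"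
    and e: "0 < e"
  shows "ennreal (e\<^sup>2) * emeasure P {\<omega> \<in> space P. \<exists>j\<le>m. e \<le> norm (X j \<omega>)} \<le> (\<integral>\<^sup>+\<omega>. sqn (X m \<omega>) \<partial>P)"
proof -
  have XP[measurable]: "X j \<in> borel_measurable P" if "j \<le> m" for j
    using L2_rvD(2)[OF X[OF that] u(1)[OF that]] .
  define A where "A j = {\<omega> \<in> space P. e \<le> norm (X j \<omega>) \<and> (\<forall>i<j. norm (X i \<omega>) < e)}" for j
  have AF: "A j \<in> sets (F (u j))" if j: "j \<le> m" for j
  proof -
    have Xi: "X i \<in> borel_measurable (F (u j))" if i: "i \<le> j" for i
      using i j by (intro measurable_F_mono[OF L2_rvD(1)[OF X u(1)] u(1) u(2)]) auto
    have 1: "{\<omega> \<in> space (F (u j)). e \<le> norm (X j \<omega>)} \<in> sets (F (u j))"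
      by (intro borel_measurable_le borel_measurable_const measurable_compose[OF Xi borel_measurable_norm]) simp
    have 2: "{\<omega> \<in> space (F (u j)). norm (X i \<omega>) < e} \<in> sets (F (u j))" if "i < j" for i
      using that by (intro borel_measurable_less borel_measurable_const measurable_compose[OF Xi borel_measurable_norm]) simp
    have "A j = {\<omega> \<in> space (F (u j)). e \<le> norm (X j \<omega>)} \<inter>
        {\<omega> \<in> space (F (u j)). \<forall>i\<in>{..<j}. norm (X i \<omega>) < e}"
      unfolding A_def space_F[OF u(1)[OF j]] by auto
    moreover have "{\<omega> \<in> space (F (u j)). \<forall>i\<in>{..<j}. norm (X i \<omega>) < e} \<in> sets (F (u j))"
      using 2 by (intro sets.sets_Collect_finite_All) auto
    ultimately show ?thesis using 1 by simp
  qed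
  have AP: "A j \<in> sets P" if "j \<le> m" for j
    using AF[OF that] subalgebra_F[OF u(1)[OF that]] by (auto simp: subalgebra_def)
  have step: "ennreal (e\<^sup>2) * emeasure P (A j) \<le> (\<integral>\<^sup>+\<omega>\<in>A j. sqn (X m \<omega>) \<partial>P)" if j: "j \<le> m" for j
  proof -
    note [measurable] = AP[OF j] XP[OF j] XP[OF order_refl]
    \<comment> \<open>The test variable to which \<open>X m - X j\<close> is orthogonal.\<close>
    define Y where "Y \<omega> = indicator (A j) \<omega> *\<^sub>R X j \<omega>" for \<omega>
    have Y: "Y \<in> L2_rv P (F (u j))"
    proof -
      have "Y \<in> borel_measurable (F (u j))"
        unfolding Y_def[abs_def]
        by (intro borel_measurable_scaleR borel_measurable_indicator AF j L2_rvD(1)[OF X u(1)])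
      moreover have "integrable P (\<lambda>\<omega>. (norm (Y \<omega>))\<^sup>2)"
        by (rule Bochner_Integration.integrable_bound[OF L2_rvD(4)[OF X[OF j] u(1)[OF j]]])
          (auto simp: Y_def indicator_def)
      ultimately show ?thesis by (simp add: L2_rv_def)
    qed
    have YY: "integrable P (\<lambda>\<omega>. Y \<omega> \<bullet> Y \<omega>)" by (rule L2_rv_integrable_inner[OF Y Y u(1)[OF j] u(1)[OF j]])
    have XY: "integrable P (\<lambda>\<omega>. X m \<omega> \<bullet> Y \<omega>)"
      by (rule L2_rv_integrable_inner[OF X[OF order_refl] Y u(1)[OF order_refl] u(1)[OF j]])
    have XjY: "integrable P (\<lambda>\<omega>. X j \<omega> \<bullet> Y \<omega>)"
      by (rule L2_rv_integrable_inner[OF X[OF j] Y u(1)[OF j] u(1)[OF j]])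
    have Xm: "integrable P (\<lambda>\<omega>. indicator (A j) \<omega> * (norm (X m \<omega>))\<^sup>2)"
      by (rule Bochner_Integration.integrable_bound[OF L2_rvD(4)[OF X[OF order_refl] u(1)[OF order_refl]]])
        (auto simp: indicator_def)
    have "e\<^sup>2 * prob (A j) = expectation (\<lambda>\<omega>. e\<^sup>2 * indicator (A j) \<omega>)" by simp
    also have "\<dots> \<le> expectation (\<lambda>\<omega>. Y \<omega> \<bullet> Y \<omega>)"
    proof (rule integral_mono)
      fix \<omega>
      have "e\<^sup>2 \<le> (norm (X j \<omega>))\<^sup>2" if "\<omega> \<in> A j" using that e by (intro power_mono) (auto simp: A_def)
      then show "e\<^sup>2 * indicator (A j) \<omega> \<le> Y \<omega> \<bullet> Y \<omega>"
        by (auto simp: Y_def indicator_def power2_norm_eq_inner)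
      have "integrable P (indicator (A j) :: 'w \<Rightarrow> real)"
        by (rule integrable_const_bound[of _ 1]) (auto simp: indicator_def)
      then show "integrable P (\<lambda>\<omega>. e\<^sup>2 * indicator (A j) \<omega>)" by simp
    qed (rule YY)
    also have "\<dots> = expectation (\<lambda>\<omega>. Y \<omega> \<bullet> Y \<omega> + 2 * ((X m \<omega> - X j \<omega>) \<bullet> Y \<omega>))"
      using YY XY XjY orth[OF j Y] by (simp add: inner_diff_left)
    also have "\<dots> \<le> expectation (\<lambda>\<omega>. indicator (A j) \<omega> * (norm (X m \<omega>))\<^sup>2)"
    proof (rule integral_mono)
      show "integrable P (\<lambda>\<omega>. Y \<omega> \<bullet> Y \<omega> + 2 * ((X m \<omega> - X j \<omega>) \<bullet> Y \<omega>))"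
        using YY XY XjY by (simp add: inner_diff_left)
      fix \<omega>
      \<comment> \<open>On \<open>A j\<close> the difference of the two sides is exactly this square.\<close>
      have "0 \<le> (X m \<omega> - X j \<omega>) \<bullet> (X m \<omega> - X j \<omega>)" by simp
      then show "Y \<omega> \<bullet> Y \<omega> + 2 * ((X m \<omega> - X j \<omega>) \<bullet> Y \<omega>) \<le> indicator (A j) \<omega> * (norm (X m \<omega>))\<^sup>2"
        by (auto simp: Y_def indicator_def power2_norm_eq_inner algebra_simps inner_commute)
    qed (rule Xm)
    finally have "ennreal (e\<^sup>2 * prob (A j)) \<le> ennreal (expectation (\<lambda>\<omega>. indicator (A j) \<omega> * (norm (X m \<omega>))\<^sup>2))"
      by (rule ennreal_leI)
    also have "\<dots> = (\<integral>\<^sup>+\<omega>. ennreal (indicator (A j) \<omega> * (norm (X m \<omega>))\<^sup>2) \<partial>P)"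
      by (rule nn_integral_eq_integral[OF Xm, symmetric]) simp
    also have "\<dots> = (\<integral>\<^sup>+\<omega>\<in>A j. sqn (X m \<omega>) \<partial>P)"
      by (intro nn_integral_cong) (auto simp: indicator_def)
    finally show ?thesis by (simp add: emeasure_eq_measure ennreal_mult)
  qed
  have disj: "disjoint_family_on A {..m}"
    unfolding disjoint_family_on_def A_def by (auto simp: linorder_neq_iff)
  have "{\<omega> \<in> space P. \<exists>j\<le>m. e \<le> norm (X j \<omega>)} = (\<Union>j\<in>{..m}. A j)"
  proof (intro equalityI subsetI)
    fix \<omega> assume w: "\<omega> \<in> {\<omega> \<in> space P. \<exists>j\<le>m. e \<le> norm (X j \<omega>)}"
    then obtain j where j: "j \<le> m" "e \<le> norm (X j \<omega>)" by blast
    define k where "k = (LEAST k. e \<le> norm (X k \<omega>))"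
    have "e \<le> norm (X k \<omega>)" "k \<le> j" unfolding k_def by (rule LeastI[of _ j], rule j(2), rule Least_le, rule j(2))
    moreover have "norm (X i \<omega>) < e" if "i < k" for i
      using not_less_Least[OF that[unfolded k_def]] by simp
    ultimately show "\<omega> \<in> (\<Union>j\<in>{..m}. A j)" using w j by (auto simp: A_def intro!: bexI[of _ k])
  qed (auto simp: A_def)
  then have "ennreal (e\<^sup>2) * emeasure P {\<omega> \<in> space P. \<exists>j\<le>m. e \<le> norm (X j \<omega>)} =
      (\<Sum>j\<in>{..m}. ennreal (e\<^sup>2) * emeasure P (A j))"
    using AP by (simp add: sum_emeasure[OF _ disj, symmetric] image_subset_iff sum_distrib_left)
  also have "\<dots> \<le> (\<Sum>j\<in>{..m}. (\<integral>\<^sup>+\<omega>\<in>A j. sqn (X m \<omega>) \<partial>P))"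
    using step by (intro sum_mono) auto
  also have "\<dots> = (\<integral>\<^sup>+\<omega>. (\<Sum>j\<in>{..m}. sqn (X m \<omega>) * indicator (A j) \<omega>) \<partial>P)"
    using AP XP[OF order_refl] by (subst nn_integral_sum) auto
  also have "\<dots> \<le> (\<integral>\<^sup>+\<omega>. sqn (X m \<omega>) \<partial>P)"
  proof (rule nn_integral_mono)
    fix \<omega>
    have "(\<Sum>j\<in>{..m}. indicator (A j) \<omega>) = (indicator (\<Union>j\<in>{..m}. A j) \<omega> :: ennreal)"
      using disj by (intro indicator_UN_disjoint[symmetric]) auto
    then show "(\<Sum>j\<in>{..m}. sqn (X m \<omega>) * indicator (A j) \<omega>) \<le> sqn (X m \<omega>)"
      unfolding sum_distrib_left[symmetric] by (auto simp: indicator_def)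
  qed
  finally show ?thesis .
qed

text \<open>The discrete inequality holds on all dyadic grids with the same right-hand side. The events of the
  grids increase, so their union satisfies the bound; outside of it a continuous path stays below
  \<open>e\<close> at every time, because dyadic times are dense.\<close>

lemma maximal_inequality:
  fixes X :: "real \<Rightarrow> 'w \<Rightarrow> 'a::euclidean_space"
  assumes T: "0 < T"
    and X: "\<And>t. t \<in> {0..T} \<Longrightarrow> X t \<in> L2_rv P (F t)"
    and orth: "\<And>t Y. t \<in> {0..T} \<Longrightarrow> Y \<in> L2_rv P (F t) \<Longrightarrow> expectation (\<lambda>\<omega>. (X T \<omega> - X t \<omega>) \<bullet> Y \<omega>) = 0"
    and cont: "AE \<omega> in P. continuous_on {0..T} (\<lambda>t. X t \<omega>)"
    and e: "0 < e"
  obtains E where "E \<in> sets P" "ennreal (e\<^sup>2) * emeasure P E \<le> (\<integral>\<^sup>+\<omega>. sqn (X T \<omega>) \<partial>P)"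
    "AE \<omega> in P. \<omega> \<notin> E \<longrightarrow> (\<forall>t\<in>{0..T}. norm (X t \<omega>) \<le> e)"
proof -
  define u where "u n j = real j * T / 2 ^ n" for n j :: nat
  have u0: "0 \<le> u n j" for n j using T by (simp add: u_def)
  have uT: "u n j \<le> T" if "j \<le> 2 ^ n" for n j
  proof -
    have "real j \<le> 2 ^ n" using that by (metis of_nat_le_iff of_nat_numeral of_nat_power)
    then have "real j * T \<le> 2 ^ n * T" using T by (intro mult_right_mono) auto
    then show ?thesis by (simp add: u_def divide_le_eq mult.commute)
  qed
  have uTT: "u n (2 ^ n) = T" for n by (simp add: u_def)
  define E where "E n = {\<omega> \<in> space P. \<exists>j\<le>2 ^ n. e \<le> norm (X (u n j) \<omega>)}" for n
  have bound: "ennreal (e\<^sup>2) * emeasure P (E n) \<le> (\<integral>\<^sup>+\<omega>. sqn (X T \<omega>) \<partial>P)" for n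
  proof -
    have "ennreal (e\<^sup>2) * emeasure P {\<omega> \<in> space P. \<exists>j\<le>2 ^ n. e \<le> norm (X (u n j) \<omega>)}
      \<le> (\<integral>\<^sup>+\<omega>. sqn (X (u n (2 ^ n)) \<omega>) \<partial>P)"
    proof (rule maximal_inequality_discrete[where u="u n" and X="\<lambda>j. X (u n j)"])
      show "u n i \<le> u n j" if "i \<le> j" for i j
        using that T by (simp add: u_def divide_right_mono)
      show "X (u n j) \<in> L2_rv P (F (u n j))" if "j \<le> 2 ^ n" for j
        using X u0 uT[OF that] by simp
      show "expectation (\<lambda>\<omega>. (X (u n (2 ^ n)) \<omega> - X (u n j) \<omega>) \<bullet> Y \<omega>) = 0"
        if "j \<le> 2 ^ n" "Y \<in> L2_rv P (F (u n j))" for j Y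
        unfolding uTT by (rule orth[OF _ that(2)]) (use u0 uT[OF that(1)] in simp)
    qed (use u0 e in auto)
    then show ?thesis by (simp add: uTT E_def)
  qed
  have Xm: "X t \<in> borel_measurable P" if "t \<in> {0..T}" for t
    using L2_rvD(2)[OF X[OF that]] that by simp
  have Es: "E n \<in> sets P" for n
  proof -
    have "E n = (\<Union>j\<in>{..2 ^ n}. {\<omega> \<in> space P. e \<le> norm (X (u n j) \<omega>)})" by (auto simp: E_def)
    moreover have "{\<omega> \<in> space P. e \<le> norm (X (u n j) \<omega>)} \<in> sets P" if "j \<in> {..2 ^ n}" for j
      by (intro borel_measurable_le borel_measurable_const measurable_compose[OF Xm borel_measurable_norm]) (use that u0 uT in auto)
    ultimately show ?thesis by auto
  qed
  have inc: "incseq E"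
  proof (rule incseq_SucI, rule subsetI)
    fix n \<omega> assume "\<omega> \<in> E n"
    then obtain j where j: "\<omega> \<in> space P" "j \<le> 2 ^ n" "e \<le> norm (X (u n j) \<omega>)" by (auto simp: E_def)
    have "u (Suc n) (2 * j) = u n j" by (simp add: u_def)
    then show "\<omega> \<in> E (Suc n)" using j by (auto simp: E_def intro!: exI[of _ "2 * j"])
  qed
  show thesis
  proof (rule that[of "\<Union>n. E n"])
    show "(\<Union>n. E n) \<in> sets P" using Es by auto
    have "ennreal (e\<^sup>2) * emeasure P (\<Union>n. E n) = ennreal (e\<^sup>2) * (SUP n. emeasure P (E n))"
      using SUP_emeasure_incseq[of E P] Es inc by (simp add: image_subset_iff)
    also have "\<dots> = (SUP n. ennreal (e\<^sup>2) * emeasure P (E n))" by (rule SUP_mult_left_ennreal)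
    also have "\<dots> \<le> (\<integral>\<^sup>+\<omega>. sqn (X T \<omega>) \<partial>P)" using bound by (intro SUP_least) auto
    finally show "ennreal (e\<^sup>2) * emeasure P (\<Union>n. E n) \<le> (\<integral>\<^sup>+\<omega>. sqn (X T \<omega>) \<partial>P)" .
    show "AE \<omega> in P. \<omega> \<notin> (\<Union>n. E n) \<longrightarrow> (\<forall>t\<in>{0..T}. norm (X t \<omega>) \<le> e)"
      using cont AE_space
    proof eventually_elim
      fix \<omega> assume c: "continuous_on {0..T} (\<lambda>t. X t \<omega>)" and w: "\<omega> \<in> space P"
      show "\<omega> \<notin> (\<Union>n. E n) \<longrightarrow> (\<forall>t\<in>{0..T}. norm (X t \<omega>) \<le> e)"
      proof (intro impI ballI)
        fix t assume nE: "\<omega> \<notin> (\<Union>n. E n)" and t: "t \<in> {0..T}"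
        define j where "j n = nat \<lfloor>2 ^ n * t / T\<rfloor>" for n :: nat
        have jn: "real (j n) \<le> 2 ^ n * t / T" "2 ^ n * t / T - 1 \<le> real (j n)" for n
        proof -
          have "0 \<le> 2 ^ n * t / T" using t T by simp
          then have "real (j n) = of_int \<lfloor>2 ^ n * t / T\<rfloor>" unfolding j_def by simp
          then show "real (j n) \<le> 2 ^ n * t / T" "2 ^ n * t / T - 1 \<le> real (j n)" by linarith+
        qed
        have j2: "j n \<le> 2 ^ n" for n
        proof -
          have "2 ^ n * t / T \<le> 2 ^ n" using t T by (simp add: divide_le_eq)
          from order_trans[OF jn(1)[of n] this] show ?thesis by simp
        qed
        have le: "norm (X (u n (j n)) \<omega>) \<le> e" for n
          using nE w j2[of n] by (force simp: E_def)
        have lim: "(\<lambda>n. u n (j n)) \<longlonglongrightarrow> t"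
        proof (rule tendsto_sandwich)
          show "\<forall>\<^sub>F n in sequentially. t - T * (1 / 2) ^ n \<le> u n (j n)"
          proof (intro always_eventually allI)
            fix n
            have "(2 ^ n * t / T - 1) * T / 2 ^ n \<le> u n (j n)"
              unfolding u_def using jn(2)[of n] T by (intro divide_right_mono mult_right_mono) auto
            moreover have "(2 ^ n * t / T - 1) * T / 2 ^ n = t - T * (1 / 2) ^ n"
              using T by (simp add: field_simps power_divide)
            ultimately show "t - T * (1 / 2) ^ n \<le> u n (j n)" by simp
          qed
          show "\<forall>\<^sub>F n in sequentially. u n (j n) \<le> t"
          proof (intro always_eventually allI)
            fix n
            have "u n (j n) \<le> (2 ^ n * t / T) * T / 2 ^ n"
              unfolding u_def using jn(1)[of n] T by (intro divide_right_mono mult_right_mono) auto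
            also have "\<dots> = t" using T by simp
            finally show "u n (j n) \<le> t" .
          qed
          have "(\<lambda>n. t - T * (1 / 2) ^ n) \<longlonglongrightarrow> t - T * 0"
            by (intro tendsto_intros LIMSEQ_realpow_zero) auto
          then show "(\<lambda>n. t - T * (1 / 2) ^ n) \<longlonglongrightarrow> t" by simp
        qed simp
        have "(\<lambda>n. norm (X (u n (j n)) \<omega>)) \<longlonglongrightarrow> norm (X t \<omega>)"
          by (intro tendsto_norm continuous_on_tendsto_compose[OF c lim t]) (use u0 uT[OF j2] in auto)
        then show "norm (X t \<omega>) \<le> e" by (rule LIMSEQ_le_const2) (use le in auto)
      qed
    qed
  qed
qed

end

section \<open>The Ito integral\<close>

text \<open>The square of the distance in \<open>L\<^sup>2([0, t] \<times> \<Omega>)\<close>, hence the factor \<open>2\<close> in its triangle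
  inequality.\<close>

definition process_dist :: "'w measure \<Rightarrow> real \<Rightarrow> (real \<Rightarrow> 'w \<Rightarrow> 'a::euclidean_space) \<Rightarrow> (real \<Rightarrow> 'w \<Rightarrow> 'a) \<Rightarrow> ennreal" where
  "process_dist P t h g = (\<integral>\<^sup>+\<omega>. (\<integral>\<^sup>+s\<in>{0..t}. sqn (h s \<omega> - g s \<omega>) \<partial>lborel) \<partial>P)"

definition jointly_measurable :: "'w measure \<Rightarrow> real \<Rightarrow> (real \<Rightarrow> 'w \<Rightarrow> 'a::euclidean_space) \<Rightarrow> bool" where
  "jointly_measurable P t h \<longleftrightarrow> (\<lambda>(s, \<omega>). indicator {0..t} s *\<^sub>R h s \<omega>) \<in> borel_measurable (borel \<Otimes>\<^sub>M P)"

lemma process_dist_commute: "process_dist P t h g = process_dist P t g h"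
  unfolding process_dist_def by (simp add: norm_minus_commute)

lemma process_dist_zero: "process_dist P t h (\<lambda>_ _. 0) = (\<integral>\<^sup>+\<omega>. (\<integral>\<^sup>+s\<in>{0..t}. sqn (h s \<omega>) \<partial>lborel) \<partial>P)"
  unfolding process_dist_def by simp

lemma jointly_measurable_lborel:
  "jointly_measurable P t h \<Longrightarrow> (\<lambda>(s, \<omega>). indicator {0..t} s *\<^sub>R h s \<omega>) \<in> borel_measurable (lborel \<Otimes>\<^sub>M P)"
proof -
  have "sets (lborel \<Otimes>\<^sub>M P) = sets (borel \<Otimes>\<^sub>M P)" by (intro sets_pair_measure_cong) auto
  from measurable_cong_sets[OF this refl] show "jointly_measurable P t h \<Longrightarrow> ?thesis"
    unfolding jointly_measurable_def by blast
qed

lemma process_dist_eq: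
  "process_dist P t h g =
    (\<integral>\<^sup>+\<omega>. (\<integral>\<^sup>+s. sqn (indicator {0..t} s *\<^sub>R h s \<omega> - indicator {0..t} s *\<^sub>R g s \<omega>) \<partial>lborel) \<partial>P)"
  unfolding process_dist_def by (intro nn_integral_cong) (auto simp: indicator_def)

lemma process_dist_triangle:
  assumes P: "prob_space P" and m: "jointly_measurable P t h" "jointly_measurable P t g" "jointly_measurable P t k"
  shows "process_dist P t h k \<le> 2 * (process_dist P t h g + process_dist P t g k)"
proof -
  interpret prob_space P by fact
  define H where "H s \<omega> = indicator {0..t} s *\<^sub>R h s \<omega>" for s \<omega>
  define G where "G s \<omega> = indicator {0..t} s *\<^sub>R g s \<omega>" for s \<omega>
  define K where "K s \<omega> = indicator {0..t} s *\<^sub>R k s \<omega>" for s \<omega>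
  note [measurable] = m[THEN jointly_measurable_lborel, folded H_def G_def K_def]
  have "process_dist P t h k = (\<integral>\<^sup>+\<omega>. (\<integral>\<^sup>+s. sqn (H s \<omega> - K s \<omega>) \<partial>lborel) \<partial>P)"
    unfolding process_dist_eq H_def K_def ..
  also have "\<dots> \<le> (\<integral>\<^sup>+\<omega>. (\<integral>\<^sup>+s. 2 * (sqn (H s \<omega> - G s \<omega>) + sqn (G s \<omega> - K s \<omega>)) \<partial>lborel) \<partial>P)"
    by (intro nn_integral_mono sqn_triangle)
  also have "\<dots> = (\<integral>\<^sup>+\<omega>. 2 * ((\<integral>\<^sup>+s. sqn (H s \<omega> - G s \<omega>) \<partial>lborel) + (\<integral>\<^sup>+s. sqn (G s \<omega> - K s \<omega>) \<partial>lborel)) \<partial>P)"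
    by (intro nn_integral_cong) (subst nn_integral_cmult, measurable, subst nn_integral_add, measurable)
  also have "\<dots> = 2 * (process_dist P t h g + process_dist P t g k)"
    unfolding process_dist_eq[of P t h g] process_dist_eq[of P t g k] H_def[symmetric] G_def[symmetric] K_def[symmetric]
    by (subst nn_integral_cmult, measurable, subst nn_integral_add, measurable)
  finally show ?thesis .
qed

lemma process_dist_mono: "s \<le> t \<Longrightarrow> process_dist P s h g \<le> process_dist P t h g"
  unfolding process_dist_def by (intro nn_integral_mono) (auto simp: indicator_def)

lemma jointly_measurable_mono:
  assumes "jointly_measurable P t h" "s \<le> t" shows "jointly_measurable P s h"
proof -
  have [measurable]: "(\<lambda>(s, \<omega>). indicator {0..t} s *\<^sub>R h s \<omega>) \<in> borel_measurable (borel \<Otimes>\<^sub>M P)"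
    using assms(1) by (simp add: jointly_measurable_def)
  have "(\<lambda>(r, \<omega>). indicator {0..s} r *\<^sub>R (indicator {0..t} r *\<^sub>R h r \<omega>)) \<in> borel_measurable (borel \<Otimes>\<^sub>M P)"
    by measurable
  also have "(\<lambda>(r, \<omega>). indicator {0..s} r *\<^sub>R (indicator {0..t} r *\<^sub>R h r \<omega>)) = (\<lambda>(r, \<omega>). indicator {0..s} r *\<^sub>R h r \<omega>)"
    using assms(2) by (auto simp: indicator_def)
  finally show ?thesis by (simp add: jointly_measurable_def)
qed

context complete_filtration
begin

lemma jointly_measurable_iff:
  "jointly_measurable P t h \<longleftrightarrow> (\<lambda>(s, \<omega>). h s \<omega>) \<in> borel_measurable (restrict_space borel {0..t} \<Otimes>\<^sub>M P)"
  unfolding jointly_measurable_def by (subst restrict_pair_measurable_iff) auto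

lemma L2_process_iff:
  "h \<in> L2_process P F 0 t \<longleftrightarrow> jointly_measurable P t h \<and> (\<forall>s\<in>{0..t}. h s \<in> borel_measurable (F s)) \<and>
    process_dist P t h (\<lambda>_ _. 0) < \<infinity>"
  unfolding L2_process_def adapted_process_def process_dist_zero jointly_measurable_iff by auto

lemma L2_process_mono: "h \<in> L2_process P F 0 t \<Longrightarrow> s \<le> t \<Longrightarrow> h \<in> L2_process P F 0 s"
  unfolding L2_process_iff
  using jointly_measurable_mono[of P t h s] process_dist_mono[of s t P h "\<lambda>_ _. 0"]
  by (auto intro: order_le_less_trans)

lemma simple_value_jointly_measurable:
  assumes "simple_integrand P F T N \<tau> \<xi>"
  shows "jointly_measurable P t (simple_value N \<tau> \<xi>)"
proof -
  have [measurable]: "\<xi> i \<in> borel_measurable P" if "i \<in> {..<N}" for i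
    using assms that by (intro L2_rvD(2)[of _ "\<tau> i"]) (auto simp: simple_integrand_def)
  show ?thesis unfolding jointly_measurable_def simple_value_def by measurable
qed

end

context brownian_filtration
begin

lemma stopped_integral_end:
  assumes "simple_integrand P F T N \<tau> \<xi>"
  shows "stopped_integral N \<tau> \<xi> T \<omega> = simple_ito_integral W N \<tau> \<xi> \<omega>"
  unfolding stopped_integral_def simple_ito_integral_elementary
proof (rule sum.cong)
  fix i assume "i \<in> {..<N}"
  then have "\<tau> i \<le> \<tau> (Suc i)" "\<tau> (Suc i) \<le> T" using assms by (auto simp: simple_integrand_def)
  then show "elementary (\<xi> i) (min (\<tau> i) T) (min (\<tau> (Suc i)) T) \<omega> = elementary (\<xi> i) (\<tau> i) (\<tau> (Suc i)) \<omega>"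
    by (simp add: min_def)
qed simp

lemma simple_ito_L2:
  assumes "simple_integrand P F t N \<tau> \<xi>" "0 \<le> t"
  shows "simple_ito_integral W N \<tau> \<xi> \<in> L2_rv P (F t)"
  using stopped_integral_L2[OF assms] unfolding stopped_integral_end[OF assms(1), abs_def] .

lemma has_ito_integral_zero:
  assumes "0 \<le> t" shows "has_ito_integral P F W t (\<lambda>_ _. 0 :: real ^ 'd ^ 'n) (\<lambda>_. 0)"
proof -
  have "simple_integrand P F t 0 (\<lambda>_. 0) (\<lambda>_ _. 0 :: real ^ 'd ^ 'n)" by (simp add: simple_integrand_def)
  moreover have "(\<lambda>_ _. 0 :: real ^ 'd ^ 'n) \<in> L2_process P F 0 t"
    unfolding L2_process_iff by (auto simp: jointly_measurable_def process_dist_def)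
  ultimately show ?thesis
    unfolding has_ito_integral_def
    by (auto intro!: exI[of _ "\<lambda>_. 0::nat"] exI[of _ "\<lambda>_ _. 0"] exI[of _ "\<lambda>_ _ _. 0"]
      simp: simple_value_def simple_ito_integral_def)
qed

text \<open>Both integrals are limits of simple ones, for which the isometry holds. Passing to the limit with
  squared distances costs a factor \<open>3\<close> for the integrals and \<open>2 * 2\<close> for the integrands; the
  resulting constant \<open>12\<close> instead of \<open>1\<close> is good enough to determine the integral up to null
  sets and to make it Lipschitz in the integrand.\<close>

lemma has_ito_integral_dist:
  fixes h g :: "real \<Rightarrow> 'w \<Rightarrow> real ^ 'd ^ 'n"
  assumes t: "0 \<le> t" and I: "has_ito_integral P F W t h I" and J: "has_ito_integral P F W t g J"
  shows "(\<integral>\<^sup>+\<omega>. sqn (I \<omega> - J \<omega>) \<partial>P) \<le> 12 * process_dist P t h g"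
proof -
  obtain N \<tau> \<xi> where 1: "\<And>k::nat. simple_integrand P F t (N k) (\<tau> k) (\<xi> k)"
    "(\<lambda>k. process_dist P t h (simple_value (N k) (\<tau> k) (\<xi> k))) \<longlonglongrightarrow> 0"
    "(\<lambda>k. \<integral>\<^sup>+\<omega>. sqn (I \<omega> - simple_ito_integral W (N k) (\<tau> k) (\<xi> k) \<omega>) \<partial>P) \<longlonglongrightarrow> 0"
    using I unfolding has_ito_integral_def process_dist_def[symmetric] by blast
  obtain M \<rho> \<eta> where 2: "\<And>k::nat. simple_integrand P F t (M k) (\<rho> k) (\<eta> k)"
    "(\<lambda>k. process_dist P t g (simple_value (M k) (\<rho> k) (\<eta> k))) \<longlonglongrightarrow> 0"
    "(\<lambda>k. \<integral>\<^sup>+\<omega>. sqn (J \<omega> - simple_ito_integral W (M k) (\<rho> k) (\<eta> k) \<omega>) \<partial>P) \<longlonglongrightarrow> 0"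
    using J unfolding has_ito_integral_def process_dist_def[symmetric] by blast
  let ?V = "\<lambda>k. simple_value (N k) (\<tau> k) (\<xi> k)" and ?U = "\<lambda>k. simple_value (M k) (\<rho> k) (\<eta> k)"
  let ?S = "\<lambda>k. simple_ito_integral W (N k) (\<tau> k) (\<xi> k)" and ?R = "\<lambda>k. simple_ito_integral W (M k) (\<rho> k) (\<eta> k)"
  have [measurable]: "I \<in> borel_measurable P" "J \<in> borel_measurable P"
    using I J L2_rvD(2)[OF _ t] by (auto simp: has_ito_integral_def)
  have [measurable]: "?S k \<in> borel_measurable P" "?R k \<in> borel_measurable P" for k
    by (rule L2_rvD(2)[OF simple_ito_L2[OF 1(1) t] t], rule L2_rvD(2)[OF simple_ito_L2[OF 2(1) t] t])
  have jm: "jointly_measurable P t h" "jointly_measurable P t g"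
    "jointly_measurable P t (?V k)" "jointly_measurable P t (?U k)" for k
    using I J simple_value_jointly_measurable[OF 1(1)] simple_value_jointly_measurable[OF 2(1)]
    by (auto simp: has_ito_integral_def L2_process_iff)
  let ?d = "process_dist P t h g"
  define X where "X k = (\<integral>\<^sup>+\<omega>. sqn (I \<omega> - ?S k \<omega>) \<partial>P)" for k
  define Y where "Y k = (\<integral>\<^sup>+\<omega>. sqn (J \<omega> - ?R k \<omega>) \<partial>P)" for k
  define A where "A k = process_dist P t h (?V k)" for k
  define B where "B k = process_dist P t g (?U k)" for k
  have le: "(\<integral>\<^sup>+\<omega>. sqn (I \<omega> - J \<omega>) \<partial>P) \<le> 3 * (X k + 2 * (A k + 2 * (?d + B k)) + Y k)" for k
  proof -
    have "process_dist P t (?V k) (?U k) \<le> 2 * (A k + process_dist P t h (?U k))"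
      unfolding A_def by (subst process_dist_commute[of P t h "?V k"])
        (rule process_dist_triangle[OF prob_space_axioms jm(3,1,4)])
    also have "\<dots> \<le> 2 * (A k + 2 * (?d + B k))"
      unfolding B_def
      by (intro mult_left_mono add_left_mono process_dist_triangle[OF prob_space_axioms jm(1,2,4)]) simp
    finally have VU: "process_dist P t (?V k) (?U k) \<le> 2 * (A k + 2 * (?d + B k))" .
    have "(\<integral>\<^sup>+\<omega>. sqn (I \<omega> - J \<omega>) \<partial>P) \<le>
        (\<integral>\<^sup>+\<omega>. 3 * (sqn (I \<omega> - ?S k \<omega>) + sqn (?S k \<omega> - ?R k \<omega>) + sqn (?R k \<omega> - J \<omega>)) \<partial>P)"
      by (intro nn_integral_mono sqn_triangle3)
    also have "\<dots> = 3 * (X k + (\<integral>\<^sup>+\<omega>. sqn (?S k \<omega> - ?R k \<omega>) \<partial>P) + Y k)"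
      by (simp add: nn_integral_cmult nn_integral_add X_def Y_def norm_minus_commute)
    also have "(\<integral>\<^sup>+\<omega>. sqn (?S k \<omega> - ?R k \<omega>) \<partial>P) = process_dist P t (?V k) (?U k)"
      unfolding process_dist_def by (rule simple_ito_isometry[OF 1(1) 2(1)])
    also have "3 * (X k + process_dist P t (?V k) (?U k) + Y k) \<le> 3 * (X k + 2 * (A k + 2 * (?d + B k)) + Y k)"
      by (intro mult_left_mono add_mono VU) auto
    finally show ?thesis .
  qed
  have "(\<lambda>k. 3 * (X k + 2 * (A k + 2 * (?d + B k)) + Y k)) \<longlonglongrightarrow> 3 * (0 + 2 * (0 + 2 * (?d + 0)) + 0)"
    using 1(2,3) 2(2,3) unfolding X_def[symmetric] Y_def[symmetric] A_def[symmetric] B_def[symmetric]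
    by (intro ennreal_tendsto_cmult tendsto_add tendsto_const) auto
  from LIMSEQ_le_const[OF this] le have "(\<integral>\<^sup>+\<omega>. sqn (I \<omega> - J \<omega>) \<partial>P) \<le> 3 * (0 + 2 * (0 + 2 * (?d + 0)) + 0)"
    by blast
  then show ?thesis by (simp add: mult.assoc[symmetric])
qed

text \<open>Simple processes \<open>V k\<close> are chosen that approximate \<open>h\<close> with squared error \<open>8\<^sup>-\<^sup>k\<close>. By the
  isometry and the maximal inequality their integrals \<open>S k\<close> differ from the next ones by more than
  \<open>2\<^sup>-\<^sup>k\<close> somewhere on \<open>[0, T]\<close> with probability at most \<open>4 * 4\<^sup>k / 8\<^sup>k = 4 / 2\<^sup>k\<close>. This is
  summable, so by the Borel-Cantelli lemma the paths converge uniformly, to a continuous limit. Cutting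
  off the approximating processes at \<open>t\<close> shows that the limit at time \<open>t\<close> is the integral over
  \<open>[0, t]\<close>.\<close>

theorem ito_integral_exists:
  fixes h :: "real \<Rightarrow> 'w \<Rightarrow> real ^ 'd ^ 'n"
  assumes T: "0 < T" and h: "h \<in> L2_process P F 0 T"
  obtains I where "\<And>\<omega>. \<omega> \<in> space P \<Longrightarrow> continuous_on {0..T} (\<lambda>t. I t \<omega>)"
    and "\<And>t. t \<in> {0..T} \<Longrightarrow> has_ito_integral P F W t h (I t)"
proof -
  obtain \<xi>0 where \<xi>0: "\<And>n. simple_integrand P F T (Suc n) (\<lambda>i. real i * T / real (Suc n)) (\<xi>0 n)"
    "(\<lambda>n. process_dist P T h (simple_value (Suc n) (\<lambda>i. real i * T / real (Suc n)) (\<xi>0 n))) \<longlonglongrightarrow> 0"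
    using simple_processes_dense[OF T h] unfolding process_dist_def[symmetric] by blast
  have "\<exists>n. process_dist P T h (simple_value (Suc n) (\<lambda>i. real i * T / real (Suc n)) (\<xi>0 n)) < ennreal ((1 / 8) ^ k)" for k :: nat
  proof -
    have "eventually (\<lambda>n. process_dist P T h (simple_value (Suc n) (\<lambda>i. real i * T / real (Suc n)) (\<xi>0 n)) < ennreal ((1 / 8) ^ k)) sequentially"
      by (rule order_tendstoD(2)[OF \<xi>0(2)]) simp
    then show ?thesis by (auto simp: eventually_sequentially)
  qed
  then obtain r where r: "\<And>k. process_dist P T h (simple_value (Suc (r k)) (\<lambda>i. real i * T / real (Suc (r k))) (\<xi>0 (r k)))
      < ennreal ((1 / 8) ^ k)"
    by metis
  define N where "N k = Suc (r k)" for k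
  define \<tau> where "\<tau> k i = real i * T / real (Suc (r k))" for k i
  define \<xi> where "\<xi> k = \<xi>0 (r k)" for k
  define V where "V k = simple_value (N k) (\<tau> k) (\<xi> k)" for k
  define S where "S k = stopped_integral (N k) (\<tau> k) (\<xi> k)" for k
  have SI: "simple_integrand P F T (N k) (\<tau> k) (\<xi> k)" for k
    using \<xi>0(1)[of "r k"] unfolding N_def \<tau>_def[abs_def] \<xi>_def .
  have hV: "process_dist P T h (V k) \<le> ennreal ((1 / 8) ^ k)" for k
    using r[of k] unfolding V_def N_def \<tau>_def[abs_def] \<xi>_def by (rule less_imp_le)
  have jm: "jointly_measurable P T h" "jointly_measurable P T (V k)" for k
    using h simple_value_jointly_measurable[OF SI] by (auto simp: V_def L2_process_iff)
  have SL2: "S k t \<in> L2_rv P (F t)" if "0 \<le> t" for k t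
    unfolding S_def by (rule stopped_integral_L2[OF SI that])
  have VV: "process_dist P T (V m) (V k) \<le> ennreal (4 * (1 / 8) ^ k)" if "k \<le> m" for m k
  proof -
    have "process_dist P T (V m) (V k) \<le> 2 * (process_dist P T (V m) h + process_dist P T h (V k))"
      by (rule process_dist_triangle[OF prob_space_axioms jm(2,1,2)])
    also have "\<dots> \<le> 2 * (ennreal ((1 / 8) ^ k) + ennreal ((1 / 8) ^ k))"
    proof (intro mult_left_mono add_mono hV)
      have "process_dist P T (V m) h \<le> ennreal ((1 / 8) ^ m)"
        using hV[of m] by (simp only: process_dist_commute[of P T h])
      also have "\<dots> \<le> ennreal ((1 / 8) ^ k)" by (intro ennreal_leI power_decreasing that) auto
      finally show "process_dist P T (V m) h \<le> ennreal ((1 / 8) ^ k)" .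
    qed auto
    also have "\<dots> = ennreal (4 * (1 / 8) ^ k)"
      unfolding mult_2[symmetric] mult.assoc[symmetric] by (simp add: ennreal_mult)
    finally show ?thesis .
  qed
  have SS: "(\<integral>\<^sup>+\<omega>. sqn (S m t \<omega> - S k t \<omega>) \<partial>P) \<le> ennreal (4 * (1 / 8) ^ k)" if "k \<le> m" "t \<in> {0..T}" for m k t
  proof -
    have "(\<integral>\<^sup>+\<omega>. sqn (S m t \<omega> - S k t \<omega>) \<partial>P) = process_dist P t (V m) (V k)"
      unfolding S_def V_def process_dist_def
      by (rule stopped_integral_isometry[OF SI SI]) (use that in simp)
    also have "\<dots> \<le> process_dist P T (V m) (V k)" by (rule process_dist_mono) (use that in simp)
    also have "\<dots> \<le> ennreal (4 * (1 / 8) ^ k)" by (rule VV[OF that(1)])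
    finally show ?thesis .
  qed
  have Scont: "AE \<omega> in P. \<forall>k. continuous_on {0..T} (\<lambda>t. S k t \<omega>)"
    using W_continuous
  proof eventually_elim
    fix \<omega> assume "continuous_on {0..} (\<lambda>t. W t \<omega>)"
    then show "\<forall>k. continuous_on {0..T} (\<lambda>t. S k t \<omega>)"
      unfolding S_def by (intro allI stopped_integral_continuous[OF _ SI])
  qed
  have "\<exists>E. E \<in> sets P \<and> ennreal (((1 / 2) ^ k)\<^sup>2) * emeasure P E \<le> ennreal (4 * (1 / 8) ^ k) \<and>
      (AE \<omega> in P. \<omega> \<notin> E \<longrightarrow> (\<forall>t\<in>{0..T}. norm (S (Suc k) t \<omega> - S k t \<omega>) \<le> (1 / 2) ^ k))" for k
  proof -
    let ?X = "\<lambda>t \<omega>. S (Suc k) t \<omega> - S k t \<omega>"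
    have X: "?X t \<in> L2_rv P (F t)" if "t \<in> {0..T}" for t
      using that by (intro L2_rv_diff SL2) auto
    have orth: "expectation (\<lambda>\<omega>. (?X T \<omega> - ?X t \<omega>) \<bullet> Y \<omega>) = 0" if t: "t \<in> {0..T}" and Y: "Y \<in> L2_rv P (F t)" for t Y
    proof -
      have t0: "0 \<le> t" "t \<le> T" "0 \<le> T" using t T by auto
      have i: "integrable P (\<lambda>\<omega>. (S j T \<omega> - S j t \<omega>) \<bullet> Y \<omega>)" for j
        by (rule L2_rv_integrable_inner[OF L2_rv_diff[OF SL2[OF t0(3)] L2_rv_mono[OF SL2[OF t0(1)] t0(1,2)] t0(3)] Y t0(3,1)])
      have e: "expectation (\<lambda>\<omega>. (S j T \<omega> - S j t \<omega>) \<bullet> Y \<omega>) = 0" for j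
        unfolding S_def by (rule stopped_integral_martingale[OF SI t0(1,2) Y])
      have "expectation (\<lambda>\<omega>. (?X T \<omega> - ?X t \<omega>) \<bullet> Y \<omega>) =
          expectation (\<lambda>\<omega>. (S (Suc k) T \<omega> - S (Suc k) t \<omega>) \<bullet> Y \<omega> - (S k T \<omega> - S k t \<omega>) \<bullet> Y \<omega>)"
        by (rule Bochner_Integration.integral_cong) (auto simp: inner_diff_left)
      also have "\<dots> = 0" using i e by simp
      finally show ?thesis .
    qed
    have c: "AE \<omega> in P. continuous_on {0..T} (\<lambda>t. ?X t \<omega>)"
      using Scont by eventually_elim (auto intro: continuous_on_diff)
    obtain E where "E \<in> sets P" "ennreal (((1 / 2) ^ k)\<^sup>2) * emeasure P E \<le> (\<integral>\<^sup>+\<omega>. sqn (?X T \<omega>) \<partial>P)"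
      "AE \<omega> in P. \<omega> \<notin> E \<longrightarrow> (\<forall>t\<in>{0..T}. norm (?X t \<omega>) \<le> (1 / 2) ^ k)"
      by (rule maximal_inequality[OF T X orth c, of "(1 / 2) ^ k"]) auto
    moreover have "(\<integral>\<^sup>+\<omega>. sqn (?X T \<omega>) \<partial>P) \<le> ennreal (4 * (1 / 8) ^ k)"
      by (rule SS) (use T in auto)
    ultimately show ?thesis by (blast intro: order_trans)
  qed
  then have "\<exists>E. \<forall>k. E k \<in> sets P \<and> ennreal (((1 / 2) ^ k)\<^sup>2) * emeasure P (E k) \<le> ennreal (4 * (1 / 8) ^ k) \<and>
      (AE \<omega> in P. \<omega> \<notin> E k \<longrightarrow> (\<forall>t\<in>{0..T}. norm (S (Suc k) t \<omega> - S k t \<omega>) \<le> (1 / 2) ^ k))"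
    by (intro choice allI)
  then obtain E where E: "\<And>k. E k \<in> sets P" "\<And>k. ennreal (((1 / 2) ^ k)\<^sup>2) * emeasure P (E k) \<le> ennreal (4 * (1 / 8) ^ k)"
    "\<And>k. AE \<omega> in P. \<omega> \<notin> E k \<longrightarrow> (\<forall>t\<in>{0..T}. norm (S (Suc k) t \<omega> - S k t \<omega>) \<le> (1 / 2) ^ k)"
    by blast
  have pb: "prob (E k) \<le> 4 * (1 / 2) ^ k" for k
  proof -
    have "((1 / 2) ^ k)\<^sup>2 * prob (E k) \<le> 4 * (1 / 8) ^ k"
      using E(2)[of k] by (simp add: emeasure_eq_measure ennreal_mult[symmetric])
    moreover have "((1 / 2 :: real) ^ k)\<^sup>2 = (1 / 4) ^ k" "(1 / 8 :: real) ^ k = (1 / 4) ^ k * (1 / 2) ^ k"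
      by (simp_all add: power_mult[symmetric] power_mult_distrib[symmetric] power2_eq_square)
    ultimately have "(1 / 4) ^ k * prob (E k) \<le> (1 / 4) ^ k * (4 * (1 / 2) ^ k)" by simp
    then show ?thesis by (subst (asm) mult_le_cancel_left_pos) auto
  qed
  have "summable (\<lambda>k. 4 * (1 / 2) ^ k :: real)"
    by (intro summable_mult summable_geometric) simp
  then have "summable (\<lambda>k. prob (E k))"
    by (rule summable_comparison_test') (simp add: pb)
  then have bc: "AE \<omega> in P. eventually (\<lambda>k. \<omega> \<in> space P - E k) sequentially"
    by (intro borel_cantelli_AE1 E(1)) (auto simp: emeasure_eq_measure)
  have E3: "AE \<omega> in P. \<forall>k. \<omega> \<notin> E k \<longrightarrow> (\<forall>t\<in>{0..T}. norm (S (Suc k) t \<omega> - S k t \<omega>) \<le> (1 / 2) ^ k)"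
    using E(3) by (simp add: AE_all_countable)
  have good: "AE \<omega> in P. continuous_on {0..T} (\<lambda>t. lim (\<lambda>k. S k t \<omega>)) \<and>
      (\<forall>t\<in>{0..T}. (\<lambda>k. S k t \<omega>) \<longlonglongrightarrow> lim (\<lambda>k. S k t \<omega>))"
    using bc E3 Scont
  proof eventually_elim
    fix \<omega> assume 1: "eventually (\<lambda>k. \<omega> \<in> space P - E k) sequentially"
      and 2: "\<forall>k. \<omega> \<notin> E k \<longrightarrow> (\<forall>t\<in>{0..T}. norm (S (Suc k) t \<omega> - S k t \<omega>) \<le> (1 / 2) ^ k)"
      and 3: "\<forall>k. continuous_on {0..T} (\<lambda>t. S k t \<omega>)"
    obtain K where K: "\<And>k. K \<le> k \<Longrightarrow> \<omega> \<notin> E k" using 1 by (auto simp: eventually_sequentially)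
    define f where "f k t = S (Suc (K + k)) t \<omega> - S (K + k) t \<omega>" for k t
    have "uniform_limit {0..T} (\<lambda>n t. \<Sum>i<n. f i t) (\<lambda>t. suminf (\<lambda>i. f i t)) sequentially"
    proof (rule Weierstrass_m_test)
      show "norm (f k t) \<le> (1 / 2) ^ (K + k)" if "t \<in> {0..T}" for k t
        using 2 K[of "K + k"] that by (simp add: f_def)
      show "summable (\<lambda>k. (1 / 2) ^ (K + k) :: real)"
        unfolding power_add by (intro summable_mult summable_geometric) simp
    qed
    moreover have "(\<Sum>i<n. f i t) = S (K + n) t \<omega> - S K t \<omega>" for n t
      unfolding f_def using sum_lessThan_telescope[of "\<lambda>i. S (K + i) t \<omega>" n] by simp
    ultimately have u: "uniform_limit {0..T} (\<lambda>n t. S (K + n) t \<omega> - S K t \<omega>) (\<lambda>t. suminf (\<lambda>i. f i t)) sequentially"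
      by simp
    have "continuous_on {0..T} (\<lambda>t. suminf (\<lambda>i. f i t))"
    proof (rule uniform_limit_theorem[OF always_eventually u])
      show "\<forall>n. continuous_on {0..T} (\<lambda>t. S (K + n) t \<omega> - S K t \<omega>)"
        using 3 by (intro allI continuous_on_diff) auto
    qed simp
    then have c: "continuous_on {0..T} (\<lambda>t. S K t \<omega> + suminf (\<lambda>i. f i t))"
      using 3 by (intro continuous_on_add) auto
    have l: "(\<lambda>k. S k t \<omega>) \<longlonglongrightarrow> S K t \<omega> + suminf (\<lambda>i. f i t)" if "t \<in> {0..T}" for t
    proof -
      have "(\<lambda>n. S (K + n) t \<omega> - S K t \<omega>) \<longlonglongrightarrow> suminf (\<lambda>i. f i t)"
        by (rule tendsto_uniform_limitI[OF u that])
      from tendsto_add[OF tendsto_const[of "S K t \<omega>"] this]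
      have "(\<lambda>n. S (n + K) t \<omega>) \<longlonglongrightarrow> S K t \<omega> + suminf (\<lambda>i. f i t)" by (simp add: add.commute)
      then show ?thesis by (rule LIMSEQ_offset)
    qed
    have eq: "S K t \<omega> + suminf (\<lambda>i. f i t) = lim (\<lambda>k. S k t \<omega>)" if "t \<in> {0..T}" for t
      by (rule limI[OF l[OF that], symmetric])
    have "continuous_on {0..T} (\<lambda>t. lim (\<lambda>k. S k t \<omega>))"
      by (rule continuous_on_eq[OF c eq])
    moreover have "(\<lambda>k. S k t \<omega>) \<longlonglongrightarrow> lim (\<lambda>k. S k t \<omega>)" if "t \<in> {0..T}" for t
      using l[OF that] unfolding eq[OF that] .
    ultimately show "continuous_on {0..T} (\<lambda>t. lim (\<lambda>k. S k t \<omega>)) \<and>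
      (\<forall>t\<in>{0..T}. (\<lambda>k. S k t \<omega>) \<longlonglongrightarrow> lim (\<lambda>k. S k t \<omega>))"
      by blast
  qed
  obtain Z where Z0: "\<And>\<omega>. \<omega> \<in> space P - Z \<Longrightarrow> continuous_on {0..T} (\<lambda>t. lim (\<lambda>k. S k t \<omega>)) \<and>
      (\<forall>t\<in>{0..T}. (\<lambda>k. S k t \<omega>) \<longlonglongrightarrow> lim (\<lambda>k. S k t \<omega>))" and Z1: "Z \<in> null_sets P"
    by (rule AE_E3[OF good]) (rule that; assumption)
  have Zc: "continuous_on {0..T} (\<lambda>t. lim (\<lambda>k. S k t \<omega>))" if "\<omega> \<in> space P" "\<omega> \<notin> Z" for \<omega>
    using Z0[of \<omega>] that by simp
  have Zl: "(\<lambda>k. S k t \<omega>) \<longlonglongrightarrow> lim (\<lambda>k. S k t \<omega>)" if "\<omega> \<in> space P" "\<omega> \<notin> Z" "t \<in> {0..T}" for \<omega> t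
    using Z0[of \<omega>] that by simp
  \<comment> \<open>The value on the exceptional null set makes every path continuous.\<close>
  define I where "I t \<omega> = (if \<omega> \<in> Z then 0 else lim (\<lambda>k. S k t \<omega>))" for t \<omega>
  have Ilim: "AE \<omega> in P. (\<lambda>k. S k t \<omega>) \<longlonglongrightarrow> I t \<omega>" if "t \<in> {0..T}" for t
    using AE_not_in[OF Z1] AE_space by eventually_elim (use Zl[OF _ _ that] in \<open>simp add: I_def\<close>)
  show thesis
  proof (rule that[of I])
    fix \<omega> assume "\<omega> \<in> space P"
    then show "continuous_on {0..T} (\<lambda>t. I t \<omega>)"
      by (cases "\<omega> \<in> Z") (simp_all add: I_def Zc)
  next
    fix t assume t: "t \<in> {0..T}"
    then have t0: "0 \<le> t" by simp
    have Sm[measurable]: "S k t \<in> borel_measurable P" for k by (rule L2_rvD(2)[OF SL2[OF t0] t0])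
    have IF: "I t \<in> borel_measurable (F t)"
      by (rule measurable_F_AE_lim[OF t0 L2_rvD(1)[OF SL2[OF t0] t0] Ilim[OF t]])
    have [measurable]: "I t \<in> borel_measurable P" by (rule measurable_F_P[OF t0 IF])
    have IS: "(\<integral>\<^sup>+\<omega>. sqn (I t \<omega> - S k t \<omega>) \<partial>P) \<le> ennreal (4 * (1 / 8) ^ k)" for k
      by (rule L2_Fatou[OF Sm Sm Ilim[OF t] SS[OF _ t]])
    have IL2: "I t \<in> L2_rv P (F t)"
    proof -
      have "(\<integral>\<^sup>+\<omega>. sqn (I t \<omega>) \<partial>P) \<le> 2 * ((\<integral>\<^sup>+\<omega>. sqn (I t \<omega> - S 0 t \<omega>) \<partial>P) + (\<integral>\<^sup>+\<omega>. sqn (S 0 t \<omega>) \<partial>P))"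
        using L2_dist_triangle[of "I t" P "S 0 t" "\<lambda>_. 0"] by simp
      also have "\<dots> < \<infinity>"
        using order_le_less_trans[OF IS[of 0]] L2_rvD(3)[OF SL2[OF t0] t0, of 0] by (simp add: ennreal_mult_less_top)
      finally show ?thesis using IF unfolding L2_rv_iff[OF t0] by blast
    qed
    have lim8: "(\<lambda>k. ennreal (c * (1 / 8) ^ k)) \<longlonglongrightarrow> 0" for c :: real
    proof -
      have "(\<lambda>k. ennreal (c * (1 / 8) ^ k)) \<longlonglongrightarrow> ennreal (c * 0)"
        by (intro tendsto_intros LIMSEQ_realpow_zero) auto
      then show ?thesis by simp
    qed
    show "has_ito_integral P F W t h (I t)"
      unfolding has_ito_integral_def process_dist_def[symmetric]
    proof (intro conjI exI allI)
      show "h \<in> L2_process P F 0 t" by (rule L2_process_mono[OF h]) (use t in simp)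
      show "simple_integrand P F t (N k) (\<lambda>i. min (\<tau> k i) t) (started_value (\<tau> k) (\<xi> k) t)" for k
        by (rule simple_integrand_stopped[OF SI t0])
      have eq: "process_dist P t h (simple_value (N k) (\<lambda>i. min (\<tau> k i) t) (started_value (\<tau> k) (\<xi> k) t)) =
          process_dist P t h (V k)" for k
        unfolding process_dist_def V_def
        by (intro nn_integral_cong) (auto simp: indicator_def simple_value_stopped)
      show "(\<lambda>k. process_dist P t h (simple_value (N k) (\<lambda>i. min (\<tau> k i) t) (started_value (\<tau> k) (\<xi> k) t))) \<longlonglongrightarrow> 0"
        unfolding eq
      proof (rule tendsto_sandwich[OF _ _ tendsto_const])
        show "\<forall>\<^sub>F k in sequentially. process_dist P t h (V k) \<le> ennreal (1 * (1 / 8) ^ k)"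
          using order_trans[OF process_dist_mono[of t T] hV] t by (auto intro!: always_eventually)
      qed (use lim8[of 1] in auto)
      have S: "simple_ito_integral W (N k) (\<lambda>i. min (\<tau> k i) t) (started_value (\<tau> k) (\<xi> k) t) = S k t" for k
        unfolding S_def stopped_integral_eq[OF SI, abs_def] ..
      show "(\<lambda>k. \<integral>\<^sup>+\<omega>. sqn (I t \<omega> - simple_ito_integral W (N k) (\<lambda>i. min (\<tau> k i) t) (started_value (\<tau> k) (\<xi> k) t) \<omega>) \<partial>P) \<longlonglongrightarrow> 0"
        unfolding S
        by (rule tendsto_sandwich[OF _ _ tendsto_const lim8[of 4]]) (use IS in auto)
    qed (rule IL2)
  qed
qed

end

section \<open>The advanced term\<close>

text \<open>Jensen's inequality.\<close>

lemma real_cond_exp_L2_contraction: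
  assumes P: "prob_space P" and G: "subalgebra P G" and Y: "Y \<in> borel_measurable P"
    and Y2: "integrable P (\<lambda>\<omega>. (Y \<omega>)\<^sup>2)"
  shows "(\<integral>\<^sup>+\<omega>. sqn (real_cond_exp P G Y \<omega>) \<partial>P) \<le> (\<integral>\<^sup>+\<omega>. sqn (Y \<omega>) \<partial>P)"
proof -
  interpret prob_space P by fact
  interpret fs: finite_measure_subalgebra P G by standard fact
  have [measurable]: "Y \<in> borel_measurable P" by fact
  have Y1: "integrable P Y" by (rule square_integrable_imp_integrable[OF Y Y2])
  have "AE \<omega> in P. (real_cond_exp P G Y \<omega>)\<^sup>2 \<le> real_cond_exp P G (\<lambda>\<omega>. (Y \<omega>)\<^sup>2) \<omega>"
    by (rule fs.real_cond_exp_jensens_inequality(2)[OF Y1 _ _ Y2]) (auto intro: convex_on_realI convex_power2)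
  then have "(\<integral>\<^sup>+\<omega>. sqn (real_cond_exp P G Y \<omega>) \<partial>P) \<le> (\<integral>\<^sup>+\<omega>. ennreal (real_cond_exp P G (\<lambda>\<omega>. (Y \<omega>)\<^sup>2) \<omega>) \<partial>P)"
    by (intro nn_integral_mono_AE) (auto intro: ennreal_leI)
  also have "\<dots> = ennreal (expectation (real_cond_exp P G (\<lambda>\<omega>. (Y \<omega>)\<^sup>2)))"
    by (intro nn_integral_eq_integral fs.real_cond_exp_int(1)[OF Y2] fs.real_cond_exp_pos) auto
  also have "\<dots> = ennreal (expectation (\<lambda>\<omega>. (Y \<omega>)\<^sup>2))"
    by (simp add: fs.real_cond_exp_int(2)[OF Y2])
  also have "\<dots> = (\<integral>\<^sup>+\<omega>. sqn (Y \<omega>) \<partial>P)"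
    by (subst nn_integral_eq_integral[OF Y2, symmetric]) auto
  finally show ?thesis .
qed

lemma process_dist_Fubini:
  assumes P: "prob_space P" and m: "jointly_measurable P t h" "jointly_measurable P t g"
  shows "process_dist P t h g = (\<integral>\<^sup>+s\<in>{0..t}. (\<integral>\<^sup>+\<omega>. sqn (h s \<omega> - g s \<omega>) \<partial>P) \<partial>lborel)"
proof -
  interpret prob_space P by fact
  interpret pair_sigma_finite lborel P ..
  define H where "H s \<omega> = indicator {0..t} s *\<^sub>R h s \<omega>" for s \<omega>
  define G where "G s \<omega> = indicator {0..t} s *\<^sub>R g s \<omega>" for s \<omega>
  note [measurable] = m[THEN jointly_measurable_lborel, folded H_def G_def]
  have "process_dist P t h g = (\<integral>\<^sup>+\<omega>. (\<integral>\<^sup>+s. sqn (H s \<omega> - G s \<omega>) \<partial>lborel) \<partial>P)"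
    unfolding process_dist_eq H_def G_def ..
  also have "\<dots> = (\<integral>\<^sup>+s. (\<integral>\<^sup>+\<omega>. sqn (H s \<omega> - G s \<omega>) \<partial>P) \<partial>lborel)"
    by (rule Fubini') measurable
  also have "\<dots> = (\<integral>\<^sup>+s\<in>{0..t}. (\<integral>\<^sup>+\<omega>. sqn (h s \<omega> - g s \<omega>) \<partial>P) \<partial>lborel)"
    by (intro nn_integral_cong) (auto simp: H_def G_def indicator_def)
  finally show ?thesis .
qed

lemma process_dist_finite:
  fixes h :: "real \<Rightarrow> 'w \<Rightarrow> 'a::euclidean_space"
  assumes P: "prob_space P" and m: "jointly_measurable P t h"
    and B: "B < \<infinity>" "\<And>s. s \<in> {0..t} \<Longrightarrow> (\<integral>\<^sup>+\<omega>. sqn (h s \<omega>) \<partial>P) \<le> B"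
  shows "process_dist P t h (\<lambda>_ _. 0) < \<infinity>"
proof -
  have "process_dist P t h (\<lambda>_ _. 0) = (\<integral>\<^sup>+s\<in>{0..t}. (\<integral>\<^sup>+\<omega>. sqn (h s \<omega>) \<partial>P) \<partial>lborel)"
    by (subst process_dist_Fubini[OF P m]) (simp_all add: jointly_measurable_def)
  also have "\<dots> \<le> (\<integral>\<^sup>+s. B * indicator {0..t} s \<partial>lborel)"
    using B(2) by (intro nn_integral_mono) (auto simp: indicator_def)
  also have "\<dots> < \<infinity>"
    using B(1) by (simp add: nn_integral_cmult_indicator ennreal_mult_less_top emeasure_lborel_Icc_eq)
  finally show ?thesis .
qed

locale advanced_setting = brownian_filtration P F W
  for P :: "'w measure" and F :: "real \<Rightarrow> 'w measure" and W :: "real \<Rightarrow> 'w \<Rightarrow> real ^ 'd" +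
  fixes T \<delta> M :: real and \<alpha> :: "real measure" and \<phi> :: "real \<Rightarrow> real \<Rightarrow> 'w \<Rightarrow> real"
  assumes T_pos: "0 < T" and \<delta>_pos: "0 < \<delta>" and M_pos: "0 < M"
    and sets_\<alpha>: "sets \<alpha> = sets borel" and \<alpha>_sigma_finite: "sigma_finite_measure \<alpha>"
    and \<alpha>_finite: "emeasure \<alpha> {0..T + \<delta>} < \<infinity>"
    and kernel: "bounded_kernel P F T \<delta> M \<phi>"
begin

sublocale \<alpha>: sigma_finite_measure \<alpha> by (rule \<alpha>_sigma_finite)

text \<open>Membership in \<open>L\<^sup>2\<close> controls a process at Lebesgue-almost every time only, whereas \<open>\<alpha>\<close> may
  have atoms. So the second moments are required to be bounded at every single time.\<close>

definition bounded_process :: "(real \<Rightarrow> 'w \<Rightarrow> 'a::euclidean_space) \<Rightarrow> bool" where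
  "bounded_process x \<longleftrightarrow> jointly_measurable P (T + \<delta>) x \<and> (\<forall>t\<in>{0..T + \<delta>}. x t \<in> borel_measurable (F t)) \<and>
    (\<exists>B<\<infinity>. \<forall>t\<in>{0..T + \<delta>}. (\<integral>\<^sup>+\<omega>. sqn (x t \<omega>) \<partial>P) \<le> B)"

lemma bounded_process_L2:
  assumes "bounded_process x" "t \<in> {0..T + \<delta>}" shows "x t \<in> L2_rv P (F t)"
proof -
  have t: "0 \<le> t" using assms(2) by simp
  show ?thesis using assms unfolding L2_rv_iff[OF t] bounded_process_def
    by (auto intro: order_le_less_trans)
qed

lemma bounded_process_zero: "bounded_process (\<lambda>_ _. 0)"
  unfolding bounded_process_def by (auto simp: jointly_measurable_def intro: exI[of _ 0])

lemma bounded_process_L2_process: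
  assumes "bounded_process x" shows "x \<in> L2_process P F 0 (T + \<delta>)"
proof -
  obtain B where B: "B < \<infinity>" "\<And>t. t \<in> {0..T + \<delta>} \<Longrightarrow> (\<integral>\<^sup>+\<omega>. sqn (x t \<omega>) \<partial>P) \<le> B"
    using assms unfolding bounded_process_def by blast
  have jm: "jointly_measurable P (T + \<delta>) x" using assms by (simp add: bounded_process_def)
  have "process_dist P (T + \<delta>) x (\<lambda>_ _. 0) < \<infinity>"
    by (rule process_dist_finite[OF prob_space_axioms jm B])
  then show ?thesis
    unfolding L2_process_iff using assms by (simp add: bounded_process_def)
qed

abbreviation Z :: "(real \<Rightarrow> 'w \<Rightarrow> real ^ 'n) \<Rightarrow> real \<Rightarrow> 'w \<Rightarrow> real ^ 'n" where
  "Z x \<equiv> advanced_term \<alpha> \<delta> \<phi> x"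

text \<open>Extended by \<open>0\<close> from the region where \<open>\<phi>\<close> is given to the whole plane.\<close>

definition kernel_ext :: "real \<Rightarrow> real \<Rightarrow> 'w \<Rightarrow> real" where
  "kernel_ext t s \<omega> = indicator {(t, s). t \<in> {0..T} \<and> s \<in> {t..t + \<delta>}} (t, s) * \<phi> t s \<omega>"

definition process_ext :: "(real \<Rightarrow> 'w \<Rightarrow> 'a::euclidean_space) \<Rightarrow> real \<Rightarrow> 'w \<Rightarrow> 'a" where
  "process_ext x s \<omega> = indicator {0..T + \<delta>} s *\<^sub>R x s \<omega>"

lemma process_ext_measurable:
  "jointly_measurable P (T + \<delta>) x \<Longrightarrow> (\<lambda>(s, \<omega>). process_ext x s \<omega>) \<in> borel_measurable (borel \<Otimes>\<^sub>M P)"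
  unfolding jointly_measurable_def process_ext_def .

lemma kernel_ext_measurable:
  "(\<lambda>((t, s), \<omega>). kernel_ext t s \<omega>) \<in> borel_measurable ((borel \<Otimes>\<^sub>M borel) \<Otimes>\<^sub>M P)"
proof -
  let ?D = "{(t, s). t \<in> {0..T} \<and> s \<in> {t..t + \<delta>}}"
  have "closed {z. (0 \<le> fst z \<and> fst z \<le> T) \<and> (fst z \<le> snd z \<and> snd z \<le> fst z + \<delta>)}"
    by (intro closed_Collect_conj closed_Collect_le continuous_intros)
  moreover have "{z. (0 \<le> fst z \<and> fst z \<le> T) \<and> (fst z \<le> snd z \<and> snd z \<le> fst z + \<delta>)} = ?D" by auto
  ultimately have D: "?D \<in> sets borel" by simp
  have "(\<lambda>(z, \<omega>). (\<lambda>z \<omega>. \<phi> (fst z) (snd z) \<omega>) z \<omega>) \<in> borel_measurable (restrict_space borel ?D \<Otimes>\<^sub>M P)"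
    using kernel by (simp add: bounded_kernel_def case_prod_beta')
  from restrict_pair_measurable_iff[OF D, THEN iffD1, OF this]
  show ?thesis
    by (simp add: kernel_ext_def borel_prod case_prod_beta')
qed

lemma kernel_ext_section_measurable: "(\<lambda>(s, \<omega>). kernel_ext t s \<omega>) \<in> borel_measurable (borel \<Otimes>\<^sub>M P)"
proof -
  have "(\<lambda>(s, \<omega>). ((t, s), \<omega>)) \<in> borel \<Otimes>\<^sub>M P \<rightarrow>\<^sub>M (borel \<Otimes>\<^sub>M borel) \<Otimes>\<^sub>M P" by measurable
  from measurable_compose[OF this kernel_ext_measurable] show ?thesis by (simp add: case_prod_beta')
qed

lemma \<alpha>_pair_measurable: "f \<in> borel_measurable (borel \<Otimes>\<^sub>M P) \<Longrightarrow> f \<in> borel_measurable (\<alpha> \<Otimes>\<^sub>M P)"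
proof -
  have "sets (\<alpha> \<Otimes>\<^sub>M P) = sets (borel \<Otimes>\<^sub>M P)" by (intro sets_pair_measure_cong sets_\<alpha> refl)
  from measurable_cong_sets[OF this refl] show "f \<in> borel_measurable (borel \<Otimes>\<^sub>M P) \<Longrightarrow> ?thesis" by blast
qed

lemma advanced_term_eq:
  assumes "t \<in> {0..T}"
  shows "Z x t \<omega> = (\<integral>s. kernel_ext t s \<omega> *\<^sub>R process_ext x s \<omega> \<partial>\<alpha>)"
  unfolding advanced_term_def set_lebesgue_integral_def
  by (rule Bochner_Integration.integral_cong)
    (use assms in \<open>auto simp: kernel_ext_def process_ext_def indicator_def\<close>)

lemma kernel_ext_bound:
  assumes t: "t \<in> {0..T}" shows "AE \<omega> in P. \<bar>kernel_ext t s \<omega>\<bar> \<le> M * indicator {t..t + \<delta>} s"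
proof (cases "s \<in> {t..t + \<delta>}")
  case True
  then have "AE \<omega> in P. \<bar>\<phi> t s \<omega>\<bar> \<le> M" using kernel t unfolding bounded_kernel_def by blast
  then show ?thesis by eventually_elim (use True t in \<open>simp add: kernel_ext_def\<close>)
qed (simp add: kernel_ext_def)

lemma \<alpha>_window: "t \<in> {0..T} \<Longrightarrow> emeasure \<alpha> {t..t + \<delta>} \<le> emeasure \<alpha> {0..T + \<delta>}"
  by (rule emeasure_mono) (auto simp: sets_\<alpha>)

text \<open>By Tonelli's theorem the integrand is integrable for almost every outcome: for each \<open>s\<close> in the
  window its norm has mean at most \<open>M (1 + B)\<close>, where \<open>B\<close> bounds the second moments of
  \<open>x\<close>. Its values at time \<open>s \<le> t + \<delta>\<close> are known at time \<open>t + \<delta>\<close>, hence so is the integral.\<close>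

lemma advanced_integrand:
  fixes x :: "real \<Rightarrow> 'w \<Rightarrow> real ^ 'n"
  assumes x: "bounded_process x" and t: "t \<in> {0..T}"
  shows "Z x t \<in> borel_measurable (F (t + \<delta>))"
    and "AE \<omega> in P. integrable \<alpha> (\<lambda>s. kernel_ext t s \<omega> *\<^sub>R process_ext x s \<omega>)"
proof -
  interpret pair_sigma_finite \<alpha> P ..
  let ?h = "\<lambda>s \<omega>. kernel_ext t s \<omega> *\<^sub>R process_ext x s \<omega>"
  have t0: "0 \<le> t + \<delta>" using t \<delta>_pos by simp
  have xm: "jointly_measurable P (T + \<delta>) x" using x by (simp add: bounded_process_def)
  note [measurable] = \<alpha>_pair_measurable[OF process_ext_measurable[OF xm]]
    \<alpha>_pair_measurable[OF kernel_ext_section_measurable[of t]]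
  obtain B where B: "B < \<infinity>" "\<And>t. t \<in> {0..T + \<delta>} \<Longrightarrow> (\<integral>\<^sup>+\<omega>. sqn (x t \<omega>) \<partial>P) \<le> B"
    using x unfolding bounded_process_def by blast
  have hF: "?h s \<in> borel_measurable (F (t + \<delta>))" for s
  proof (cases "s \<in> {t..t + \<delta>}")
    case True
    then have s: "0 \<le> s" "s \<le> t + \<delta>" "s \<in> {0..T + \<delta>}" using t by auto
    have "\<phi> t s \<in> borel_measurable (F s)" using kernel t True unfolding bounded_kernel_def by blast
    then have "\<phi> t s \<in> borel_measurable (F (t + \<delta>))" by (rule measurable_F_mono[OF _ s(1,2)])
    moreover have "x s \<in> borel_measurable (F (t + \<delta>))"
      by (rule measurable_F_mono[OF _ s(1,2)]) (use x s(3) in \<open>simp add: bounded_process_def\<close>)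
    ultimately show ?thesis
      unfolding kernel_ext_def process_ext_def
      by (intro borel_measurable_scaleR borel_measurable_times borel_measurable_const)
  next
    case False
    then have "?h s = (\<lambda>_. 0)" by (simp add: kernel_ext_def)
    then show ?thesis by simp
  qed
  have "(\<integral>\<^sup>+\<omega>. (\<integral>\<^sup>+s. ennreal (norm (?h s \<omega>)) \<partial>\<alpha>) \<partial>P) = (\<integral>\<^sup>+s. (\<integral>\<^sup>+\<omega>. ennreal (norm (?h s \<omega>)) \<partial>P) \<partial>\<alpha>)"
    by (rule Fubini') measurable
  also have "\<dots> \<le> (\<integral>\<^sup>+s. (ennreal M * (1 + B)) * indicator {t..t + \<delta>} s \<partial>\<alpha>)"
  proof (rule nn_integral_mono)
    fix s
    have "(\<integral>\<^sup>+\<omega>. ennreal (norm (?h s \<omega>)) \<partial>P) \<le> (\<integral>\<^sup>+\<omega>. ennreal M * indicator {t..t + \<delta>} s * (1 + sqn (x s \<omega>)) \<partial>P)"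
    proof (rule nn_integral_mono_AE)
      show "AE \<omega> in P. ennreal (norm (?h s \<omega>)) \<le> ennreal M * indicator {t..t + \<delta>} s * (1 + sqn (x s \<omega>))"
        using kernel_ext_bound[OF t, of s]
      proof eventually_elim
        fix \<omega> assume k: "\<bar>kernel_ext t s \<omega>\<bar> \<le> M * indicator {t..t + \<delta>} s"
        have "norm (x s \<omega>) \<le> 1 + (norm (x s \<omega>))\<^sup>2"
          by (rule norm_le_one_plus_square)
        then have "norm (process_ext x s \<omega>) \<le> 1 + (norm (x s \<omega>))\<^sup>2"
          by (auto simp: process_ext_def indicator_def)
        then have "norm (?h s \<omega>) \<le> (M * indicator {t..t + \<delta>} s) * (1 + (norm (x s \<omega>))\<^sup>2)"
          using k M_pos by (simp only: norm_scaleR real_norm_def) (intro mult_mono, auto)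
        then have "ennreal (norm (?h s \<omega>)) \<le> ennreal ((M * indicator {t..t + \<delta>} s) * (1 + (norm (x s \<omega>))\<^sup>2))"
          by (rule ennreal_leI)
        also have "\<dots> = ennreal M * indicator {t..t + \<delta>} s * (1 + sqn (x s \<omega>))"
          using M_pos by (simp add: ennreal_mult ennreal_indicator[symmetric] ennreal_plus)
        finally show "ennreal (norm (?h s \<omega>)) \<le> ennreal M * indicator {t..t + \<delta>} s * (1 + sqn (x s \<omega>))" .
      qed
    qed
    also have "\<dots> \<le> (ennreal M * (1 + B)) * indicator {t..t + \<delta>} s"
    proof (cases "s \<in> {t..t + \<delta>}")
      case True
      then have s: "s \<in> {0..T + \<delta>}" using t by auto
      have [measurable]: "x s \<in> borel_measurable P"
        using L2_rvD(2)[OF bounded_process_L2[OF x s]] s by simp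
      have "(\<integral>\<^sup>+\<omega>. ennreal M * indicator {t..t + \<delta>} s * (1 + sqn (x s \<omega>)) \<partial>P) =
          ennreal M * (1 + (\<integral>\<^sup>+\<omega>. sqn (x s \<omega>) \<partial>P))"
        using True by (simp add: nn_integral_cmult nn_integral_add emeasure_space_1)
      also have "\<dots> \<le> ennreal M * (1 + B)" using B(2)[OF s] by (intro mult_left_mono add_left_mono) auto
      finally show ?thesis using True by simp
    qed simp
    finally show "(\<integral>\<^sup>+\<omega>. ennreal (norm (?h s \<omega>)) \<partial>P) \<le> (ennreal M * (1 + B)) * indicator {t..t + \<delta>} s" .
  qed
  also have "\<dots> = (ennreal M * (1 + B)) * emeasure \<alpha> {t..t + \<delta>}"
    by (rule nn_integral_cmult_indicator) (simp add: sets_\<alpha>)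
  also have "\<dots> < \<infinity>"
    using B(1) order_le_less_trans[OF \<alpha>_window[OF t] \<alpha>_finite] by (simp add: ennreal_mult_less_top)
  finally have fin: "(\<integral>\<^sup>+\<omega>. (\<integral>\<^sup>+s. ennreal (norm (?h s \<omega>)) \<partial>\<alpha>) \<partial>P) < \<infinity>" .
  have hm: "(\<lambda>(s, \<omega>). ?h s \<omega>) \<in> borel_measurable (\<alpha> \<Otimes>\<^sub>M P)" by measurable
  note i = integral_adapted_measurable[OF \<alpha>.sigma_finite_measure_axioms prob_space_axioms complete_measure_axioms
      subalgebra_F[OF t0] null_F[OF t0] hm hF fin]
  show "Z x t \<in> borel_measurable (F (t + \<delta>))"
    using i(1) unfolding advanced_term_eq[OF t, abs_def] .
  show "AE \<omega> in P. integrable \<alpha> (\<lambda>s. ?h s \<omega>)" by (rule i(2))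
qed

lemma advanced_set_integrable:
  fixes x :: "real \<Rightarrow> 'w \<Rightarrow> real ^ 'n"
  assumes x: "bounded_process x" and t: "t \<in> {0..T}"
  shows "AE \<omega> in P. set_integrable \<alpha> {t..t + \<delta>} (\<lambda>s. \<phi> t s \<omega> *\<^sub>R x s \<omega>)"
  using advanced_integrand(2)[OF x t]
proof eventually_elim
  fix \<omega> assume i: "integrable \<alpha> (\<lambda>s. kernel_ext t s \<omega> *\<^sub>R process_ext x s \<omega>)"
  have "(\<lambda>s. kernel_ext t s \<omega> *\<^sub>R process_ext x s \<omega>) = (\<lambda>s. indicator {t..t + \<delta>} s *\<^sub>R (\<phi> t s \<omega> *\<^sub>R x s \<omega>))"
    using t by (auto simp: kernel_ext_def process_ext_def indicator_def)
  then show "set_integrable \<alpha> {t..t + \<delta>} (\<lambda>s. \<phi> t s \<omega> *\<^sub>R x s \<omega>)"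
    unfolding set_integrable_def using i by simp
qed

text \<open>Cauchy-Schwarz with respect to \<open>\<alpha>\<close> on the window, whose measure is at most
  \<open>\<alpha> [0, T + \<delta>]\<close>, followed by Tonelli's theorem.\<close>

lemma advanced_term_dist:
  fixes x y :: "real \<Rightarrow> 'w \<Rightarrow> real ^ 'n"
  assumes x: "bounded_process x" and y: "bounded_process y" and t: "t \<in> {0..T}"
  shows "(\<integral>\<^sup>+\<omega>. sqn (Z x t \<omega> - Z y t \<omega>) \<partial>P) \<le>
    ennreal (M\<^sup>2) * emeasure \<alpha> {0..T + \<delta>} * (\<integral>\<^sup>+s\<in>{t..t + \<delta>}. (\<integral>\<^sup>+\<omega>. sqn (x s \<omega> - y s \<omega>) \<partial>P) \<partial>\<alpha>)"
proof -
  interpret pair_sigma_finite \<alpha> P ..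
  let ?J = "{t..t + \<delta>}" and ?A = "emeasure \<alpha> {0..T + \<delta>}"
  define D where "D s \<omega> = process_ext x s \<omega> - process_ext y s \<omega>" for s \<omega>
  have xm: "jointly_measurable P (T + \<delta>) x" "jointly_measurable P (T + \<delta>) y"
    using x y by (auto simp: bounded_process_def)
  note [measurable] = xm[THEN process_ext_measurable, THEN \<alpha>_pair_measurable]
    \<alpha>_pair_measurable[OF kernel_ext_section_measurable[of t]]
  have Dm[measurable]: "(\<lambda>(s, \<omega>). D s \<omega>) \<in> borel_measurable (\<alpha> \<Otimes>\<^sub>M P)" unfolding D_def by measurable
  have J[measurable]: "?J \<in> sets \<alpha>" by (simp add: sets_\<alpha>)
  have "AE \<omega> in P. sqn (Z x t \<omega> - Z y t \<omega>) \<le> ?A * (\<integral>\<^sup>+s. sqn (kernel_ext t s \<omega> *\<^sub>R D s \<omega>) \<partial>\<alpha>)"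
    using advanced_integrand(2)[OF x t] advanced_integrand(2)[OF y t] AE_space
  proof eventually_elim
    fix \<omega> assume i: "integrable \<alpha> (\<lambda>s. kernel_ext t s \<omega> *\<^sub>R process_ext x s \<omega>)"
      "integrable \<alpha> (\<lambda>s. kernel_ext t s \<omega> *\<^sub>R process_ext y s \<omega>)" and w: "\<omega> \<in> space P"
    have "Z x t \<omega> - Z y t \<omega> = (\<integral>s. kernel_ext t s \<omega> *\<^sub>R D s \<omega> \<partial>\<alpha>)"
      unfolding advanced_term_eq[OF t] D_def using i by (simp add: scaleR_diff_right)
    also have "\<dots> = (LINT s:?J|\<alpha>. kernel_ext t s \<omega> *\<^sub>R D s \<omega>)"
      unfolding set_lebesgue_integral_def
      by (rule Bochner_Integration.integral_cong) (auto simp: kernel_ext_def indicator_def)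
    finally have "sqn (Z x t \<omega> - Z y t \<omega>) = sqn (LINT s:?J|\<alpha>. kernel_ext t s \<omega> *\<^sub>R D s \<omega>)" by simp
    also have "\<dots> \<le> emeasure \<alpha> ?J * (\<integral>\<^sup>+s\<in>?J. sqn (kernel_ext t s \<omega> *\<^sub>R D s \<omega>) \<partial>\<alpha>)"
      by (rule sqn_set_integral_le[OF J]) (use w in measurable)
    also have "\<dots> \<le> ?A * (\<integral>\<^sup>+s. sqn (kernel_ext t s \<omega> *\<^sub>R D s \<omega>) \<partial>\<alpha>)"
      by (intro mult_mono \<alpha>_window t nn_integral_mono) (auto simp: indicator_def)
    finally show "sqn (Z x t \<omega> - Z y t \<omega>) \<le> ?A * (\<integral>\<^sup>+s. sqn (kernel_ext t s \<omega> *\<^sub>R D s \<omega>) \<partial>\<alpha>)" .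
  qed
  then have outer: "(\<integral>\<^sup>+\<omega>. sqn (Z x t \<omega> - Z y t \<omega>) \<partial>P) \<le> (\<integral>\<^sup>+\<omega>. ?A * (\<integral>\<^sup>+s. sqn (kernel_ext t s \<omega> *\<^sub>R D s \<omega>) \<partial>\<alpha>) \<partial>P)"
    by (rule nn_integral_mono_AE)
  have "(\<integral>\<^sup>+\<omega>. (\<integral>\<^sup>+s. sqn (kernel_ext t s \<omega> *\<^sub>R D s \<omega>) \<partial>\<alpha>) \<partial>P) =
      (\<integral>\<^sup>+s. (\<integral>\<^sup>+\<omega>. sqn (kernel_ext t s \<omega> *\<^sub>R D s \<omega>) \<partial>P) \<partial>\<alpha>)"
    by (rule Fubini') measurable
  also have "\<dots> \<le> (\<integral>\<^sup>+s. ennreal (M\<^sup>2) * ((\<integral>\<^sup>+\<omega>. sqn (D s \<omega>) \<partial>P) * indicator ?J s) \<partial>\<alpha>)"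
  proof (rule nn_integral_mono)
    fix s assume s: "s \<in> space \<alpha>"
    have "(\<integral>\<^sup>+\<omega>. sqn (kernel_ext t s \<omega> *\<^sub>R D s \<omega>) \<partial>P) \<le> (\<integral>\<^sup>+\<omega>. ennreal (M\<^sup>2) * indicator ?J s * sqn (D s \<omega>) \<partial>P)"
    proof (rule nn_integral_mono_AE)
      show "AE \<omega> in P. sqn (kernel_ext t s \<omega> *\<^sub>R D s \<omega>) \<le> ennreal (M\<^sup>2) * indicator ?J s * sqn (D s \<omega>)"
        using kernel_ext_bound[OF t, of s]
      proof eventually_elim
        fix \<omega> assume k: "\<bar>kernel_ext t s \<omega>\<bar> \<le> M * indicator ?J s"
        have "(kernel_ext t s \<omega>)\<^sup>2 \<le> (M * indicator ?J s)\<^sup>2"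
          using power_mono[OF k, of 2] by simp
        then have "ennreal ((kernel_ext t s \<omega>)\<^sup>2) \<le> ennreal (M\<^sup>2) * indicator ?J s"
          by (cases "s \<in> ?J") (simp_all add: ennreal_leI)
        then show "sqn (kernel_ext t s \<omega> *\<^sub>R D s \<omega>) \<le> ennreal (M\<^sup>2) * indicator ?J s * sqn (D s \<omega>)"
          unfolding sqn_scaleR by (rule mult_right_mono) simp
      qed
    qed
    also have "\<dots> = ennreal (M\<^sup>2) * ((\<integral>\<^sup>+\<omega>. sqn (D s \<omega>) \<partial>P) * indicator ?J s)"
      using s by (subst nn_integral_cmult) (auto simp: mult_ac)
    finally show "(\<integral>\<^sup>+\<omega>. sqn (kernel_ext t s \<omega> *\<^sub>R D s \<omega>) \<partial>P) \<le> \<dots>" .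
  qed
  also have "\<dots> = ennreal (M\<^sup>2) * (\<integral>\<^sup>+s\<in>?J. (\<integral>\<^sup>+\<omega>. sqn (D s \<omega>) \<partial>P) \<partial>\<alpha>)"
    by (rule nn_integral_cmult) measurable
  also have "(\<integral>\<^sup>+s\<in>?J. (\<integral>\<^sup>+\<omega>. sqn (D s \<omega>) \<partial>P) \<partial>\<alpha>) = (\<integral>\<^sup>+s\<in>?J. (\<integral>\<^sup>+\<omega>. sqn (x s \<omega> - y s \<omega>) \<partial>P) \<partial>\<alpha>)"
    by (intro nn_integral_cong) (use t in \<open>auto simp: D_def process_ext_def indicator_def\<close>)
  finally have inner: "(\<integral>\<^sup>+\<omega>. (\<integral>\<^sup>+s. sqn (kernel_ext t s \<omega> *\<^sub>R D s \<omega>) \<partial>\<alpha>) \<partial>P) \<le>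
      ennreal (M\<^sup>2) * (\<integral>\<^sup>+s\<in>?J. (\<integral>\<^sup>+\<omega>. sqn (x s \<omega> - y s \<omega>) \<partial>P) \<partial>\<alpha>)" .
  have "(\<integral>\<^sup>+\<omega>. ?A * (\<integral>\<^sup>+s. sqn (kernel_ext t s \<omega> *\<^sub>R D s \<omega>) \<partial>\<alpha>) \<partial>P) =
      ?A * (\<integral>\<^sup>+\<omega>. (\<integral>\<^sup>+s. sqn (kernel_ext t s \<omega> *\<^sub>R D s \<omega>) \<partial>\<alpha>) \<partial>P)"
    by (rule nn_integral_cmult) measurable
  also have "\<dots> \<le> ?A * (ennreal (M\<^sup>2) * (\<integral>\<^sup>+s\<in>?J. (\<integral>\<^sup>+\<omega>. sqn (x s \<omega> - y s \<omega>) \<partial>P) \<partial>\<alpha>))"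
    by (rule mult_left_mono[OF inner]) simp
  finally show ?thesis using order_trans[OF outer] by (simp only: mult_ac)
qed

lemma advanced_term_moment:
  fixes x :: "real \<Rightarrow> 'w \<Rightarrow> real ^ 'n"
  assumes x: "bounded_process x"
  shows "\<exists>B<\<infinity>. \<forall>t\<in>{0..T}. (\<integral>\<^sup>+\<omega>. sqn (Z x t \<omega>) \<partial>P) \<le> B"
proof -
  obtain B where B: "B < \<infinity>" "\<And>t. t \<in> {0..T + \<delta>} \<Longrightarrow> (\<integral>\<^sup>+\<omega>. sqn (x t \<omega>) \<partial>P) \<le> B"
    using x unfolding bounded_process_def by blast
  let ?A = "emeasure \<alpha> {0..T + \<delta>}"
  have "(\<integral>\<^sup>+\<omega>. sqn (Z x t \<omega>) \<partial>P) \<le> ennreal (M\<^sup>2) * ?A * (B * ?A)" if t: "t \<in> {0..T}" for t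
  proof -
    have "Z (\<lambda>_ _. 0 :: real ^ 'n) t \<omega> = 0" for \<omega> by (simp add: advanced_term_def set_lebesgue_integral_def)
    then have "(\<integral>\<^sup>+\<omega>. sqn (Z x t \<omega>) \<partial>P) \<le> ennreal (M\<^sup>2) * ?A * (\<integral>\<^sup>+s\<in>{t..t + \<delta>}. (\<integral>\<^sup>+\<omega>. sqn (x s \<omega>) \<partial>P) \<partial>\<alpha>)"
      using advanced_term_dist[OF x bounded_process_zero t] by simp
    also have "\<dots> \<le> ennreal (M\<^sup>2) * ?A * (\<integral>\<^sup>+s. B * indicator {0..T + \<delta>} s \<partial>\<alpha>)"
      using t B(2) by (intro mult_left_mono nn_integral_mono) (auto simp: indicator_def)
    also have "(\<integral>\<^sup>+s. B * indicator {0..T + \<delta>} s \<partial>\<alpha>) = B * ?A"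
      by (rule nn_integral_cmult_indicator) (simp add: sets_\<alpha>)
    finally show ?thesis .
  qed
  moreover have "ennreal (M\<^sup>2) * ?A * (B * ?A) < \<infinity>"
    using B(1) \<alpha>_finite by (simp add: ennreal_mult_less_top)
  ultimately show ?thesis by blast
qed

lemma advanced_term_L2:
  fixes x :: "real \<Rightarrow> 'w \<Rightarrow> real ^ 'n"
  assumes x: "bounded_process x" and t: "t \<in> {0..T}"
  shows "Z x t \<in> L2_rv P (F (t + \<delta>))"
proof -
  have t0: "0 \<le> t + \<delta>" using t \<delta>_pos by simp
  show ?thesis
    unfolding L2_rv_iff[OF t0] using advanced_integrand(1)[OF x t] advanced_term_moment[OF x] t
    by (auto intro: order_le_less_trans)
qed

lemma advanced_term_jointly_measurable:
  fixes x :: "real \<Rightarrow> 'w \<Rightarrow> real ^ 'n"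
  assumes xm: "jointly_measurable P (T + \<delta>) x"
  shows "jointly_measurable P T (Z x)"
proof -
  have m: "(\<lambda>p. kernel_ext (fst (fst p)) (snd p) (snd (fst p)) *\<^sub>R process_ext x (snd p) (snd (fst p)))
      \<in> borel_measurable ((borel \<Otimes>\<^sub>M P) \<Otimes>\<^sub>M borel)"
  proof (rule borel_measurable_scaleR)
    have "(\<lambda>p. ((fst (fst p), snd p), snd (fst p))) \<in> (borel \<Otimes>\<^sub>M P) \<Otimes>\<^sub>M borel \<rightarrow>\<^sub>M (borel \<Otimes>\<^sub>M borel) \<Otimes>\<^sub>M P"
      by measurable
    from measurable_compose[OF this kernel_ext_measurable]
    show "(\<lambda>p. kernel_ext (fst (fst p)) (snd p) (snd (fst p))) \<in> borel_measurable ((borel \<Otimes>\<^sub>M P) \<Otimes>\<^sub>M borel)"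
      by (simp add: case_prod_beta')
    have "(\<lambda>p. (snd p, snd (fst p))) \<in> (borel \<Otimes>\<^sub>M P) \<Otimes>\<^sub>M borel \<rightarrow>\<^sub>M borel \<Otimes>\<^sub>M P" by measurable
    from measurable_compose[OF this process_ext_measurable[OF xm]]
    show "(\<lambda>p. process_ext x (snd p) (snd (fst p))) \<in> borel_measurable ((borel \<Otimes>\<^sub>M P) \<Otimes>\<^sub>M borel)"
      by (simp add: case_prod_beta')
  qed
  have "sets ((borel \<Otimes>\<^sub>M P) \<Otimes>\<^sub>M \<alpha>) = sets ((borel \<Otimes>\<^sub>M P) \<Otimes>\<^sub>M borel)"
    by (intro sets_pair_measure_cong sets_\<alpha> refl)
  from measurable_cong_sets[OF this refl] m
  have "(\<lambda>p. kernel_ext (fst (fst p)) (snd p) (snd (fst p)) *\<^sub>R process_ext x (snd p) (snd (fst p)))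
      \<in> borel_measurable ((borel \<Otimes>\<^sub>M P) \<Otimes>\<^sub>M \<alpha>)"
    by blast
  then have "(\<lambda>(z, s). (\<lambda>z s. kernel_ext (fst z) s (snd z) *\<^sub>R process_ext x s (snd z)) z s) \<in> borel_measurable ((borel \<Otimes>\<^sub>M P) \<Otimes>\<^sub>M \<alpha>)"
    by (simp add: case_prod_beta')
  then have "(\<lambda>z. \<integral>s. kernel_ext (fst z) s (snd z) *\<^sub>R process_ext x s (snd z) \<partial>\<alpha>) \<in> borel_measurable (borel \<Otimes>\<^sub>M P)"
    by (rule \<alpha>.borel_measurable_lebesgue_integral)
  then have "(\<lambda>(t, \<omega>). indicator {0..T} t *\<^sub>R (\<integral>s. kernel_ext t s \<omega> *\<^sub>R process_ext x s \<omega> \<partial>\<alpha>)) \<in> borel_measurable (borel \<Otimes>\<^sub>M P)"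
    unfolding case_prod_beta' by (intro borel_measurable_scaleR) (auto intro!: measurable_compose[OF measurable_fst])
  moreover have "indicator {0..T} t *\<^sub>R (\<integral>s. kernel_ext t s \<omega> *\<^sub>R process_ext x s \<omega> \<partial>\<alpha>) =
      indicator {0..T} t *\<^sub>R Z x t \<omega>" for t \<omega>
    by (cases "t \<in> {0..T}") (simp_all add: advanced_term_eq)
  ultimately show ?thesis by (simp add: jointly_measurable_def)
qed

lemma advanced_term_L2_process:
  fixes x :: "real \<Rightarrow> 'w \<Rightarrow> real ^ 'n"
  assumes x: "bounded_process x"
  shows "Z x \<in> L2_process P (\<lambda>t. F (t + \<delta>)) 0 T"
proof -
  have jm: "jointly_measurable P T (Z x)"
    by (rule advanced_term_jointly_measurable) (use x in \<open>simp add: bounded_process_def\<close>)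
  obtain B where B: "B < \<infinity>" "\<And>t. t \<in> {0..T} \<Longrightarrow> (\<integral>\<^sup>+\<omega>. sqn (Z x t \<omega>) \<partial>P) \<le> B"
    using advanced_term_moment[OF x] by blast
  have "process_dist P T (Z x) (\<lambda>_ _. 0) < \<infinity>"
    by (rule process_dist_finite[OF prob_space_axioms jm B])
  then show ?thesis
    unfolding L2_process_def adapted_process_def process_dist_zero
    using jm advanced_integrand(1)[OF x] unfolding jointly_measurable_iff by simp
qed

end

section \<open>Coefficients along a process\<close>

context advanced_setting
begin

text \<open>The advanced term at time \<open>t\<close> is known at time \<open>t + \<delta>\<close>, so the Lipschitz condition is needed
  for random variables known at that time.\<close>

definition admissible :: "real \<Rightarrow> real \<Rightarrow>
    (real \<Rightarrow> real ^ 'n \<Rightarrow> ('w \<Rightarrow> real ^ 'n) \<Rightarrow> 'w \<Rightarrow> 'a::euclidean_space) \<Rightarrow> bool" where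
  "admissible C K f \<longleftrightarrow> 0 < C \<and> coefficient P F T \<delta> f \<and> time_measurable P F T \<delta> f \<and>
    (\<forall>t\<in>{0..T}. \<forall>\<xi>\<in>L2_rv P (F (t + \<delta>)). \<forall>\<xi>'\<in>L2_rv P (F (t + \<delta>)). AE \<omega> in P. \<forall>x x'.
       norm (f t x \<xi> \<omega> - f t x' \<xi>' \<omega>) \<le>
         C * (norm (x - x') + real_cond_exp P (F t) (\<lambda>\<omega>. norm (\<xi> \<omega> - \<xi>' \<omega>)) \<omega>)) \<and>
    (\<forall>t\<in>{0..T}. AE \<omega> in P. norm (f t 0 (\<lambda>_. 0) \<omega>) \<le> K)"

definition along :: "(real \<Rightarrow> real ^ 'n \<Rightarrow> ('w \<Rightarrow> real ^ 'n) \<Rightarrow> 'w \<Rightarrow> 'a::euclidean_space) \<Rightarrow>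
    (real \<Rightarrow> 'w \<Rightarrow> real ^ 'n) \<Rightarrow> real \<Rightarrow> 'w \<Rightarrow> 'a" where
  "along f x t \<omega> = f t (x t \<omega>) (Z x t) \<omega>"

lemma Z_zero [simp]: "Z (\<lambda>_ _. 0 :: real ^ 'n) t = (\<lambda>_. 0)"
  by (rule ext) (simp add: advanced_term_def set_lebesgue_integral_def)

text \<open>Measurability of \<open>f t q \<zeta>\<close> is assumed for fixed vectors \<open>q\<close>. It passes to simple functions
  in place of \<open>q\<close>, and by the Lipschitz condition, whose exceptional null set is the same for all
  pairs of vectors, to their limits.\<close>

lemma coefficient_at_random_point:
  fixes f :: "real \<Rightarrow> real ^ 'n \<Rightarrow> ('w \<Rightarrow> real ^ 'n) \<Rightarrow> 'w \<Rightarrow> 'a::euclidean_space"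
  assumes f: "admissible C K f" and t: "t \<in> {0..T}" and X: "X \<in> borel_measurable (F t)"
    and \<zeta>: "\<zeta> \<in> L2_rv P (F (t + \<delta>))"
  shows "(\<lambda>\<omega>. f t (X \<omega>) \<zeta> \<omega>) \<in> borel_measurable (F t)"
proof -
  have t0: "0 \<le> t" using t by simp
  have td: "t + \<delta> \<in> {t..T + \<delta>}" using t \<delta>_pos by simp
  have fq: "f t q \<zeta> \<in> borel_measurable (F t)" for q
    using f t td \<zeta> L2_rvD(1)[OF _ t0] unfolding admissible_def coefficient_def by blast
  obtain X' where X': "\<And>i. simple_function (F t) (X' i)" "\<And>\<omega>. \<omega> \<in> space (F t) \<Longrightarrow> (\<lambda>i. X' i \<omega>) \<longlonglongrightarrow> X \<omega>"
    using borel_measurable_implies_sequence_metric[OF X] by blast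
  have m: "(\<lambda>\<omega>. f t (X' i \<omega>) \<zeta> \<omega>) \<in> borel_measurable (F t)" for i
  proof (rule measurable_compose_countable'[of "X' i ` space (F t)"])
    show "X' i \<in> F t \<rightarrow>\<^sub>M count_space (X' i ` space (F t))"
      using X'(1)[of i] by (subst measurable_count_space_eq2) (auto simp: simple_function_def)
    show "countable (X' i ` space (F t))"
      using simple_functionD(1)[OF X'(1)[of i]] by (rule countable_finite)
  qed (rule fq)
  have "AE \<omega> in P. \<forall>x x'. norm (f t x \<zeta> \<omega> - f t x' \<zeta> \<omega>) \<le>
         C * (norm (x - x') + real_cond_exp P (F t) (\<lambda>\<omega>. norm (\<zeta> \<omega> - \<zeta> \<omega>)) \<omega>)"
    using f t \<zeta> unfolding admissible_def by blast
  moreover have "AE \<omega> in P. real_cond_exp P (F t) (\<lambda>\<omega>. norm (\<zeta> \<omega> - \<zeta> \<omega>)) \<omega> = 0"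
  proof -
    interpret fs: finite_measure_subalgebra P "F t" by standard (rule subalgebra_F[OF t0])
    have "AE \<omega> in P. real_cond_exp P (F t) (\<lambda>_. 0) \<omega> = 0"
      by (rule fs.real_cond_exp_F_meas) auto
    then show ?thesis by simp
  qed
  ultimately have "AE \<omega> in P. (\<lambda>i. f t (X' i \<omega>) \<zeta> \<omega>) \<longlonglongrightarrow> f t (X \<omega>) \<zeta> \<omega>"
    using AE_space
  proof eventually_elim
    fix \<omega> assume lip: "\<forall>x x'. norm (f t x \<zeta> \<omega> - f t x' \<zeta> \<omega>) \<le>
         C * (norm (x - x') + real_cond_exp P (F t) (\<lambda>\<omega>. norm (\<zeta> \<omega> - \<zeta> \<omega>)) \<omega>)"
      and z: "real_cond_exp P (F t) (\<lambda>\<omega>. norm (\<zeta> \<omega> - \<zeta> \<omega>)) \<omega> = 0" and w: "\<omega> \<in> space P"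
    have l: "(\<lambda>i. C * norm (X' i \<omega> - X \<omega>)) \<longlonglongrightarrow> C * norm (X \<omega> - X \<omega>)"
      using X'(2)[of \<omega>] w space_F[OF t0] by (intro tendsto_intros) simp
    show "(\<lambda>i. f t (X' i \<omega>) \<zeta> \<omega>) \<longlonglongrightarrow> f t (X \<omega>) \<zeta> \<omega>"
    proof (subst tendsto_dist_iff, rule tendsto_sandwich[OF _ _ tendsto_const])
      show "\<forall>\<^sub>F i in sequentially. dist (f t (X' i \<omega>) \<zeta> \<omega>) (f t (X \<omega>) \<zeta> \<omega>) \<le> C * norm (X' i \<omega> - X \<omega>)"
        using lip z by (intro always_eventually allI) (simp add: dist_norm)
      show "(\<lambda>i. C * norm (X' i \<omega> - X \<omega>)) \<longlonglongrightarrow> 0" using l by simp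
    qed simp
  qed
  from measurable_F_AE_lim[OF t0 m this] show ?thesis .
qed

lemma along_measurable_F:
  assumes "admissible C K f" "bounded_process x" "t \<in> {0..T}"
  shows "along f x t \<in> borel_measurable (F t)"
  unfolding along_def[abs_def]
  by (rule coefficient_at_random_point[OF assms(1,3) _ advanced_term_L2[OF assms(2,3)]])
    (use assms \<delta>_pos in \<open>simp add: bounded_process_def\<close>)

text \<open>The Lipschitz bound contains the conditional expectation of the distance of the advanced terms,
  which does not exceed that distance in \<open>L\<^sup>2\<close>. Thus looking ahead costs nothing here. The
  factor \<open>2\<close> comes from \<open>(u + v)\<^sup>2 \<le> 2 (u\<^sup>2 + v\<^sup>2)\<close>.\<close>

lemma along_dist:
  fixes f :: "real \<Rightarrow> real ^ 'n \<Rightarrow> ('w \<Rightarrow> real ^ 'n) \<Rightarrow> 'w \<Rightarrow> 'a::euclidean_space"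
  assumes f: "admissible C K f" and x: "bounded_process x" and y: "bounded_process y" and t: "t \<in> {0..T}"
  shows "(\<integral>\<^sup>+\<omega>. sqn (along f x t \<omega> - along f y t \<omega>) \<partial>P) \<le>
    ennreal (2 * C\<^sup>2) * ((\<integral>\<^sup>+\<omega>. sqn (x t \<omega> - y t \<omega>) \<partial>P) + (\<integral>\<^sup>+\<omega>. sqn (Z x t \<omega> - Z y t \<omega>) \<partial>P))"
proof -
  have t0: "0 \<le> t" "0 \<le> t + \<delta>" "t \<in> {0..T + \<delta>}" using t \<delta>_pos by auto
  define Y where "Y \<omega> = norm (Z x t \<omega> - Z y t \<omega>)" for \<omega>
  note Zx = advanced_term_L2[OF x t] and Zy = advanced_term_L2[OF y t]
  have D: "(\<lambda>\<omega>. Z x t \<omega> - Z y t \<omega>) \<in> L2_rv P (F (t + \<delta>))" by (rule L2_rv_diff[OF Zx Zy t0(2)])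
  have Dx: "(\<lambda>\<omega>. x t \<omega> - y t \<omega>) \<in> L2_rv P (F t)"
    by (rule L2_rv_diff[OF bounded_process_L2[OF x t0(3)] bounded_process_L2[OF y t0(3)] t0(1)])
  note [measurable] = L2_rvD(2)[OF D t0(2)] L2_rvD(2)[OF Dx t0(1)]
  have Ym[measurable]: "Y \<in> borel_measurable P" unfolding Y_def by measurable
  have Y2: "integrable P (\<lambda>\<omega>. (Y \<omega>)\<^sup>2)" unfolding Y_def by (rule L2_rvD(4)[OF D t0(2)])
  define E where "E = real_cond_exp P (F t) Y"
  have [measurable]: "E \<in> borel_measurable P" unfolding E_def by simp
  have "AE \<omega> in P. \<forall>v v'. norm (f t v (Z x t) \<omega> - f t v' (Z y t) \<omega>) \<le> C * (norm (v - v') + E \<omega>)"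
    using f t Zx Zy unfolding admissible_def E_def Y_def by blast
  then have "(\<integral>\<^sup>+\<omega>. sqn (along f x t \<omega> - along f y t \<omega>) \<partial>P) \<le>
      (\<integral>\<^sup>+\<omega>. ennreal (2 * C\<^sup>2) * (sqn (x t \<omega> - y t \<omega>) + sqn (E \<omega>)) \<partial>P)"
  proof (intro nn_integral_mono_AE, eventually_elim)
    fix \<omega> assume "\<forall>v v'. norm (f t v (Z x t) \<omega> - f t v' (Z y t) \<omega>) \<le> C * (norm (v - v') + E \<omega>)"
    then have "norm (along f x t \<omega> - along f y t \<omega>) \<le> C * (norm (x t \<omega> - y t \<omega>) + E \<omega>)"
      unfolding along_def by blast
    also have "\<dots> \<le> C * (norm (x t \<omega> - y t \<omega>) + \<bar>E \<omega>\<bar>)"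
      using f by (intro mult_left_mono) (auto simp: admissible_def)
    finally have "(norm (along f x t \<omega> - along f y t \<omega>))\<^sup>2 \<le> (C * (norm (x t \<omega> - y t \<omega>) + \<bar>E \<omega>\<bar>))\<^sup>2"
      by (intro power_mono) auto
    also have "\<dots> = C\<^sup>2 * (norm (x t \<omega> - y t \<omega>) + \<bar>E \<omega>\<bar>)\<^sup>2" by (rule power_mult_distrib)
    also have "\<dots> \<le> C\<^sup>2 * (2 * ((norm (x t \<omega> - y t \<omega>))\<^sup>2 + (E \<omega>)\<^sup>2))"
      using sum_squares_bound[of "norm (x t \<omega> - y t \<omega>)" "\<bar>E \<omega>\<bar>"]
      by (intro mult_left_mono) (auto simp: power2_sum)
    also have "\<dots> = 2 * C\<^sup>2 * ((norm (x t \<omega> - y t \<omega>))\<^sup>2 + (norm (E \<omega>))\<^sup>2)" by simp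
    finally have "sqn (along f x t \<omega> - along f y t \<omega>) \<le> ennreal (2 * C\<^sup>2 * ((norm (x t \<omega> - y t \<omega>))\<^sup>2 + (norm (E \<omega>))\<^sup>2))"
      by (rule ennreal_leI)
    also have "\<dots> = ennreal (2 * C\<^sup>2) * (sqn (x t \<omega> - y t \<omega>) + sqn (E \<omega>))"
      by (subst ennreal_mult) (auto simp: ennreal_plus)
    finally show "sqn (along f x t \<omega> - along f y t \<omega>) \<le> ennreal (2 * C\<^sup>2) * (sqn (x t \<omega> - y t \<omega>) + sqn (E \<omega>))" .
  qed
  also have "\<dots> = ennreal (2 * C\<^sup>2) * ((\<integral>\<^sup>+\<omega>. sqn (x t \<omega> - y t \<omega>) \<partial>P) + (\<integral>\<^sup>+\<omega>. sqn (E \<omega>) \<partial>P))"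
    by (subst nn_integral_cmult, measurable, subst nn_integral_add, measurable)
  also have "\<dots> \<le> ennreal (2 * C\<^sup>2) * ((\<integral>\<^sup>+\<omega>. sqn (x t \<omega> - y t \<omega>) \<partial>P) + (\<integral>\<^sup>+\<omega>. sqn (Y \<omega>) \<partial>P))"
    unfolding E_def
    by (intro mult_left_mono add_left_mono real_cond_exp_L2_contraction[OF prob_space_axioms subalgebra_F[OF t0(1)] Ym Y2]) simp
  finally show ?thesis unfolding Y_def by simp
qed

lemma along_jointly_measurable:
  assumes f: "admissible C K f" and x: "bounded_process x"
  shows "jointly_measurable P T (along f x)"
proof -
  have "x \<in> L2_process P F 0 T"
    using L2_process_mono[OF bounded_process_L2_process[OF x], of T] \<delta>_pos by simp
  moreover have "\<forall>t\<in>{0..T}. Z x t \<in> L2_rv P (F (t + \<delta>))" using advanced_term_L2[OF x] by blast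
  ultimately have "(\<lambda>(t, \<omega>). f t (x t \<omega>) (Z x t) \<omega>) \<in> borel_measurable (restrict_space borel {0..T} \<Otimes>\<^sub>M P)"
    using f advanced_term_L2_process[OF x] unfolding admissible_def time_measurable_def by blast
  then show ?thesis unfolding jointly_measurable_iff along_def .
qed

text \<open>Comparison with the zero process, along which the coefficient is bounded by \<open>K\<close>.\<close>

lemma along_moment:
  fixes f :: "real \<Rightarrow> real ^ 'n \<Rightarrow> ('w \<Rightarrow> real ^ 'n) \<Rightarrow> 'w \<Rightarrow> 'a::euclidean_space"
  assumes f: "admissible C K f" and x: "bounded_process x"
  shows "\<exists>B<\<infinity>. \<forall>t\<in>{0..T}. (\<integral>\<^sup>+\<omega>. sqn (along f x t \<omega>) \<partial>P) \<le> B"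
proof -
  obtain B where B: "B < \<infinity>" "\<And>t. t \<in> {0..T + \<delta>} \<Longrightarrow> (\<integral>\<^sup>+\<omega>. sqn (x t \<omega>) \<partial>P) \<le> B"
    using x unfolding bounded_process_def by blast
  obtain B' where B': "B' < \<infinity>" "\<And>t. t \<in> {0..T} \<Longrightarrow> (\<integral>\<^sup>+\<omega>. sqn (Z x t \<omega>) \<partial>P) \<le> B'"
    using advanced_term_moment[OF x] by blast
  let ?R = "2 * (ennreal (2 * C\<^sup>2) * (B + B') + ennreal (K\<^sup>2))"
  have "(\<integral>\<^sup>+\<omega>. sqn (along f x t \<omega>) \<partial>P) \<le> ?R" if t: "t \<in> {0..T}" for t
  proof -
    let ?o = "\<lambda>_ _. 0 :: real ^ 'n"
    have t0: "0 \<le> t" using t by simp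
    note [measurable] = measurable_F_P[OF t0 along_measurable_F[OF f x t]]
      measurable_F_P[OF t0 along_measurable_F[OF f bounded_process_zero t]]
    have "(\<integral>\<^sup>+\<omega>. sqn (along f x t \<omega>) \<partial>P) \<le>
        2 * ((\<integral>\<^sup>+\<omega>. sqn (along f x t \<omega> - along f ?o t \<omega>) \<partial>P) + (\<integral>\<^sup>+\<omega>. sqn (along f ?o t \<omega>) \<partial>P))"
      using L2_dist_triangle[of "along f x t" P "along f ?o t" "\<lambda>_. 0"] by simp
    also have "\<dots> \<le> ?R"
    proof (intro mult_left_mono add_mono)
      have "(\<integral>\<^sup>+\<omega>. sqn (along f x t \<omega> - along f ?o t \<omega>) \<partial>P) \<le>
          ennreal (2 * C\<^sup>2) * ((\<integral>\<^sup>+\<omega>. sqn (x t \<omega>) \<partial>P) + (\<integral>\<^sup>+\<omega>. sqn (Z x t \<omega>) \<partial>P))"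
        using along_dist[OF f x bounded_process_zero t] by simp
      also have "\<dots> \<le> ennreal (2 * C\<^sup>2) * (B + B')"
        using B(2)[of t] B'(2)[OF t] t \<delta>_pos by (intro mult_left_mono add_mono) auto
      finally show "(\<integral>\<^sup>+\<omega>. sqn (along f x t \<omega> - along f ?o t \<omega>) \<partial>P) \<le> ennreal (2 * C\<^sup>2) * (B + B')" .
      have "AE \<omega> in P. norm (f t 0 (\<lambda>_. 0) \<omega>) \<le> K" using f t unfolding admissible_def by blast
      then have "(\<integral>\<^sup>+\<omega>. sqn (along f ?o t \<omega>) \<partial>P) \<le> (\<integral>\<^sup>+\<omega>. ennreal (K\<^sup>2) \<partial>P)"
        by (intro nn_integral_mono_AE, eventually_elim)
          (auto simp: along_def intro!: ennreal_leI power_mono)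
      then show "(\<integral>\<^sup>+\<omega>. sqn (along f ?o t \<omega>) \<partial>P) \<le> ennreal (K\<^sup>2)" by (simp add: emeasure_space_1)
    qed simp
    finally show ?thesis .
  qed
  moreover have "?R < \<infinity>" using B B' by (simp add: ennreal_mult_less_top)
  ultimately show ?thesis by blast
qed

lemma along_L2_process:
  assumes f: "admissible C K f" and x: "bounded_process x"
  shows "along f x \<in> L2_process P F 0 T"
proof -
  note jm = along_jointly_measurable[OF f x]
  obtain B where B: "B < \<infinity>" "\<And>t. t \<in> {0..T} \<Longrightarrow> (\<integral>\<^sup>+\<omega>. sqn (along f x t \<omega>) \<partial>P) \<le> B"
    using along_moment[OF f x] by blast
  have "process_dist P T (along f x) (\<lambda>_ _. 0) < \<infinity>"
    by (rule process_dist_finite[OF prob_space_axioms jm B])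
  then show ?thesis
    unfolding L2_process_iff using jm along_measurable_F[OF f x] by blast
qed

lemma along_process_dist:
  fixes f :: "real \<Rightarrow> real ^ 'n \<Rightarrow> ('w \<Rightarrow> real ^ 'n) \<Rightarrow> 'w \<Rightarrow> 'a::euclidean_space"
  assumes f: "admissible C K f" and x: "bounded_process x" and y: "bounded_process y" and t: "t \<in> {0..T}"
  shows "process_dist P t (along f x) (along f y) \<le>
    ennreal (2 * C\<^sup>2) * (process_dist P t x y + process_dist P t (Z x) (Z y))"
proof -
  interpret pair_sigma_finite lborel P ..
  have tT: "t \<le> T" "t \<le> T + \<delta>" using t \<delta>_pos by auto
  have jx: "jointly_measurable P t x" "jointly_measurable P t y"
    using x y jointly_measurable_mono[OF _ tT(2)] by (auto simp: bounded_process_def)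
  have jZ: "jointly_measurable P t (Z x)" "jointly_measurable P t (Z y)"
    using x y by (auto simp: bounded_process_def intro!: jointly_measurable_mono[OF advanced_term_jointly_measurable tT(1)])
  have jf: "jointly_measurable P t (along f x)" "jointly_measurable P t (along f y)"
    by (rule jointly_measurable_mono[OF along_jointly_measurable[OF f x] tT(1)],
        rule jointly_measurable_mono[OF along_jointly_measurable[OF f y] tT(1)])
  have m: "(\<lambda>s. (\<integral>\<^sup>+\<omega>. sqn (h s \<omega> - g s \<omega>) \<partial>P) * indicator {0..t} s) \<in> borel_measurable lborel"
    if "jointly_measurable P t h" "jointly_measurable P t g" for h g :: "real \<Rightarrow> 'w \<Rightarrow> real ^ 'n"
  proof -
    note [measurable] = that[THEN jointly_measurable_lborel]
    have "(\<lambda>s. \<integral>\<^sup>+\<omega>. sqn (indicator {0..t} s *\<^sub>R h s \<omega> - indicator {0..t} s *\<^sub>R g s \<omega>) \<partial>P) \<in> borel_measurable lborel"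
      by measurable
    also have "(\<lambda>s. \<integral>\<^sup>+\<omega>. sqn (indicator {0..t} s *\<^sub>R h s \<omega> - indicator {0..t} s *\<^sub>R g s \<omega>) \<partial>P) =
        (\<lambda>s. (\<integral>\<^sup>+\<omega>. sqn (h s \<omega> - g s \<omega>) \<partial>P) * indicator {0..t} s)"
      by (rule ext) (auto simp: indicator_def)
    finally show ?thesis .
  qed
  have "process_dist P t (along f x) (along f y) =
      (\<integral>\<^sup>+s\<in>{0..t}. (\<integral>\<^sup>+\<omega>. sqn (along f x s \<omega> - along f y s \<omega>) \<partial>P) \<partial>lborel)"
    by (rule process_dist_Fubini[OF prob_space_axioms jf])
  also have "\<dots> \<le> (\<integral>\<^sup>+s. ennreal (2 * C\<^sup>2) * ((\<integral>\<^sup>+\<omega>. sqn (x s \<omega> - y s \<omega>) \<partial>P) * indicator {0..t} s +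
      (\<integral>\<^sup>+\<omega>. sqn (Z x s \<omega> - Z y s \<omega>) \<partial>P) * indicator {0..t} s) \<partial>lborel)"
  proof (rule nn_integral_mono)
    fix s show "(\<integral>\<^sup>+\<omega>. sqn (along f x s \<omega> - along f y s \<omega>) \<partial>P) * indicator {0..t} s \<le>
      ennreal (2 * C\<^sup>2) * ((\<integral>\<^sup>+\<omega>. sqn (x s \<omega> - y s \<omega>) \<partial>P) * indicator {0..t} s +
      (\<integral>\<^sup>+\<omega>. sqn (Z x s \<omega> - Z y s \<omega>) \<partial>P) * indicator {0..t} s)"
      using along_dist[OF f x y, of s] tT(1) by (cases "s \<in> {0..t}") auto
  qed
  also have "\<dots> = ennreal (2 * C\<^sup>2) * (process_dist P t x y + process_dist P t (Z x) (Z y))"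
    unfolding process_dist_Fubini[OF prob_space_axioms jx] process_dist_Fubini[OF prob_space_axioms jZ]
    using m[OF jx] m[OF jZ] by (simp add: nn_integral_cmult nn_integral_add)
  finally show ?thesis .
qed

end

section \<open>The drift\<close>

context complete_filtration
begin

definition drift :: "(real \<Rightarrow> 'w \<Rightarrow> 'a::euclidean_space) \<Rightarrow> real \<Rightarrow> 'w \<Rightarrow> 'a" where
  "drift h t \<omega> = (LINT s:{0..t}|lborel. h s \<omega>)"

lemma L2_process_jm: "h \<in> L2_process P F 0 T \<Longrightarrow> jointly_measurable P T h"
  by (simp add: L2_process_iff)

lemma section_measurable:
  assumes "jointly_measurable P t h" "\<omega> \<in> space P"
  shows "(\<lambda>s. indicator {0..t} s *\<^sub>R h s \<omega>) \<in> borel_measurable borel"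
  using measurable_compose[OF measurable_Pair2'[OF assms(2), of borel] assms(1)[unfolded jointly_measurable_def]]
  by simp

lemma drift_integrable:
  assumes h: "h \<in> L2_process P F 0 T"
  shows "AE \<omega> in P. set_integrable lborel {0..T} (\<lambda>s. h s \<omega>)"
proof -
  note [measurable] = jointly_measurable_lborel[OF L2_process_jm[OF h]]
  have "(\<lambda>\<omega>. \<integral>\<^sup>+s. sqn (indicator {0..T} s *\<^sub>R h s \<omega>) \<partial>lborel) \<in> borel_measurable P" by measurable
  moreover have eq: "(\<integral>\<^sup>+s. sqn (indicator {0..T} s *\<^sub>R h s \<omega>) \<partial>lborel) = (\<integral>\<^sup>+s\<in>{0..T}. sqn (h s \<omega>) \<partial>lborel)" for \<omega>
    by (intro nn_integral_cong) (auto simp: indicator_def)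
  moreover have "(\<integral>\<^sup>+\<omega>. (\<integral>\<^sup>+s\<in>{0..T}. sqn (h s \<omega>) \<partial>lborel) \<partial>P) \<noteq> \<infinity>"
    using h by (simp add: L2_process_iff process_dist_zero less_top)
  ultimately have "AE \<omega> in P. (\<integral>\<^sup>+s\<in>{0..T}. sqn (h s \<omega>) \<partial>lborel) \<noteq> \<infinity>"
    by (intro nn_integral_PInf_AE) simp_all
  then show ?thesis using AE_space
  proof eventually_elim
    fix \<omega> assume "(\<integral>\<^sup>+s\<in>{0..T}. sqn (h s \<omega>) \<partial>lborel) \<noteq> \<infinity>" and w: "\<omega> \<in> space P"
    then show "set_integrable lborel {0..T} (\<lambda>s. h s \<omega>)"
      using section_measurable[OF L2_process_jm[OF h] w]
      by (intro set_integrable_of_square) (auto simp: emeasure_lborel_Icc_eq less_top)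
  qed
qed

lemma drift_measurable:
  assumes h: "h \<in> L2_process P F 0 T" and t: "t \<in> {0..T}"
  shows "drift h t \<in> borel_measurable (F t)"
proof -
  have t0: "0 \<le> t" "t \<le> T" using t by auto
  have ht: "h \<in> L2_process P F 0 t" by (rule L2_process_mono[OF h t0(2)])
  show ?thesis
    unfolding drift_def[abs_def]
  proof (rule set_integral_adapted_measurable[OF lborel.sigma_finite_measure_axioms prob_space_axioms
        complete_measure_axioms subalgebra_F[OF t0(1)] null_F[OF t0(1)] _ _
        jointly_measurable_lborel[OF L2_process_jm[OF ht]]])
    show "h s \<in> borel_measurable (F t)" if "s \<in> {0..t}" for s
    proof (rule measurable_F_mono)
      show "h s \<in> borel_measurable (F s)" using ht that by (simp add: L2_process_iff)
    qed (use that in auto)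
    show "(\<integral>\<^sup>+\<omega>. (\<integral>\<^sup>+s. sqn (indicator {0..t} s *\<^sub>R h s \<omega>) \<partial>lborel) \<partial>P) < \<infinity>"
      using ht process_dist_eq[of P t h "\<lambda>_ _. 0"] by (simp add: L2_process_iff)
  qed (simp_all add: emeasure_lborel_Icc_eq)
qed

lemma drift_continuous:
  assumes h: "h \<in> L2_process P F 0 T"
  shows "AE \<omega> in P. continuous_on {0..T} (\<lambda>t. drift h t \<omega>)"
  using drift_integrable[OF h]
proof eventually_elim
  fix \<omega> assume i: "set_integrable lborel {0..T} (\<lambda>s. h s \<omega>)"
  have "continuous_on {0..T} (\<lambda>t. integral {0..t} (\<lambda>s. h s \<omega>))"
    by (rule indefinite_integral_continuous_1) (rule set_borel_integral_eq_integral(1)[OF i])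
  then show "continuous_on {0..T} (\<lambda>t. drift h t \<omega>)"
  proof (rule continuous_on_eq)
    fix t assume "t \<in> {0..T}"
    then have "set_integrable lborel {0..t} (\<lambda>s. h s \<omega>)" by (intro set_integrable_subset[OF i]) auto
    then show "integral {0..t} (\<lambda>s. h s \<omega>) = drift h t \<omega>"
      unfolding drift_def by (rule set_borel_integral_eq_integral(2)[symmetric])
  qed
qed

text \<open>Cauchy-Schwarz on the interval \<open>[0, t]\<close>.\<close>

lemma drift_dist:
  assumes h: "h \<in> L2_process P F 0 T" and g: "g \<in> L2_process P F 0 T" and t: "t \<in> {0..T}"
  shows "(\<integral>\<^sup>+\<omega>. sqn (drift h t \<omega> - drift g t \<omega>) \<partial>P) \<le> ennreal T * process_dist P t h g"
proof -
  have t0: "0 \<le> t" "t \<le> T" using t by auto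
  have jm: "jointly_measurable P t h" "jointly_measurable P t g"
    by (rule jointly_measurable_mono[OF L2_process_jm[OF h] t0(2)],
        rule jointly_measurable_mono[OF L2_process_jm[OF g] t0(2)])
  note [measurable] = jm[THEN jointly_measurable_lborel]
  have "AE \<omega> in P. sqn (drift h t \<omega> - drift g t \<omega>) \<le>
      ennreal T * (\<integral>\<^sup>+s. sqn (indicator {0..t} s *\<^sub>R h s \<omega> - indicator {0..t} s *\<^sub>R g s \<omega>) \<partial>lborel)"
    using drift_integrable[OF h] drift_integrable[OF g] AE_space
  proof eventually_elim
    fix \<omega> assume i: "set_integrable lborel {0..T} (\<lambda>s. h s \<omega>)" "set_integrable lborel {0..T} (\<lambda>s. g s \<omega>)"
      and w: "\<omega> \<in> space P"
    have i': "set_integrable lborel {0..t} (\<lambda>s. h s \<omega>)" "set_integrable lborel {0..t} (\<lambda>s. g s \<omega>)"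
      using t0 by (auto intro: set_integrable_subset[OF i(1)] set_integrable_subset[OF i(2)])
    have "drift h t \<omega> - drift g t \<omega> = (LINT s:{0..t}|lborel. h s \<omega> - g s \<omega>)"
      unfolding drift_def using i' by (simp add: set_integral_diff)
    then have "sqn (drift h t \<omega> - drift g t \<omega>) = sqn (LINT s:{0..t}|lborel. h s \<omega> - g s \<omega>)" by simp
    also have "\<dots> \<le> emeasure lborel {0..t} * (\<integral>\<^sup>+s\<in>{0..t}. sqn (h s \<omega> - g s \<omega>) \<partial>lborel)"
    proof (rule sqn_set_integral_le)
      note [measurable] = section_measurable[OF jm(1) w] section_measurable[OF jm(2) w]
      have "(\<lambda>s. indicator {0..t} s *\<^sub>R h s \<omega> - indicator {0..t} s *\<^sub>R g s \<omega>) \<in> borel_measurable lborel"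
        by measurable
      then show "(\<lambda>s. indicator {0..t} s *\<^sub>R (h s \<omega> - g s \<omega>)) \<in> borel_measurable lborel"
        by (simp add: scaleR_diff_right)
    qed simp
    also have "\<dots> \<le> ennreal T * (\<integral>\<^sup>+s. sqn (indicator {0..t} s *\<^sub>R h s \<omega> - indicator {0..t} s *\<^sub>R g s \<omega>) \<partial>lborel)"
    proof (rule mult_mono)
      show "emeasure lborel {0..t} \<le> ennreal T" using t0 by (simp add: ennreal_leI)
    qed (auto intro!: nn_integral_mono simp: indicator_def)
    finally show "sqn (drift h t \<omega> - drift g t \<omega>) \<le>
      ennreal T * (\<integral>\<^sup>+s. sqn (indicator {0..t} s *\<^sub>R h s \<omega> - indicator {0..t} s *\<^sub>R g s \<omega>) \<partial>lborel)" .
  qed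
  then have "(\<integral>\<^sup>+\<omega>. sqn (drift h t \<omega> - drift g t \<omega>) \<partial>P) \<le>
      (\<integral>\<^sup>+\<omega>. ennreal T * (\<integral>\<^sup>+s. sqn (indicator {0..t} s *\<^sub>R h s \<omega> - indicator {0..t} s *\<^sub>R g s \<omega>) \<partial>lborel) \<partial>P)"
    by (rule nn_integral_mono_AE)
  also have "\<dots> = ennreal T * process_dist P t h g"
    unfolding process_dist_eq by (rule nn_integral_cmult) measurable
  finally show ?thesis .
qed

lemma zero_L2_process: "(\<lambda>_ _. 0 :: 'a::euclidean_space) \<in> L2_process P F 0 T"
  unfolding L2_process_iff by (auto simp: jointly_measurable_def process_dist_def)

lemma drift_moment:
  fixes h :: "real \<Rightarrow> 'w \<Rightarrow> 'a::euclidean_space"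
  assumes h: "h \<in> L2_process P F 0 T" and t: "t \<in> {0..T}"
  shows "(\<integral>\<^sup>+\<omega>. sqn (drift h t \<omega>) \<partial>P) \<le> ennreal T * process_dist P t h (\<lambda>_ _. 0)"
proof -
  have "drift (\<lambda>_ _. 0 :: 'a) t \<omega> = 0" for \<omega> by (simp add: drift_def set_lebesgue_integral_def)
  then show ?thesis using drift_dist[OF h zero_L2_process t] by simp
qed

lemma process_dist_at_zero: "process_dist P 0 h g = 0"
proof -
  have "(\<integral>\<^sup>+s\<in>{0..0}. sqn (h s \<omega> - g s \<omega>) \<partial>lborel) = 0" for \<omega>
  proof -
    have "(\<integral>\<^sup>+s\<in>{0..0}. sqn (h s \<omega> - g s \<omega>) \<partial>lborel) = (\<integral>\<^sup>+(s::real). 0 \<partial>lborel)"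
      by (rule nn_integral_cong_AE)
        (use AE_lborel_singleton[of "0::real"] in \<open>eventually_elim, auto simp: indicator_def\<close>)
    then show ?thesis by simp
  qed
  then show ?thesis by (simp add: process_dist_def)
qed

end

section \<open>The Picard step\<close>

locale asde_setting = advanced_setting P F W T \<delta> M \<alpha> \<phi>
  for P :: "'w measure" and F :: "real \<Rightarrow> 'w measure" and W :: "real \<Rightarrow> 'w \<Rightarrow> real ^ 'd"
    and T \<delta> M :: real and \<alpha> :: "real measure" and \<phi> :: "real \<Rightarrow> real \<Rightarrow> 'w \<Rightarrow> real" +
  fixes b :: "real \<Rightarrow> real ^ 'n \<Rightarrow> ('w \<Rightarrow> real ^ 'n) \<Rightarrow> 'w \<Rightarrow> real ^ 'n"
    and \<sigma> :: "real \<Rightarrow> real ^ 'n \<Rightarrow> ('w \<Rightarrow> real ^ 'n) \<Rightarrow> 'w \<Rightarrow> real ^ 'd ^ 'n"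
    and x0 :: "'w \<Rightarrow> real ^ 'n" and l :: "real \<Rightarrow> 'w \<Rightarrow> real ^ 'n"
    and C K :: real and L :: ennreal
  assumes b: "admissible C K b" and \<sigma>: "admissible C K \<sigma>"
    and x0: "x0 \<in> L2_rv P (F 0)"
    and l: "l \<in> adapted_process P F {T<..T + \<delta>}"
    and l_moment: "L < \<infinity>" "\<And>t. t \<in> {T<..T + \<delta>} \<Longrightarrow> (\<integral>\<^sup>+\<omega>. sqn (l t \<omega>) \<partial>P) \<le> L"
begin

lemma C_pos: "0 < C"
  using b by (simp add: admissible_def)

text \<open>One Picard iteration: \<open>x'\<close> solves the equation on \<open>[0, T]\<close> with the coefficients evaluated
  along \<open>x\<close>. It is a relation because the integrals determine \<open>x'\<close> only up to null
  sets.\<close>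

definition step :: "(real \<Rightarrow> 'w \<Rightarrow> real ^ 'n) \<Rightarrow> (real \<Rightarrow> 'w \<Rightarrow> real ^ 'n) \<Rightarrow> bool" where
  "step x x' \<longleftrightarrow> (\<forall>t\<in>{0..T}. \<exists>I. has_ito_integral P F W t (along \<sigma> x) I \<and>
      (AE \<omega> in P. x' t \<omega> = x0 \<omega> + drift (along b x) t \<omega> + I \<omega>))"

lemma ito_moment:
  fixes h :: "real \<Rightarrow> 'w \<Rightarrow> real ^ 'd ^ 'n"
  assumes "has_ito_integral P F W t h I" "t \<in> {0..T}"
  shows "(\<integral>\<^sup>+\<omega>. sqn (I \<omega>) \<partial>P) \<le> 12 * process_dist P T h (\<lambda>_ _. 0)"
proof -
  have t: "0 \<le> t" "t \<le> T" using assms(2) by auto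
  have "(\<integral>\<^sup>+\<omega>. sqn (I \<omega>) \<partial>P) \<le> 12 * process_dist P t h (\<lambda>_ _. 0)"
    using has_ito_integral_dist[OF t(1) assms(1) has_ito_integral_zero[OF t(1)]] by simp
  also have "\<dots> \<le> 12 * process_dist P T h (\<lambda>_ _. 0)"
    by (intro mult_left_mono process_dist_mono t(2)) simp
  finally show ?thesis .
qed

text \<open>Applies to the Picard iterates and, with \<open>h\<close> and \<open>g\<close> the coefficients along \<open>y\<close> itself,
  to any solution.\<close>

lemma equation_moment:
  fixes h :: "real \<Rightarrow> 'w \<Rightarrow> real ^ 'n" and g :: "real \<Rightarrow> 'w \<Rightarrow> real ^ 'd ^ 'n"
  assumes h: "h \<in> L2_process P F 0 T" and t: "t \<in> {0..T}" and I: "has_ito_integral P F W t g I"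
    and y: "AE \<omega> in P. y \<omega> = x0 \<omega> + drift h t \<omega> + I \<omega>"
  shows "(\<integral>\<^sup>+\<omega>. sqn (y \<omega>) \<partial>P) \<le> 3 * ((\<integral>\<^sup>+\<omega>. sqn (x0 \<omega>) \<partial>P) +
      ennreal T * process_dist P T h (\<lambda>_ _. 0) + 12 * process_dist P T g (\<lambda>_ _. 0))"
proof -
  have t0: "0 \<le> t" "t \<le> T" using t by auto
  note [measurable] = L2_rvD(2)[OF x0 order_refl] measurable_F_P[OF t0(1) drift_measurable[OF h t]]
  have [measurable]: "I \<in> borel_measurable P"
    using I by (intro L2_rvD(2)[OF _ t0(1)]) (simp add: has_ito_integral_def)
  have "(\<integral>\<^sup>+\<omega>. sqn (y \<omega>) \<partial>P) = (\<integral>\<^sup>+\<omega>. sqn (x0 \<omega> + drift h t \<omega> + I \<omega>) \<partial>P)"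
    using y by (intro nn_integral_cong_AE, eventually_elim) simp
  also have "\<dots> \<le> (\<integral>\<^sup>+\<omega>. 3 * (sqn (x0 \<omega>) + sqn (drift h t \<omega>) + sqn (I \<omega>)) \<partial>P)"
    by (intro nn_integral_mono sqn_add3_le)
  also have "\<dots> = 3 * ((\<integral>\<^sup>+\<omega>. sqn (x0 \<omega>) \<partial>P) + (\<integral>\<^sup>+\<omega>. sqn (drift h t \<omega>) \<partial>P) + (\<integral>\<^sup>+\<omega>. sqn (I \<omega>) \<partial>P))"
    by (simp add: nn_integral_cmult nn_integral_add)
  also have "\<dots> \<le> 3 * ((\<integral>\<^sup>+\<omega>. sqn (x0 \<omega>) \<partial>P) +
      ennreal T * process_dist P T h (\<lambda>_ _. 0) + 12 * process_dist P T g (\<lambda>_ _. 0))"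
  proof (intro mult_left_mono add_mono order_refl)
    show "(\<integral>\<^sup>+\<omega>. sqn (drift h t \<omega>) \<partial>P) \<le> ennreal T * process_dist P T h (\<lambda>_ _. 0)"
      by (rule order_trans[OF drift_moment[OF h t] mult_left_mono[OF process_dist_mono[OF t0(2)]]]) simp
    show "(\<integral>\<^sup>+\<omega>. sqn (I \<omega>) \<partial>P) \<le> 12 * process_dist P T g (\<lambda>_ _. 0)"
      by (rule ito_moment[OF I t])
  qed simp
  finally show ?thesis .
qed

text \<open>The initial value, the drift and the continuous version of the Ito integral add up to a continuous
  adapted process on \<open>[0, T]\<close>, which is continued by \<open>l\<close>.\<close>

lemma step_exists:
  assumes x: "bounded_process x"
  obtains x' where "bounded_process x'" "step x x'" "AE \<omega> in P. continuous_on {0..T} (\<lambda>t. x' t \<omega>)"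
    "AE \<omega> in P. x' 0 \<omega> = x0 \<omega>" "\<And>t \<omega>. t \<in> {T<..T + \<delta>} \<Longrightarrow> x' t \<omega> = l t \<omega>"
proof -
  let ?h = "along b x" and ?g = "along \<sigma> x"
  note h = along_L2_process[OF b x] and g = along_L2_process[OF \<sigma> x]
  obtain I where Ic: "\<And>\<omega>. \<omega> \<in> space P \<Longrightarrow> continuous_on {0..T} (\<lambda>t. I t \<omega>)"
    and I: "\<And>t. t \<in> {0..T} \<Longrightarrow> has_ito_integral P F W t ?g (I t)"
    using ito_integral_exists[OF T_pos g] by blast
  obtain N where N0: "\<And>\<omega>. \<omega> \<in> space P - N \<Longrightarrow> continuous_on {0..T} (\<lambda>t. drift ?h t \<omega>)" and N: "N \<in> null_sets P"
    by (rule AE_E3[OF drift_continuous[OF h]]) (rule that; assumption)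
  \<comment> \<open>Continuity of every path, and not just of almost every one, gives joint measurability.\<close>
  define y where "y t \<omega> = (if \<omega> \<in> N then 0 else x0 \<omega> + drift ?h t \<omega> + I t \<omega>)" for t \<omega>
  define x' where "x' t \<omega> = (if t \<le> T then y t \<omega> else l t \<omega>)" for t \<omega>
  have yeq: "AE \<omega> in P. x0 \<omega> + drift ?h t \<omega> + I t \<omega> = y t \<omega>" for t
    using AE_not_in[OF N] by eventually_elim (simp add: y_def)
  have yc: "continuous_on {0..T} (\<lambda>t. y t \<omega>)" if "\<omega> \<in> space P" for \<omega>
  proof (cases "\<omega> \<in> N")
    case False
    then show ?thesis using N0[of \<omega>] Ic[OF that] that
      by (auto simp: y_def intro!: continuous_on_add continuous_on_const)
  qed (simp add: y_def)
  have yF: "y t \<in> borel_measurable (F t)" if t: "t \<in> {0..T}" for t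
  proof (rule measurable_F_AE_eq[OF _ _ yeq])
    show t0: "0 \<le> t" using t by simp
    have "I t \<in> borel_measurable (F t)"
      using I[OF t] by (intro L2_rvD(1)[OF _ t0]) (simp add: has_ito_integral_def)
    then show "(\<lambda>\<omega>. x0 \<omega> + drift ?h t \<omega> + I t \<omega>) \<in> borel_measurable (F t)"
      by (intro borel_measurable_add drift_measurable[OF h t]
          measurable_F_mono[OF L2_rvD(1)[OF x0 order_refl] order_refl t0])
  qed
  have yP: "y t \<in> borel_measurable P" if "t \<in> {0..T}" for t
    by (rule measurable_F_P[OF _ yF[OF that]]) (use that in simp)
  have yj: "jointly_measurable P T y"
    unfolding jointly_measurable_iff
    by (rule continuous_process_measurable[OF _ yP yc]) (use T_pos in simp_all)
  have lj: "(\<lambda>(t, \<omega>). indicator {T<..T + \<delta>} t *\<^sub>R l t \<omega>) \<in> borel_measurable (borel \<Otimes>\<^sub>M P)"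
    using l restrict_pair_measurable_iff[of "{T<..T + \<delta>}" borel l P] by (simp add: adapted_process_def)
  have xj: "jointly_measurable P (T + \<delta>) x'"
  proof -
    note [measurable] = lj yj[unfolded jointly_measurable_def]
    have "(\<lambda>(t, \<omega>). indicator {0..T} t *\<^sub>R y t \<omega> + indicator {T<..T + \<delta>} t *\<^sub>R l t \<omega>) \<in> borel_measurable (borel \<Otimes>\<^sub>M P)"
      by measurable
    moreover have "indicator {0..T} t *\<^sub>R y t \<omega> + indicator {T<..T + \<delta>} t *\<^sub>R l t \<omega> =
        indicator {0..T + \<delta>} t *\<^sub>R x' t \<omega>" for t \<omega>
      using T_pos \<delta>_pos by (auto simp: x'_def indicator_def)
    ultimately show ?thesis unfolding jointly_measurable_def by simp
  qed
  have xF: "x' t \<in> borel_measurable (F t)" if "t \<in> {0..T + \<delta>}" for t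
  proof (cases "t \<le> T")
    case True
    then show ?thesis using yF[of t] that by (simp add: x'_def[abs_def])
  next
    case False
    then have "l t \<in> borel_measurable (F t)" using l that by (simp add: adapted_process_def)
    then show ?thesis using False by (simp add: x'_def[abs_def])
  qed
  have steq: "AE \<omega> in P. x' t \<omega> = x0 \<omega> + drift ?h t \<omega> + I t \<omega>" if "t \<in> {0..T}" for t
    using yeq[of t] by eventually_elim (use that in \<open>simp add: x'_def\<close>)
  let ?B = "3 * ((\<integral>\<^sup>+\<omega>. sqn (x0 \<omega>) \<partial>P) + ennreal T * process_dist P T ?h (\<lambda>_ _. 0) + 12 * process_dist P T ?g (\<lambda>_ _. 0))"
  have m1: "(\<integral>\<^sup>+\<omega>. sqn (x' t \<omega>) \<partial>P) \<le> ?B" if "t \<in> {0..T}" for t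
    by (rule equation_moment[OF h that I[OF that] steq[OF that]])
  have m2: "(\<integral>\<^sup>+\<omega>. sqn (x' t \<omega>) \<partial>P) \<le> L" if "t \<in> {T<..T + \<delta>}" for t
    using l_moment(2)[OF that] that by (simp add: x'_def)
  have "(\<integral>\<^sup>+\<omega>. sqn (x' t \<omega>) \<partial>P) \<le> ?B + L" if "t \<in> {0..T + \<delta>}" for t
  proof (cases "t \<le> T")
    case True
    with m1[of t] that show ?thesis by (intro order_trans[OF _ add_increasing2]) auto
  next
    case False
    with m2[of t] that show ?thesis by (intro order_trans[OF _ add_increasing]) auto
  qed
  moreover have "?B + L < \<infinity>"
    using l_moment(1) h g L2_rvD(3)[OF x0 order_refl] by (simp add: L2_process_iff ennreal_mult_less_top)
  ultimately have "\<exists>B<\<infinity>. \<forall>t\<in>{0..T + \<delta>}. (\<integral>\<^sup>+\<omega>. sqn (x' t \<omega>) \<partial>P) \<le> B" by blast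
  then have bx: "bounded_process x'" using xj xF by (simp add: bounded_process_def)
  have T0: "0 \<in> {0..T}" using T_pos by simp
  show thesis
  proof (rule that[OF bx])
    show "step x x'" unfolding step_def using I steq by blast
    show "AE \<omega> in P. continuous_on {0..T} (\<lambda>t. x' t \<omega>)"
      using AE_space by eventually_elim (rule continuous_on_eq[OF yc], auto simp: x'_def)
    show "x' t \<omega> = l t \<omega>" if "t \<in> {T<..T + \<delta>}" for t \<omega> using that by (simp add: x'_def)
    have "(\<integral>\<^sup>+\<omega>. sqn (I 0 \<omega>) \<partial>P) \<le> 12 * process_dist P 0 ?g (\<lambda>_ _. 0)"
      using has_ito_integral_dist[OF order_refl I[OF T0] has_ito_integral_zero[OF order_refl]] by simp
    moreover have "I 0 \<in> borel_measurable P"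
      using I[OF T0] by (intro L2_rvD(2)[OF _ order_refl]) (simp add: has_ito_integral_def)
    ultimately have "AE \<omega> in P. I 0 \<omega> = 0"
      by (simp add: process_dist_at_zero nn_integral_0_iff_AE)
    moreover have "drift ?h 0 \<omega> = 0" for \<omega>
      unfolding drift_def set_lebesgue_integral_def
      by (rule integral_eq_zero_AE)
        (use AE_lborel_singleton[of "0::real"] in \<open>eventually_elim, simp\<close>)
    ultimately show "AE \<omega> in P. x' 0 \<omega> = x0 \<omega>"
      using steq[OF T0] by (auto elim: eventually_elim2)
  qed
qed

text \<open>The drift contributes \<open>T\<close> and the Ito integral \<open>12\<close> times the squared distance of the
  coefficients, which is \<open>2 C\<^sup>2\<close> times that of the processes and their advanced terms; splitting
  the sum of drift and Ito integral doubles this.\<close>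

lemma step_dist:
  assumes x: "bounded_process x" and y: "bounded_process y" and sx: "step x x'" and sy: "step y y'"
    and t: "t \<in> {0..T}"
  shows "(\<integral>\<^sup>+\<omega>. sqn (x' t \<omega> - y' t \<omega>) \<partial>P) \<le>
    ennreal (4 * (T + 12) * C\<^sup>2) * (process_dist P t x y + process_dist P t (Z x) (Z y))"
proof -
  have t0: "0 \<le> t" "t \<le> T" using t by auto
  let ?d = "process_dist P t x y + process_dist P t (Z x) (Z y)"
  note hx = along_L2_process[OF b x] and hy = along_L2_process[OF b y]
  obtain I where I: "has_ito_integral P F W t (along \<sigma> x) I"
    "AE \<omega> in P. x' t \<omega> = x0 \<omega> + drift (along b x) t \<omega> + I \<omega>"
    using sx t unfolding step_def by blast
  obtain J where J: "has_ito_integral P F W t (along \<sigma> y) J"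
    "AE \<omega> in P. y' t \<omega> = x0 \<omega> + drift (along b y) t \<omega> + J \<omega>"
    using sy t unfolding step_def by blast
  note [measurable] = measurable_F_P[OF t0(1) drift_measurable[OF hx t]] measurable_F_P[OF t0(1) drift_measurable[OF hy t]]
  have [measurable]: "I \<in> borel_measurable P" "J \<in> borel_measurable P"
    using I(1) J(1) L2_rvD(2)[OF _ t0(1)] by (auto simp: has_ito_integral_def)
  have "(\<integral>\<^sup>+\<omega>. sqn (x' t \<omega> - y' t \<omega>) \<partial>P) \<le>
      (\<integral>\<^sup>+\<omega>. 2 * (sqn (drift (along b x) t \<omega> - drift (along b y) t \<omega>) + sqn (I \<omega> - J \<omega>)) \<partial>P)"
  proof (rule nn_integral_mono_AE)
    show "AE \<omega> in P. sqn (x' t \<omega> - y' t \<omega>) \<le> 2 * (sqn (drift (along b x) t \<omega> - drift (along b y) t \<omega>) + sqn (I \<omega> - J \<omega>))"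
      using I(2) J(2)
    proof eventually_elim
      fix \<omega> assume 1: "x' t \<omega> = x0 \<omega> + drift (along b x) t \<omega> + I \<omega>" "y' t \<omega> = x0 \<omega> + drift (along b y) t \<omega> + J \<omega>"
      have "x' t \<omega> - y' t \<omega> = (drift (along b x) t \<omega> - drift (along b y) t \<omega>) + (I \<omega> - J \<omega>)"
        unfolding 1 by (simp add: algebra_simps)
      then show "sqn (x' t \<omega> - y' t \<omega>) \<le> 2 * (sqn (drift (along b x) t \<omega> - drift (along b y) t \<omega>) + sqn (I \<omega> - J \<omega>))"
        by (simp only: sqn_add_le)
    qed
  qed
  also have "\<dots> = 2 * ((\<integral>\<^sup>+\<omega>. sqn (drift (along b x) t \<omega> - drift (along b y) t \<omega>) \<partial>P) + (\<integral>\<^sup>+\<omega>. sqn (I \<omega> - J \<omega>) \<partial>P))"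
    by (subst nn_integral_cmult, measurable, subst nn_integral_add, measurable)
  also have "\<dots> \<le> 2 * (ennreal T * (ennreal (2 * C\<^sup>2) * ?d) + 12 * (ennreal (2 * C\<^sup>2) * ?d))"
  proof (intro mult_left_mono add_mono)
    show "(\<integral>\<^sup>+\<omega>. sqn (drift (along b x) t \<omega> - drift (along b y) t \<omega>) \<partial>P) \<le> ennreal T * (ennreal (2 * C\<^sup>2) * ?d)"
      by (rule order_trans[OF drift_dist[OF hx hy t] mult_left_mono[OF along_process_dist[OF b x y t]]]) simp
    show "(\<integral>\<^sup>+\<omega>. sqn (I \<omega> - J \<omega>) \<partial>P) \<le> 12 * (ennreal (2 * C\<^sup>2) * ?d)"
      by (rule order_trans[OF has_ito_integral_dist[OF t0(1) I(1) J(1)] mult_left_mono[OF along_process_dist[OF \<sigma> x y t]]]) simp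
  qed simp
  also have "\<dots> = (2 * (ennreal T + 12) * ennreal (2 * C\<^sup>2)) * ?d"
    by (simp only: distrib_right distrib_left mult.assoc add_ac)
  also have "2 * (ennreal T + 12) * ennreal (2 * C\<^sup>2) = ennreal (2 * (T + 12) * (2 * C\<^sup>2))"
    using T_pos by (simp only: ennreal_mult ennreal_plus ennreal_numeral zero_le_numeral less_imp_le
        add_nonneg_nonneg mult_nonneg_nonneg zero_le_power2)
  also have "2 * (T + 12) * (2 * C\<^sup>2) = 4 * (T + 12) * C\<^sup>2" by simp
  finally show ?thesis .
qed

end

section \<open>Contraction for a small delay\<close>

lemma ennreal_geometric_zero:
  fixes X :: ennreal
  assumes "\<And>n. X \<le> ennreal (c * (1 / 4) ^ n)"
  shows "X = 0"
proof -
  have "(\<lambda>n. ennreal (c * (1 / 4) ^ n)) \<longlonglongrightarrow> ennreal (c * 0)"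
    by (intro tendsto_intros LIMSEQ_realpow_zero) auto
  from LIMSEQ_le_const[OF this] have "X \<le> ennreal (c * 0)" using assms by blast
  then show ?thesis by simp
qed

lemma AE_eq_of_L2_zero:
  fixes X Y :: "'w \<Rightarrow> 'a::euclidean_space"
  assumes "X \<in> borel_measurable M" "Y \<in> borel_measurable M" "(\<integral>\<^sup>+\<omega>. sqn (X \<omega> - Y \<omega>) \<partial>M) = 0"
  shows "AE \<omega> in M. X \<omega> = Y \<omega>"
  using assms by (subst (asm) nn_integral_0_iff_AE) auto

context advanced_setting
begin

text \<open>A point \<open>u\<close> lies in the window of \<open>s\<close> only for \<open>s\<close> in \<open>[u - \<delta>, u]\<close>. After exchanging
  the integrals this gives the factor \<open>\<delta>\<close>, the only place where a small delay helps.\<close>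

lemma window_integral:
  assumes t: "t \<in> {0..T}"
  shows "(\<integral>\<^sup>+s\<in>{0..t}. emeasure \<alpha> {s..s + \<delta>} \<partial>lborel) \<le> ennreal \<delta> * emeasure \<alpha> {0..T + \<delta>}"
proof -
  interpret pair_sigma_finite lborel \<alpha> ..
  let ?f = "\<lambda>s u. indicator {0..t} s * indicator {s..s + \<delta>} u :: ennreal"
  let ?D = "{(s, u). s \<in> {0..t} \<and> u \<in> {s..s + \<delta>}}"
  have "closed {z. (0 \<le> fst z \<and> fst z \<le> t) \<and> (fst z \<le> snd z \<and> snd z \<le> fst z + \<delta>)}"
    by (intro closed_Collect_conj closed_Collect_le continuous_intros)
  moreover have "{z. (0 \<le> fst z \<and> fst z \<le> t) \<and> (fst z \<le> snd z \<and> snd z \<le> fst z + \<delta>)} = ?D" by auto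
  ultimately have "?D \<in> sets borel" by simp
  moreover have "sets (lborel \<Otimes>\<^sub>M \<alpha>) = sets (borel :: (real \<times> real) measure)"
    unfolding borel_prod[symmetric] by (intro sets_pair_measure_cong sets_\<alpha>) simp
  ultimately have "?D \<in> sets (lborel \<Otimes>\<^sub>M \<alpha>)" by simp
  then have D: "(indicator ?D :: _ \<Rightarrow> ennreal) \<in> borel_measurable (lborel \<Otimes>\<^sub>M \<alpha>)"
    by (rule borel_measurable_indicator)
  have f: "(indicator ?D :: _ \<Rightarrow> ennreal) = (\<lambda>(s, u). ?f s u)"
    by (rule ext) (auto simp: indicator_def)
  note m = D[unfolded f]
  have "(\<integral>\<^sup>+s\<in>{0..t}. emeasure \<alpha> {s..s + \<delta>} \<partial>lborel) = (\<integral>\<^sup>+s. (\<integral>\<^sup>+u. ?f s u \<partial>\<alpha>) \<partial>lborel)"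
  proof (rule nn_integral_cong)
    fix s
    show "emeasure \<alpha> {s..s + \<delta>} * indicator {0..t} s = (\<integral>\<^sup>+u. ?f s u \<partial>\<alpha>)"
      by (subst nn_integral_cmult_indicator) (auto simp: sets_\<alpha> mult.commute)
  qed
  also have "\<dots> = (\<integral>\<^sup>+u. (\<integral>\<^sup>+s. ?f s u \<partial>lborel) \<partial>\<alpha>)"
    by (rule Fubini'[OF m, symmetric])
  also have "\<dots> \<le> (\<integral>\<^sup>+u. ennreal \<delta> * indicator {0..T + \<delta>} u \<partial>\<alpha>)"
  proof (rule nn_integral_mono)
    fix u
    show "(\<integral>\<^sup>+s. ?f s u \<partial>lborel) \<le> ennreal \<delta> * indicator {0..T + \<delta>} u"
    proof (cases "u \<in> {0..T + \<delta>}")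
      case True
      have "(\<integral>\<^sup>+s. ?f s u \<partial>lborel) \<le> (\<integral>\<^sup>+s. indicator {u - \<delta>..u} s \<partial>lborel)"
        by (intro nn_integral_mono) (auto simp: indicator_def)
      also have "\<dots> = ennreal \<delta>" using \<delta>_pos by simp
      finally show ?thesis using True by simp
    next
      case False
      then have "?f s u = 0" for s using t by (auto simp: indicator_def)
      then have "(\<integral>\<^sup>+s. ?f s u \<partial>lborel) = (\<integral>\<^sup>+(s::real). 0 \<partial>lborel)" by (intro nn_integral_cong)
      also have "\<dots> = 0" by simp
      finally show ?thesis by (simp only: zero_le)
    qed
  qed
  also have "\<dots> = ennreal \<delta> * emeasure \<alpha> {0..T + \<delta>}"
    by (rule nn_integral_cmult_indicator) (simp add: sets_\<alpha>)
  finally show ?thesis .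
qed

end

text \<open>The constant \<open>\<kappa>\<close> is the one of a Picard step. Distances are measured with the weight
  \<open>exp (\<beta> t)\<close>. The choice \<open>\<beta> = 8 \<kappa>\<close> and the smallness of \<open>\<delta>\<close> make the two terms of the
  estimate of a step contribute a factor \<open>1/8\<close> each.\<close>

locale small_delay_asde = asde_setting P F W T \<delta> M \<alpha> \<phi> b \<sigma> x0 l C K L
  for P :: "'w measure" and F :: "real \<Rightarrow> 'w measure" and W :: "real \<Rightarrow> 'w \<Rightarrow> real ^ 'd"
    and T \<delta> M :: real and \<alpha> :: "real measure" and \<phi> :: "real \<Rightarrow> real \<Rightarrow> 'w \<Rightarrow> real"
    and b :: "real \<Rightarrow> real ^ 'n \<Rightarrow> ('w \<Rightarrow> real ^ 'n) \<Rightarrow> 'w \<Rightarrow> real ^ 'n"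
    and \<sigma> :: "real \<Rightarrow> real ^ 'n \<Rightarrow> ('w \<Rightarrow> real ^ 'n) \<Rightarrow> 'w \<Rightarrow> real ^ 'd ^ 'n"
    and x0 :: "'w \<Rightarrow> real ^ 'n" and l :: "real \<Rightarrow> 'w \<Rightarrow> real ^ 'n"
    and C K :: real and L :: ennreal +
  fixes \<kappa> \<beta> a :: real
  assumes \<kappa>_def: "\<kappa> = 4 * (T + 12) * C\<^sup>2" and \<beta>_def: "\<beta> = 8 * \<kappa>" and a_def: "a = measure \<alpha> {0..T + \<delta>}"
    and small: "\<kappa> * M\<^sup>2 * a\<^sup>2 * exp (\<beta> * T) * \<delta> \<le> 1 / 8"
begin

lemma \<kappa>_pos: "0 < \<kappa>" and \<beta>_pos: "0 < \<beta>"
  using T_pos C_pos by (simp_all add: \<kappa>_def \<beta>_def)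

lemma a_eq: "emeasure \<alpha> {0..T + \<delta>} = ennreal a" and a_nonneg: "0 \<le> a"
  unfolding a_def using \<alpha>_finite by (simp_all add: emeasure_eq_ennreal_measure less_top)

text \<open>The distance of the processes enters through its integral over the past, which the exponential weight
  reduces by the factor \<open>1 / \<beta>\<close>. The distance of the advanced terms involves the future, where the
  weight works in the wrong direction: it is bounded by its value at \<open>T\<close>, and the factor \<open>\<delta>\<close>
  from \<open>window_integral\<close> makes up for it. After time \<open>T\<close> the two processes agree.\<close>

lemma step_contraction:
  assumes x: "bounded_process x" and y: "bounded_process y" and sx: "step x x'" and sy: "step y y'"
    and \<rho>: "0 \<le> \<rho>" and D: "\<And>u. u \<in> {0..T} \<Longrightarrow> (\<integral>\<^sup>+\<omega>. sqn (x u \<omega> - y u \<omega>) \<partial>P) \<le> ennreal (\<rho> * exp (\<beta> * u))"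
    and tail: "\<And>u. u \<in> {T<..T + \<delta>} \<Longrightarrow> AE \<omega> in P. x u \<omega> = y u \<omega>" and t: "t \<in> {0..T}"
  shows "(\<integral>\<^sup>+\<omega>. sqn (x' t \<omega> - y' t \<omega>) \<partial>P) \<le> ennreal (\<rho> / 4 * exp (\<beta> * t))"
proof -
  have t0: "0 \<le> t" "t \<le> T" using t by auto
  have jm: "jointly_measurable P t x" "jointly_measurable P t y"
    using x y t \<delta>_pos by (auto simp: bounded_process_def intro!: jointly_measurable_mono[of P "T + \<delta>"])
  have jZ: "jointly_measurable P t (Z x)" "jointly_measurable P t (Z y)"
    using x y by (auto simp: bounded_process_def intro!: jointly_measurable_mono[OF advanced_term_jointly_measurable t0(2)])
  have "process_dist P t x y = (\<integral>\<^sup>+s\<in>{0..t}. (\<integral>\<^sup>+\<omega>. sqn (x s \<omega> - y s \<omega>) \<partial>P) \<partial>lborel)"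
    by (rule process_dist_Fubini[OF prob_space_axioms jm])
  also have "\<dots> \<le> (\<integral>\<^sup>+s. ennreal (\<rho> * exp (\<beta> * s)) * indicator {0..t} s \<partial>lborel)"
    using D t by (intro nn_integral_mono) (auto simp: indicator_def)
  also have "\<dots> = ennreal (\<rho> * exp (\<beta> * t) / \<beta> - \<rho> * exp (\<beta> * 0) / \<beta>)"
    using \<rho> \<beta>_pos t0(1) by (intro nn_integral_FTC_Icc) (auto intro!: derivative_eq_intros)
  also have "\<dots> \<le> ennreal (\<rho> * exp (\<beta> * t) / \<beta>)"
    using \<rho> \<beta>_pos by (intro ennreal_leI) simp
  finally have pd1: "process_dist P t x y \<le> ennreal (\<rho> * exp (\<beta> * t) / \<beta>)" .
  \<comment> \<open>The largest value of the weighted bound, valid over the whole time range that the windows reach.\<close>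
  define q where "q = \<rho> * exp (\<beta> * T)"
  have q0: "0 \<le> q" using \<rho> by (simp add: q_def)
  have Dq: "(\<integral>\<^sup>+\<omega>. sqn (x u \<omega> - y u \<omega>) \<partial>P) \<le> ennreal q" if u: "u \<in> {0..T + \<delta>}" for u
  proof (cases "u \<le> T")
    case True
    then have "(\<integral>\<^sup>+\<omega>. sqn (x u \<omega> - y u \<omega>) \<partial>P) \<le> ennreal (\<rho> * exp (\<beta> * u))" using D u by simp
    also have "\<dots> \<le> ennreal q" unfolding q_def
      using \<rho> \<beta>_pos True by (intro ennreal_leI mult_left_mono) auto
    finally show ?thesis .
  next
    case False
    then have "(\<integral>\<^sup>+\<omega>. sqn (x u \<omega> - y u \<omega>) \<partial>P) = (\<integral>\<^sup>+\<omega>. 0 \<partial>P)"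
      using tail[of u] u by (intro nn_integral_cong_AE) (auto elim: eventually_mono)
    then show ?thesis by simp
  qed
  have ZD: "(\<integral>\<^sup>+\<omega>. sqn (Z x s \<omega> - Z y s \<omega>) \<partial>P) \<le> ennreal (M\<^sup>2) * ennreal a * (ennreal q * emeasure \<alpha> {s..s + \<delta>})"
    if s: "s \<in> {0..t}" for s
  proof -
    have "(\<integral>\<^sup>+\<omega>. sqn (Z x s \<omega> - Z y s \<omega>) \<partial>P) \<le>
        ennreal (M\<^sup>2) * ennreal a * (\<integral>\<^sup>+u\<in>{s..s + \<delta>}. (\<integral>\<^sup>+\<omega>. sqn (x u \<omega> - y u \<omega>) \<partial>P) \<partial>\<alpha>)"
      using advanced_term_dist[OF x y, of s] s t0 by (simp add: a_eq)
    also have "\<dots> \<le> ennreal (M\<^sup>2) * ennreal a * (\<integral>\<^sup>+u. ennreal q * indicator {s..s + \<delta>} u \<partial>\<alpha>)"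
      using Dq s t0 by (intro mult_left_mono nn_integral_mono) (auto simp: indicator_def)
    also have "(\<integral>\<^sup>+u. ennreal q * indicator {s..s + \<delta>} u \<partial>\<alpha>) = ennreal q * emeasure \<alpha> {s..s + \<delta>}"
      by (rule nn_integral_cmult_indicator) (simp add: sets_\<alpha>)
    finally show ?thesis .
  qed
  have wm: "(\<lambda>s. emeasure \<alpha> {s..s + \<delta>} * indicator {0..t} s) \<in> borel_measurable lborel"
  proof -
    have "closed {z :: real \<times> real. fst z \<le> snd z \<and> snd z \<le> fst z + \<delta>}"
      by (intro closed_Collect_conj closed_Collect_le continuous_intros)
    then have "{z :: real \<times> real. fst z \<le> snd z \<and> snd z \<le> fst z + \<delta>} \<in> sets (borel \<Otimes>\<^sub>M borel)"
      unfolding borel_prod by (rule borel_closed)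
    moreover have "sets (lborel \<Otimes>\<^sub>M \<alpha>) = sets (borel \<Otimes>\<^sub>M (borel :: real measure))"
      by (intro sets_pair_measure_cong sets_\<alpha>) simp
    ultimately have "{z :: real \<times> real. fst z \<le> snd z \<and> snd z \<le> fst z + \<delta>} \<in> sets (lborel \<Otimes>\<^sub>M \<alpha>)" by blast
    from \<alpha>.measurable_emeasure_Pair[OF this]
    have "(\<lambda>s. emeasure \<alpha> (Pair s -` {z :: real \<times> real. fst z \<le> snd z \<and> snd z \<le> fst z + \<delta>})) \<in> borel_measurable lborel" .
    moreover have "Pair s -` {z :: real \<times> real. fst z \<le> snd z \<and> snd z \<le> fst z + \<delta>} = {s..s + \<delta>}" for s by auto
    ultimately have [measurable]: "(\<lambda>s. emeasure \<alpha> {s..s + \<delta>}) \<in> borel_measurable lborel" by simp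
    show ?thesis by measurable
  qed
  have "process_dist P t (Z x) (Z y) = (\<integral>\<^sup>+s\<in>{0..t}. (\<integral>\<^sup>+\<omega>. sqn (Z x s \<omega> - Z y s \<omega>) \<partial>P) \<partial>lborel)"
    by (rule process_dist_Fubini[OF prob_space_axioms jZ])
  also have "\<dots> \<le> (\<integral>\<^sup>+s. (ennreal (M\<^sup>2) * ennreal a * ennreal q) * (emeasure \<alpha> {s..s + \<delta>} * indicator {0..t} s) \<partial>lborel)"
  proof (rule nn_integral_mono)
    fix s
    show "(\<integral>\<^sup>+\<omega>. sqn (Z x s \<omega> - Z y s \<omega>) \<partial>P) * indicator {0..t} s \<le>
        (ennreal (M\<^sup>2) * ennreal a * ennreal q) * (emeasure \<alpha> {s..s + \<delta>} * indicator {0..t} s)"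
      using ZD[of s] by (cases "s \<in> {0..t}") (simp_all add: mult.assoc)
  qed
  also have "\<dots> = (ennreal (M\<^sup>2) * ennreal a * ennreal q) * (\<integral>\<^sup>+s\<in>{0..t}. emeasure \<alpha> {s..s + \<delta>} \<partial>lborel)"
    by (rule nn_integral_cmult[OF wm])
  also have "\<dots> \<le> (ennreal (M\<^sup>2) * ennreal a * ennreal q) * (ennreal \<delta> * ennreal a)"
    using window_integral[OF t] by (intro mult_left_mono) (auto simp: a_eq)
  also have "\<dots> = ennreal (M\<^sup>2 * a * q * (\<delta> * a))"
    using a_nonneg q0 \<delta>_pos by (simp add: ennreal_mult)
  finally have pd2: "process_dist P t (Z x) (Z y) \<le> ennreal (M\<^sup>2 * a * q * (\<delta> * a))" .
  have "(\<integral>\<^sup>+\<omega>. sqn (x' t \<omega> - y' t \<omega>) \<partial>P) \<le> ennreal \<kappa> * (process_dist P t x y + process_dist P t (Z x) (Z y))"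
    using step_dist[OF x y sx sy t] by (simp only: \<kappa>_def)
  also have "\<dots> \<le> ennreal \<kappa> * (ennreal (\<rho> * exp (\<beta> * t) / \<beta>) + ennreal (M\<^sup>2 * a * q * (\<delta> * a)))"
    by (intro mult_left_mono add_mono pd1 pd2) simp
  also have "\<dots> = ennreal (\<kappa> * (\<rho> * exp (\<beta> * t) / \<beta> + M\<^sup>2 * a * q * (\<delta> * a)))"
    using \<kappa>_pos \<rho> \<beta>_pos a_nonneg q0 \<delta>_pos by (simp add: ennreal_mult ennreal_plus)
  also have "\<dots> \<le> ennreal (\<rho> / 4 * exp (\<beta> * t))"
  proof (rule ennreal_leI)
    have 1: "\<kappa> * (\<rho> * exp (\<beta> * t) / \<beta>) = \<rho> * exp (\<beta> * t) / 8" using \<kappa>_pos by (simp add: \<beta>_def)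
    have "\<kappa> * (M\<^sup>2 * a * q * (\<delta> * a)) = \<rho> * (\<kappa> * M\<^sup>2 * a\<^sup>2 * exp (\<beta> * T) * \<delta>)"
      by (simp add: q_def power2_eq_square mult_ac)
    also have "\<dots> \<le> \<rho> * (1 / 8)" by (intro mult_left_mono small \<rho>)
    also have "\<dots> \<le> \<rho> * (exp (\<beta> * t) / 8)" using \<rho> \<beta>_pos t0 by (intro mult_left_mono) auto
    finally show "\<kappa> * (\<rho> * exp (\<beta> * t) / \<beta> + M\<^sup>2 * a * q * (\<delta> * a)) \<le> \<rho> / 4 * exp (\<beta> * t)"
      using 1 by (simp add: distrib_left)
  qed
  finally show ?thesis .
qed

lemma bounded_process_dist_bound:
  assumes x: "bounded_process x" and y: "bounded_process (y :: real \<Rightarrow> 'w \<Rightarrow> real ^ 'n)"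
  obtains \<rho> where "0 \<le> \<rho>" "\<And>t. t \<in> {0..T + \<delta>} \<Longrightarrow> (\<integral>\<^sup>+\<omega>. sqn (x t \<omega> - y t \<omega>) \<partial>P) \<le> ennreal \<rho>"
proof -
  obtain B where B: "B < \<infinity>" "\<And>t. t \<in> {0..T + \<delta>} \<Longrightarrow> (\<integral>\<^sup>+\<omega>. sqn (x t \<omega>) \<partial>P) \<le> B"
    using x unfolding bounded_process_def by blast
  obtain B' where B': "B' < \<infinity>" "\<And>t. t \<in> {0..T + \<delta>} \<Longrightarrow> (\<integral>\<^sup>+\<omega>. sqn (y t \<omega>) \<partial>P) \<le> B'"
    using y unfolding bounded_process_def by blast
  have "2 * (B + B') < \<infinity>" using B B' by (simp add: ennreal_mult_less_top)
  then obtain \<rho> where \<rho>: "2 * (B + B') = ennreal \<rho>" "0 \<le> \<rho>" by (cases "2 * (B + B')") auto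
  have "(\<integral>\<^sup>+\<omega>. sqn (x t \<omega> - y t \<omega>) \<partial>P) \<le> ennreal \<rho>" if t: "t \<in> {0..T + \<delta>}" for t
  proof -
    have t0: "0 \<le> t" using t by simp
    note [measurable] = L2_rvD(2)[OF bounded_process_L2[OF x t] t0] L2_rvD(2)[OF bounded_process_L2[OF y t] t0]
    have "(\<integral>\<^sup>+\<omega>. sqn (x t \<omega> - y t \<omega>) \<partial>P) \<le> 2 * ((\<integral>\<^sup>+\<omega>. sqn (x t \<omega>) \<partial>P) + (\<integral>\<^sup>+\<omega>. sqn (y t \<omega>) \<partial>P))"
      using L2_dist_triangle[of "x t" P "\<lambda>_. 0" "y t"] by simp
    also have "\<dots> \<le> 2 * (B + B')" by (intro mult_left_mono add_mono B(2) B'(2) t) simp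
    finally show ?thesis by (simp only: \<rho>)
  qed
  then show thesis using that \<rho>(2) by blast
qed

text \<open>Iterating the contraction on a pair of fixed points, which are at finite distance, shows that the
  distance is \<open>0\<close>.\<close>

lemma fixed_point_unique:
  assumes x: "bounded_process x" and y: "bounded_process y" and sx: "step x x" and sy: "step y y"
    and tail: "\<And>u. u \<in> {T<..T + \<delta>} \<Longrightarrow> AE \<omega> in P. x u \<omega> = y u \<omega>" and t: "t \<in> {0..T}"
  shows "AE \<omega> in P. x t \<omega> = y t \<omega>"
proof -
  obtain \<rho> where \<rho>: "0 \<le> \<rho>" "\<And>t. t \<in> {0..T + \<delta>} \<Longrightarrow> (\<integral>\<^sup>+\<omega>. sqn (x t \<omega> - y t \<omega>) \<partial>P) \<le> ennreal \<rho>"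
    using bounded_process_dist_bound[OF x y] by blast
  have iter: "\<forall>t\<in>{0..T}. (\<integral>\<^sup>+\<omega>. sqn (x t \<omega> - y t \<omega>) \<partial>P) \<le> ennreal (\<rho> * (1 / 4) ^ n * exp (\<beta> * t))" for n
  proof (induction n)
    case 0
    show ?case
    proof
      fix t assume t: "t \<in> {0..T}"
      have "(\<integral>\<^sup>+\<omega>. sqn (x t \<omega> - y t \<omega>) \<partial>P) \<le> ennreal (\<rho> * 1)" using \<rho>(2)[of t] t \<delta>_pos by simp
      also have "\<dots> \<le> ennreal (\<rho> * exp (\<beta> * t))"
        using \<rho>(1) \<beta>_pos t by (intro ennreal_leI mult_left_mono) auto
      finally show "(\<integral>\<^sup>+\<omega>. sqn (x t \<omega> - y t \<omega>) \<partial>P) \<le> ennreal (\<rho> * (1 / 4) ^ 0 * exp (\<beta> * t))" by simp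
    qed
  next
    case (Suc n)
    show ?case
    proof
      fix t assume t: "t \<in> {0..T}"
      have "(\<integral>\<^sup>+\<omega>. sqn (x t \<omega> - y t \<omega>) \<partial>P) \<le> ennreal (\<rho> * (1 / 4) ^ n / 4 * exp (\<beta> * t))"
        by (rule step_contraction[OF x y sx sy _ _ tail t]) (use Suc \<rho>(1) in auto)
      then show "(\<integral>\<^sup>+\<omega>. sqn (x t \<omega> - y t \<omega>) \<partial>P) \<le> ennreal (\<rho> * (1 / 4) ^ Suc n * exp (\<beta> * t))" by simp
    qed
  qed
  have "(\<integral>\<^sup>+\<omega>. sqn (x t \<omega> - y t \<omega>) \<partial>P) \<le> ennreal (\<rho> * exp (\<beta> * t) * (1 / 4) ^ n)" for n
    using bspec[OF iter[of n] t] by (simp only: mult.assoc mult.commute[of "exp (\<beta> * t)"])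
  then have "(\<integral>\<^sup>+\<omega>. sqn (x t \<omega> - y t \<omega>) \<partial>P) = 0" by (rule ennreal_geometric_zero)
  then show ?thesis
    using t \<delta>_pos by (intro AE_eq_of_L2_zero L2_rvD(2)[OF bounded_process_L2[OF x]] L2_rvD(2)[OF bounded_process_L2[OF y]]) auto
qed

end

section \<open>The fixed point\<close>

text \<open>Almost surely the two paths agree at the countably many points of the grids of \<open>grid_tendsto\<close>, and
  hence everywhere by continuity.\<close>

lemma indistinguishable:
  fixes x y :: "real \<Rightarrow> 'w \<Rightarrow> 'a::metric_space"
  assumes T: "0 \<le> T" and c: "AE \<omega> in P. continuous_on {0..T} (\<lambda>t. x t \<omega>)" "AE \<omega> in P. continuous_on {0..T} (\<lambda>t. y t \<omega>)"
    and eq: "\<And>t. t \<in> {0..T} \<Longrightarrow> AE \<omega> in P. x t \<omega> = y t \<omega>"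
  shows "AE \<omega> in P. \<forall>t\<in>{0..T}. x t \<omega> = y t \<omega>"
proof -
  let ?g = "\<lambda>n (i::int). max 0 (min T (of_int i / real (Suc n)))"
  have "AE \<omega> in P. \<forall>n i. x (?g n i) \<omega> = y (?g n i) \<omega>"
    unfolding AE_all_countable by (intro allI, rule eq) (use T in auto)
  with c show ?thesis
  proof eventually_elim
    fix \<omega> assume c: "continuous_on {0..T} (\<lambda>t. x t \<omega>)" "continuous_on {0..T} (\<lambda>t. y t \<omega>)"
      and e: "\<forall>n i. x (?g n i) \<omega> = y (?g n i) \<omega>"
    show "\<forall>t\<in>{0..T}. x t \<omega> = y t \<omega>"
    proof
      fix t assume t: "t \<in> {0..T}"
      have lx: "(\<lambda>n. x (?g n \<lfloor>real (Suc n) * t\<rfloor>) \<omega>) \<longlonglongrightarrow> x t \<omega>"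
        by (rule continuous_on_tendsto_compose[OF c(1) grid_tendsto[OF t] t]) (use T in auto)
      have ly: "(\<lambda>n. y (?g n \<lfloor>real (Suc n) * t\<rfloor>) \<omega>) \<longlonglongrightarrow> y t \<omega>"
        by (rule continuous_on_tendsto_compose[OF c(2) grid_tendsto[OF t] t]) (use T in auto)
      have xy: "(\<lambda>n. x (?g n \<lfloor>real (Suc n) * t\<rfloor>) \<omega>) = (\<lambda>n. y (?g n \<lfloor>real (Suc n) * t\<rfloor>) \<omega>)"
        using e by blast
      show "x t \<omega> = y t \<omega>" by (rule LIMSEQ_unique[OF lx[unfolded xy] ly])
    qed
  qed
qed

context small_delay_asde
begin

text \<open>The sequence starts with a step from the zero process, so that all its members agree with
  \<open>l\<close> after time \<open>T\<close>.\<close>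

lemma picard_sequence:
  obtains X where "\<And>k. bounded_process (X k)" "\<And>k t \<omega>. t \<in> {T<..T + \<delta>} \<Longrightarrow> X k t \<omega> = l t \<omega>"
    "\<And>k. step (X k) (X (Suc k))"
proof -
  have "\<exists>X. \<forall>k. (bounded_process (X k) \<and> (\<forall>t\<in>{T<..T + \<delta>}. \<forall>\<omega>. X k t \<omega> = l t \<omega>)) \<and> step (X k) (X (Suc k))"
  proof (rule dependent_nat_choice)
    obtain x' where "bounded_process x'" "\<And>t \<omega>. t \<in> {T<..T + \<delta>} \<Longrightarrow> x' t \<omega> = l t \<omega>"
      by (rule step_exists[OF bounded_process_zero]) (rule that; assumption)
    then show "\<exists>x. bounded_process x \<and> (\<forall>t\<in>{T<..T + \<delta>}. \<forall>\<omega>. x t \<omega> = l t \<omega>)" by blast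
  next
    fix x and n :: nat
    assume x: "bounded_process x \<and> (\<forall>t\<in>{T<..T + \<delta>}. \<forall>\<omega>. x t \<omega> = l t \<omega>)"
    obtain x' where "bounded_process x'" "step x x'" "\<And>t \<omega>. t \<in> {T<..T + \<delta>} \<Longrightarrow> x' t \<omega> = l t \<omega>"
      by (rule step_exists[OF conjunct1[OF x]]) (rule that; assumption)
    then show "\<exists>y. (bounded_process y \<and> (\<forall>t\<in>{T<..T + \<delta>}. \<forall>\<omega>. y t \<omega> = l t \<omega>)) \<and> step x y" by blast
  qed
  then show thesis using that by blast
qed

text \<open>The iterates form a Cauchy sequence in mean square, uniformly in time, with geometric speed. At each
  time they converge almost surely as well, because the speed is summable; the pointwise limit is
  adapted and jointly measurable, and Fatou's lemma transfers the bounds to it.\<close>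

lemma picard_limit:
  obtains X y c where "\<And>k. bounded_process (X k)" "\<And>k. step (X k) (X (Suc k))"
    "\<And>k t \<omega>. t \<in> {T<..T + \<delta>} \<Longrightarrow> X k t \<omega> = l t \<omega>" "\<And>t \<omega>. t \<in> {T<..T + \<delta>} \<Longrightarrow> y t \<omega> = l t \<omega>"
    "bounded_process y" "0 \<le> c" "\<And>k t. t \<in> {0..T} \<Longrightarrow> (\<integral>\<^sup>+\<omega>. sqn (y t \<omega> - X k t \<omega>) \<partial>P) \<le> ennreal (c * (1 / 4) ^ k)"
proof -
  obtain X where X: "\<And>k. bounded_process (X k)" "\<And>k t \<omega>. t \<in> {T<..T + \<delta>} \<Longrightarrow> X k t \<omega> = l t \<omega>"
    "\<And>k. step (X k) (X (Suc k))"
    using picard_sequence by blast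
  define D where "D m k t = (\<integral>\<^sup>+\<omega>. sqn (X m t \<omega> - X k t \<omega>) \<partial>P)" for m k t
  have tail: "AE \<omega> in P. X m u \<omega> = X k u \<omega>" if "u \<in> {T<..T + \<delta>}" for m k u
    using X(2)[OF that] by simp
  have Xm: "X k t \<in> borel_measurable P" if "t \<in> {0..T + \<delta>}" for k t
    by (rule L2_rvD(2)[OF bounded_process_L2[OF X(1) that]]) (use that in simp)
  have sub: "t \<in> {0..T + \<delta>}" if "t \<in> {0..T}" for t using that \<delta>_pos by simp
  obtain \<rho> where \<rho>: "0 \<le> \<rho>" "\<And>t. t \<in> {0..T + \<delta>} \<Longrightarrow> D 1 0 t \<le> ennreal \<rho>"
    unfolding D_def using bounded_process_dist_bound[OF X(1) X(1)] by blast
  have contr: "\<forall>t\<in>{0..T}. D (Suc m) (Suc k) t \<le> ennreal (r / 4 * exp (\<beta> * t))"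
    if "\<forall>t\<in>{0..T}. D m k t \<le> ennreal (r * exp (\<beta> * t))" "0 \<le> r" for m k r
    using step_contraction[OF X(1) X(1) X(3) X(3) that(2) _ tail] that(1) unfolding D_def by blast
  \<comment> \<open>All iterates stay within a fixed distance of the first: \<open>2 * (4 \<rho> / 4 + \<rho>) = 4 \<rho>\<close> closes the induction.\<close>
  have D0: "\<forall>t\<in>{0..T}. D j 0 t \<le> ennreal (4 * \<rho> * exp (\<beta> * t))" for j
  proof (induction j)
    case 0
    show ?case by (simp add: D_def)
  next
    case (Suc j)
    show ?case
    proof
      fix t assume t: "t \<in> {0..T}"
      have e: "1 \<le> exp (\<beta> * t)" using \<beta>_pos t by simp
      have "D (Suc j) (Suc 0) t \<le> ennreal (4 * \<rho> / 4 * exp (\<beta> * t))"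
        using contr[OF Suc] \<rho>(1) t by simp
      moreover have "D 1 0 t \<le> ennreal (\<rho> * exp (\<beta> * t))"
        using order_trans[OF \<rho>(2)[OF sub[OF t]] ennreal_leI] mult_left_mono[OF e \<rho>(1)] by simp
      ultimately have "2 * (D (Suc j) 1 t + D 1 0 t) \<le> 2 * (ennreal (\<rho> * exp (\<beta> * t)) + ennreal (\<rho> * exp (\<beta> * t)))"
        by (intro mult_left_mono add_mono) auto
      also have "\<dots> = ennreal (4 * \<rho> * exp (\<beta> * t))"
        unfolding mult_2[symmetric] mult.assoc[symmetric] using \<rho>(1) by (simp add: ennreal_mult mult.assoc)
      finally have "2 * (D (Suc j) 1 t + D 1 0 t) \<le> ennreal (4 * \<rho> * exp (\<beta> * t))" .
      moreover have "D (Suc j) 0 t \<le> 2 * (D (Suc j) 1 t + D 1 0 t)"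
        unfolding D_def by (intro L2_dist_triangle Xm sub t)
      ultimately show "D (Suc j) 0 t \<le> ennreal (4 * \<rho> * exp (\<beta> * t))" by (rule order_trans[rotated])
    qed
  qed
  have Dk: "\<forall>t\<in>{0..T}. D (k + j) k t \<le> ennreal (4 * \<rho> * (1 / 4) ^ k * exp (\<beta> * t))" for k j
  proof (induction k)
    case 0
    show ?case using D0[of j] by simp
  next
    case (Suc k)
    show ?case using contr[OF Suc] \<rho>(1) by simp
  qed
  define c where "c = 4 * \<rho> * exp (\<beta> * T)"
  have c0: "0 \<le> c" using \<rho>(1) by (simp add: c_def)
  have Dc: "D m k t \<le> ennreal (c * (1 / 4) ^ k)" if "k \<le> m" "t \<in> {0..T}" for m k t
  proof -
    have "D m k t \<le> ennreal (4 * \<rho> * (1 / 4) ^ k * exp (\<beta> * t))"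
      using bspec[OF Dk[of k "m - k"] that(2)] that(1) by simp
    also have "\<dots> \<le> ennreal (4 * \<rho> * (1 / 4) ^ k * exp (\<beta> * T))"
      using \<rho>(1) \<beta>_pos that(2) by (intro ennreal_leI mult_left_mono) auto
    finally show ?thesis by (simp add: c_def mult_ac)
  qed
  define y where "y t \<omega> = lim (\<lambda>k. X k t \<omega>)" for t \<omega>
  have y_tail: "y t \<omega> = l t \<omega>" if "t \<in> {T<..T + \<delta>}" for t \<omega>
    unfolding y_def by (simp add: X(2)[OF that])
  have conv: "AE \<omega> in P. (\<lambda>k. X k t \<omega>) \<longlonglongrightarrow> y t \<omega>" if t: "t \<in> {0..T}" for t
  proof -
    note [measurable] = Xm[OF sub[OF t]]
    have bnd: "(\<integral>\<^sup>+\<omega>. ennreal (norm (X (Suc k) t \<omega> - X k t \<omega>)) \<partial>P) \<le> ennreal ((1 + c) * (1 / 2) ^ k)" for k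
    proof -
      have "(\<integral>\<^sup>+\<omega>. ennreal (norm (X (Suc k) t \<omega> - X k t \<omega>)) \<partial>P) \<le>
          (\<integral>\<^sup>+\<omega>. ennreal ((1 / 2) ^ k) + ennreal (2 ^ k) * sqn (X (Suc k) t \<omega> - X k t \<omega>) \<partial>P)"
      proof (rule nn_integral_mono)
        fix \<omega>
        let ?v = "norm (X (Suc k) t \<omega> - X k t \<omega>)"
        \<comment> \<open>The scaling by \<open>2 ^ k\<close> balances the two terms, since the mean of \<open>?v\<^sup>2\<close> is of order \<open>4\<^sup>-\<^sup>k\<close>.\<close>
        have "2 ^ k * ?v \<le> 1 + (2 ^ k * ?v)\<^sup>2"
          using norm_le_one_plus_square[of "2 ^ k * ?v"] by simp
        then have "(1 / 2) ^ k * (2 ^ k * ?v) \<le> (1 / 2) ^ k * (1 + (2 ^ k * ?v)\<^sup>2)"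
          by (intro mult_left_mono) auto
        also have "(1 / 2) ^ k * (2 ^ k * ?v) = ?v" by (simp add: power_one_over)
        also have "(1 / 2) ^ k * (1 + (2 ^ k * ?v)\<^sup>2) = (1 / 2) ^ k + 2 ^ k * ?v\<^sup>2"
          by (simp add: power_one_over power2_eq_square field_simps)
        finally have "ennreal ?v \<le> ennreal ((1 / 2) ^ k + 2 ^ k * ?v\<^sup>2)" by (rule ennreal_leI)
        then show "ennreal ?v \<le> ennreal ((1 / 2) ^ k) + ennreal (2 ^ k) * sqn (X (Suc k) t \<omega> - X k t \<omega>)"
          by (simp only: ennreal_plus ennreal_mult zero_le_power zero_le_numeral zero_le_divide_1_iff
              mult_nonneg_nonneg zero_le_power2)
      qed
      also have "\<dots> = ennreal ((1 / 2) ^ k) + ennreal (2 ^ k) * D (Suc k) k t"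
        unfolding D_def by (subst nn_integral_add, measurable, subst nn_integral_cmult, measurable)
          (simp add: emeasure_space_1)
      also have "\<dots> \<le> ennreal ((1 / 2) ^ k) + ennreal (2 ^ k) * ennreal (c * (1 / 4) ^ k)"
        using t by (intro add_left_mono mult_left_mono Dc) auto
      also have "\<dots> = ennreal ((1 / 2) ^ k + 2 ^ k * (c * (1 / 4) ^ k))"
        using c0 by (simp add: ennreal_plus ennreal_mult)
      also have "(1 / 2) ^ k + 2 ^ k * (c * (1 / 4) ^ k) = (1 + c) * (1 / 2) ^ k"
      proof -
        have "2 ^ k * (1 / 4 :: real) ^ k = (1 / 2) ^ k" by (simp add: power_mult_distrib[symmetric])
        then have "2 ^ k * (c * (1 / 4) ^ k) = c * (1 / 2) ^ k" by (simp only: mult.left_commute)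
        then show ?thesis by (simp add: distrib_right)
      qed
      finally show ?thesis .
    qed
    have "(\<integral>\<^sup>+\<omega>. (\<Sum>k. ennreal (norm (X (Suc k) t \<omega> - X k t \<omega>))) \<partial>P) =
        (\<Sum>k. \<integral>\<^sup>+\<omega>. ennreal (norm (X (Suc k) t \<omega> - X k t \<omega>)) \<partial>P)"
      by (rule nn_integral_suminf) measurable
    also have "\<dots> \<le> (\<Sum>k. ennreal ((1 + c) * (1 / 2) ^ k))"
      by (intro suminf_le bnd) auto
    also have "\<dots> = ennreal (\<Sum>k. (1 + c) * (1 / 2) ^ k)"
      using c0 by (intro suminf_ennreal2 summable_mult summable_geometric) auto
    also have "\<dots> < \<infinity>" by simp
    finally have "AE \<omega> in P. (\<Sum>k. ennreal (norm (X (Suc k) t \<omega> - X k t \<omega>))) \<noteq> \<infinity>"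
      by (intro nn_integral_PInf_AE) auto
    then show ?thesis
    proof eventually_elim
      fix \<omega> assume "(\<Sum>k. ennreal (norm (X (Suc k) t \<omega> - X k t \<omega>))) \<noteq> \<infinity>"
      then have "summable (\<lambda>k. norm (X (Suc k) t \<omega> - X k t \<omega>))"
        by (intro summable_suminf_not_top) auto
      then have "summable (\<lambda>k. X (Suc k) t \<omega> - X k t \<omega>)" by (rule summable_norm_cancel)
      then have "convergent (\<lambda>n. \<Sum>k<n. X (Suc k) t \<omega> - X k t \<omega>)" by (simp add: summable_iff_convergent)
      then have "convergent (\<lambda>n. X n t \<omega> - X 0 t \<omega>)" using sum_lessThan_telescope[of "\<lambda>k. X k t \<omega>"] by simp
      then obtain v where "(\<lambda>n. X n t \<omega> - X 0 t \<omega>) \<longlonglongrightarrow> v" by (auto simp: convergent_def)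
      from tendsto_add[OF this tendsto_const[of "X 0 t \<omega>"]]
      have "(\<lambda>n. X n t \<omega>) \<longlonglongrightarrow> v + X 0 t \<omega>" by simp
      then show "(\<lambda>k. X k t \<omega>) \<longlonglongrightarrow> y t \<omega>"
        unfolding y_def using convergent_LIMSEQ_iff convergentI by blast
    qed
  qed
  have yk: "(\<integral>\<^sup>+\<omega>. sqn (y t \<omega> - X k t \<omega>) \<partial>P) \<le> ennreal (c * (1 / 4) ^ k)" if t: "t \<in> {0..T}" for k t
    by (rule L2_Fatou[OF Xm[OF sub[OF t]] Xm[OF sub[OF t]] conv[OF t]]) (use Dc[OF _ t] in \<open>simp add: D_def\<close>)
  have yF: "y t \<in> borel_measurable (F t)" if t: "t \<in> {0..T + \<delta>}" for t
    unfolding y_def[abs_def]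
    by (intro borel_measurable_lim_metric) (use X(1) t in \<open>simp add: bounded_process_def\<close>)
  have yj: "jointly_measurable P (T + \<delta>) y"
  proof -
    have "(\<lambda>z. lim (\<lambda>k. indicator {0..T + \<delta>} (fst z) *\<^sub>R X k (fst z) (snd z))) \<in> borel_measurable (borel \<Otimes>\<^sub>M P)"
      by (intro borel_measurable_lim_metric)
        (use X(1) in \<open>simp add: bounded_process_def jointly_measurable_def case_prod_beta'\<close>)
    moreover have "lim (\<lambda>k. indicator {0..T + \<delta>} t *\<^sub>R X k t \<omega>) = indicator {0..T + \<delta>} t *\<^sub>R y t \<omega>" for t \<omega>
      by (cases "t \<in> {0..T + \<delta>}") (simp_all add: y_def)
    ultimately show ?thesis by (simp add: jointly_measurable_def case_prod_beta')
  qed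
  obtain B where B: "B < \<infinity>" "\<And>t. t \<in> {0..T + \<delta>} \<Longrightarrow> (\<integral>\<^sup>+\<omega>. sqn (X 0 t \<omega>) \<partial>P) \<le> B"
    using X(1)[of 0] unfolding bounded_process_def by blast
  have ym: "(\<integral>\<^sup>+\<omega>. sqn (y t \<omega>) \<partial>P) \<le> 2 * (ennreal c + B)" if t: "t \<in> {0..T + \<delta>}" for t
  proof -
    have t0: "0 \<le> t" using t by simp
    have d: "(\<integral>\<^sup>+\<omega>. sqn (y t \<omega> - X 0 t \<omega>) \<partial>P) \<le> ennreal c"
    proof (cases "t \<le> T")
      case True
      then show ?thesis using yk[of t 0] t by simp
    next
      case False
      then have "t \<in> {T<..T + \<delta>}" using t by simp
      then show ?thesis by (simp add: y_tail X(2))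
    qed
    have "(\<integral>\<^sup>+\<omega>. sqn (y t \<omega>) \<partial>P) \<le> 2 * ((\<integral>\<^sup>+\<omega>. sqn (y t \<omega> - X 0 t \<omega>) \<partial>P) + (\<integral>\<^sup>+\<omega>. sqn (X 0 t \<omega>) \<partial>P))"
      using L2_dist_triangle[OF measurable_F_P[OF t0 yF[OF t]] Xm[OF t, of 0] borel_measurable_const[of 0]] by simp
    also have "\<dots> \<le> 2 * (ennreal c + B)" by (intro mult_left_mono add_mono d B(2)[OF t]) simp
    finally show ?thesis .
  qed
  have "2 * (ennreal c + B) < \<infinity>" using B(1) by (simp add: ennreal_mult_less_top)
  then have yb: "bounded_process y" unfolding bounded_process_def using yj yF ym by blast
  show thesis by (rule that[OF X(1) X(3) X(2) y_tail yb c0 yk])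
qed

text \<open>The limit \<open>y\<close> of the iterates is obtained separately for every time, and its paths need not be
  continuous. The contraction shows that a step from \<open>y\<close> leads to a process \<open>x\<close> that agrees with
  \<open>y\<close> almost surely at each time and has continuous paths. A step from \<open>x\<close> leads to the same
  place as one from \<open>y\<close>, again by the contraction, now applied to processes at distance \<open>0\<close>.\<close>

lemma fixed_point_exists:
  obtains x where "bounded_process x" "step x x" "AE \<omega> in P. continuous_on {0..T} (\<lambda>t. x t \<omega>)"
    "AE \<omega> in P. x 0 \<omega> = x0 \<omega>" "\<And>t \<omega>. t \<in> {T<..T + \<delta>} \<Longrightarrow> x t \<omega> = l t \<omega>"
proof -
  obtain X y c where X: "\<And>k. bounded_process (X k)" "\<And>k. step (X k) (X (Suc k))"
    "\<And>k t \<omega>. t \<in> {T<..T + \<delta>} \<Longrightarrow> X k t \<omega> = l t \<omega>" and yl: "\<And>t \<omega>. t \<in> {T<..T + \<delta>} \<Longrightarrow> y t \<omega> = l t \<omega>"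
    and y: "bounded_process y" and c: "0 \<le> c"
    and yX: "\<And>k t. t \<in> {0..T} \<Longrightarrow> (\<integral>\<^sup>+\<omega>. sqn (y t \<omega> - X k t \<omega>) \<partial>P) \<le> ennreal (c * (1 / 4) ^ k)"
    by (rule picard_limit) (rule that; assumption)
  obtain x where x: "bounded_process x" "step y x" "AE \<omega> in P. continuous_on {0..T} (\<lambda>t. x t \<omega>)"
    "AE \<omega> in P. x 0 \<omega> = x0 \<omega>" "\<And>t \<omega>. t \<in> {T<..T + \<delta>} \<Longrightarrow> x t \<omega> = l t \<omega>"
    by (rule step_exists[OF y]) (rule that; assumption)
  have m: "z t \<in> borel_measurable P" if "bounded_process z" "t \<in> {0..T}" for z :: "real \<Rightarrow> 'w \<Rightarrow> real ^ 'n" and t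
    using that \<delta>_pos by (intro L2_rvD(2)[OF bounded_process_L2[OF that(1)]]) auto
  have xy: "AE \<omega> in P. x t \<omega> = y t \<omega>" if t: "t \<in> {0..T}" for t
  proof -
    have "(\<integral>\<^sup>+\<omega>. sqn (x t \<omega> - y t \<omega>) \<partial>P) \<le> ennreal (4 * c * exp (\<beta> * T) * (1 / 4) ^ k)" for k
    proof -
      let ?e = "c * exp (\<beta> * T) * (1 / 4) ^ k"
      have 1: "1 \<le> exp (\<beta> * t)" "exp (\<beta> * t) \<le> exp (\<beta> * T)" "1 \<le> exp (\<beta> * T)"
        using \<beta>_pos t T_pos by auto
      have "(\<integral>\<^sup>+\<omega>. sqn (x t \<omega> - X (Suc k) t \<omega>) \<partial>P) \<le> ennreal (c * (1 / 4) ^ k / 4 * exp (\<beta> * t))"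
      proof (rule step_contraction[OF y X(1) x(2) X(2) _ _ _ t])
        fix u assume u: "u \<in> {0..T}"
        have "c * (1 / 4) ^ k * 1 \<le> c * (1 / 4) ^ k * exp (\<beta> * u)"
          using u c \<beta>_pos by (intro mult_left_mono) auto
        then show "(\<integral>\<^sup>+\<omega>. sqn (y u \<omega> - X k u \<omega>) \<partial>P) \<le> ennreal (c * (1 / 4) ^ k * exp (\<beta> * u))"
          using order_trans[OF yX[OF u, of k] ennreal_leI] by simp
      qed (use c in \<open>simp_all add: yl X(3)\<close>)
      also have "\<dots> \<le> ennreal ?e"
      proof (rule ennreal_leI)
        have "c * (1 / 4) ^ k / 4 * exp (\<beta> * t) \<le> c * (1 / 4) ^ k * exp (\<beta> * T)"
          using c 1 by (intro mult_mono) auto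
        then show "c * (1 / 4) ^ k / 4 * exp (\<beta> * t) \<le> ?e" by (simp add: mult_ac)
      qed
      finally have a: "(\<integral>\<^sup>+\<omega>. sqn (x t \<omega> - X (Suc k) t \<omega>) \<partial>P) \<le> ennreal ?e" .
      have "(\<integral>\<^sup>+\<omega>. sqn (X (Suc k) t \<omega> - y t \<omega>) \<partial>P) \<le> ennreal (c * (1 / 4) ^ Suc k)"
        using yX[OF t, of "Suc k"] by (simp add: norm_minus_commute)
      also have "\<dots> \<le> ennreal ?e"
      proof (rule ennreal_leI)
        have "c * (1 / 4) ^ Suc k \<le> c * (1 / 4) ^ k * 1" using c by (simp add: mult_left_mono)
        also have "\<dots> \<le> c * (1 / 4) ^ k * exp (\<beta> * T)" using c 1 by (intro mult_left_mono) auto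
        finally show "c * (1 / 4) ^ Suc k \<le> ?e" by (simp add: mult_ac)
      qed
      finally have b: "(\<integral>\<^sup>+\<omega>. sqn (X (Suc k) t \<omega> - y t \<omega>) \<partial>P) \<le> ennreal ?e" .
      have "(\<integral>\<^sup>+\<omega>. sqn (x t \<omega> - y t \<omega>) \<partial>P) \<le> 2 * ((\<integral>\<^sup>+\<omega>. sqn (x t \<omega> - X (Suc k) t \<omega>) \<partial>P) + (\<integral>\<^sup>+\<omega>. sqn (X (Suc k) t \<omega> - y t \<omega>) \<partial>P))"
        by (intro L2_dist_triangle m x(1) X(1) y t)
      also have "\<dots> \<le> 2 * (ennreal ?e + ennreal ?e)" by (intro mult_left_mono add_mono a b) simp
      also have "\<dots> = ennreal (4 * ?e)"
        unfolding mult_2[symmetric] mult.assoc[of 2 2, symmetric] using c by (subst ennreal_mult) auto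
      finally show ?thesis by (simp add: mult.assoc)
    qed
    then have "(\<integral>\<^sup>+\<omega>. sqn (x t \<omega> - y t \<omega>) \<partial>P) = 0" by (rule ennreal_geometric_zero)
    then show ?thesis by (intro AE_eq_of_L2_zero m x(1) y t)
  qed
  obtain z where z: "bounded_process z" "step x z" by (rule step_exists[OF x(1)]) (rule that; assumption)
  have zx: "AE \<omega> in P. z t \<omega> = x t \<omega>" if t: "t \<in> {0..T}" for t
  proof -
    have "(\<integral>\<^sup>+\<omega>. sqn (z t \<omega> - x t \<omega>) \<partial>P) \<le> ennreal (0 / 4 * exp (\<beta> * t))"
    proof (rule step_contraction[OF x(1) y z(2) x(2) _ _ _ t])
      fix u assume "u \<in> {0..T}"
      from xy[OF this] have "(\<integral>\<^sup>+\<omega>. sqn (x u \<omega> - y u \<omega>) \<partial>P) = (\<integral>\<^sup>+\<omega>. 0 \<partial>P)"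
        by (intro nn_integral_cong_AE) (auto elim: eventually_mono)
      then show "(\<integral>\<^sup>+\<omega>. sqn (x u \<omega> - y u \<omega>) \<partial>P) \<le> ennreal (0 * exp (\<beta> * u))" by simp
    qed (simp_all add: yl x(5))
    then have "(\<integral>\<^sup>+\<omega>. sqn (z t \<omega> - x t \<omega>) \<partial>P) = 0" by simp
    then show ?thesis by (intro AE_eq_of_L2_zero m x(1) z t)
  qed
  have "step x x"
    unfolding step_def
  proof
    fix t assume t: "t \<in> {0..T}"
    obtain I where I: "has_ito_integral P F W t (along \<sigma> x) I" "AE \<omega> in P. z t \<omega> = x0 \<omega> + drift (along b x) t \<omega> + I \<omega>"
      using z(2) t unfolding step_def by blast
    have "AE \<omega> in P. x t \<omega> = x0 \<omega> + drift (along b x) t \<omega> + I \<omega>"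
      using I(2) zx[OF t] by eventually_elim simp
    with I(1) show "\<exists>I. has_ito_integral P F W t (along \<sigma> x) I \<and> (AE \<omega> in P. x t \<omega> = x0 \<omega> + drift (along b x) t \<omega> + I \<omega>)"
      by blast
  qed
  then show thesis using that x by blast
qed

end

section \<open>Existence and uniqueness of solutions\<close>

context asde_setting
begin

lemma along_unfold: "along f x = (\<lambda>t \<omega>. f t (x t \<omega>) (Z x t) \<omega>)"
  by (intro ext) (simp add: along_def)

lemma asde_solution_of_fixed_point:
  assumes x: "bounded_process x" and s: "step x x" and c: "AE \<omega> in P. continuous_on {0..T} (\<lambda>t. x t \<omega>)"
    and i: "AE \<omega> in P. x 0 \<omega> = x0 \<omega>" and tail: "\<And>t \<omega>. t \<in> {T<..T + \<delta>} \<Longrightarrow> x t \<omega> = l t \<omega>"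
  shows "asde_solution P F W T \<delta> \<alpha> \<phi> b \<sigma> x0 l x"
  unfolding asde_solution_def along_unfold[symmetric]
proof (intro conjI ballI)
  show "x \<in> L2_process P F 0 (T + \<delta>)" by (rule bounded_process_L2_process[OF x])
  show "AE \<omega> in P. continuous_on {0..T} (\<lambda>t. x t \<omega>)" by (rule c)
  show "AE \<omega> in P. set_integrable \<alpha> {t..t + \<delta>} (\<lambda>s. \<phi> t s \<omega> *\<^sub>R x s \<omega>)" if "t \<in> {0..T}" for t
    by (rule advanced_set_integrable[OF x that])
  show "Z x t \<in> L2_rv P (F (t + \<delta>))" if "t \<in> {0..T}" for t by (rule advanced_term_L2[OF x that])
  show "along b x \<in> L2_process P F 0 T" by (rule along_L2_process[OF b x])
  show "along \<sigma> x \<in> L2_process P F 0 T" by (rule along_L2_process[OF \<sigma> x])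
  show "AE \<omega> in P. x 0 \<omega> = x0 \<omega>" by (rule i)
  show "AE \<omega> in P. \<forall>t\<in>{T<..T + \<delta>}. x t \<omega> = l t \<omega>" using tail by simp
  fix t assume t: "t \<in> {0..T}"
  from bspec[OF s[unfolded step_def] t] obtain I where
    I: "has_ito_integral P F W t (along \<sigma> x) I" "AE \<omega> in P. x t \<omega> = x0 \<omega> + drift (along b x) t \<omega> + I \<omega>"
    by blast
  show "\<exists>I. has_ito_integral P F W t (along \<sigma> x) I \<and>
      (AE \<omega> in P. x t \<omega> = x0 \<omega> + (LINT s:{0..t}|lborel. b s (x s \<omega>) (Z x s) \<omega>) + I \<omega>)"
    using I unfolding drift_def along_def by blast
qed

text \<open>A solution is only required to be square integrable in time, but the equation itself bounds its
  second moment at every time.\<close>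

lemma fixed_point_of_asde_solution:
  assumes sol: "asde_solution P F W T \<delta> \<alpha> \<phi> b \<sigma> x0 l x"
  shows "bounded_process x" "step x x" "AE \<omega> in P. continuous_on {0..T} (\<lambda>t. x t \<omega>)"
    "AE \<omega> in P. \<forall>t\<in>{T<..T + \<delta>}. x t \<omega> = l t \<omega>"
proof -
  note s = sol[unfolded asde_solution_def along_unfold[symmetric]]
  show "AE \<omega> in P. continuous_on {0..T} (\<lambda>t. x t \<omega>)" using s by blast
  show tail: "AE \<omega> in P. \<forall>t\<in>{T<..T + \<delta>}. x t \<omega> = l t \<omega>" using s by blast
  have xL: "x \<in> L2_process P F 0 (T + \<delta>)" using s by blast
  have h: "along b x \<in> L2_process P F 0 T" and g: "along \<sigma> x \<in> L2_process P F 0 T" using s by blast+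
  have eq: "\<forall>t\<in>{0..T}. \<exists>I. has_ito_integral P F W t (along \<sigma> x) I \<and>
      (AE \<omega> in P. x t \<omega> = x0 \<omega> + drift (along b x) t \<omega> + I \<omega>)"
    using s unfolding drift_def along_def by blast
  then show "step x x" unfolding step_def .
  let ?B = "3 * ((\<integral>\<^sup>+\<omega>. sqn (x0 \<omega>) \<partial>P) + ennreal T * process_dist P T (along b x) (\<lambda>_ _. 0) +
    12 * process_dist P T (along \<sigma> x) (\<lambda>_ _. 0))"
  have "(\<integral>\<^sup>+\<omega>. sqn (x t \<omega>) \<partial>P) \<le> ?B + L" if t: "t \<in> {0..T + \<delta>}" for t
  proof (cases "t \<le> T")
    case True
    then have t': "t \<in> {0..T}" using t by simp
    from bspec[OF eq t'] obtain I where I: "has_ito_integral P F W t (along \<sigma> x) I"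
      "AE \<omega> in P. x t \<omega> = x0 \<omega> + drift (along b x) t \<omega> + I \<omega>" by blast
    show ?thesis by (rule order_trans[OF equation_moment[OF h t' I]]) simp
  next
    case False
    then have t': "t \<in> {T<..T + \<delta>}" using t by simp
    have "(\<integral>\<^sup>+\<omega>. sqn (x t \<omega>) \<partial>P) = (\<integral>\<^sup>+\<omega>. sqn (l t \<omega>) \<partial>P)"
      using tail by (intro nn_integral_cong_AE, eventually_elim) (simp add: t'[simplified])
    also have "\<dots> \<le> L" by (rule l_moment(2)[OF t'])
    also have "\<dots> \<le> ?B + L" by simp
    finally show ?thesis .
  qed
  moreover have "?B + L < \<infinity>"
    using l_moment(1) h g L2_rvD(3)[OF x0 order_refl] by (simp add: L2_process_iff ennreal_mult_less_top)
  ultimately have "\<exists>B<\<infinity>. \<forall>t\<in>{0..T + \<delta>}. (\<integral>\<^sup>+\<omega>. sqn (x t \<omega>) \<partial>P) \<le> B" by blast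
  then show "bounded_process x"
    using xL unfolding bounded_process_def L2_process_iff by blast
qed

end

context small_delay_asde
begin

lemma asde_solution_exists: "\<exists>x. asde_solution P F W T \<delta> \<alpha> \<phi> b \<sigma> x0 l x"
proof -
  obtain x where "bounded_process x" "step x x" "AE \<omega> in P. continuous_on {0..T} (\<lambda>t. x t \<omega>)"
    "AE \<omega> in P. x 0 \<omega> = x0 \<omega>" "\<And>t \<omega>. t \<in> {T<..T + \<delta>} \<Longrightarrow> x t \<omega> = l t \<omega>"
    by (rule fixed_point_exists) (rule that; assumption)
  from asde_solution_of_fixed_point[OF this] show ?thesis by blast
qed

lemma asde_solution_unique:
  assumes x: "asde_solution P F W T \<delta> \<alpha> \<phi> b \<sigma> x0 l x" and y: "asde_solution P F W T \<delta> \<alpha> \<phi> b \<sigma> x0 l y"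
  shows "AE \<omega> in P. \<forall>t\<in>{0..T + \<delta>}. x t \<omega> = y t \<omega>"
proof -
  note fx = fixed_point_of_asde_solution[OF x] and fy = fixed_point_of_asde_solution[OF y]
  have tail: "AE \<omega> in P. x u \<omega> = y u \<omega>" if "u \<in> {T<..T + \<delta>}" for u
    using fx(4) fy(4) by eventually_elim (simp add: that[simplified])
  have "AE \<omega> in P. \<forall>t\<in>{0..T}. x t \<omega> = y t \<omega>"
    by (rule indistinguishable[OF less_imp_le[OF T_pos] fx(3) fy(3)])
      (rule fixed_point_unique[OF fx(1) fy(1) fx(2) fy(2) tail])
  then show ?thesis using fx(4) fy(4)
  proof eventually_elim
    fix \<omega> assume 1: "\<forall>t\<in>{0..T}. x t \<omega> = y t \<omega>" "\<forall>t\<in>{T<..T + \<delta>}. x t \<omega> = l t \<omega>" "\<forall>t\<in>{T<..T + \<delta>}. y t \<omega> = l t \<omega>"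
    show "\<forall>t\<in>{0..T + \<delta>}. x t \<omega> = y t \<omega>"
    proof
      fix t assume "t \<in> {0..T + \<delta>}"
      then show "x t \<omega> = y t \<omega>" using 1 by (cases "t \<le> T") auto
    qed
  qed
qed

end

context complete_filtration
begin

text \<open>A random variable known at time \<open>r\<close> is the value at \<open>r\<close> of a square integrable adapted process.
  In this way the Lipschitz condition for processes yields the one for random variables.\<close>

lemma single_time_process:
  fixes \<xi> :: "'w \<Rightarrow> 'a::euclidean_space"
  assumes r: "r \<in> {t..u}" "0 \<le> t" and \<xi>: "\<xi> \<in> L2_rv P (F r)"
  shows "(\<lambda>s \<omega>. if s = r then \<xi> \<omega> else 0) \<in> L2_process P F t u"
proof -
  have r0: "0 \<le> r" using r by simp
  note [measurable] = L2_rvD(2)[OF \<xi> r0]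
  have "(\<lambda>(s, \<omega>). if s = r then \<xi> \<omega> else 0) \<in> borel_measurable (borel \<Otimes>\<^sub>M P)"
    by measurable
  then have "(\<lambda>(s, \<omega>). indicator {t..u} s *\<^sub>R (if s = r then \<xi> \<omega> else 0)) \<in> borel_measurable (borel \<Otimes>\<^sub>M P)"
    by measurable
  then have "(\<lambda>(s, \<omega>). if s = r then \<xi> \<omega> else 0) \<in> borel_measurable (restrict_space borel {t..u} \<Otimes>\<^sub>M P)"
    by (subst restrict_pair_measurable_iff) auto
  moreover have "(\<lambda>\<omega>. if s = r then \<xi> \<omega> else 0) \<in> borel_measurable (F s)" for s
    using L2_rvD(1)[OF \<xi> r0] by (cases "s = r") auto
  moreover have "(\<integral>\<^sup>+s\<in>{t..u}. sqn (if s = r then \<xi> \<omega> else 0) \<partial>lborel) = 0" for \<omega>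
  proof -
    have "(\<integral>\<^sup>+s\<in>{t..u}. sqn (if s = r then \<xi> \<omega> else 0) \<partial>lborel) = (\<integral>\<^sup>+(s::real). 0 \<partial>lborel)"
      by (rule nn_integral_cong_AE) (use AE_lborel_singleton[of r] in \<open>eventually_elim, simp\<close>)
    then show ?thesis by simp
  qed
  ultimately show ?thesis unfolding L2_process_def adapted_process_def by simp
qed

end

theorem theorem2p2:
  fixes P :: "'w measure"
    and W :: "real \<Rightarrow> 'w \<Rightarrow> real ^ 'd"
    and F :: "real \<Rightarrow> 'w measure"
    and \<alpha> :: "real measure"
    and T C M :: real
  assumes "prob_space P" and "complete_measure P"
    and "standard_brownian_motion P W"
    and "F = augmented_filtration P W"
    and "sets \<alpha> = sets borel" and "sigma_finite_measure \<alpha>"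
    and "T > 0" and "C > 0" and "M > 0"
  shows
    "\<exists>\<delta>0>0. \<forall>\<delta>. 0 < \<delta> \<and> \<delta> \<le> \<delta>0 \<and> emeasure \<alpha> {0..T + \<delta>} < \<infinity> \<longrightarrow>
      (\<forall>(\<phi> :: real \<Rightarrow> real \<Rightarrow> 'w \<Rightarrow> real)
        (b :: real \<Rightarrow> real ^ 'n \<Rightarrow> ('w \<Rightarrow> real ^ 'n) \<Rightarrow> 'w \<Rightarrow> real ^ 'n)
        (\<sigma> :: real \<Rightarrow> real ^ 'n \<Rightarrow> ('w \<Rightarrow> real ^ 'n) \<Rightarrow> 'w \<Rightarrow> real ^ 'd ^ 'n)
        (x0 :: 'w \<Rightarrow> real ^ 'n)
        (l :: real \<Rightarrow> 'w \<Rightarrow> real ^ 'n).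
        bounded_kernel P F T \<delta> M \<phi> \<and>
        coefficient P F T \<delta> b \<and> time_measurable P F T \<delta> b \<and>
        coefficient P F T \<delta> \<sigma> \<and> time_measurable P F T \<delta> \<sigma> \<and>
        (\<forall>t\<in>{0..T}. \<forall>\<zeta>\<in>L2_process P F t (T + \<delta>). \<forall>\<zeta>'\<in>L2_process P F t (T + \<delta>).
           \<forall>r\<in>{t..T + \<delta>}. \<zeta> r \<in> L2_rv P (F r) \<and> \<zeta>' r \<in> L2_rv P (F r) \<longrightarrow>
           (AE \<omega> in P. \<forall>x x'.
              norm (b t x (\<zeta> r) \<omega> - b t x' (\<zeta>' r) \<omega>) + norm (\<sigma> t x (\<zeta> r) \<omega> - \<sigma> t x' (\<zeta>' r) \<omega>)
                \<le> C * (norm (x - x') + real_cond_exp P (F t) (\<lambda>\<omega>. norm (\<zeta> r \<omega> - \<zeta>' r \<omega>)) \<omega>))) \<and>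
        (\<exists>K. \<forall>t\<in>{0..T}. AE \<omega> in P.
           norm (b t 0 (\<lambda>_. 0) \<omega>) + norm (\<sigma> t 0 (\<lambda>_. 0) \<omega>) \<le> K) \<and>
        x0 \<in> L2_rv P (F 0) \<and>
        l \<in> adapted_process P F {T<..T + \<delta>} \<and>
        (\<integral>\<^sup>+\<omega>. (SUP t\<in>{T<..T + \<delta>}. ennreal ((norm (l t \<omega>))\<^sup>2)) \<partial>P) < \<infinity>
        \<longrightarrow>
        (\<exists>x. asde_solution P F W T \<delta> \<alpha> \<phi> b \<sigma> x0 l x) \<and>
        (\<forall>x y. asde_solution P F W T \<delta> \<alpha> \<phi> b \<sigma> x0 l x \<and>
               asde_solution P F W T \<delta> \<alpha> \<phi> b \<sigma> x0 l y \<longrightarrow>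
               (AE \<omega> in P. \<forall>t\<in>{0..T + \<delta>}. x t \<omega> = y t \<omega>)))"
proof (cases "\<exists>\<delta>1>0. emeasure \<alpha> {0..T + \<delta>1} < \<infinity>")
  case False
  \<comment> \<open>No delay makes the measure of the time range finite.\<close>
  then show ?thesis by (intro exI[of _ 1]) auto
next
  case True
  then obtain \<delta>1 where \<delta>1: "0 < \<delta>1" "emeasure \<alpha> {0..T + \<delta>1} < \<infinity>" by blast
  have "complete_filtration P F"
    unfolding assms(4) by (rule complete_filtration_augmented[OF assms(1,2)])
      (use assms(3) in \<open>simp add: standard_brownian_motion_def\<close>)
  then interpret complete_filtration P F .
  interpret brownian_filtration P F W by standard (rule assms(3,4))+
  define \<kappa> where "\<kappa> = 4 * (T + 12) * C\<^sup>2"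
  define \<beta> where "\<beta> = 8 * \<kappa>"
  define a1 where "a1 = measure \<alpha> {0..T + \<delta>1}"
  define k where "k = \<kappa> * M\<^sup>2 * a1\<^sup>2 * exp (\<beta> * T)"
  have \<kappa>0: "0 \<le> \<kappa>" using assms(7) by (simp add: \<kappa>_def)
  have k0: "0 \<le> k" using \<kappa>0 by (simp add: k_def)
  show ?thesis
  \<comment> \<open>Below \<open>\<delta>1\<close> the measure of the time range is at most \<open>a1\<close>, so \<open>k \<delta> \<le> 1/8\<close> suffices for the contraction; \<open>k\<close> may be \<open>0\<close>, but \<open>k + 1\<close> is positive.\<close>
  proof (intro exI[of _ "min \<delta>1 (1 / (8 * (k + 1)))"] conjI allI impI)
    show "0 < min \<delta>1 (1 / (8 * (k + 1)))" using \<delta>1 k0 by simp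
  next
    fix \<delta> and \<phi> :: "real \<Rightarrow> real \<Rightarrow> 'w \<Rightarrow> real" and b :: "real \<Rightarrow> real ^ 'n \<Rightarrow> ('w \<Rightarrow> real ^ 'n) \<Rightarrow> 'w \<Rightarrow> real ^ 'n"
      and \<sigma> :: "real \<Rightarrow> real ^ 'n \<Rightarrow> ('w \<Rightarrow> real ^ 'n) \<Rightarrow> 'w \<Rightarrow> real ^ 'd ^ 'n"
      and x0 :: "'w \<Rightarrow> real ^ 'n" and l :: "real \<Rightarrow> 'w \<Rightarrow> real ^ 'n"
    assume "0 < \<delta> \<and> \<delta> \<le> min \<delta>1 (1 / (8 * (k + 1))) \<and> emeasure \<alpha> {0..T + \<delta>} < \<infinity>"
    then have \<delta>: "0 < \<delta>" "\<delta> \<le> \<delta>1" "\<delta> \<le> 1 / (8 * (k + 1))" "emeasure \<alpha> {0..T + \<delta>} < \<infinity>" by auto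
    assume hyp: "bounded_kernel P F T \<delta> M \<phi> \<and>
        coefficient P F T \<delta> b \<and> time_measurable P F T \<delta> b \<and>
        coefficient P F T \<delta> \<sigma> \<and> time_measurable P F T \<delta> \<sigma> \<and>
        (\<forall>t\<in>{0..T}. \<forall>\<zeta>\<in>L2_process P F t (T + \<delta>). \<forall>\<zeta>'\<in>L2_process P F t (T + \<delta>).
           \<forall>r\<in>{t..T + \<delta>}. \<zeta> r \<in> L2_rv P (F r) \<and> \<zeta>' r \<in> L2_rv P (F r) \<longrightarrow>
           (AE \<omega> in P. \<forall>x x'.
              norm (b t x (\<zeta> r) \<omega> - b t x' (\<zeta>' r) \<omega>) + norm (\<sigma> t x (\<zeta> r) \<omega> - \<sigma> t x' (\<zeta>' r) \<omega>)
                \<le> C * (norm (x - x') + real_cond_exp P (F t) (\<lambda>\<omega>. norm (\<zeta> r \<omega> - \<zeta>' r \<omega>)) \<omega>))) \<and>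
        (\<exists>K. \<forall>t\<in>{0..T}. AE \<omega> in P.
           norm (b t 0 (\<lambda>_. 0) \<omega>) + norm (\<sigma> t 0 (\<lambda>_. 0) \<omega>) \<le> K) \<and>
        x0 \<in> L2_rv P (F 0) \<and>
        l \<in> adapted_process P F {T<..T + \<delta>} \<and>
        (\<integral>\<^sup>+\<omega>. (SUP t\<in>{T<..T + \<delta>}. sqn (l t \<omega>)) \<partial>P) < \<infinity>"
    then have kernel: "bounded_kernel P F T \<delta> M \<phi>"
      and coef: "coefficient P F T \<delta> b" "time_measurable P F T \<delta> b" "coefficient P F T \<delta> \<sigma>" "time_measurable P F T \<delta> \<sigma>"
      and x0: "x0 \<in> L2_rv P (F 0)" and l: "l \<in> adapted_process P F {T<..T + \<delta>}"
      and lL: "(\<integral>\<^sup>+\<omega>. (SUP t\<in>{T<..T + \<delta>}. sqn (l t \<omega>)) \<partial>P) < \<infinity>"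
      by blast+
    from hyp have lip: "\<forall>t\<in>{0..T}. \<forall>\<zeta>\<in>L2_process P F t (T + \<delta>). \<forall>\<zeta>'\<in>L2_process P F t (T + \<delta>).
           \<forall>r\<in>{t..T + \<delta>}. \<zeta> r \<in> L2_rv P (F r) \<and> \<zeta>' r \<in> L2_rv P (F r) \<longrightarrow>
           (AE \<omega> in P. \<forall>x x'.
              norm (b t x (\<zeta> r) \<omega> - b t x' (\<zeta>' r) \<omega>) + norm (\<sigma> t x (\<zeta> r) \<omega> - \<sigma> t x' (\<zeta>' r) \<omega>)
                \<le> C * (norm (x - x') + real_cond_exp P (F t) (\<lambda>\<omega>. norm (\<zeta> r \<omega> - \<zeta>' r \<omega>)) \<omega>))"
      by blast
    from hyp obtain K where K: "\<And>t. t \<in> {0..T} \<Longrightarrow> AE \<omega> in P. norm (b t 0 (\<lambda>_. 0) \<omega>) + norm (\<sigma> t 0 (\<lambda>_. 0) \<omega>) \<le> K"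
      by blast
    have lip_rv: "AE \<omega> in P. \<forall>x x'. norm (b t x \<xi> \<omega> - b t x' \<xi>' \<omega>) + norm (\<sigma> t x \<xi> \<omega> - \<sigma> t x' \<xi>' \<omega>)
          \<le> C * (norm (x - x') + real_cond_exp P (F t) (\<lambda>\<omega>. norm (\<xi> \<omega> - \<xi>' \<omega>)) \<omega>)"
      if t: "t \<in> {0..T}" and \<xi>: "\<xi> \<in> L2_rv P (F (t + \<delta>))" "\<xi>' \<in> L2_rv P (F (t + \<delta>))" for t \<xi> \<xi>'
    proof -
      have r: "t + \<delta> \<in> {t..T + \<delta>}" "0 \<le> t" using t \<delta>(1) by auto
      note lip_t = bspec[OF bspec[OF bspec[OF bspec[OF lip t] single_time_process[OF r \<xi>(1)]] single_time_process[OF r \<xi>(2)]] r(1)]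
      show ?thesis by (rule lip_t[unfolded simp_thms(6) if_True, rule_format, OF conjI[OF \<xi>]])
    qed
    interpret advanced_setting P F W T \<delta> M \<alpha> \<phi>
      by (intro advanced_setting.intro brownian_filtration_axioms advanced_setting_axioms.intro
          assms(5-7,9) \<delta>(1,4) kernel)
    have adm_b: "admissible C K b"
      unfolding admissible_def
    proof (intro conjI ballI assms(8) coef)
      show "AE \<omega> in P. \<forall>x x'. norm (b t x \<xi> \<omega> - b t x' \<xi>' \<omega>) \<le>
         C * (norm (x - x') + real_cond_exp P (F t) (\<lambda>\<omega>. norm (\<xi> \<omega> - \<xi>' \<omega>)) \<omega>)"
        if "t \<in> {0..T}" "\<xi> \<in> L2_rv P (F (t + \<delta>))" "\<xi>' \<in> L2_rv P (F (t + \<delta>))" for t \<xi> \<xi>'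
        using lip_rv[OF that] by eventually_elim (meson le_add_same_cancel1 norm_ge_zero order_trans)
      show "AE \<omega> in P. norm (b t 0 (\<lambda>_. 0) \<omega>) \<le> K" if "t \<in> {0..T}" for t
        using K[OF that] by eventually_elim (meson le_add_same_cancel1 norm_ge_zero order_trans)
    qed
    have adm_\<sigma>: "admissible C K \<sigma>"
      unfolding admissible_def
    proof (intro conjI ballI assms(8) coef)
      show "AE \<omega> in P. \<forall>x x'. norm (\<sigma> t x \<xi> \<omega> - \<sigma> t x' \<xi>' \<omega>) \<le>
         C * (norm (x - x') + real_cond_exp P (F t) (\<lambda>\<omega>. norm (\<xi> \<omega> - \<xi>' \<omega>)) \<omega>)"
        if "t \<in> {0..T}" "\<xi> \<in> L2_rv P (F (t + \<delta>))" "\<xi>' \<in> L2_rv P (F (t + \<delta>))" for t \<xi> \<xi>'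
        using lip_rv[OF that] by eventually_elim (meson le_add_same_cancel2 norm_ge_zero order_trans)
      show "AE \<omega> in P. norm (\<sigma> t 0 (\<lambda>_. 0) \<omega>) \<le> K" if "t \<in> {0..T}" for t
        using K[OF that] by eventually_elim (meson le_add_same_cancel2 norm_ge_zero order_trans)
    qed
    have small: "\<kappa> * M\<^sup>2 * (measure \<alpha> {0..T + \<delta>})\<^sup>2 * exp (\<beta> * T) * \<delta> \<le> 1 / 8"
    proof -
      have "measure \<alpha> {0..T + \<delta>} \<le> a1"
        unfolding a1_def using \<delta>(2) \<delta>1(2)
        by (intro measure_mono_fmeasurable fmeasurableI) (auto simp: assms(5))
      then have "(measure \<alpha> {0..T + \<delta>})\<^sup>2 \<le> a1\<^sup>2" by (intro power_mono) auto
      then have "\<kappa> * M\<^sup>2 * (measure \<alpha> {0..T + \<delta>})\<^sup>2 * exp (\<beta> * T) \<le> k"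
        unfolding k_def using \<kappa>0 by (intro mult_right_mono mult_left_mono) auto
      then have "\<kappa> * M\<^sup>2 * (measure \<alpha> {0..T + \<delta>})\<^sup>2 * exp (\<beta> * T) * \<delta> \<le> k * (1 / (8 * (k + 1)))"
        using \<delta> k0 by (intro mult_mono) auto
      also have "\<dots> \<le> 1 / 8" using k0 by (simp add: field_simps)
      finally show ?thesis .
    qed
    interpret small_delay_asde P F W T \<delta> M \<alpha> \<phi> b \<sigma> x0 l C K
      "\<integral>\<^sup>+\<omega>. (SUP t\<in>{T<..T + \<delta>}. sqn (l t \<omega>)) \<partial>P" \<kappa> \<beta> "measure \<alpha> {0..T + \<delta>}"
    proof (intro small_delay_asde.intro asde_setting.intro advanced_setting_axioms asde_setting_axioms.intro
        small_delay_asde_axioms.intro adm_b adm_\<sigma> x0 l lL small \<kappa>_def \<beta>_def refl)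
      show "(\<integral>\<^sup>+\<omega>. sqn (l t \<omega>) \<partial>P) \<le> (\<integral>\<^sup>+\<omega>. (SUP t\<in>{T<..T + \<delta>}. sqn (l t \<omega>)) \<partial>P)"
        if "t \<in> {T<..T + \<delta>}" for t
        using that by (intro nn_integral_mono SUP_upper)
    qed
    show "\<exists>x. asde_solution P F W T \<delta> \<alpha> \<phi> b \<sigma> x0 l x" by (rule asde_solution_exists)
    fix x y assume "asde_solution P F W T \<delta> \<alpha> \<phi> b \<sigma> x0 l x \<and> asde_solution P F W T \<delta> \<alpha> \<phi> b \<sigma> x0 l y"
    then show "AE \<omega> in P. \<forall>t\<in>{0..T + \<delta>}. x t \<omega> = y t \<omega>"
      using asde_solution_unique by blast
  qed
qed

end
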